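(* Assume that the initial state $u_0\in H^2(\Omega)\cap H^1_0(\Omega)$ and the desirable target state $u_1\in L^2(\Omega)$ have the same surfaces of change of sign (in the sense of the definition in the context). Then the system $$u_t=\Delta u+v(x,t)u\ \text{ in }\Omega\times(0,T),\qquad u|_{\partial\Omega}=0,\qquad u|_{t=0}=u_0$$ can be steered from $u_0$ to $u_1$ as close as we wish in $L^2(\Omega)$ at some time $T>0$: for every $\varepsilon>0$ there exist $T>0$ and an admissible control $v$ on $\Omega\times(0,T)$ such that the corresponding solution satisfies $\|u(\cdot,T)-u_1\|_{L^2(\Omega)}<\varepsilon$.
   Context: $\Omega=(a_1,b_1)\times\cdots\times(a_n,b_n)\subset\mathbb R^n$ is an open parallelepiped. For $T>0$ put $Q_T=\Omega\times(0,T)$. An admissible (multiplicative) control is a function $v\in L^\infty(Q_T)$ that is piecewise constant in time, i.e. there is a partition $0=t_0<t_1<\dots<t_N=T$ and functions $v_m\in L^\infty(\Omega)$ with $v(x,t)=v_m(x)$ for $t\in(t_{m-1},t_m)$. For $u_0\in H^2(\Omega)\cap H^1_0(\Omega)$ and an admissible $v$ the system has a unique solution $u\in H^{2,1}(Q_T)\cap C([0,T];H^2(\Omega)\cap H^1_0(\Omega))$, where $H^{2,1}(Q_T)$ is the space of $\phi$ with $\phi,\phi_{x_i},\phi_{x_ix_j},\phi_t\in L^2(Q_T)$. Definition (surfaces of change of sign). A function on $\Omega$ has finitely many $(n-1)$-dimensional surfaces of change of sign if the total measure of these surfaces is zero and they split $\Omega$ into finitely many subdomains (simply connected open sets) $S_i^+$,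 $i=1,\dots,l$, and $S_j^-$, $j=1,\dots,m$, bounded by these surfaces and possibly by parts of $\partial\Omega$, such that the function is positive inside each $S_i^+$ and negative inside each $S_j^-$ (except, possibly, on sets of zero measure), and the function changes its sign (in this almost everywhere sense) across these surfaces. *)

theory Defs
  imports "HOL-Analysis.Analysis"
begin

text \<open>Elements of Lebesgue and Sobolev spaces on an open set are represented by functions on the
  whole Euclidean space; only their values on that open set matter, up to null sets.\<close>

definition L2 :: "'a::euclidean_space set \<Rightarrow> ('a \<Rightarrow> real) set" where
  "L2 \<Omega> = {f. f \<in> borel_measurable (lebesgue_on \<Omega>) \<and> integrable (lebesgue_on \<Omega>) (\<lambda>x. (f x)\<^sup>2)}"

definition L2_norm :: "'a::euclidean_space set \<Rightarrow> ('a \<Rightarrow> real) \<Rightarrow> real" where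
  "L2_norm \<Omega> f = sqrt (LINT x|lebesgue_on \<Omega>. (f x)\<^sup>2)"

definition L_infinity :: "'a::euclidean_space set \<Rightarrow> ('a \<Rightarrow> real) set" where
  "L_infinity \<Omega> = {f. f \<in> borel_measurable (lebesgue_on \<Omega>) \<and>
                       (\<exists>C. AE x in lebesgue_on \<Omega>. \<bar>f x\<bar> \<le> C)}"

primrec Ck_fun :: "nat \<Rightarrow> ('a::euclidean_space \<Rightarrow> real) \<Rightarrow> bool" where
  "Ck_fun 0 f \<longleftrightarrow> continuous_on UNIV f"
| "Ck_fun (Suc k) f \<longleftrightarrow> (\<forall>x. f differentiable (at x)) \<and>
     (\<forall>e\<in>Basis. Ck_fun k (\<lambda>x. frechet_derivative f (at x) e))"

definition test_functions :: "'a::euclidean_space set \<Rightarrow> ('a \<Rightarrow> real) set" where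
  "test_functions \<Omega> = {\<phi>. (\<forall>k. Ck_fun k \<phi>) \<and> compact (closure {x. \<phi> x \<noteq> 0}) \<and>
                          closure {x. \<phi> x \<noteq> 0} \<subseteq> \<Omega>}"

definition has_weak_deriv ::
  "'a::euclidean_space set \<Rightarrow> 'a \<Rightarrow> ('a \<Rightarrow> real) \<Rightarrow> ('a \<Rightarrow> real) \<Rightarrow> bool" where
  "has_weak_deriv \<Omega> e f g \<longleftrightarrow> f \<in> L2 \<Omega> \<and> g \<in> L2 \<Omega> \<and>
     (\<forall>\<phi>\<in>test_functions \<Omega>.
        (LINT x|lebesgue_on \<Omega>. f x * frechet_derivative \<phi> (at x) e) =
        - (LINT x|lebesgue_on \<Omega>. g x * \<phi> x))"

text \<open>A representative of the weak derivative, unique up to null sets; meaningful only if the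
  weak derivative exists in \<open>L2\<close>.\<close>

definition weak_deriv :: "'a::euclidean_space set \<Rightarrow> 'a \<Rightarrow> ('a \<Rightarrow> real) \<Rightarrow> 'a \<Rightarrow> real" where
  "weak_deriv \<Omega> e f = (SOME g. has_weak_deriv \<Omega> e f g)"

definition H1 :: "'a::euclidean_space set \<Rightarrow> ('a \<Rightarrow> real) set" where
  "H1 \<Omega> = {f \<in> L2 \<Omega>. \<forall>e\<in>Basis. \<exists>g. has_weak_deriv \<Omega> e f g}"

definition H1_norm :: "'a::euclidean_space set \<Rightarrow> ('a \<Rightarrow> real) \<Rightarrow> real" where
  "H1_norm \<Omega> f = sqrt ((L2_norm \<Omega> f)\<^sup>2 + (\<Sum>e\<in>Basis. (L2_norm \<Omega> (weak_deriv \<Omega> e f))\<^sup>2))"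

definition H10 :: "'a::euclidean_space set \<Rightarrow> ('a \<Rightarrow> real) set" where
  "H10 \<Omega> = {f \<in> H1 \<Omega>. \<forall>\<epsilon>>0. \<exists>\<phi>\<in>test_functions \<Omega>. H1_norm \<Omega> (\<lambda>x. f x - \<phi> x) < \<epsilon>}"

definition H2 :: "'a::euclidean_space set \<Rightarrow> ('a \<Rightarrow> real) set" where
  "H2 \<Omega> = {f \<in> L2 \<Omega>. \<forall>e\<in>Basis. \<exists>g. has_weak_deriv \<Omega> e f g \<and> g \<in> H1 \<Omega>}"

definition H2_norm :: "'a::euclidean_space set \<Rightarrow> ('a \<Rightarrow> real) \<Rightarrow> real" where
  "H2_norm \<Omega> f = sqrt ((L2_norm \<Omega> f)\<^sup>2 + (\<Sum>e\<in>Basis. (L2_norm \<Omega> (weak_deriv \<Omega> e f))\<^sup>2) +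
     (\<Sum>e\<in>Basis. \<Sum>d\<in>Basis. (L2_norm \<Omega> (weak_deriv \<Omega> d (weak_deriv \<Omega> e f)))\<^sup>2))"

definition cylinder :: "'a::euclidean_space set \<Rightarrow> real \<Rightarrow> ('a \<times> real) set" where
  "cylinder \<Omega> T = \<Omega> \<times> {0<..<T}"

definition H21 :: "'a::euclidean_space set \<Rightarrow> real \<Rightarrow> ('a \<times> real \<Rightarrow> real) set" where
  "H21 \<Omega> T = {u \<in> L2 (cylinder \<Omega> T).
     (\<exists>g. has_weak_deriv (cylinder \<Omega> T) (0, 1) u g) \<and>
     (\<forall>e\<in>Basis. \<exists>g. has_weak_deriv (cylinder \<Omega> T) (e, 0) u g \<and>
        (\<forall>d\<in>Basis. \<exists>h. has_weak_deriv (cylinder \<Omega> T) (d, 0) g h))}"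

definition C_H2_H10 :: "'a::euclidean_space set \<Rightarrow> real \<Rightarrow> ('a \<times> real \<Rightarrow> real) set" where
  "C_H2_H10 \<Omega> T = {u. \<forall>t\<in>{0..T}. (\<lambda>x. u (x, t)) \<in> H2 \<Omega> \<inter> H10 \<Omega> \<and>
     ((\<lambda>s. H2_norm \<Omega> (\<lambda>x. u (x, s) - u (x, t))) \<longlongrightarrow> 0) (at t within {0..T})}"

definition admissible_control ::
  "'a::euclidean_space set \<Rightarrow> real \<Rightarrow> ('a \<times> real \<Rightarrow> real) \<Rightarrow> bool" where
  "admissible_control \<Omega> T v \<longleftrightarrow> v \<in> L_infinity (cylinder \<Omega> T) \<and>
     (\<exists>(N::nat) (\<tau>::nat \<Rightarrow> real) (w::nat \<Rightarrow> 'a \<Rightarrow> real).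
        \<tau> 0 = 0 \<and> \<tau> N = T \<and> (\<forall>m<N. \<tau> m < \<tau> (Suc m)) \<and> (\<forall>m<N. w m \<in> L_infinity \<Omega>) \<and>
        (\<forall>m<N. \<forall>x\<in>\<Omega>. \<forall>t\<in>{\<tau> m<..<\<tau> (Suc m)}. v (x, t) = w m x))"

text \<open>The Dirichlet condition is contained in the requirement that all time slices lie in
  \<open>H10\<close>; the initial condition refers to the time slice of the \<open>H2\<close>-continuous representative.\<close>

definition is_solution :: "'a::euclidean_space set \<Rightarrow> real \<Rightarrow> ('a \<times> real \<Rightarrow> real) \<Rightarrow>
    ('a \<Rightarrow> real) \<Rightarrow> ('a \<times> real \<Rightarrow> real) \<Rightarrow> bool" where
  "is_solution \<Omega> T v u\<^sub>0 u \<longleftrightarrow> u \<in> H21 \<Omega> T \<inter> C_H2_H10 \<Omega> T \<and>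
     (AE z in lebesgue_on (cylinder \<Omega> T).
        weak_deriv (cylinder \<Omega> T) (0, 1) u z =
        (\<Sum>e\<in>Basis. weak_deriv (cylinder \<Omega> T) (e, 0) (weak_deriv (cylinder \<Omega> T) (e, 0) u) z)
        + v z * u z) \<and>
     (AE x in lebesgue_on \<Omega>. u (x, 0) = u\<^sub>0 x)"

text \<open>\<open>\<G>\<close> is the family of surfaces, \<open>\<P>\<close> and \<open>\<N>\<close> are the families of the subdomains on which
  \<open>f\<close> is positive and negative, respectively. The dimension of a surface is its topological (small
  inductive) dimension. Change of sign across a surface means that near each of its points \<open>f\<close>
  takes positive and negative values on sets of positive measure.\<close>

definition sign_change_surfaces :: "'a::euclidean_space set \<Rightarrow> 'a set set \<Rightarrow> 'a set set \<Rightarrow>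
    'a set set \<Rightarrow> ('a \<Rightarrow> real) \<Rightarrow> bool" where
  "sign_change_surfaces \<Omega> \<G> \<P> \<N> f \<longleftrightarrow>
     finite \<G> \<and> finite \<P> \<and> finite \<N> \<and>
     (\<forall>G\<in>\<G>. G \<subseteq> \<Omega> \<and> top_of_set G dim_le (int DIM('a) - 1) \<and>
              \<not> top_of_set G dim_le (int DIM('a) - 2)) \<and>
     \<Union>\<G> \<in> null_sets lebesgue \<and>
     \<Omega> - \<Union>\<G> = \<Union>(\<P> \<union> \<N>) \<and> \<P> \<inter> \<N> = {} \<and> disjoint (\<P> \<union> \<N>) \<and>
     (\<forall>S\<in>\<P> \<union> \<N>. open S \<and> S \<noteq> {} \<and> simply_connected S \<and>
                  frontier S \<subseteq> \<Union>\<G> \<union> frontier \<Omega>) \<and>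
     (\<forall>S\<in>\<P>. AE x in lebesgue_on S. f x > 0) \<and>
     (\<forall>S\<in>\<N>. AE x in lebesgue_on S. f x < 0) \<and>
     (\<forall>x\<in>\<Union>\<G>. \<forall>r>0. \<not> (AE y in lebesgue_on (\<Omega> \<inter> ball x r). f y \<le> 0) \<and>
                       \<not> (AE y in lebesgue_on (\<Omega> \<inter> ball x r). f y \<ge> 0))"

text \<open>Two functions have the same surfaces of change of sign if the surfaces and the subdomains of
  positivity and negativity coincide. The sign pattern has to be part of this notion: \<open>f\<close> and
  \<open>- f\<close> change sign across the same sets, but a multiplicative control cannot reverse signs.\<close>

definition same_sign_change_surfaces ::
  "'a::euclidean_space set \<Rightarrow> ('a \<Rightarrow> real) \<Rightarrow> ('a \<Rightarrow> real) \<Rightarrow> bool" where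
  "same_sign_change_surfaces \<Omega> f g \<longleftrightarrow>
     (\<exists>\<G> \<P> \<N>. sign_change_surfaces \<Omega> \<G> \<P> \<N> f \<and> sign_change_surfaces \<Omega> \<G> \<P> \<N> g)"

end

theory Submission
  imports Defs
begin

text \<open>On a short time interval the diffusion hardly acts, while the control \<open>v = \<alpha> / T\<close> acts with full
  strength: the solution stays within \<open>O(T)\<close> of \<open>exp (t \<alpha> / T) u\<^sub>0\<close>, hence \<open>u(T)\<close> is close to
  \<open>exp \<alpha> u\<^sub>0\<close>. Since \<open>u\<^sub>0\<close> and \<open>u\<^sub>1\<close> have the same sign almost everywhere, \<open>exp \<alpha> u\<^sub>0\<close> approximates
  \<open>u\<^sub>1\<close> if \<open>\<alpha>\<close> approximates a truncation of \<open>ln (u\<^sub>1 / u\<^sub>0)\<close>.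

  The exponent \<open>\<alpha>\<close> is taken to be a polynomial in the functions \<open>cos (\<pi> (x\<^sub>i - a\<^sub>i) / (b\<^sub>i - a\<^sub>i))\<close>.
  Multiplication by such a cosine maps each sine mode to its two neighbours, so that multiplication by
  \<open>\<alpha>\<close> is bounded on the domain of the Dirichlet Laplacian. This yields a solution by Duhamel's formula
  for the sine coefficients, and it bounds the Laplacian of \<open>exp (t \<alpha> / T) u\<^sub>0\<close> uniformly in \<open>T\<close>. An arbitrary
  solution is compared with this function by an energy estimate for its sine coefficients, which
  satisfy ordinary differential equations.\<close>

subsection \<open>Square integrable functions\<close>

text \<open>What has to be beaten is the size \<open>1 / T\<close> of the control: every constant
  must survive \<open>T \<rightarrow> 0\<close>. A potential bounded by \<open>K / T\<close> acting
  for a time \<open>T\<close> costs a factor that depends on \<open>K\<close> alone, whereas the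
  Laplacian of the comparison function is a bounded forcing and contributes only a multiple of
  \<open>T\<close>. The second obstacle is the notion of solution: it is formulated by weak
  derivatives on the cylinder, while initial and final states are time slices, and the claim
  concerns every solution. For existence the unknown is the sequence of coefficients multiplied by
  the eigenvalues; its norm is equivalent to the \<open>H2\<close> norm, so a continuous curve of
  sequences is a continuous curve in \<open>H2\<close>. For an arbitrary solution the equation has
  to be tested with sine functions, which have no compact support; they are cut off near the faces,
  where their linear decay compensates the steep gradient of the cutoff. The shift property of the
  cosines serves a second time: with the Stone-Weierstrass theorem it yields completeness of the
  sine system.\<close>

definition sq_int :: "'a measure \<Rightarrow> ('a \<Rightarrow> real) \<Rightarrow> bool" where
  "sq_int M f \<longleftrightarrow> f \<in> borel_measurable M \<and> integrable M (\<lambda>x. (f x)\<^sup>2)"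

definition ip :: "'a measure \<Rightarrow> ('a \<Rightarrow> real) \<Rightarrow> ('a \<Rightarrow> real) \<Rightarrow> real" where
  "ip M f g = (LINT x|M. f x * g x)"

definition nrm :: "'a measure \<Rightarrow> ('a \<Rightarrow> real) \<Rightarrow> real" where
  "nrm M f = sqrt (LINT x|M. (f x)\<^sup>2)"

lemma L2_iff_sq_int: "f \<in> L2 \<Omega> \<longleftrightarrow> sq_int (lebesgue_on \<Omega>) f"
  by (simp add: L2_def sq_int_def)

lemma L2_norm_eq_nrm: "L2_norm \<Omega> f = nrm (lebesgue_on \<Omega>) f"
  by (simp add: L2_norm_def nrm_def)

lemma sq_int_measurable [measurable_dest]: "sq_int M f \<Longrightarrow> f \<in> borel_measurable M"
  by (simp add: sq_int_def)

lemma nrm_nonneg [simp]: "nrm M f \<ge> 0"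
  by (simp add: nrm_def)

lemma nrm_power2: "(nrm M f)\<^sup>2 = (LINT x|M. (f x)\<^sup>2)"
  by (simp add: nrm_def)

lemma nrm_power2_ip: "(nrm M f)\<^sup>2 = ip M f f"
  by (simp add: nrm_def ip_def power2_eq_square)

lemma nrm_zero [simp]: "nrm M (\<lambda>x. 0) = 0"
  by (simp add: nrm_def)

lemma ip_commute: "ip M f g = ip M g f"
  by (simp add: ip_def mult.commute)

lemma sq_int_mult_integrable:
  assumes "sq_int M f" "sq_int M g"
  shows "integrable M (\<lambda>x. f x * g x)"
proof (rule Bochner_Integration.integrable_bound)
  show "integrable M (\<lambda>x. (f x)\<^sup>2 + (g x)\<^sup>2)"
    using assms by (auto simp: sq_int_def)
  show "AE x in M. norm (f x * g x) \<le> norm ((f x)\<^sup>2 + (g x)\<^sup>2)"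
  proof (rule AE_I2)
    fix x
    have "0 \<le> (\<bar>f x\<bar> - \<bar>g x\<bar>)\<^sup>2" by simp
    then have "2 * (\<bar>f x\<bar> * \<bar>g x\<bar>) \<le> (f x)\<^sup>2 + (g x)\<^sup>2"
      by (simp add: power2_diff)
    moreover have "0 \<le> \<bar>f x\<bar> * \<bar>g x\<bar>" by simp
    ultimately have "\<bar>f x\<bar> * \<bar>g x\<bar> \<le> (f x)\<^sup>2 + (g x)\<^sup>2" by linarith
    then show "norm (f x * g x) \<le> norm ((f x)\<^sup>2 + (g x)\<^sup>2)" by (simp add: abs_mult)
  qed
qed (use assms in \<open>auto simp: sq_int_def\<close>)

lemma sq_int_zero [simp]: "sq_int M (\<lambda>x. 0)"
  by (simp add: sq_int_def)

lemma sq_int_add: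
  assumes "sq_int M f" "sq_int M g"
  shows "sq_int M (\<lambda>x. f x + g x)"
proof -
  have "(\<lambda>x. (f x + g x)\<^sup>2) = (\<lambda>x. (f x)\<^sup>2 + (g x)\<^sup>2 + 2 * (f x * g x))"
    by (simp add: power2_sum fun_eq_iff)
  moreover have "integrable M (\<lambda>x. (f x)\<^sup>2 + (g x)\<^sup>2 + 2 * (f x * g x))"
    using assms sq_int_mult_integrable[OF assms] by (auto simp: sq_int_def)
  ultimately show ?thesis
    using assms by (auto simp: sq_int_def)
qed

lemma sq_int_cmult [intro]: "sq_int M f \<Longrightarrow> sq_int M (\<lambda>x. c * f x)"
  by (auto simp: sq_int_def power_mult_distrib)

lemma sq_int_minus [intro]: "sq_int M f \<Longrightarrow> sq_int M (\<lambda>x. - f x)"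
  by (auto simp: sq_int_def)

lemma sq_int_diff [intro]: "sq_int M f \<Longrightarrow> sq_int M g \<Longrightarrow> sq_int M (\<lambda>x. f x - g x)"
  using sq_int_add[of M f "\<lambda>x. - g x"] sq_int_minus by auto

lemma sq_int_sum: "(\<And>i. i \<in> I \<Longrightarrow> sq_int M (f i)) \<Longrightarrow> sq_int M (\<lambda>x. \<Sum>i\<in>I. f i x)"
  by (induction I rule: infinite_finite_induct) (auto intro: sq_int_add)

lemma sq_int_bounded_mult:
  assumes "sq_int M f" and "h \<in> borel_measurable M" and "\<And>x. x \<in> space M \<Longrightarrow> \<bar>h x\<bar> \<le> C"
  shows "sq_int M (\<lambda>x. h x * f x)" and "nrm M (\<lambda>x. h x * f x) \<le> C * nrm M f"
proof -
  have le: "(h x * f x)\<^sup>2 \<le> C\<^sup>2 * (f x)\<^sup>2" if "x \<in> space M" for x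
    using assms(3)[OF that] power_mono[of "\<bar>h x\<bar>" C 2]
    by (auto simp: power_mult_distrib intro: mult_right_mono)
  have int: "integrable M (\<lambda>x. C\<^sup>2 * (f x)\<^sup>2)"
    using assms by (auto simp: sq_int_def)
  have int': "integrable M (\<lambda>x. (h x * f x)\<^sup>2)"
    by (rule Bochner_Integration.integrable_bound[OF int]) (use assms le in \<open>auto simp: sq_int_def\<close>)
  then show "sq_int M (\<lambda>x. h x * f x)"
    using assms by (auto simp: sq_int_def)
  show "nrm M (\<lambda>x. h x * f x) \<le> C * nrm M f"
  \<comment> \<open>Nonnegativity of \<open>C\<close> follows from the bound only if some point
    exists; on an empty space both norms are zero.\<close>
  proof (cases "space M = {}")
    case True
    then have "(LINT x|M. g x) = 0" for g :: "'a \<Rightarrow> real"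
      by (subst Bochner_Integration.integral_cong[where g = "\<lambda>_. 0"]) auto
    then show ?thesis by (simp add: nrm_def)
  next
    case False
    then have "0 \<le> C" using assms(3) by fastforce
    have "(LINT x|M. (h x * f x)\<^sup>2) \<le> (LINT x|M. C\<^sup>2 * (f x)\<^sup>2)"
      by (rule integral_mono[OF int' int]) (use le in auto)
    then have "nrm M (\<lambda>x. h x * f x) \<le> sqrt (C\<^sup>2 * (LINT x|M. (f x)\<^sup>2))"
      unfolding nrm_def by (simp add: real_sqrt_le_mono)
    also have "\<dots> = C * nrm M f"
      using \<open>0 \<le> C\<close> by (simp add: nrm_def real_sqrt_mult)
    finally show ?thesis .
  qed
qed

lemma sq_int_bounded:
  assumes "finite_measure M" and "h \<in> borel_measurable M" and "\<And>x. x \<in> space M \<Longrightarrow> \<bar>h x\<bar> \<le> C"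
  shows "sq_int M h"
proof -
  interpret finite_measure M by fact
  have "sq_int M (\<lambda>x. 1)" by (simp add: sq_int_def)
  from sq_int_bounded_mult(1)[OF this assms(2,3)] show ?thesis by simp
qed

lemma ip_add_left:
  assumes "sq_int M f" "sq_int M g" "sq_int M h"
  shows "ip M (\<lambda>x. f x + g x) h = ip M f h + ip M g h"
  unfolding ip_def distrib_right using assms
  by (intro Bochner_Integration.integral_add sq_int_mult_integrable)

lemma ip_diff_left:
  assumes "sq_int M f" "sq_int M g" "sq_int M h"
  shows "ip M (\<lambda>x. f x - g x) h = ip M f h - ip M g h"
  unfolding ip_def left_diff_distrib using assms
  by (intro Bochner_Integration.integral_diff sq_int_mult_integrable)

lemma ip_cmult_left: "ip M (\<lambda>x. c * f x) h = c * ip M f h"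
  by (simp add: ip_def mult.assoc)

lemma ip_minus_left: "ip M (\<lambda>x. - f x) h = - ip M f h"
  by (simp add: ip_def)

lemma ip_sum_left:
  assumes "\<And>i. i \<in> I \<Longrightarrow> sq_int M (f i)" "sq_int M h"
  shows "ip M (\<lambda>x. \<Sum>i\<in>I. f i x) h = (\<Sum>i\<in>I. ip M (f i) h)"
  unfolding ip_def sum_distrib_right using assms
  by (intro Bochner_Integration.integral_sum sq_int_mult_integrable) auto

lemma ip_mult_assoc: "ip M (\<lambda>x. p x * f x) g = ip M f (\<lambda>x. p x * g x)"
  by (simp add: ip_def mult.assoc mult.left_commute)

text \<open>The square of the norm of \<open>f + t g\<close> is a quadratic polynomial in
  \<open>t\<close> without negative values; evaluating it at its minimum gives the bound. Functions
  are not identified modulo null sets, so \<open>ip\<close> is only positive semidefinite and the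
  inequality of the class \<open>real_inner\<close> cannot be quoted.\<close>

lemma Cauchy_Schwarz_ip:
  assumes f: "sq_int M f" and g: "sq_int M g"
  shows "\<bar>ip M f g\<bar> \<le> nrm M f * nrm M g"
proof -
  have quad: "0 \<le> (nrm M f)\<^sup>2 + 2 * t * ip M f g + t\<^sup>2 * (nrm M g)\<^sup>2" for t
  proof -
    have tg: "sq_int M (\<lambda>x. t * g x)" using g by auto
    have s: "sq_int M (\<lambda>x. f x + t * g x)" using f tg by (rule sq_int_add)
    have "0 \<le> ip M (\<lambda>x. f x + t * g x) (\<lambda>x. f x + t * g x)"
      by (simp flip: nrm_power2_ip)
    also have "\<dots> = ip M f f + t * ip M f g + t * (ip M f g + t * ip M g g)"
      using f g tg s
      by (simp add: ip_add_left ip_cmult_left ip_commute[of M f "\<lambda>x. f x + t * g x"]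
            ip_commute[of M g "\<lambda>x. f x + t * g x"] ip_commute[of M g f])
    finally show ?thesis
      unfolding nrm_power2_ip by (simp add: power2_eq_square algebra_simps)
  qed
  define A B C where "A = nrm M f" and "B = nrm M g" and "C = ip M f g"
  have AB: "0 \<le> A" "0 \<le> B" by (simp_all add: A_def B_def)
  have q: "0 \<le> A\<^sup>2 + 2 * t * C + t\<^sup>2 * B\<^sup>2" for t
    using quad[of t] by (simp add: A_def B_def C_def)
  have "\<bar>C\<bar> \<le> A * B"
  proof (cases "B = 0")
    case True
    have "C = 0"
    proof (rule ccontr)
      assume "C \<noteq> 0"
      \<comment> \<open>For \<open>B = 0\<close> the polynomial is affine in \<open>t\<close>; this
        argument gives it the value \<open>-1\<close>.\<close>
      with q[of "- (A\<^sup>2 + 1) / (2 * C)"] True show False by (simp add: field_simps)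
    qed
    with True show ?thesis by simp
  next
    case False
    then have B2: "0 < B\<^sup>2" by simp
    have "A\<^sup>2 + 2 * (- C / B\<^sup>2) * C + (- C / B\<^sup>2)\<^sup>2 * B\<^sup>2 = A\<^sup>2 - C\<^sup>2 / B\<^sup>2"
      using False by (simp add: field_simps power2_eq_square)
    with q[of "- C / B\<^sup>2"] have "C\<^sup>2 / B\<^sup>2 \<le> A\<^sup>2" by linarith
    then have "C\<^sup>2 \<le> A\<^sup>2 * B\<^sup>2" by (simp only: pos_divide_le_eq[OF B2])
    then have "\<bar>C\<bar>\<^sup>2 \<le> (A * B)\<^sup>2" by (simp add: power_mult_distrib)
    then show ?thesis by (rule power2_le_imp_le) (use AB in simp)
  qed
  then show ?thesis by (simp add: A_def B_def C_def)
qed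

lemma nrm_triangle:
  assumes "sq_int M f" "sq_int M g"
  shows "nrm M (\<lambda>x. f x + g x) \<le> nrm M f + nrm M g"
proof (rule power2_le_imp_le)
  have "(nrm M (\<lambda>x. f x + g x))\<^sup>2 = (nrm M f)\<^sup>2 + 2 * ip M f g + (nrm M g)\<^sup>2"
    using assms sq_int_add[OF assms]
    by (simp add: nrm_power2_ip ip_add_left ip_commute[of M f "\<lambda>x. f x + g x"]
          ip_commute[of M g "\<lambda>x. f x + g x"] ip_commute[of M g f])
  also have "\<dots> \<le> (nrm M f)\<^sup>2 + 2 * (nrm M f * nrm M g) + (nrm M g)\<^sup>2"
    using Cauchy_Schwarz_ip[OF assms] by linarith
  also have "\<dots> = (nrm M f + nrm M g)\<^sup>2" by (simp add: power2_sum)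
  finally show "(nrm M (\<lambda>x. f x + g x))\<^sup>2 \<le> (nrm M f + nrm M g)\<^sup>2" .
qed simp

lemma nrm_cmult: "nrm M (\<lambda>x. c * f x) = \<bar>c\<bar> * nrm M f"
  by (simp add: nrm_def power_mult_distrib real_sqrt_mult)

lemma nrm_minus: "nrm M (\<lambda>x. - f x) = nrm M f"
  by (simp add: nrm_def)

lemma nrm_minus_commute: "nrm M (\<lambda>x. f x - g x) = nrm M (\<lambda>x. g x - f x)"
  by (simp add: nrm_def power2_commute)

lemma nrm_triangle_diff:
  assumes "sq_int M f" "sq_int M g" "sq_int M h"
  shows "nrm M (\<lambda>x. f x - h x) \<le> nrm M (\<lambda>x. f x - g x) + nrm M (\<lambda>x. g x - h x)"
  using nrm_triangle[of M "\<lambda>x. f x - g x" "\<lambda>x. g x - h x"] assms by auto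

lemma nrm_sum:
  "(\<And>i. i \<in> I \<Longrightarrow> sq_int M (f i)) \<Longrightarrow> nrm M (\<lambda>x. \<Sum>i\<in>I. f i x) \<le> (\<Sum>i\<in>I. nrm M (f i))"
proof (induction I rule: infinite_finite_induct)
  case (insert i I)
  then show ?case
    using nrm_triangle[of M "f i" "\<lambda>x. \<Sum>i\<in>I. f i x"] sq_int_sum[of I M f] by auto
qed auto

lemma nrm_cong_AE:
  assumes "AE x in M. f x = g x" "f \<in> borel_measurable M" "g \<in> borel_measurable M"
  shows "nrm M f = nrm M g"
  unfolding nrm_def using assms by (intro arg_cong[where f = sqrt] integral_cong_AE) auto

lemma ip_cong_AE:
  assumes "AE x in M. f x = g x" "f \<in> borel_measurable M" "g \<in> borel_measurable M" "h \<in> borel_measurable M"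
  shows "ip M f h = ip M g h"
  unfolding ip_def using assms by (intro integral_cong_AE) auto

lemma sq_int_cong_AE:
  assumes "AE x in M. f x = g x" "sq_int M f" "g \<in> borel_measurable M"
  shows "sq_int M g"
proof -
  have "integrable M (\<lambda>x. (f x)\<^sup>2) \<longleftrightarrow> integrable M (\<lambda>x. (g x)\<^sup>2)"
    using assms by (intro integrable_cong_AE) (auto simp: sq_int_def)
  then show ?thesis using assms by (auto simp: sq_int_def)
qed

lemma nrm_mono:
  assumes "sq_int M g" "f \<in> borel_measurable M" "\<And>x. x \<in> space M \<Longrightarrow> \<bar>f x\<bar> \<le> \<bar>g x\<bar>"
  shows "sq_int M f" "nrm M f \<le> nrm M g"
proof -
  have le: "(f x)\<^sup>2 \<le> (g x)\<^sup>2" if "x \<in> space M" for x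
    using assms(3)[OF that] by (simp add: abs_le_square_iff)
  have int: "integrable M (\<lambda>x. (f x)\<^sup>2)"
    by (rule Bochner_Integration.integrable_bound[of M "\<lambda>x. (g x)\<^sup>2"]) (use assms le in \<open>auto simp: sq_int_def\<close>)
  then show "sq_int M f" using assms by (simp add: sq_int_def)
  show "nrm M f \<le> nrm M g"
    unfolding nrm_def
    by (intro real_sqrt_le_mono integral_mono int) (use assms le in \<open>auto simp: sq_int_def\<close>)
qed

lemma nrm_eq_0_AE:
  assumes "sq_int M f" "nrm M f = 0"
  shows "AE x in M. f x = 0"
proof -
  have "(LINT x|M. (f x)\<^sup>2) = 0" using assms by (simp add: nrm_def)
  then have "AE x in M. (f x)\<^sup>2 = 0"
    using assms by (subst (asm) integral_nonneg_eq_0_iff_AE) (auto simp: sq_int_def)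
  then show ?thesis by simp
qed

text \<open>Both \<open>f j\<close> and \<open>g\<close> are bounded by \<open>w\<close> almost
  everywhere, so the squared differences are dominated by \<open>4 * w^2\<close>. This is the
  passage from pointwise convergence to convergence in \<open>L2\<close>.\<close>

lemma nrm_dominated_convergence:
  assumes w: "sq_int M w" and meas: "\<And>j. f j \<in> borel_measurable M" "g \<in> borel_measurable M"
    and bd: "\<And>j. AE x in M. \<bar>f j x\<bar> \<le> w x"
    and lim: "AE x in M. (\<lambda>j. f j x) \<longlonglongrightarrow> g x"
  shows "sq_int M g" and "(\<lambda>j. nrm M (\<lambda>x. f j x - g x)) \<longlonglongrightarrow> 0"
proof -
  have AEbd: "AE x in M. \<forall>j. \<bar>f j x\<bar> \<le> w x" using bd by (simp add: AE_all_countable)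
  have gw: "AE x in M. \<bar>g x\<bar> \<le> w x"
    using AEbd lim
  proof eventually_elim
    case (elim x)
    then have "(\<lambda>j. \<bar>f j x\<bar>) \<longlonglongrightarrow> \<bar>g x\<bar>" by (intro tendsto_rabs) auto
    with elim show ?case by (intro LIMSEQ_le_const2[of _ "\<bar>g x\<bar>"]) auto
  qed
  have intw: "integrable M (\<lambda>x. (w x)\<^sup>2)" using w by (simp add: sq_int_def)
  have "integrable M (\<lambda>x. (g x)\<^sup>2)"
  proof (rule Bochner_Integration.integrable_bound[OF intw])
    show "AE x in M. norm ((g x)\<^sup>2) \<le> norm ((w x)\<^sup>2)"
      using gw by eventually_elim (auto simp: abs_le_square_iff[symmetric])
  qed (use meas in auto)
  then show "sq_int M g" using meas by (simp add: sq_int_def)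
  have "(\<lambda>j. LINT x|M. (f j x - g x)\<^sup>2) \<longlonglongrightarrow> (LINT x|M. 0)"
  proof (rule integral_dominated_convergence[where w = "\<lambda>x. 4 * (w x)\<^sup>2"])
    show "AE x in M. (\<lambda>j. (f j x - g x)\<^sup>2) \<longlonglongrightarrow> 0"
      using lim
    proof eventually_elim
      case (elim x)
      then have "(\<lambda>j. (f j x - g x)\<^sup>2) \<longlonglongrightarrow> (g x - g x)\<^sup>2" by (intro tendsto_intros)
      then show ?case by simp
    qed
    fix j
    show "AE x in M. norm ((f j x - g x)\<^sup>2) \<le> 4 * (w x)\<^sup>2"
      using AEbd gw
    proof eventually_elim
      case (elim x)
      then have "\<bar>f j x\<bar> \<le> w x" "\<bar>g x\<bar> \<le> w x" by auto
      then have "\<bar>f j x - g x\<bar> \<le> \<bar>2 * w x\<bar>" by linarith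
      then have "(f j x - g x)\<^sup>2 \<le> (2 * w x)\<^sup>2" by (simp add: abs_le_square_iff)
      then show ?case by (simp add: power_mult_distrib)
    qed
  qed (use meas intw w in \<open>auto simp: sq_int_def\<close>)
  then have "(\<lambda>j. sqrt (LINT x|M. (f j x - g x)\<^sup>2)) \<longlonglongrightarrow> sqrt 0"
    by (intro tendsto_real_sqrt) simp
  then show "(\<lambda>j. nrm M (\<lambda>x. f j x - g x)) \<longlonglongrightarrow> 0" by (simp add: nrm_def)
qed

text \<open>Fatou's lemma and Tonelli's theorem deliver bounds on nonnegative integrals; such a
  bound contains integrability and a norm estimate at once.\<close>

lemma sq_int_nn_integral:
  assumes f: "f \<in> borel_measurable M" and le: "(\<integral>\<^sup>+x. ennreal ((f x)\<^sup>2) \<partial>M) \<le> ennreal (C\<^sup>2)" and C: "0 \<le> C"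
  shows "sq_int M f" "nrm M f \<le> C"
proof -
  have "integrable M (\<lambda>x. (f x)\<^sup>2)"
    by (rule integrableI_bounded) (use f le in \<open>auto intro: le_less_trans\<close>)
  then show s: "sq_int M f" using f by (simp add: sq_int_def)
  have "ennreal (LINT x|M. (f x)\<^sup>2) = (\<integral>\<^sup>+x. ennreal ((f x)\<^sup>2) \<partial>M)"
    using s by (intro nn_integral_eq_integral[symmetric]) (auto simp: sq_int_def)
  with le have "ennreal (LINT x|M. (f x)\<^sup>2) \<le> ennreal (C\<^sup>2)" by simp
  then have "(LINT x|M. (f x)\<^sup>2) \<le> C\<^sup>2" by (subst (asm) ennreal_le_iff) auto
  then have "sqrt (LINT x|M. (f x)\<^sup>2) \<le> sqrt (C\<^sup>2)" by (rule real_sqrt_le_mono)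
  then show "nrm M f \<le> C" using C by (simp add: nrm_def)
qed

lemma nn_integral_sq_int:
  assumes "sq_int M f"
  shows "(\<integral>\<^sup>+x. ennreal ((f x)\<^sup>2) \<partial>M) = ennreal ((nrm M f)\<^sup>2)"
  using assms unfolding nrm_power2 by (intro nn_integral_eq_integral) (auto simp: sq_int_def)

text \<open>The limit is taken pointwise, so that one formula for it serves both for functions on a
  space-time cylinder and for their time slices.\<close>

lemma Riesz_Fischer_fast:
  fixes f :: "nat \<Rightarrow> 'a \<Rightarrow> real"
  assumes sq: "\<And>j. sq_int M (f j)"
    and fast: "\<And>j. nrm M (\<lambda>x. f (Suc j) x - f j x) \<le> (1/2) ^ j"
  defines "F \<equiv> \<lambda>x. lim (\<lambda>j. f j x)"
  shows "sq_int M F" and "nrm M (\<lambda>x. f j x - F x) \<le> 2 * (1/2) ^ j"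
proof -
  define d where "d j x = f (Suc j) x - f j x" for j x
  have dsq: "sq_int M (d j)" for j unfolding d_def using sq by auto
  have [measurable]: "f j \<in> borel_measurable M" "d j \<in> borel_measurable M" for j
    using sq dsq by (auto simp: sq_int_def)
  have [measurable]: "F \<in> borel_measurable M" unfolding F_def by measurable
  \<comment> \<open>The weight \<open>2 ^ j\<close> still leaves a convergent series, and it makes
    the squared increments decay like \<open>(1/2) ^ j\<close> at almost every point, so that the
    increments themselves are summable there.\<close>
  have "(\<integral>\<^sup>+x. (\<Sum>j. ennreal (2 ^ j * (d j x)\<^sup>2)) \<partial>M) = (\<Sum>j. (\<integral>\<^sup>+x. ennreal (2 ^ j * (d j x)\<^sup>2) \<partial>M))"
    by (intro nn_integral_suminf) auto
  also have "\<dots> \<le> (\<Sum>j. ennreal ((1/2) ^ j))"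
  proof (intro suminf_le summableI)
    fix j
    have "(\<integral>\<^sup>+x. ennreal (2 ^ j * (d j x)\<^sup>2) \<partial>M) = ennreal (2 ^ j) * (\<integral>\<^sup>+x. ennreal ((d j x)\<^sup>2) \<partial>M)"
      by (subst nn_integral_cmult[symmetric]) (auto simp: ennreal_mult)
    also have "\<dots> = ennreal (2 ^ j * (nrm M (d j))\<^sup>2)"
      by (simp add: nn_integral_sq_int[OF dsq] ennreal_mult)
    also have "\<dots> \<le> ennreal (2 ^ j * ((1/2) ^ j)\<^sup>2)"
      using fast[of j] unfolding d_def by (intro ennreal_leI mult_left_mono power_mono) auto
    also have "(2::real) ^ j * ((1/2) ^ j)\<^sup>2 = (1/2) ^ j"
      by (simp add: power2_eq_square power_one_over)
    finally show "(\<integral>\<^sup>+x. ennreal (2 ^ j * (d j x)\<^sup>2) \<partial>M) \<le> ennreal ((1/2) ^ j)" .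
  qed
  also have "\<dots> = ennreal (\<Sum>j. (1/2) ^ j)"
    by (intro suminf_ennreal2) (auto intro: summable_geometric)
  also have "\<dots> < \<infinity>" by simp
  finally have "(\<integral>\<^sup>+x. (\<Sum>j. ennreal (2 ^ j * (d j x)\<^sup>2)) \<partial>M) \<noteq> \<infinity>" by simp
  then have "AE x in M. (\<Sum>j. ennreal (2 ^ j * (d j x)\<^sup>2)) \<noteq> \<infinity>"
    by (intro nn_integral_noteq_infinite) auto
  then have conv: "AE x in M. convergent (\<lambda>j. f j x)"
  proof eventually_elim
    case (elim x)
    define S where "S = (\<Sum>j. ennreal (2 ^ j * (d j x)\<^sup>2))"
    obtain C where C: "S = ennreal C" "0 \<le> C"
      using elim by (cases S) (auto simp flip: S_def)
    have b: "\<bar>d j x\<bar> \<le> sqrt C * (sqrt (1/2)) ^ j" for j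
    proof -
      have "(\<Sum>i\<in>{j}. ennreal (2 ^ i * (d i x)\<^sup>2)) \<le> S"
        unfolding S_def by (rule sum_le_suminf) (auto intro: summableI)
      then have "ennreal (2 ^ j * (d j x)\<^sup>2) \<le> ennreal C" using C(1) by simp
      then have "2 ^ j * (d j x)\<^sup>2 \<le> C" using C(2) by (subst (asm) ennreal_le_iff) auto
      then have "(d j x)\<^sup>2 \<le> C * (1/2) ^ j" by (simp add: field_simps power_one_over)
      then have "sqrt ((d j x)\<^sup>2) \<le> sqrt (C * (1/2) ^ j)" by (rule real_sqrt_le_mono)
      then have "\<bar>d j x\<bar> \<le> sqrt (C * (1/2) ^ j)" by (simp only: real_sqrt_abs)
      then show ?thesis by (simp only: real_sqrt_mult real_sqrt_power)
    qed
    have "sqrt (1/2) < sqrt (1::real)" by (rule real_sqrt_less_mono) simp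
    then have "norm (sqrt (1/2)) < (1::real)" by (simp only: real_sqrt_one) simp
    then have "summable (\<lambda>j. sqrt C * (sqrt (1/2)) ^ j)"
      by (intro summable_mult summable_geometric)
    then have "summable (\<lambda>j. d j x)"
      by (rule summable_comparison_test'[where N = 0]) (use b in auto)
    then have "(\<lambda>n. \<Sum>j<n. d j x) \<longlonglongrightarrow> (\<Sum>j. d j x)" by (rule summable_LIMSEQ)
    moreover have "(\<Sum>j<n. d j x) = f n x - f 0 x" for n
      unfolding d_def by (rule sum_lessThan_telescope)
    ultimately have "(\<lambda>n. (f n x - f 0 x) + f 0 x) \<longlonglongrightarrow> (\<Sum>j. d j x) + f 0 x"
      by (intro tendsto_add) auto
    then show ?case by (auto simp: convergent_def)
  qed
  have near: "nrm M (\<lambda>x. f m x - f j x) \<le> 2 * (1/2) ^ j" if "j \<le> m" for j m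
  proof -
    have half: "(1/2 :: real) ^ Suc n = (1/2) ^ n / 2" for n by simp
    have tel: "nrm M (\<lambda>x. f m x - f j x) \<le> 2 * ((1/2) ^ j - (1/2) ^ m)"
      using that
    proof (induction m rule: dec_induct)
      case (step n)
      then show ?case
        using nrm_triangle_diff[OF sq[of "Suc n"] sq[of n] sq[of j]] fast[of n] unfolding half by argo
    qed simp
    show ?thesis using tel by (rule order_trans) simp
  qed
  have Fj: "sq_int M (\<lambda>x. f j x - F x) \<and> nrm M (\<lambda>x. f j x - F x) \<le> 2 * (1/2) ^ j" for j
  proof -
    \<comment> \<open>Fatou's lemma: the bound on \<open>f m - f j\<close> is uniform in
      \<open>m \<ge> j\<close>, so it passes to the pointwise limit \<open>F - f j\<close>.\<close>
    have "(\<integral>\<^sup>+x. ennreal ((f j x - F x)\<^sup>2) \<partial>M) = (\<integral>\<^sup>+x. liminf (\<lambda>m. ennreal ((f m x - f j x)\<^sup>2)) \<partial>M)"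
    proof (rule nn_integral_cong_AE)
      show "AE x in M. ennreal ((f j x - F x)\<^sup>2) = liminf (\<lambda>m. ennreal ((f m x - f j x)\<^sup>2))"
        using conv
      proof eventually_elim
        case (elim x)
        then have "(\<lambda>j. f j x) \<longlonglongrightarrow> F x" by (simp add: F_def convergent_LIMSEQ_iff)
        then have "(\<lambda>m. ennreal ((f m x - f j x)\<^sup>2)) \<longlonglongrightarrow> ennreal ((F x - f j x)\<^sup>2)"
          by (intro tendsto_intros)
        then show ?case
          by (metis lim_imp_Liminf power2_commute sequentially_bot)
      qed
    qed
    also have "\<dots> \<le> liminf (\<lambda>m. \<integral>\<^sup>+x. ennreal ((f m x - f j x)\<^sup>2) \<partial>M)"
      by (rule nn_integral_liminf) auto
    also have "\<dots> \<le> ennreal ((2 * (1/2) ^ j)\<^sup>2)"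
    proof -
      have "\<forall>\<^sub>F m in sequentially. (\<integral>\<^sup>+x. ennreal ((f m x - f j x)\<^sup>2) \<partial>M) \<le> ennreal ((2 * (1/2) ^ j)\<^sup>2)"
        using eventually_ge_at_top[of j]
      proof eventually_elim
        case (elim m)
        have "(nrm M (\<lambda>x. f m x - f j x))\<^sup>2 \<le> (2 * (1/2) ^ j)\<^sup>2"
          using near[OF elim] by (intro power_mono) auto
        then show ?case by (subst nn_integral_sq_int) (use sq in \<open>auto intro: ennreal_leI\<close>)
      qed
      then have "limsup (\<lambda>m. \<integral>\<^sup>+x. ennreal ((f m x - f j x)\<^sup>2) \<partial>M) \<le> ennreal ((2 * (1/2) ^ j)\<^sup>2)"
        by (rule Limsup_bounded)
      then show ?thesis using Liminf_le_Limsup[OF sequentially_bot] order_trans by blast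
    qed
    finally show ?thesis by (intro conjI sq_int_nn_integral[where C = "2 * (1/2) ^ j"]) auto
  qed
  then show "nrm M (\<lambda>x. f j x - F x) \<le> 2 * (1/2) ^ j" by blast
  have "sq_int M (\<lambda>x. f 0 x - (f 0 x - F x))"
    by (rule sq_int_diff[OF sq[of 0] conjunct1[OF Fj[of 0]]])
  then show "sq_int M F" by simp
qed

subsection \<open>Smooth functions and test functions\<close>

lemma Ck_fun_SucD: "Ck_fun (Suc k) f \<Longrightarrow> Ck_fun k f"
proof (induction k arbitrary: f)
  case 0
  then show ?case
    by (auto intro!: differentiable_imp_continuous_on simp: differentiable_on_def differentiable_at_withinI)
next
  case (Suc k)
  then show ?case by (metis Ck_fun.simps(2))
qed

lemma Ck_fun_const: "Ck_fun k (\<lambda>x. c)"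
  by (induction k arbitrary: c) (auto simp: frechet_derivative_const)

lemma frechet_derivative_plus':
  "f differentiable (at x) \<Longrightarrow> g differentiable (at x) \<Longrightarrow>
   frechet_derivative (\<lambda>x. f x + g x) (at x) = (\<lambda>v. frechet_derivative f (at x) v + frechet_derivative g (at x) v)"
  by (rule frechet_derivative_at[symmetric])
    (auto intro!: derivative_intros simp: frechet_derivative_works[symmetric])

lemma frechet_derivative_mult':
  fixes f g :: "'a::real_normed_vector \<Rightarrow> real"
  shows "f differentiable (at x) \<Longrightarrow> g differentiable (at x) \<Longrightarrow>
   frechet_derivative (\<lambda>x. f x * g x) (at x) = (\<lambda>v. f x * frechet_derivative g (at x) v + frechet_derivative f (at x) v * g x)"
  by (rule frechet_derivative_at[symmetric])
    (auto intro!: derivative_intros simp: frechet_derivative_works[symmetric])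

lemma Ck_fun_add: "Ck_fun k f \<Longrightarrow> Ck_fun k g \<Longrightarrow> Ck_fun k (\<lambda>x. f x + g x)"
proof (induction k arbitrary: f g)
  case 0
  then show ?case by (auto intro!: continuous_intros)
next
  case (Suc k)
  then show ?case by (simp add: frechet_derivative_plus')
qed

lemma Ck_fun_mult: "Ck_fun k f \<Longrightarrow> Ck_fun k g \<Longrightarrow> Ck_fun k (\<lambda>x. f x * g x)"
proof (induction k arbitrary: f g)
  case 0
  then show ?case by (auto intro!: continuous_intros)
next
  case (Suc k)
  have "Ck_fun k f" "Ck_fun k g" using Suc.prems Ck_fun_SucD by blast+
  with Suc show ?case by (auto simp: frechet_derivative_mult' intro!: Ck_fun_add)
qed

text \<open>The chain rule replaces \<open>D n\<close> by \<open>D (Suc n)\<close>, so the induction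
  on \<open>k\<close> has to run over the whole sequence of derivatives at once; hence
  \<open>n\<close> is arbitrary.\<close>

lemma Ck_fun_compose_real:
  fixes D :: "nat \<Rightarrow> real \<Rightarrow> real"
  assumes D: "\<And>n x. (D n has_real_derivative D (Suc n) x) (at x)"
  shows "Ck_fun k f \<Longrightarrow> Ck_fun k (\<lambda>x. D n (f x))"
proof (induction k arbitrary: n)
  case 0
  have "continuous_on UNIV (D n)"
    using D by (auto intro!: continuous_at_imp_continuous_on DERIV_isCont)
  with 0 show ?case by (auto intro: continuous_on_compose2)
next
  case (Suc k)
  have der: "((\<lambda>x. D n (f x)) has_derivative (\<lambda>v. D (Suc n) (f x) * frechet_derivative f (at x) v)) (at x)" for x
  proof -
    have "(f has_derivative frechet_derivative f (at x)) (at x)"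
      using Suc.prems by (simp add: frechet_derivative_works[symmetric])
    moreover have "(D n has_derivative (*) (D (Suc n) (f x))) (at (f x))"
      using D[of n "f x"] by (simp add: has_field_derivative_def)
    ultimately show ?thesis
      using has_derivative_compose by fastforce
  qed
  have "Ck_fun k (\<lambda>x. D (Suc n) (f x) * frechet_derivative f (at x) e)" if "e \<in> Basis" for e
    using Suc.IH[OF Ck_fun_SucD[OF Suc.prems]] Suc.prems that by (intro Ck_fun_mult) auto
  then show ?case
    using der by (auto simp: frechet_derivative_at[OF der, symmetric] intro: differentiableI)
qed

lemma Ck_fun_sum: "(\<And>i. i \<in> I \<Longrightarrow> Ck_fun k (f i)) \<Longrightarrow> Ck_fun k (\<lambda>x. \<Sum>i\<in>I. f i x)"
  by (induction I rule: infinite_finite_induct) (auto intro: Ck_fun_add Ck_fun_const)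

lemma Ck_fun_prod: "(\<And>i. i \<in> I \<Longrightarrow> Ck_fun k (f i)) \<Longrightarrow> Ck_fun k (\<lambda>x. \<Prod>i\<in>I. f i x)"
  by (induction I rule: infinite_finite_induct) (auto intro: Ck_fun_mult Ck_fun_const)

lemma Ck_fun_linear:
  assumes "bounded_linear L" shows "Ck_fun k L"
proof (cases k)
  case 0
  then show ?thesis using assms by (simp add: linear_continuous_on)
next
  case (Suc j)
  have "frechet_derivative L (at x) = L" for x
    by (rule frechet_derivative_at[symmetric, OF bounded_linear_imp_has_derivative[OF assms]])
  then show ?thesis
    using Suc assms by (auto simp: Ck_fun_const intro: bounded_linear_imp_differentiable)
qed

text \<open>A directional derivative of the composite is a constant linear combination of partial
  derivatives of \<open>f\<close> composed with \<open>L\<close>, so the induction stays within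
  functions of this form. \<open>L\<close> will be a coordinate or a projection of
  space-time.\<close>

lemma Ck_fun_compose_linear:
  fixes L :: "'a::euclidean_space \<Rightarrow> 'b::euclidean_space"
  assumes L: "bounded_linear L"
  shows "Ck_fun k f \<Longrightarrow> Ck_fun k (\<lambda>x. f (L x))"
proof (induction k arbitrary: f)
  case 0
  then show ?case using linear_continuous_on[OF L] by (auto intro: continuous_on_compose2)
next
  case (Suc k)
  have fd: "(f has_derivative frechet_derivative f (at y)) (at y)" for y
    using Suc.prems by (simp add: frechet_derivative_works[symmetric])
  have der: "((\<lambda>x. f (L x)) has_derivative (\<lambda>v. frechet_derivative f (at (L x)) (L v))) (at x)" for x
    using has_derivative_compose[OF bounded_linear_imp_has_derivative[OF L] fd] .
  have "frechet_derivative f (at y) w = (\<Sum>b\<in>Basis. (w \<bullet> b) * frechet_derivative f (at y) b)" for y w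
  proof -
    have lin: "linear (frechet_derivative f (at y))" using fd has_derivative_linear by blast
    have "frechet_derivative f (at y) w = frechet_derivative f (at y) (\<Sum>b\<in>Basis. (w \<bullet> b) *\<^sub>R b)"
      by (simp add: euclidean_representation)
    also have "\<dots> = (\<Sum>b\<in>Basis. (w \<bullet> b) * frechet_derivative f (at y) b)"
      using lin by (simp add: linear_sum linear_cmul)
    finally show ?thesis .
  qed
  then have "frechet_derivative (\<lambda>x. f (L x)) (at x) e =
      (\<Sum>b\<in>Basis. (L e \<bullet> b) * frechet_derivative f (at (L x)) b)" for x e
    using frechet_derivative_at[OF der] by metis
  then show ?case
    using Suc.prems der by (auto intro!: Ck_fun_sum Ck_fun_mult Ck_fun_const Suc.IH differentiableI)
qed

lemma Ck_fun_has_derivative: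
  "Ck_fun (Suc k) f \<Longrightarrow> (f has_derivative frechet_derivative f (at x)) (at x)"
  by (simp add: frechet_derivative_works[symmetric])

lemma Ck_fun_continuous: "Ck_fun k f \<Longrightarrow> continuous_on UNIV f"
  by (induction k arbitrary: f) (auto dest: Ck_fun_SucD simp del: Ck_fun.simps(2))

lemma has_derivative_directional:
  assumes "(f has_derivative f') (at x)"
  shows "((\<lambda>s. f (x + s *\<^sub>R e)) has_real_derivative f' e) (at 0)"
proof -
  have "((\<lambda>s::real. x + s *\<^sub>R e) has_derivative (\<lambda>s. s *\<^sub>R e)) (at 0)"
    by (auto intro!: derivative_eq_intros)
  moreover have "(f has_derivative f') (at (x + 0 *\<^sub>R e))" using assms by simp
  ultimately have "((\<lambda>s. f (x + s *\<^sub>R e)) has_derivative (\<lambda>s. f' (s *\<^sub>R e))) (at 0)"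
    by (rule has_derivative_compose)
  moreover have "(\<lambda>s. f' (s *\<^sub>R e)) = (*) (f' e)"
    using has_derivative_linear[OF assms] by (auto simp: linear_cmul)
  ultimately show ?thesis by (simp add: has_field_derivative_def)
qed

lemma frechet_derivative_directional:
  assumes "Ck_fun (Suc k) f" "((\<lambda>s. f (x + s *\<^sub>R e)) has_real_derivative d) (at 0)"
  shows "frechet_derivative f (at x) e = d"
  using has_derivative_directional[OF Ck_fun_has_derivative[OF assms(1)]] assms(2) by (rule DERIV_unique)

section \<open>Smooth functions that are flat at the origin\<close>

definition flat_poly :: "real poly \<Rightarrow> real \<Rightarrow> real" where
  "flat_poly p s = (if s \<le> 0 then 0 else poly p (1 / s) * exp (- 1 / s))"

text \<open>With \<open>t = 1 / s\<close>, the derivative of \<open>p(t) exp(-t)\<close> with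
  respect to \<open>s\<close> is \<open>t^2 (p(t) - p'(t)) exp(-t)\<close>. Carrying the polynomial
  along closes the family under differentiation, so the smoothness of \<open>exp(-1/s)\<close>
  extended by zero takes a single derivative computation.\<close>

definition flat_step :: "real poly \<Rightarrow> real poly" where
  "flat_step p = [:0, 0, 1:] * (p - pderiv p)"

abbreviation flat :: "real \<Rightarrow> real" where "flat \<equiv> flat_poly 1"

lemma poly_mult_exp_tendsto_0: "((\<lambda>x. poly p x * exp (- x)) \<longlongrightarrow> (0::real)) at_top"
proof -
  have "((\<lambda>x. \<Sum>i\<le>degree p. coeff p i * (x ^ i / exp x)) \<longlongrightarrow> (\<Sum>i\<le>degree p. coeff p i * 0)) at_top"
    by (intro tendsto_intros tendsto_power_div_exp_0)
  then show ?thesis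
    by (simp add: poly_altdef sum_distrib_right exp_minus divide_inverse mult.assoc)
qed

lemma flat_poly_DERIV: "(flat_poly p has_real_derivative flat_poly (flat_step p) s) (at s)"
proof (cases s "0 :: real" rule: linorder_cases)
  case less
  have "((\<lambda>_. 0) has_real_derivative 0) (at s)" by simp
  then have "(flat_poly p has_real_derivative 0) (at s)"
    by (rule has_field_derivative_transform_within_open[where S = "{..<0}"]) (use less in \<open>auto simp: flat_poly_def\<close>)
  then show ?thesis using less by (simp add: flat_poly_def)
next
  case greater
  have "((\<lambda>s. poly p (1 / s) * exp (- 1 / s)) has_real_derivative
      poly (flat_step p) (1 / s) * exp (- 1 / s)) (at s)"
    using greater unfolding flat_step_def
    by (auto intro!: derivative_eq_intros simp: field_simps power2_eq_square)
  then have "(flat_poly p has_real_derivative poly (flat_step p) (1 / s) * exp (- 1 / s)) (at s)"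
    by (rule has_field_derivative_transform_within_open[where S = "{0<..}"]) (use greater in \<open>auto simp: flat_poly_def\<close>)
  then show ?thesis using greater by (simp add: flat_poly_def)
next
  case equal
  \<comment> \<open>At the origin the right difference quotient is \<open>t * p(t) * exp(-t)\<close>
    with \<open>t = 1 / h\<close>; \<open>pCons 0 p\<close> is the polynomial
    \<open>t * p(t)\<close>.\<close>
  have r: "((\<lambda>h. flat_poly p h / h) \<longlongrightarrow> 0) (at_right 0)"
  proof -
    have "((\<lambda>h. poly (pCons 0 p) (inverse h) * exp (- inverse h)) \<longlongrightarrow> 0) (at_right (0::real))"
      by (rule filterlim_compose[OF poly_mult_exp_tendsto_0 filterlim_inverse_at_top_right])
    then show ?thesis
    proof (rule Lim_transform_eventually)
      show "\<forall>\<^sub>F h in at_right 0. poly (pCons 0 p) (inverse h) * exp (- inverse h) = flat_poly p h / h"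
        by (auto simp: eventually_at_filter flat_poly_def field_simps)
    qed
  qed
  have l: "((\<lambda>h. flat_poly p h / h) \<longlongrightarrow> 0) (at_left 0)"
    by (rule Lim_transform_eventually[OF tendsto_const]) (auto simp: eventually_at_filter flat_poly_def)
  have "((\<lambda>h. flat_poly p h / h) \<longlongrightarrow> 0) (at 0)"
    using l r by (simp add: filterlim_split_at)
  then show ?thesis using equal by (simp add: DERIV_def flat_poly_def)
qed

lemma Ck_fun_flat:
  assumes "Ck_fun k f" shows "Ck_fun k (\<lambda>x. flat_poly p (f x))"
  using Ck_fun_compose_real[where D = "\<lambda>n. flat_poly ((flat_step ^^ n) p)" and n = 0, OF _ assms]
  by (simp add: flat_poly_DERIV)

lemma flat_nonneg: "0 \<le> flat s" and flat_le_1: "flat s \<le> 1" and flat_eq_0: "s \<le> 0 \<Longrightarrow> flat s = 0"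
  and flat_pos: "0 < s \<Longrightarrow> 0 < flat s"
  by (auto simp: flat_poly_def)

lemma flat_tendsto_1:
  assumes "filterlim g at_top F" shows "((\<lambda>j. flat (g j)) \<longlongrightarrow> 1) F"
proof -
  have "((\<lambda>s::real. exp (- 1 / s)) \<longlongrightarrow> exp 0) at_top"
    by (intro tendsto_exp real_tendsto_divide_at_top[OF tendsto_const] filterlim_ident)
  moreover have "\<forall>\<^sub>F s in at_top. exp (- 1 / s) = flat s"
    using eventually_gt_at_top[of 0] by eventually_elim (auto simp: flat_poly_def)
  ultimately have "(flat \<longlongrightarrow> exp 0) at_top" by (rule Lim_transform_eventually)
  then show ?thesis using filterlim_compose[OF _ assms] by simp
qed

text \<open>Prepared for arguments \<open>s = j * r - 1\<close>, where \<open>r\<close> is the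
  distance to a face of the box: then \<open>s + 1 = j * r\<close>, and the derivative of a cutoff
  multiplied by that distance is controlled independently of \<open>j\<close>. In
  \<open>t = 1 / s\<close> the product is \<open>(t + t^2) exp(-t)\<close>, and the constant comes
  from \<open>1 + t + t^2 / 2 \<le> exp t\<close>.\<close>

lemma flat_deriv_bound:
  shows "0 \<le> flat_poly (flat_step 1) s" "(s + 1) * flat_poly (flat_step 1) s \<le> 3"
proof -
  show "0 \<le> flat_poly (flat_step 1) s"
    by (auto simp: flat_poly_def flat_step_def)
  show "(s + 1) * flat_poly (flat_step 1) s \<le> 3"
  proof (cases "s \<le> 0")
    case False
    define t where "t = 1 / s"
    have t: "t > 0" "s = 1 / t" using False by (auto simp: t_def)
    have "1 + t + t\<^sup>2 / 2 \<le> exp t" using exp_lower_Taylor_quadratic[of t] t by simp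
    then have "t + t\<^sup>2 \<le> 3 * exp t" using t zero_le_power2[of t] by linarith
    then have "(t + t\<^sup>2) * exp (- t) \<le> 3" by (simp add: exp_minus field_simps)
    moreover have "(s + 1) * flat_poly (flat_step 1) s = (t + t\<^sup>2) * exp (- t)"
      using t(1) unfolding t(2) by (simp add: flat_poly_def flat_step_def field_simps power2_eq_square)
    ultimately show ?thesis by simp
  qed (auto simp: flat_poly_def)
qed

lemma flat_deriv_tendsto_0:
  assumes "filterlim g at_top F" shows "((\<lambda>j. (g j + 1) * flat_poly (flat_step 1) (g j)) \<longlongrightarrow> 0) F"
proof -
  have "((\<lambda>s::real. (1 / s + (1 / s)\<^sup>2) * exp (- 1 / s)) \<longlongrightarrow> (0 + 0\<^sup>2) * exp 0) at_top"
    by (intro tendsto_intros real_tendsto_divide_at_top[OF tendsto_const] filterlim_ident)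
  moreover have "\<forall>\<^sub>F s in at_top. (1 / s + (1 / s)\<^sup>2) * exp (- 1 / s) = (s + 1) * flat_poly (flat_step 1) s"
    using eventually_gt_at_top[of 0]
    by eventually_elim (auto simp: flat_poly_def flat_step_def field_simps power2_eq_square)
  ultimately have "((\<lambda>s. (s + 1) * flat_poly (flat_step 1) s) \<longlongrightarrow> (0 + 0\<^sup>2) * exp 0) at_top"
    by (rule Lim_transform_eventually)
  then show ?thesis using filterlim_compose[OF _ assms] by simp
qed

section \<open>Extension by zero and integration by parts\<close>

lemma restrict_extend_continuous:
  fixes h :: "'a::euclidean_space \<Rightarrow> real"
  assumes "open U" "compact K" "K \<subseteq> U" "continuous_on U h" "\<And>x. x \<in> U \<Longrightarrow> x \<notin> K \<Longrightarrow> h x = 0"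
  shows "continuous_on UNIV (\<lambda>x. if x \<in> U then h x else 0)"
proof -
  let ?F = "\<lambda>x. if x \<in> U then h x else 0"
  have "continuous_on U ?F"
    by (rule continuous_on_eq[OF assms(4)]) auto
  moreover have "continuous_on (- K) ?F"
    by (rule continuous_on_eq[of _ "\<lambda>_. 0"]) (use assms in auto)
  ultimately have "continuous_on (U \<union> - K) ?F"
    using assms by (intro continuous_on_open_Un) (auto intro: compact_imp_closed)
  moreover have "U \<union> - K = UNIV" using assms by auto
  ultimately show ?thesis by simp
qed

text \<open>The definitions speak of restricted complete measures, whereas translation invariance
  and product formulas are used for \<open>lborel\<close>. This is the passage between the two for
  integrands that are Borel after extension by zero.\<close>

lemma LINT_lebesgue_on_lborel:
  fixes f :: "'a::euclidean_space \<Rightarrow> real"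
  assumes "U \<in> sets borel" "(\<lambda>x. if x \<in> U then f x else 0) \<in> borel_measurable borel"
  shows "(LINT x|lebesgue_on U. f x) = (LINT x|lborel. (if x \<in> U then f x else 0))"
proof -
  have "(LINT x|lebesgue_on U. f x) = (LINT x|lebesgue. indicator U x *\<^sub>R f x)"
    using assms by (subst integral_restrict_space) auto
  also have "\<dots> = (LINT x|lebesgue. (if x \<in> U then f x else 0))"
    by (intro Bochner_Integration.integral_cong) auto
  also have "\<dots> = (LINT x|lborel. (if x \<in> U then f x else 0))"
    using assms by (intro integral_completion) auto
  finally show ?thesis .
qed

lemma continuous_compact_support_integrable:
  fixes F :: "'a::euclidean_space \<Rightarrow> real"
  assumes "continuous_on UNIV F" "compact K" "\<And>x. x \<notin> K \<Longrightarrow> F x = 0"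
  shows "integrable lborel F"
proof -
  have "integrable lborel (\<lambda>x. indicator K x *\<^sub>R F x)"
    using borel_integrable_compact[OF assms(2), of F] continuous_on_subset[OF assms(1)]
    by (simp add: indicator_def of_bool_def if_distrib cong: if_cong)
  moreover have "(\<lambda>x. indicator K x *\<^sub>R F x) = F"
    using assms(3) by (auto simp: fun_eq_iff indicator_def)
  ultimately show ?thesis by simp
qed

lemma integral_lborel_shift:
  fixes F :: "'a::euclidean_space \<Rightarrow> real"
  assumes "F \<in> borel_measurable borel"
  shows "(LINT x|lborel. F (c + x)) = (LINT x|lborel. F x)"
proof -
  have "(LINT x|lborel. F x) = (LINT x|distr lborel borel ((+) c). F x)"
    by (simp add: lborel_distr_plus)
  also have "\<dots> = (LINT x|lborel. F (c + x))"
    using assms by (subst integral_distr) auto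
  finally show ?thesis by simp
qed

text \<open>By translation invariance the difference quotients have integral zero.\<close>

lemma integral_directional_derivative_eq_0:
  fixes F D :: "'a::euclidean_space \<Rightarrow> real"
  assumes F: "continuous_on UNIV F" and D: "continuous_on UNIV D"
    and K: "compact K" "\<And>x. x \<notin> K \<Longrightarrow> F x = 0" "\<And>x. x \<notin> K \<Longrightarrow> D x = 0"
    and der: "\<And>x. ((\<lambda>s. F (x + s *\<^sub>R e)) has_real_derivative D x) (at 0)"
  shows "(LINT x|lborel. D x) = 0"
proof -
  define h where "h n = inverse (real (Suc n))" for n
  have h: "0 < h n" "h n \<le> 1" for n by (auto simp: h_def inverse_le_1_iff)
  have der': "((\<lambda>s. F (x + s *\<^sub>R e)) has_real_derivative D (x + t *\<^sub>R e)) (at t)" for x t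
    using DERIV_shift[of "\<lambda>s. F (x + s *\<^sub>R e)" "D (x + t *\<^sub>R e)" 0 t] der[of "x + t *\<^sub>R e"]
    by (simp add: algebra_simps)
  obtain C where C: "\<And>x. \<bar>D x\<bar> \<le> C"
  proof -
    have "bounded (D ` K)"
      by (intro compact_imp_bounded compact_continuous_image continuous_on_subset[OF D] K) auto
    then obtain C where "\<And>x. x \<in> K \<Longrightarrow> \<bar>D x\<bar> \<le> C" by (auto simp: bounded_iff)
    then have "\<bar>D x\<bar> \<le> max C 0" for x using K(3)[of x] by (cases "x \<in> K") fastforce+
    then show thesis by (rule that)
  qed
  obtain R where R: "\<And>x. x \<in> K \<Longrightarrow> norm x \<le> R"
    using compact_imp_bounded[OF K(1)] by (auto simp: bounded_iff)
  define q where "q n x = (F (h n *\<^sub>R e + x) - F x) / h n" for n x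
  \<comment> \<open>By the mean value theorem a difference quotient is a value of \<open>D\<close>
    at a point at most \<open>norm e\<close> away, because \<open>h n \<le> 1\<close>; so all
    quotients vanish outside this ball and are bounded by \<open>C\<close>.\<close>
  define w where "w x = C * indicator (cball 0 (R + norm e)) x" for x :: 'a
  have [measurable]: "F \<in> borel_measurable borel" "D \<in> borel_measurable borel"
    using F D by (auto intro: borel_measurable_continuous_onI)
  have intF: "integrable lborel F" by (rule continuous_compact_support_integrable[OF F K(1,2)])
  have "compact ((\<lambda>x. x - h n *\<^sub>R e) ` K)" for n
    by (intro compact_continuous_image continuous_intros K(1))
  moreover have "F (h n *\<^sub>R e + x) = 0" if "x \<notin> (\<lambda>x. x - h n *\<^sub>R e) ` K" for n x
    using that by (intro K(2)) (auto simp: image_iff algebra_simps)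
  ultimately have intS: "integrable lborel (\<lambda>x. F (h n *\<^sub>R e + x))" for n
    by (intro continuous_compact_support_integrable[where K = "(\<lambda>x. x - h n *\<^sub>R e) ` K"])
      (auto intro!: continuous_on_compose2[OF F] continuous_intros)
  have "(\<lambda>n. LINT x|lborel. q n x) \<longlonglongrightarrow> (LINT x|lborel. D x)"
  proof (rule integral_dominated_convergence[where w = w])
    show "integrable lborel w" unfolding w_def
      using emeasure_lborel_cball_finite[of 0 "R + norm e"]
      by (intro integrable_mult_right integrable_real_indicator) (auto simp: infinity_ennreal_def)
    show "AE x in lborel. (\<lambda>n. q n x) \<longlonglongrightarrow> D x"
    proof (rule AE_I2)
      fix x
      have "((\<lambda>s. (F (x + s *\<^sub>R e) - F x) / s) \<longlongrightarrow> D x) (at 0)"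
        using der[of x] by (simp add: DERIV_def)
      moreover have "filterlim h (at 0) sequentially"
      proof -
        have "h \<longlonglongrightarrow> 0" unfolding h_def[abs_def] by (rule LIMSEQ_inverse_real_of_nat)
        moreover have "\<forall>n. h n \<noteq> 0" using h(1) by (auto simp: less_le)
        ultimately show ?thesis by (simp add: filterlim_at)
      qed
      ultimately have "(\<lambda>n. (F (x + h n *\<^sub>R e) - F x) / h n) \<longlonglongrightarrow> D x"
        by (rule filterlim_compose)
      then show "(\<lambda>n. q n x) \<longlonglongrightarrow> D x" by (simp add: q_def add.commute)
    qed
    fix n
    show "AE x in lborel. norm (q n x) \<le> w x"
    proof (rule AE_I2)
      fix x
      obtain z where z: "0 < z" "z < h n" "F (x + h n *\<^sub>R e) - F (x + 0 *\<^sub>R e) = (h n - 0) * D (x + z *\<^sub>R e)"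
        using MVT2[OF h(1)[of n], of "\<lambda>s. F (x + s *\<^sub>R e)" "\<lambda>t. D (x + t *\<^sub>R e)"] der'[of x] by auto
      have qx: "q n x = D (x + z *\<^sub>R e)" using z h(1)[of n] by (simp add: q_def add.commute)
      show "norm (q n x) \<le> w x"
      proof (cases "x \<in> cball 0 (R + norm e)")
        case True then show ?thesis using C by (simp add: w_def qx)
      next
        case False
        have "z * norm e \<le> 1 * norm e" using z h(2)[of n] by (intro mult_right_mono) auto
        then have "norm (z *\<^sub>R e) \<le> norm e" using z by simp
        then have "R < norm (x + z *\<^sub>R e)"
          using False norm_triangle_ineq4[of "x + z *\<^sub>R e" "z *\<^sub>R e"] by simp
        then have "x + z *\<^sub>R e \<notin> K" using R by force
        then show ?thesis using False by (simp add: w_def qx K(3))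
      qed
    qed
  qed (auto simp: q_def)
  moreover have "(LINT x|lborel. q n x) = 0" for n
    using intF intS integral_lborel_shift[of F "h n *\<^sub>R e"] by (simp add: q_def)
  ultimately show ?thesis by (simp add: LIMSEQ_const_iff)
qed

lemma test_functionsE:
  assumes "\<phi> \<in> test_functions U"
  obtains K where "compact K" "K \<subseteq> U" "\<And>x. x \<notin> K \<Longrightarrow> \<phi> x = 0"
    "\<And>x e. x \<notin> K \<Longrightarrow> frechet_derivative \<phi> (at x) e = 0"
proof -
  define K where "K = closure {x. \<phi> x \<noteq> 0}"
  have K: "compact K" "K \<subseteq> U" using assms by (auto simp: test_functions_def K_def)
  have z: "\<phi> x = 0" if "x \<notin> K" for x using that closure_subset[of "{x. \<phi> x \<noteq> 0}"] by (auto simp: K_def)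
  have "frechet_derivative \<phi> (at x) e = 0" if x: "x \<notin> K" for x e
  proof -
    have "((\<lambda>_. 0) has_derivative (\<lambda>_. 0)) (at x)" by simp
    then have "(\<phi> has_derivative (\<lambda>_. 0)) (at x)"
      by (rule has_derivative_transform_within_open[where s = "- K"])
        (use x z compact_imp_closed[OF K(1)] in auto)
    from frechet_derivative_at[OF this, symmetric] show ?thesis by simp
  qed
  with K z show thesis by (rule that)
qed

lemma test_functions_smooth: "\<phi> \<in> test_functions U \<Longrightarrow> Ck_fun k \<phi>"
  by (simp add: test_functions_def)

lemma test_functionsI:
  assumes "\<And>k. Ck_fun k \<phi>" "compact K" "K \<subseteq> U" "\<And>x. x \<notin> K \<Longrightarrow> \<phi> x = 0"
  shows "\<phi> \<in> test_functions U"
proof -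
  have "closure {x. \<phi> x \<noteq> 0} \<subseteq> K"
    using assms by (intro closure_minimal) (auto intro: compact_imp_closed)
  then show ?thesis
    using assms bounded_subset[OF compact_imp_bounded[OF assms(2)], of "{x. \<phi> x \<noteq> 0}"]
    by (auto simp: test_functions_def)
qed

lemma test_functions_deriv:
  assumes "\<phi> \<in> test_functions U" "e \<in> Basis"
  shows "(\<lambda>x. frechet_derivative \<phi> (at x) e) \<in> test_functions U"
proof -
  obtain K where K: "compact K" "K \<subseteq> U" "\<And>x e. x \<notin> K \<Longrightarrow> frechet_derivative \<phi> (at x) e = 0"
    using test_functionsE[OF assms(1)] by metis
  have "Ck_fun k (\<lambda>x. frechet_derivative \<phi> (at x) e)" for k
    using test_functions_smooth[OF assms(1), of "Suc k"] assms(2) by simp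
  then show ?thesis by (rule test_functionsI[of _ K]) (use K in auto)
qed

lemma test_functions_add:
  assumes "\<phi> \<in> test_functions U" "\<psi> \<in> test_functions U"
  shows "(\<lambda>x. \<phi> x + \<psi> x) \<in> test_functions U"
proof -
  obtain K where K: "compact K" "K \<subseteq> U" "\<And>x. x \<notin> K \<Longrightarrow> \<phi> x = 0"
    using test_functionsE[OF assms(1)] by metis
  obtain L where L: "compact L" "L \<subseteq> U" "\<And>x. x \<notin> L \<Longrightarrow> \<psi> x = 0"
    using test_functionsE[OF assms(2)] by metis
  show ?thesis
  proof (rule test_functionsI[of _ "K \<union> L"])
    show "Ck_fun k (\<lambda>x. \<phi> x + \<psi> x)" for k
      using assms by (intro Ck_fun_add test_functions_smooth)
  qed (use K L in auto)
qed

lemma test_functions_cmult: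
  assumes "\<phi> \<in> test_functions U"
  shows "(\<lambda>x. c * \<phi> x) \<in> test_functions U"
proof -
  obtain K where K: "compact K" "K \<subseteq> U" "\<And>x. x \<notin> K \<Longrightarrow> \<phi> x = 0"
    using test_functionsE[OF assms] by metis
  show ?thesis
  proof (rule test_functionsI[of _ K])
    show "Ck_fun k (\<lambda>x. c * \<phi> x)" for k
      using assms by (intro Ck_fun_mult Ck_fun_const test_functions_smooth)
  qed (use K in auto)
qed

lemma test_functions_zero: "(\<lambda>x. 0) \<in> test_functions U"
  by (rule test_functionsI[of _ "{}"]) (simp_all add: Ck_fun_const)

lemma test_functions_sum:
  "(\<And>i. i \<in> I \<Longrightarrow> \<phi> i \<in> test_functions U) \<Longrightarrow> (\<lambda>x. \<Sum>i\<in>I. \<phi> i x) \<in> test_functions U"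
  by (induction I rule: infinite_finite_induct) (simp_all add: test_functions_add test_functions_zero)

lemma frechet_derivative_linear_comb:
  assumes "\<And>i. i \<in> I \<Longrightarrow> Ck_fun 1 (f i)"
  shows "frechet_derivative (\<lambda>x. \<Sum>i\<in>I. c i * f i x) (at x) e = (\<Sum>i\<in>I. c i * frechet_derivative (f i) (at x) e)"
proof -
  have "((\<lambda>x. \<Sum>i\<in>I. c i * f i x) has_derivative (\<lambda>v. \<Sum>i\<in>I. c i * frechet_derivative (f i) (at x) v)) (at x)"
  proof (rule has_derivative_sum)
    fix i assume "i \<in> I"
    then have "(f i has_derivative frechet_derivative (f i) (at x)) (at x)"
      using Ck_fun_has_derivative[of 0 "f i" x] assms by simp
    then show "((\<lambda>x. c i * f i x) has_derivative (\<lambda>v. c i * frechet_derivative (f i) (at x) v)) (at x)"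
      by (rule has_derivative_mult_right)
  qed
  from frechet_derivative_at[OF this, symmetric] show ?thesis by simp
qed

text \<open>Continuity and compact support give integrability of the square with respect to
  \<open>lborel\<close>, and the completion and the restriction to \<open>U\<close> inherit
  it.\<close>

lemma test_function_sq_int:
  assumes "\<phi> \<in> test_functions U" "open U"
  shows "sq_int (lebesgue_on U) \<phi>"
proof -
  obtain K where K: "compact K" "K \<subseteq> U" "\<And>x. x \<notin> K \<Longrightarrow> \<phi> x = 0"
    using test_functionsE[OF assms(1)] by metis
  have c: "continuous_on UNIV \<phi>" by (rule Ck_fun_continuous[OF test_functions_smooth[OF assms(1)]])
  then have [measurable]: "\<phi> \<in> borel_measurable borel" by (rule borel_measurable_continuous_onI)
  have "integrable lborel (\<lambda>x. (\<phi> x)\<^sup>2)"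
    using K by (intro continuous_compact_support_integrable[of _ K] continuous_intros c) auto
  then have "integrable lebesgue (\<lambda>x. (\<phi> x)\<^sup>2)"
    by (subst integrable_completion) auto
  then have "integrable lebesgue (\<lambda>x. indicator U x *\<^sub>R (\<phi> x)\<^sup>2)"
    using assms(2) by (intro integrable_mult_indicator) auto
  then have "integrable (lebesgue_on U) (\<lambda>x. (\<phi> x)\<^sup>2)"
    using assms(2) by (subst integrable_restrict_space) auto
  moreover have "\<phi> \<in> borel_measurable (lebesgue_on U)"
    by (intro measurable_restrict_space1 measurable_completion) simp
  ultimately show ?thesis by (simp add: sq_int_def)
qed

text \<open>The product \<open>f * \<phi>\<close>, extended by zero, is continuously differentiable
  in direction \<open>e\<close> on the whole space, whatever \<open>f\<close> does near the boundary
  of \<open>U\<close>; the integral of its derivative is zero.\<close>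

lemma integration_by_parts_test:
  fixes U :: "'a::euclidean_space set"
  assumes U: "open U" and \<phi>: "\<phi> \<in> test_functions U"
    and f: "continuous_on U f" and g: "continuous_on U g"
    and der: "\<And>x. x \<in> U \<Longrightarrow> ((\<lambda>s. f (x + s *\<^sub>R e)) has_real_derivative g x) (at 0)"
    and e: "e \<in> Basis"
  shows "ip (lebesgue_on U) f (\<lambda>x. frechet_derivative \<phi> (at x) e) = - ip (lebesgue_on U) g \<phi>"
proof -
  obtain K where K: "compact K" "K \<subseteq> U" "\<And>x. x \<notin> K \<Longrightarrow> \<phi> x = 0"
    "\<And>x e. x \<notin> K \<Longrightarrow> frechet_derivative \<phi> (at x) e = 0"
    using test_functionsE[OF \<phi>] by metis
  let ?d = "\<lambda>x. frechet_derivative \<phi> (at x) e"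
  have c: "continuous_on U \<phi>" "continuous_on U ?d"
    using Ck_fun_continuous[OF test_functions_smooth[OF \<phi>]]
      Ck_fun_continuous[OF test_functions_smooth[OF test_functions_deriv[OF \<phi> e]]]
    by (auto intro: continuous_on_subset)
  define F where "F x = (if x \<in> U then f x * \<phi> x else 0)" for x
  define A where "A x = (if x \<in> U then f x * ?d x else 0)" for x
  define G where "G x = (if x \<in> U then g x * \<phi> x else 0)" for x
  have cont: "continuous_on UNIV F" "continuous_on UNIV A" "continuous_on UNIV G"
    unfolding F_def A_def G_def using K
    by (auto intro!: restrict_extend_continuous[OF U K(1,2)] continuous_intros f g c)
  have zero: "F x = 0" "A x = 0" "G x = 0" if "x \<notin> K" for x
    using that K by (auto simp: F_def A_def G_def)
  have "(LINT x|lborel. A x + G x) = 0"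
  proof (rule integral_directional_derivative_eq_0[where F = F and K = K and e = e])
    show "((\<lambda>s. F (x + s *\<^sub>R e)) has_real_derivative A x + G x) (at 0)" for x
    proof (cases "x \<in> U")
      case True
      have "((\<lambda>s. \<phi> (x + s *\<^sub>R e)) has_real_derivative ?d x) (at 0)"
        by (rule has_derivative_directional[OF Ck_fun_has_derivative[OF test_functions_smooth[OF \<phi>]]])
      then have d: "((\<lambda>s. f (x + s *\<^sub>R e) * \<phi> (x + s *\<^sub>R e)) has_real_derivative A x + G x) (at 0)"
        using DERIV_mult[OF der[OF True]] True by (fastforce simp: A_def G_def algebra_simps)
      have op: "open ((\<lambda>s. x + s *\<^sub>R e) -` U)" by (intro open_vimage U continuous_intros)
      show ?thesis
        by (rule has_field_derivative_transform_within_open[OF d op]) (use True in \<open>auto simp: F_def\<close>)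
    next
      case False
      then have xK: "x \<notin> K" using K by auto
      have op: "open ((\<lambda>s. x + s *\<^sub>R e) -` (- K))"
        by (intro open_vimage continuous_intros) (use K(1) compact_imp_closed in auto)
      have "((\<lambda>s. 0) has_real_derivative 0) (at 0)" by simp
      then have "((\<lambda>s. F (x + s *\<^sub>R e)) has_real_derivative 0) (at 0)"
        by (rule has_field_derivative_transform_within_open[OF _ op]) (use xK zero in auto)
      then show ?thesis using zero xK by simp
    qed
  qed (use cont zero K in \<open>auto intro!: continuous_intros\<close>)
  moreover have "integrable lborel A" "integrable lborel G"
    using continuous_compact_support_integrable[OF _ K(1)] cont zero by blast+
  ultimately have "(LINT x|lborel. A x) = - (LINT x|lborel. G x)" by simp
  moreover have "ip (lebesgue_on U) f ?d = (LINT x|lborel. A x)"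
    unfolding ip_def A_def using U cont(2)
    by (intro LINT_lebesgue_on_lborel) (auto intro: borel_measurable_continuous_onI simp flip: A_def)
  moreover have "ip (lebesgue_on U) g \<phi> = (LINT x|lborel. G x)"
    unfolding ip_def G_def using U cont(3)
    by (intro LINT_lebesgue_on_lborel) (auto intro: borel_measurable_continuous_onI simp flip: G_def)
  ultimately show ?thesis by simp
qed

section \<open>Smooth plateaus and the fundamental lemma of the calculus of variations\<close>

definition plateau :: "'a::euclidean_space \<Rightarrow> 'a \<Rightarrow> nat \<Rightarrow> 'a \<Rightarrow> real" where
  "plateau c d j x = (\<Prod>b\<in>Basis. flat (real j * (x \<bullet> b - c \<bullet> b)) * flat (real j * (d \<bullet> b - x \<bullet> b)))"

lemma plateau_bounds: "0 \<le> plateau c d j x" "plateau c d j x \<le> 1"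
proof -
  have "0 \<le> flat r * flat s \<and> flat r * flat s \<le> 1" for r s
    using flat_nonneg[of r] flat_nonneg[of s] flat_le_1[of r] flat_le_1[of s] by (simp add: mult_le_one)
  then show "0 \<le> plateau c d j x" "plateau c d j x \<le> 1"
    unfolding plateau_def by (intro prod_nonneg prod_le_1 ballI; blast)+
qed

lemma plateau_zero:
  assumes "x \<notin> box c d" shows "plateau c d j x = 0"
proof -
  obtain b where b: "b \<in> Basis" "x \<bullet> b \<le> c \<bullet> b \<or> d \<bullet> b \<le> x \<bullet> b" using assms by (force simp: mem_box)
  then have "flat (real j * (x \<bullet> b - c \<bullet> b)) * flat (real j * (d \<bullet> b - x \<bullet> b)) = 0"
    by (auto simp: flat_eq_0 mult_le_0_iff)
  then show ?thesis unfolding plateau_def using b by (auto intro!: prod_zero)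
qed

lemma plateau_tendsto: "(\<lambda>j. plateau c d j x) \<longlonglongrightarrow> indicator (box c d) x"
proof (cases "x \<in> box c d")
  case True
  have lim: "filterlim (\<lambda>j. real j * r) at_top sequentially" if "r > 0" for r
    by (rule filterlim_at_top_mult_tendsto_pos[OF tendsto_const that filterlim_real_sequentially])
  have "(\<lambda>j. plateau c d j x) \<longlonglongrightarrow> (\<Prod>b\<in>(Basis::'a set). 1 * 1)"
    unfolding plateau_def using True
    by (intro tendsto_prod tendsto_mult flat_tendsto_1 lim) (auto simp: mem_box)
  with True show ?thesis by simp
qed (simp add: plateau_zero)

lemma plateau_smooth: "Ck_fun k (plateau c d j)"
proof -
  have b: "Ck_fun k (\<lambda>x. x \<bullet> b)" for b :: 'a by (rule Ck_fun_linear[OF bounded_linear_inner_left])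
  have "Ck_fun k (\<lambda>x. flat (real j * (x \<bullet> b - c \<bullet> b)) * flat (real j * (d \<bullet> b - x \<bullet> b)))" for b
  proof (intro Ck_fun_mult Ck_fun_flat Ck_fun_const)
    show "Ck_fun k (\<lambda>x. x \<bullet> b - c \<bullet> b)" using Ck_fun_add[OF b Ck_fun_const[of _ "- (c \<bullet> b)"]] by simp
    show "Ck_fun k (\<lambda>x. d \<bullet> b - x \<bullet> b)"
      using Ck_fun_add[OF Ck_fun_const Ck_fun_mult[OF Ck_fun_const[of _ "-1"] b]] by simp
  qed
  then show ?thesis unfolding plateau_def[abs_def] by (intro Ck_fun_prod)
qed

lemma plateau_test:
  assumes "cbox c d \<subseteq> U" shows "plateau c d j \<in> test_functions U"
  using assms box_subset_cbox[of c d]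
  by (intro test_functionsI[of _ "cbox c d"] plateau_smooth) (auto intro!: plateau_zero)

text \<open>Plateaus converge boundedly to the indicator of a box, so \<open>g\<close> has integral
  zero over every closed box inside \<open>U\<close>. Lebesgue's differentiation theorem along
  shrinking cubes then recovers \<open>g\<close> almost everywhere.\<close>

lemma fundamental_lemma:
  fixes g :: "'a::euclidean_space \<Rightarrow> real"
  assumes U: "open U" and g: "sq_int (lebesgue_on U) g"
    and orth: "\<And>\<phi>. \<phi> \<in> test_functions U \<Longrightarrow> ip (lebesgue_on U) g \<phi> = 0"
  shows "AE x in lebesgue_on U. g x = 0"
proof -
  define G where "G x = (if x \<in> U then g x else 0)" for x
  have Um: "U \<in> sets lebesgue" using U by auto
  have Gm: "G \<in> borel_measurable lebesgue"
    using g Um borel_measurable_if[of U g] by (simp add: sq_int_def G_def[abs_def])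
  have "integrable lebesgue (\<lambda>x. indicator U x *\<^sub>R (g x)\<^sup>2)"
    using g Um by (subst integrable_restrict_space[symmetric]) (auto simp: sq_int_def)
  also have "(\<lambda>x. indicator U x *\<^sub>R (g x)\<^sup>2) = (\<lambda>x. (G x)\<^sup>2)" by (auto simp: G_def)
  finally have Gsq: "sq_int lebesgue G" using Gm by (simp add: sq_int_def)
  have indsq: "sq_int lebesgue (\<lambda>x. indicator (cbox c d) x)" for c d :: 'a
  proof -
    have "(\<lambda>x. (indicator (cbox c d) x)\<^sup>2) = (indicator (cbox c d) :: 'a \<Rightarrow> real)"
      by (auto simp: indicator_def)
    then show ?thesis using lmeasurable_cbox[of c d] by (auto simp: sq_int_def lmeasurable_iff_integrable)
  qed
  have GI: "G absolutely_integrable_on cbox c d" for c d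
    using sq_int_mult_integrable[OF indsq Gsq, of c d]
    by (simp add: set_integrable_def)
  have zero: "integral (cbox c d) G = 0" if cd: "cbox c d \<subseteq> U" for c d
  proof -
    have "(\<lambda>j. LINT x|lebesgue. G x * plateau c d j x) \<longlonglongrightarrow> (LINT x|lebesgue. G x * indicator (box c d) x)"
    proof (rule integral_dominated_convergence[where w = "\<lambda>x. \<bar>G x * indicator (cbox c d) x\<bar>"])
      show "integrable lebesgue (\<lambda>x. \<bar>G x * indicator (cbox c d) x\<bar>)"
        using sq_int_mult_integrable[OF Gsq indsq] by simp
      show "AE x in lebesgue. (\<lambda>j. G x * plateau c d j x) \<longlonglongrightarrow> G x * indicator (box c d) x"
        by (intro AE_I2 tendsto_intros plateau_tendsto)
      show "AE x in lebesgue. norm (G x * plateau c d j x) \<le> \<bar>G x * indicator (cbox c d) x\<bar>" for j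
      proof (rule AE_I2)
        fix x
        show "norm (G x * plateau c d j x) \<le> \<bar>G x * indicator (cbox c d) x\<bar>"
        proof (cases "x \<in> box c d")
          case True
          then have "x \<in> cbox c d" using box_subset_cbox by blast
          then show ?thesis using plateau_bounds[of c d j x] by (simp add: abs_mult mult_left_le)
        qed (simp add: plateau_zero)
      qed
      have "plateau c d j \<in> borel_measurable lebesgue" for j
        using borel_measurable_continuous_onI[OF Ck_fun_continuous[OF plateau_smooth]]
        by (intro measurable_completion) simp
      then show "(\<lambda>x. G x * plateau c d j x) \<in> borel_measurable lebesgue" for j
        using Gm by (intro borel_measurable_times)
      show "(\<lambda>x. G x * indicator (box c d) x) \<in> borel_measurable lebesgue"
        using Gm by (intro borel_measurable_times borel_measurable_indicator fmeasurableD lmeasurable_box)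
    qed
    moreover have "(LINT x|lebesgue. G x * plateau c d j x) = 0" for j
    proof -
      have "(LINT x|lebesgue. G x * plateau c d j x) = (LINT x|lebesgue. indicator U x *\<^sub>R (g x * plateau c d j x))"
        by (intro Bochner_Integration.integral_cong) (auto simp: G_def)
      also have "\<dots> = ip (lebesgue_on U) g (plateau c d j)"
        using Um unfolding ip_def by (subst integral_restrict_space) auto
      also have "\<dots> = 0" by (rule orth[OF plateau_test[OF cd]])
      finally show ?thesis .
    qed
    ultimately have z: "(LINT x|lebesgue. G x * indicator (box c d) x) = 0"
      by (simp add: LIMSEQ_const_iff)
    have "integral (cbox c d) G = (LINT x:cbox c d|lebesgue. G x)"
      using GI by (simp add: set_lebesgue_integral_eq_integral(2))
    also have "\<dots> = (LINT x|lebesgue. G x * indicator (box c d) x)"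
      unfolding set_lebesgue_integral_def
    proof (rule integral_cong_AE)
      have "negligible (cbox c d - box c d)"
        using negligible_frontier_interval by blast
      then have "AE x in lebesgue. x \<notin> cbox c d - box c d"
        by (intro AE_not_in) (simp add: negligible_iff_null_sets)
      then show "AE x in lebesgue. indicator (cbox c d) x *\<^sub>R G x = G x * indicator (box c d) x"
      proof eventually_elim
        case (elim x)
        then show ?case using box_subset_cbox[of c d] by (auto simp: indicator_def)
      qed
      show "(\<lambda>x. G x * indicator (box c d) x) \<in> borel_measurable lebesgue"
        "(\<lambda>x. indicator (cbox c d) x *\<^sub>R G x) \<in> borel_measurable lebesgue"
        using Gm borel_measurable_indicator[OF fmeasurableD[OF lmeasurable_box[of c d]]]
          borel_measurable_indicator[OF fmeasurableD[OF lmeasurable_cbox[of c d]]]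
        by (auto intro!: borel_measurable_times)
    qed
    finally show ?thesis using z by simp
  qed
  obtain N where N: "negligible N" "\<And>x e. x \<notin> N \<Longrightarrow> 0 < e \<Longrightarrow>
      \<exists>d>0. \<forall>h. 0 < h \<and> h < d \<longrightarrow> norm (integral (cbox x (x + h *\<^sub>R One)) G /\<^sub>R h ^ DIM('a) - G x) < e"
  proof (rule integrable_ccontinuous_explicit[of G])
    show "G integrable_on cbox c d" for c d
      using GI by (rule set_lebesgue_integral_eq_integral(1))
  qed blast
  have G0: "G x = 0" if x: "x \<in> U" "x \<notin> N" for x
  proof (rule ccontr)
    assume "G x \<noteq> 0"
    then obtain d where d: "d > 0" "\<And>h. 0 < h \<and> h < d \<Longrightarrow>
        norm (integral (cbox x (x + h *\<^sub>R One)) G /\<^sub>R h ^ DIM('a) - G x) < norm (G x)"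
      using N(2)[OF x(2), of "norm (G x)"] by auto
    obtain r where r: "r > 0" "ball x r \<subseteq> U" using U x(1) by (auto simp: open_contains_ball)
    \<comment> \<open>The dimension appears because the norm is bounded by the sum of the
      coordinates; the factor 2 keeps the cube strictly inside the ball.\<close>
    define h where "h = min (d / 2) (r / (2 * real DIM('a)))"
    have h: "0 < h" "h < d" using d(1) r(1) by (auto simp: h_def)
    have "cbox x (x + h *\<^sub>R One) \<subseteq> ball x r"
    proof
      fix y assume y: "y \<in> cbox x (x + h *\<^sub>R One)"
      have "norm (y - x) \<le> (\<Sum>b\<in>Basis. \<bar>(y - x) \<bullet> b\<bar>)" by (rule norm_le_l1)
      also have "\<dots> \<le> (\<Sum>b\<in>(Basis::'a set). h)"
        using y by (intro sum_mono) (auto simp: mem_box inner_diff_left inner_add_left abs_if)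
      also have "\<dots> = real DIM('a) * h" by simp
      also have "\<dots> \<le> real DIM('a) * (r / (2 * real DIM('a)))"
        by (intro mult_left_mono) (auto simp: h_def)
      also have "\<dots> < r" using r(1) by simp
      finally show "y \<in> ball x r" by (simp add: dist_norm norm_minus_commute)
    qed
    then have "integral (cbox x (x + h *\<^sub>R One)) G = 0" using r(2) by (intro zero) auto
    then show False using d(2)[of h] h by simp
  qed
  have "AE x in lebesgue. x \<notin> N"
    using N(1) by (intro AE_not_in) (simp add: negligible_iff_null_sets)
  then have "AE x in lebesgue. x \<in> U \<longrightarrow> g x = 0"
  proof eventually_elim
    case (elim x)
    then show ?case using G0[of x] by (auto simp: G_def)
  qed
  then show ?thesis using Um by (simp add: AE_restrict_space_iff)
qed

subsection \<open>Weak derivatives\<close>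

lemma has_weak_deriv_iff:
  "has_weak_deriv U e f g \<longleftrightarrow> sq_int (lebesgue_on U) f \<and> sq_int (lebesgue_on U) g \<and>
     (\<forall>\<phi>\<in>test_functions U. ip (lebesgue_on U) f (\<lambda>x. frechet_derivative \<phi> (at x) e) = - ip (lebesgue_on U) g \<phi>)"
  by (simp add: has_weak_deriv_def L2_iff_sq_int ip_def)

lemma sq_int_tendsto_ip:
  assumes "\<And>j. sq_int M (f j)" "sq_int M F" "sq_int M h" "(\<lambda>j. nrm M (\<lambda>x. f j x - F x)) \<longlonglongrightarrow> 0"
  shows "(\<lambda>j. ip M (f j) h) \<longlonglongrightarrow> ip M F h"
proof (rule LIM_zero_cancel, rule Lim_null_comparison)
  show "\<forall>\<^sub>F j in sequentially. norm (ip M (f j) h - ip M F h) \<le> nrm M (\<lambda>x. f j x - F x) * nrm M h"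
  proof (intro always_eventually allI)
    fix j
    have "ip M (f j) h - ip M F h = ip M (\<lambda>x. f j x - F x) h"
      using assms by (simp add: ip_diff_left)
    then show "norm (ip M (f j) h - ip M F h) \<le> nrm M (\<lambda>x. f j x - F x) * nrm M h"
      using Cauchy_Schwarz_ip[of M "\<lambda>x. f j x - F x" h] assms by auto
  qed
  show "(\<lambda>j. nrm M (\<lambda>x. f j x - F x) * nrm M h) \<longlonglongrightarrow> 0"
    using tendsto_mult_left_zero[OF assms(4)] .
qed

context
  fixes U :: "'a::euclidean_space set"
  assumes U: "open U"
begin

abbreviation "mU \<equiv> lebesgue_on U"

lemma has_weak_deriv_cong_AE:
  assumes e: "e \<in> Basis" and w: "has_weak_deriv U e f g"
    and ae: "AE x in mU. f x = f' x" "AE x in mU. g x = g' x"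
    and m: "f' \<in> borel_measurable mU" "g' \<in> borel_measurable mU"
  shows "has_weak_deriv U e f' g'"
proof -
  have s: "sq_int mU f" "sq_int mU g" using w by (auto simp: has_weak_deriv_iff)
  have "ip mU f' (\<lambda>x. frechet_derivative \<phi> (at x) e) = - ip mU g' \<phi>" if \<phi>: "\<phi> \<in> test_functions U" for \<phi>
  proof -
    have "ip mU f (\<lambda>x. frechet_derivative \<phi> (at x) e) = ip mU f' (\<lambda>x. frechet_derivative \<phi> (at x) e)"
      using s m ae test_function_sq_int[OF test_functions_deriv[OF \<phi> e] U]
      by (intro ip_cong_AE) (auto simp: sq_int_def)
    moreover have "ip mU g \<phi> = ip mU g' \<phi>"
      using s m ae test_function_sq_int[OF \<phi> U] by (intro ip_cong_AE) (auto simp: sq_int_def)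
    ultimately show ?thesis using w \<phi> by (simp add: has_weak_deriv_iff)
  qed
  then show ?thesis using s ae m by (auto simp: has_weak_deriv_iff intro: sq_int_cong_AE)
qed

lemma has_weak_deriv_add:
  assumes "e \<in> Basis" "has_weak_deriv U e f g" "has_weak_deriv U e f' g'"
  shows "has_weak_deriv U e (\<lambda>x. f x + f' x) (\<lambda>x. g x + g' x)"
  using assms unfolding has_weak_deriv_iff
  by (auto simp: sq_int_add ip_add_left test_function_sq_int[OF _ U] test_functions_deriv)

lemma has_weak_deriv_cmult:
  "has_weak_deriv U e f g \<Longrightarrow> has_weak_deriv U e (\<lambda>x. c * f x) (\<lambda>x. c * g x)"
  unfolding has_weak_deriv_iff by (auto simp: ip_cmult_left)

lemma has_weak_deriv_diff:
  assumes "e \<in> Basis" "has_weak_deriv U e f g" "has_weak_deriv U e f' g'"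
  shows "has_weak_deriv U e (\<lambda>x. f x - f' x) (\<lambda>x. g x - g' x)"
  using has_weak_deriv_add[OF assms(1,2) has_weak_deriv_cmult[OF assms(3), of "-1"]] by simp

lemma has_weak_deriv_zero: "has_weak_deriv U e (\<lambda>x. 0) (\<lambda>x. 0)"
  by (simp add: has_weak_deriv_iff ip_def)

lemma has_weak_deriv_sum:
  assumes "e \<in> Basis" "\<And>i. i \<in> I \<Longrightarrow> has_weak_deriv U e (f i) (g i)"
  shows "has_weak_deriv U e (\<lambda>x. \<Sum>i\<in>I. f i x) (\<lambda>x. \<Sum>i\<in>I. g i x)"
  using assms(2) by (induction I rule: infinite_finite_induct)
    (auto intro!: has_weak_deriv_add assms(1) has_weak_deriv_zero)

text \<open>For a fixed test function both sides of the defining identity are continuous in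
  \<open>L2\<close>: weak differentiation is a closed operator. Series are differentiated term by
  term in this way.\<close>

lemma has_weak_deriv_limit:
  assumes e: "e \<in> Basis" and w: "\<And>j. has_weak_deriv U e (f j) (g j)" and s: "sq_int mU F" "sq_int mU G"
    and l: "(\<lambda>j. nrm mU (\<lambda>x. f j x - F x)) \<longlonglongrightarrow> 0" "(\<lambda>j. nrm mU (\<lambda>x. g j x - G x)) \<longlonglongrightarrow> 0"
  shows "has_weak_deriv U e F G"
  unfolding has_weak_deriv_iff
proof (intro conjI ballI s)
  fix \<phi> assume \<phi>: "\<phi> \<in> test_functions U"
  have "(\<lambda>j. ip mU (f j) (\<lambda>x. frechet_derivative \<phi> (at x) e)) \<longlonglongrightarrow> ip mU F (\<lambda>x. frechet_derivative \<phi> (at x) e)"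
    using w s l \<phi> e by (intro sq_int_tendsto_ip) (auto simp: has_weak_deriv_iff test_function_sq_int[OF _ U] test_functions_deriv)
  moreover have "ip mU (f j) (\<lambda>x. frechet_derivative \<phi> (at x) e) = - ip mU (g j) \<phi>" for j
    using w[of j] \<phi> by (simp add: has_weak_deriv_iff)
  ultimately have "(\<lambda>j. - ip mU (g j) \<phi>) \<longlonglongrightarrow> ip mU F (\<lambda>x. frechet_derivative \<phi> (at x) e)" by simp
  moreover have "(\<lambda>j. - ip mU (g j) \<phi>) \<longlonglongrightarrow> - ip mU G \<phi>"
    using w s l \<phi> by (intro tendsto_minus sq_int_tendsto_ip) (auto simp: has_weak_deriv_iff test_function_sq_int[OF _ U])
  ultimately show "ip mU F (\<lambda>x. frechet_derivative \<phi> (at x) e) = - ip mU G \<phi>" by (rule LIMSEQ_unique)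
qed

text \<open>The difference of two candidates is orthogonal to every test function. This makes the
  choice inside \<open>weak_deriv\<close> harmless.\<close>

lemma has_weak_deriv_unique:
  assumes e: "e \<in> Basis" and w: "has_weak_deriv U e f g" "has_weak_deriv U e f' g'" and ae: "AE x in mU. f x = f' x"
  shows "AE x in mU. g x = g' x"
proof -
  have d: "has_weak_deriv U e (\<lambda>x. f x - f' x) (\<lambda>x. g x - g' x)"
    by (rule has_weak_deriv_diff[OF e w])
  have "AE x in mU. g x - g' x = 0"
  proof (rule fundamental_lemma[OF U])
    show "sq_int mU (\<lambda>x. g x - g' x)" using d by (simp add: has_weak_deriv_iff)
    fix \<phi> assume \<phi>: "\<phi> \<in> test_functions U"
    have "ip mU (\<lambda>x. f x - f' x) (\<lambda>x. frechet_derivative \<phi> (at x) e) = ip mU (\<lambda>x. 0) (\<lambda>x. frechet_derivative \<phi> (at x) e)"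
      using ae d test_function_sq_int[OF test_functions_deriv[OF \<phi> e] U]
      by (intro ip_cong_AE) (auto simp: has_weak_deriv_iff sq_int_def)
    then show "ip mU (\<lambda>x. g x - g' x) \<phi> = 0"
      using d \<phi> by (simp add: has_weak_deriv_iff ip_def)
  qed
  then show ?thesis by simp
qed

lemma weak_deriv_works: "has_weak_deriv U e f g \<Longrightarrow> has_weak_deriv U e f (weak_deriv U e f)"
  unfolding weak_deriv_def by (rule someI[where P = "\<lambda>g. has_weak_deriv U e f g"])

lemma weak_deriv_AE:
  assumes "e \<in> Basis" "has_weak_deriv U e f g"
  shows "AE x in mU. weak_deriv U e f x = g x"
  using has_weak_deriv_unique[OF assms(1) weak_deriv_works[OF assms(2)] assms(2)] by simp

lemma nrm_weak_deriv:
  assumes "e \<in> Basis" "has_weak_deriv U e f g"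
  shows "nrm mU (weak_deriv U e f) = nrm mU g"
  using weak_deriv_AE[OF assms] weak_deriv_works[OF assms(2)] assms(2)
  by (intro nrm_cong_AE) (auto simp: has_weak_deriv_iff sq_int_def)

text \<open>The second derivatives in \<open>H2_norm\<close> and \<open>is_solution\<close> are
  taken of the chosen representative \<open>weak_deriv U e f\<close>; explicit second derivatives
  are transferred to it.\<close>

lemma has_weak_deriv_weak_deriv:
  assumes "e \<in> Basis" "d \<in> Basis" "has_weak_deriv U e f g" "has_weak_deriv U d g h"
  shows "has_weak_deriv U d (weak_deriv U e f) h"
  using weak_deriv_AE[OF assms(1,3)] weak_deriv_works[OF assms(3)] assms(4)
  by (intro has_weak_deriv_cong_AE[OF assms(2,4)]) (auto simp: has_weak_deriv_iff sq_int_def)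

lemma has_weak_deriv_classical:
  assumes "e \<in> Basis" "continuous_on U f" "continuous_on U g" "sq_int mU f" "sq_int mU g"
    "\<And>x. x \<in> U \<Longrightarrow> ((\<lambda>s. f (x + s *\<^sub>R e)) has_real_derivative g x) (at 0)"
  shows "has_weak_deriv U e f g"
  using assms by (auto simp: has_weak_deriv_iff intro!: integration_by_parts_test[OF U])

lemma has_weak_deriv_test:
  assumes "e \<in> Basis" "\<phi> \<in> test_functions U"
  shows "has_weak_deriv U e \<phi> (\<lambda>x. frechet_derivative \<phi> (at x) e)"
proof (rule has_weak_deriv_classical[OF assms(1)])
  show "((\<lambda>s. \<phi> (x + s *\<^sub>R e)) has_real_derivative frechet_derivative \<phi> (at x) e) (at 0)" for x
    by (rule has_derivative_directional[OF Ck_fun_has_derivative[OF test_functions_smooth[OF assms(2)]]])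
qed (use test_functions_deriv[OF assms(2,1)] assms(2) in
    \<open>auto intro: test_function_sq_int[OF _ U] continuous_on_subset[OF Ck_fun_continuous[OF test_functions_smooth]]\<close>)

section \<open>Membership in the Sobolev spaces\<close>

lemma H1_norm_eq:
  assumes "\<And>e. e \<in> Basis \<Longrightarrow> has_weak_deriv U e f (G e)"
  shows "H1_norm U f = sqrt ((nrm mU f)\<^sup>2 + (\<Sum>e\<in>Basis. (nrm mU (G e))\<^sup>2))"
proof -
  have "(\<Sum>e\<in>Basis. (nrm mU (weak_deriv U e f))\<^sup>2) = (\<Sum>e\<in>Basis. (nrm mU (G e))\<^sup>2)"
    by (intro sum.cong refl) (simp add: nrm_weak_deriv[OF _ assms])
  then show ?thesis by (simp add: H1_norm_def L2_norm_eq_nrm)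
qed

lemma H1I: "sq_int mU w \<Longrightarrow> (\<And>e. e \<in> Basis \<Longrightarrow> has_weak_deriv U e w (G e)) \<Longrightarrow> w \<in> H1 U"
  by (auto simp: H1_def L2_iff_sq_int)

text \<open>Convergence is asked for explicitly known derivatives \<open>G e\<close>, so that
  applications do not touch the chosen representatives inside the \<open>H1\<close> norm.\<close>

lemma H10I:
  assumes w: "\<And>e. e \<in> Basis \<Longrightarrow> has_weak_deriv U e w (G e)"
    and t: "\<And>j. \<phi> j \<in> test_functions U"
    and l: "(\<lambda>j. nrm mU (\<lambda>x. w x - \<phi> j x)) \<longlonglongrightarrow> 0"
      "\<And>e. e \<in> Basis \<Longrightarrow> (\<lambda>j. nrm mU (\<lambda>x. G e x - frechet_derivative (\<phi> j) (at x) e)) \<longlonglongrightarrow> 0"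
  shows "w \<in> H10 U"
proof -
  obtain e0 :: 'a where e0: "e0 \<in> Basis" using nonempty_Basis by blast
  have sw: "sq_int mU w" using w[OF e0] by (simp add: has_weak_deriv_iff)
  have eq: "H1_norm U (\<lambda>x. w x - \<phi> j x) =
      sqrt ((nrm mU (\<lambda>x. w x - \<phi> j x))\<^sup>2 + (\<Sum>e\<in>Basis. (nrm mU (\<lambda>x. G e x - frechet_derivative (\<phi> j) (at x) e))\<^sup>2))" for j
    by (rule H1_norm_eq) (intro has_weak_deriv_diff w has_weak_deriv_test t)
  have "(\<lambda>j. H1_norm U (\<lambda>x. w x - \<phi> j x)) \<longlonglongrightarrow> sqrt (0\<^sup>2 + (\<Sum>e\<in>(Basis :: 'a set). 0\<^sup>2))"
    unfolding eq by (intro tendsto_intros l)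
  then have lim: "(\<lambda>j. H1_norm U (\<lambda>x. w x - \<phi> j x)) \<longlonglongrightarrow> 0" by simp
  have "\<exists>\<phi>\<in>test_functions U. H1_norm U (\<lambda>x. w x - \<phi> x) < \<epsilon>" if "\<epsilon> > 0" for \<epsilon>
  proof -
    have "\<forall>\<^sub>F j in sequentially. H1_norm U (\<lambda>x. w x - \<phi> j x) < \<epsilon>"
      using lim that by (rule order_tendstoD)
    then show ?thesis using t by (meson eventually_happens sequentially_bot)
  qed
  then show ?thesis using H1I[OF sw w] by (simp add: H10_def)
qed

text \<open>Each component of the \<open>H1\<close> norm is at most the whole, so the rate
  \<open>1 / (j + 1)\<close> is inherited by the function and by every first derivative.\<close>

lemma H10D:
  assumes "w \<in> H10 U"
  shows "\<exists>\<phi>. (\<forall>j::nat. \<phi> j \<in> test_functions U) \<and> (\<lambda>j. nrm mU (\<lambda>x. w x - \<phi> j x)) \<longlonglongrightarrow> 0 \<and>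
    (\<forall>e\<in>Basis. (\<lambda>j. nrm mU (\<lambda>x. weak_deriv U e w x - frechet_derivative (\<phi> j) (at x) e)) \<longlonglongrightarrow> 0)"
proof -
  have "\<forall>j::nat. \<exists>\<phi>\<in>test_functions U. H1_norm U (\<lambda>x. w x - \<phi> x) < inverse (real (Suc j))"
    using assms by (simp add: H10_def)
  then obtain \<phi> where t: "\<And>j. \<phi> j \<in> test_functions U"
    and le: "\<And>j. H1_norm U (\<lambda>x. w x - \<phi> j x) < inverse (real (Suc j))" by metis
  have wd: "has_weak_deriv U e w (weak_deriv U e w)" if "e \<in> Basis" for e
    using assms that weak_deriv_works by (auto simp: H10_def H1_def)
  have eq: "H1_norm U (\<lambda>x. w x - \<phi> j x) =
      sqrt ((nrm mU (\<lambda>x. w x - \<phi> j x))\<^sup>2 + (\<Sum>e\<in>Basis. (nrm mU (\<lambda>x. weak_deriv U e w x - frechet_derivative (\<phi> j) (at x) e))\<^sup>2))" for j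
    by (rule H1_norm_eq) (intro has_weak_deriv_diff wd has_weak_deriv_test t)
  have b1: "nrm mU (\<lambda>x. w x - \<phi> j x) \<le> inverse (real (Suc j))" for j
    by (rule order_trans[OF real_le_rsqrt less_imp_le[OF le[of j, unfolded eq]]]) (simp add: sum_nonneg)
  have b2: "nrm mU (\<lambda>x. weak_deriv U e w x - frechet_derivative (\<phi> j) (at x) e) \<le> inverse (real (Suc j))" if "e \<in> Basis" for e j
  proof (rule order_trans[OF real_le_rsqrt less_imp_le[OF le[of j, unfolded eq]]])
    show "(nrm mU (\<lambda>x. weak_deriv U e w x - frechet_derivative (\<phi> j) (at x) e))\<^sup>2 \<le>
      (nrm mU (\<lambda>x. w x - \<phi> j x))\<^sup>2 + (\<Sum>e\<in>Basis. (nrm mU (\<lambda>x. weak_deriv U e w x - frechet_derivative (\<phi> j) (at x) e))\<^sup>2)"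
      using that member_le_sum[of e Basis "\<lambda>e. (nrm mU (\<lambda>x. weak_deriv U e w x - frechet_derivative (\<phi> j) (at x) e))\<^sup>2"]
      by (simp add: add_increasing)
  qed
  have null: "X \<longlonglongrightarrow> 0" if "\<And>j. 0 \<le> X j" "\<And>j. X j \<le> inverse (real (Suc j))" for X
    by (rule tendsto_sandwich[OF _ _ tendsto_const LIMSEQ_inverse_real_of_nat]) (use that in auto)
  show ?thesis
    by (intro exI[of _ \<phi>] conjI allI ballI t null b1 b2 nrm_nonneg)
qed

lemma H2D:
  assumes "w \<in> H2 U"
  shows "sq_int mU w" and "e \<in> Basis \<Longrightarrow> has_weak_deriv U e w (weak_deriv U e w)"
    and "e \<in> Basis \<Longrightarrow> d \<in> Basis \<Longrightarrow> has_weak_deriv U d (weak_deriv U e w) (weak_deriv U d (weak_deriv U e w))"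
    and "nrm mU w \<le> H2_norm U w" and "e \<in> Basis \<Longrightarrow> d \<in> Basis \<Longrightarrow> nrm mU (weak_deriv U d (weak_deriv U e w)) \<le> H2_norm U w"
proof -
  show "sq_int mU w" using assms by (simp add: H2_def L2_iff_sq_int)
  have *: "\<exists>g. has_weak_deriv U e w g \<and> g \<in> H1 U" if "e \<in> Basis" for e using assms that by (auto simp: H2_def)
  then show "e \<in> Basis \<Longrightarrow> has_weak_deriv U e w (weak_deriv U e w)" using weak_deriv_works by blast
  show "has_weak_deriv U d (weak_deriv U e w) (weak_deriv U d (weak_deriv U e w))" if ed: "e \<in> Basis" "d \<in> Basis"
  proof -
    obtain g h where "has_weak_deriv U e w g" "has_weak_deriv U d g h"
      using *[OF ed(1)] ed(2) by (auto simp: H1_def)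
    then show ?thesis using has_weak_deriv_weak_deriv[OF ed] weak_deriv_works by blast
  qed
  show "nrm mU w \<le> H2_norm U w"
    unfolding H2_norm_def L2_norm_eq_nrm by (intro real_le_rsqrt) (simp add: sum_nonneg add.assoc)
  show "nrm mU (weak_deriv U d (weak_deriv U e w)) \<le> H2_norm U w" if ed: "e \<in> Basis" "d \<in> Basis"
    unfolding H2_norm_def L2_norm_eq_nrm
  proof (rule real_le_rsqrt)
    let ?t = "\<lambda>e d. (nrm mU (weak_deriv U d (weak_deriv U e w)))\<^sup>2"
    have "?t e d \<le> (\<Sum>d\<in>Basis. ?t e d)" using ed by (intro member_le_sum) auto
    also have "\<dots> \<le> (\<Sum>e\<in>Basis. \<Sum>d\<in>Basis. ?t e d)"
      using ed by (intro member_le_sum[of e Basis "\<lambda>e. \<Sum>d\<in>Basis. ?t e d"]) (auto intro: sum_nonneg)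
    finally show "?t e d \<le> (nrm mU w)\<^sup>2 + (\<Sum>e\<in>Basis. (nrm mU (weak_deriv U e w))\<^sup>2) + (\<Sum>e\<in>Basis. \<Sum>d\<in>Basis. ?t e d)"
      by (simp add: add_increasing sum_nonneg)
  qed
qed

text \<open>Any weak derivatives compute the norm, because they agree almost everywhere with the
  chosen ones.\<close>

lemma H2I:
  assumes s: "sq_int mU w" and w1: "\<And>e. e \<in> Basis \<Longrightarrow> has_weak_deriv U e w (G e)"
    and w2: "\<And>e d. e \<in> Basis \<Longrightarrow> d \<in> Basis \<Longrightarrow> has_weak_deriv U d (G e) (G2 e d)"
  shows "w \<in> H2 U"
    and "H2_norm U w = sqrt ((nrm mU w)\<^sup>2 + (\<Sum>e\<in>Basis. (nrm mU (G e))\<^sup>2) + (\<Sum>e\<in>Basis. \<Sum>d\<in>Basis. (nrm mU (G2 e d))\<^sup>2))"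
proof -
  have sG: "sq_int mU (G e)" if "e \<in> Basis" for e using w1[OF that] by (simp add: has_weak_deriv_iff)
  show "w \<in> H2 U"
    unfolding H2_def using s w1 H1I[OF sG w2] by (auto simp: L2_iff_sq_int)
  have "(\<Sum>e\<in>Basis. (nrm mU (weak_deriv U e w))\<^sup>2) = (\<Sum>e\<in>Basis. (nrm mU (G e))\<^sup>2)"
    by (intro sum.cong refl) (simp add: nrm_weak_deriv[OF _ w1])
  moreover have "(\<Sum>e\<in>Basis. \<Sum>d\<in>Basis. (nrm mU (weak_deriv U d (weak_deriv U e w)))\<^sup>2) = (\<Sum>e\<in>Basis. \<Sum>d\<in>Basis. (nrm mU (G2 e d))\<^sup>2)"
    by (intro sum.cong refl) (simp add: nrm_weak_deriv[OF _ has_weak_deriv_weak_deriv[OF _ _ w1 w2]])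
  ultimately show "H2_norm U w = sqrt ((nrm mU w)\<^sup>2 + (\<Sum>e\<in>Basis. (nrm mU (G e))\<^sup>2) + (\<Sum>e\<in>Basis. \<Sum>d\<in>Basis. (nrm mU (G2 e d))\<^sup>2))"
    by (simp add: H2_norm_def L2_norm_eq_nrm)
qed

lemma H2_diff:
  assumes "v \<in> H2 U" "w \<in> H2 U"
  shows "(\<lambda>x. v x - w x) \<in> H2 U"
proof (rule H2I(1))
  show "sq_int mU (\<lambda>x. v x - w x)" using H2D(1) assms by auto
  show "has_weak_deriv U e (\<lambda>x. v x - w x) (\<lambda>x. weak_deriv U e v x - weak_deriv U e w x)" if "e \<in> Basis" for e
    using assms that by (intro has_weak_deriv_diff H2D)
  show "has_weak_deriv U d (\<lambda>x. weak_deriv U e v x - weak_deriv U e w x)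
    (\<lambda>x. weak_deriv U d (weak_deriv U e v) x - weak_deriv U d (weak_deriv U e w) x)" if "e \<in> Basis" "d \<in> Basis" for e d
    using assms that by (intro has_weak_deriv_diff H2D)
qed

lemma H10_diff:
  assumes v: "v \<in> H10 U" and w: "w \<in> H10 U"
  shows "(\<lambda>x. v x - w x) \<in> H10 U"
proof -
  obtain \<phi> where \<phi>: "\<And>j. \<phi> j \<in> test_functions U" "(\<lambda>j. nrm mU (\<lambda>x. v x - \<phi> j x)) \<longlonglongrightarrow> 0"
    "\<And>e. e \<in> Basis \<Longrightarrow> (\<lambda>j. nrm mU (\<lambda>x. weak_deriv U e v x - frechet_derivative (\<phi> j) (at x) e)) \<longlonglongrightarrow> 0"
    using H10D[OF v] by blast
  obtain \<psi> where \<psi>: "\<And>j. \<psi> j \<in> test_functions U" "(\<lambda>j. nrm mU (\<lambda>x. w x - \<psi> j x)) \<longlonglongrightarrow> 0"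
    "\<And>e. e \<in> Basis \<Longrightarrow> (\<lambda>j. nrm mU (\<lambda>x. weak_deriv U e w x - frechet_derivative (\<psi> j) (at x) e)) \<longlonglongrightarrow> 0"
    using H10D[OF w] by blast
  have wd: "has_weak_deriv U e v (weak_deriv U e v)" "has_weak_deriv U e w (weak_deriv U e w)" if "e \<in> Basis" for e
    using v w that weak_deriv_works by (auto simp: H10_def H1_def)
  have sq: "sq_int mU v" "sq_int mU w" using v w by (auto simp: H10_def H1_def L2_iff_sq_int)
  have lim: "(\<lambda>j. nrm mU (\<lambda>x. (p x - q x) - (f j x - g j x))) \<longlonglongrightarrow> 0"
    if s: "sq_int mU p" "sq_int mU q" "\<And>j. sq_int mU (f j)" "\<And>j. sq_int mU (g j)"
      and l: "(\<lambda>j. nrm mU (\<lambda>x. p x - f j x)) \<longlonglongrightarrow> 0" "(\<lambda>j. nrm mU (\<lambda>x. q x - g j x)) \<longlonglongrightarrow> 0" for p q f g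
  proof (rule Lim_null_comparison)
    show "\<forall>\<^sub>F j in sequentially. norm (nrm mU (\<lambda>x. (p x - q x) - (f j x - g j x))) \<le> nrm mU (\<lambda>x. p x - f j x) + nrm mU (\<lambda>x. q x - g j x)"
    proof (intro always_eventually allI)
      fix j
      have "nrm mU (\<lambda>x. (p x - f j x) + - (q x - g j x)) \<le> nrm mU (\<lambda>x. p x - f j x) + nrm mU (\<lambda>x. - (q x - g j x))"
        by (intro nrm_triangle sq_int_diff sq_int_minus s)
      moreover have "(\<lambda>x. (p x - f j x) + - (q x - g j x)) = (\<lambda>x. (p x - q x) - (f j x - g j x))" by auto
      ultimately show "norm (nrm mU (\<lambda>x. (p x - q x) - (f j x - g j x))) \<le> nrm mU (\<lambda>x. p x - f j x) + nrm mU (\<lambda>x. q x - g j x)"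
        using nrm_minus[of mU "\<lambda>x. q x - g j x"] by simp
    qed
    show "(\<lambda>j. nrm mU (\<lambda>x. p x - f j x) + nrm mU (\<lambda>x. q x - g j x)) \<longlonglongrightarrow> 0"
      using tendsto_add[OF l] by simp
  qed
  have t: "(\<lambda>x. \<phi> j x - \<psi> j x) \<in> test_functions U" for j
    using test_functions_add[OF \<phi>(1) test_functions_cmult[OF \<psi>(1), of "-1"]] by simp
  have fd: "frechet_derivative (\<lambda>x. \<phi> j x - \<psi> j x) (at x) e = frechet_derivative (\<phi> j) (at x) e - frechet_derivative (\<psi> j) (at x) e" for j x e
  proof -
    have "((\<lambda>x. \<phi> j x - \<psi> j x) has_derivative (\<lambda>e. frechet_derivative (\<phi> j) (at x) e - frechet_derivative (\<psi> j) (at x) e)) (at x)"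
      by (intro has_derivative_diff Ck_fun_has_derivative[OF test_functions_smooth[OF \<phi>(1)]]
          Ck_fun_has_derivative[OF test_functions_smooth[OF \<psi>(1)]])
    from frechet_derivative_at[OF this, symmetric] show ?thesis by simp
  qed
  show ?thesis
  proof (rule H10I[OF _ t])
    show "has_weak_deriv U e (\<lambda>x. v x - w x) (\<lambda>x. weak_deriv U e v x - weak_deriv U e w x)" if "e \<in> Basis" for e
      using that by (intro has_weak_deriv_diff wd)
    show "(\<lambda>j. nrm mU (\<lambda>x. (v x - w x) - (\<phi> j x - \<psi> j x))) \<longlonglongrightarrow> 0"
      by (intro lim sq \<phi> \<psi> test_function_sq_int[OF _ U])
    show "(\<lambda>j. nrm mU (\<lambda>x. weak_deriv U e v x - weak_deriv U e w x - frechet_derivative (\<lambda>x. \<phi> j x - \<psi> j x) (at x) e)) \<longlonglongrightarrow> 0"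
      if e: "e \<in> Basis" for e
    proof -
      have "sq_int mU (weak_deriv U e v)" "sq_int mU (weak_deriv U e w)"
        using wd[OF e] by (auto simp: has_weak_deriv_iff)
      moreover have "sq_int mU (\<lambda>x. frechet_derivative (\<phi> j) (at x) e)" "sq_int mU (\<lambda>x. frechet_derivative (\<psi> j) (at x) e)" for j
        by (rule test_function_sq_int[OF test_functions_deriv[OF \<phi>(1) e] U],
            rule test_function_sq_int[OF test_functions_deriv[OF \<psi>(1) e] U])
      ultimately show ?thesis
        unfolding fd by (intro lim \<phi>(3)[OF e] \<psi>(3)[OF e])
    qed
  qed
qed

end

subsection \<open>Square summable families and Duhamel's formula\<close>

text \<open>A type of its own, so that bounded operators, vector-valued integrals and the fixed
  point theorem come from the type classes. The index set is arbitrary: multi-indices are used as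
  they are, without an enumeration, and sums are unconditional.\<close>

typedef 'k ell2 = "{x :: 'k \<Rightarrow> real. (\<lambda>k. (x k)\<^sup>2) summable_on UNIV}"
  morphisms coord Abs_ell2
  by (rule exI[of _ "\<lambda>_. 0"]) simp

setup_lifting type_definition_ell2

lemma summable_on_mult_ell2:
  fixes x y :: "'k \<Rightarrow> real"
  assumes "(\<lambda>k. (x k)\<^sup>2) summable_on UNIV" "(\<lambda>k. (y k)\<^sup>2) summable_on UNIV"
  shows "(\<lambda>k. x k * y k) summable_on UNIV"
proof -
  have s: "(\<lambda>k. (x k)\<^sup>2 + (y k)\<^sup>2) summable_on UNIV"
    using assms by (rule summable_on_add)
  have "(\<lambda>k. norm (x k * y k)) summable_on UNIV"
  proof (rule Infinite_Sum.abs_summable_on_comparison_test'[OF s])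
    fix k
    have "0 \<le> (\<bar>x k\<bar> - \<bar>y k\<bar>)\<^sup>2" by simp
    then have "2 * (\<bar>x k\<bar> * \<bar>y k\<bar>) \<le> (x k)\<^sup>2 + (y k)\<^sup>2"
      by (simp add: power2_diff)
    moreover have "0 \<le> \<bar>x k\<bar> * \<bar>y k\<bar>" by simp
    ultimately have "\<bar>x k\<bar> * \<bar>y k\<bar> \<le> (x k)\<^sup>2 + (y k)\<^sup>2" by linarith
    then show "norm (x k * y k) \<le> (x k)\<^sup>2 + (y k)\<^sup>2" by (simp add: abs_mult)
  qed
  then show ?thesis by (rule abs_summable_summable)
qed

lemma summable_on_add_ell2:
  fixes x y :: "'k \<Rightarrow> real"
  assumes "(\<lambda>k. (x k)\<^sup>2) summable_on UNIV" "(\<lambda>k. (y k)\<^sup>2) summable_on UNIV"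
  shows "(\<lambda>k. (x k + y k)\<^sup>2) summable_on UNIV"
proof -
  have "(\<lambda>k. ((x k)\<^sup>2 + (y k)\<^sup>2) + 2 * (x k * y k)) summable_on UNIV"
    using assms by (intro summable_on_add summable_on_cmult_right summable_on_mult_ell2)
  then show ?thesis by (simp add: power2_sum algebra_simps)
qed

instantiation ell2 :: (type) real_inner
begin

lift_definition zero_ell2 :: "'a ell2" is "\<lambda>_. 0" by simp
lift_definition plus_ell2 :: "'a ell2 \<Rightarrow> 'a ell2 \<Rightarrow> 'a ell2" is "\<lambda>x y k. x k + y k"
  by (rule summable_on_add_ell2)
lift_definition uminus_ell2 :: "'a ell2 \<Rightarrow> 'a ell2" is "\<lambda>x k. - x k" by simp
lift_definition minus_ell2 :: "'a ell2 \<Rightarrow> 'a ell2 \<Rightarrow> 'a ell2" is "\<lambda>x y k. x k - y k"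
  subgoal for x y using summable_on_add_ell2[of x "\<lambda>k. - y k"] by simp
  done
lift_definition scaleR_ell2 :: "real \<Rightarrow> 'a ell2 \<Rightarrow> 'a ell2" is "\<lambda>r x k. r * x k"
  by (simp add: power_mult_distrib summable_on_cmult_right)
lift_definition inner_ell2 :: "'a ell2 \<Rightarrow> 'a ell2 \<Rightarrow> real" is "\<lambda>x y. infsum (\<lambda>k. x k * y k) UNIV" .

definition norm_ell2 :: "'a ell2 \<Rightarrow> real" where "norm_ell2 x = sqrt (inner x x)"
definition dist_ell2 :: "'a ell2 \<Rightarrow> 'a ell2 \<Rightarrow> real" where "dist_ell2 x y = norm (x - y)"
definition sgn_ell2 :: "'a ell2 \<Rightarrow> 'a ell2" where "sgn_ell2 x = inverse (norm x) *\<^sub>R x"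
definition uniformity_ell2 :: "('a ell2 \<times> 'a ell2) filter" where
  "uniformity_ell2 = (INF e\<in>{0<..}. principal {(x, y). dist x y < e})"
definition open_ell2 :: "'a ell2 set \<Rightarrow> bool" where
  "open_ell2 U \<longleftrightarrow> (\<forall>x\<in>U. \<forall>\<^sub>F (x', y) in uniformity. x' = x \<longrightarrow> y \<in> U)"

instance
proof
  fix x y z :: "'a ell2" and r s :: real
  show "x + y + z = x + (y + z)" by transfer (simp add: add.assoc)
  show "x + y = y + x" by transfer (simp add: add.commute)
  show "0 + x = x" by transfer simp
  show "- x + x = 0" by transfer simp
  show "x - y = x + - y" by transfer simp
  show "r *\<^sub>R (x + y) = r *\<^sub>R x + r *\<^sub>R y" by transfer (simp add: distrib_left)
  show "(r + s) *\<^sub>R x = r *\<^sub>R x + s *\<^sub>R x" by transfer (simp add: distrib_right)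
  show "r *\<^sub>R s *\<^sub>R x = (r * s) *\<^sub>R x" by transfer (simp add: mult.assoc)
  show "1 *\<^sub>R x = x" by transfer simp
  show "dist x y = norm (x - y)" by (rule dist_ell2_def)
  show "sgn x = inverse (norm x) *\<^sub>R x" by (rule sgn_ell2_def)
  show "(uniformity :: ('a ell2 \<times> 'a ell2) filter) = (INF e\<in>{0<..}. principal {(x, y). dist x y < e})"
    by (rule uniformity_ell2_def)
  show "open U \<longleftrightarrow> (\<forall>x\<in>U. \<forall>\<^sub>F (x', y) in uniformity. x' = x \<longrightarrow> y \<in> U)" for U :: "'a ell2 set"
    by (rule open_ell2_def)
  show "inner x y = inner y x" by transfer (simp add: mult.commute)
  show "inner (x + y) z = inner x z + inner y z"
    by transfer (simp add: distrib_right infsum_add summable_on_mult_ell2)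
  show "inner (r *\<^sub>R x) y = r * inner x y"
    by transfer (simp add: mult.assoc infsum_cmult_right summable_on_mult_ell2)
  show "0 \<le> inner x x"
    by transfer (simp add: infsum_nonneg)
  show "inner x x = 0 \<longleftrightarrow> x = 0"
  proof transfer
    fix x :: "'a \<Rightarrow> real" assume x: "(\<lambda>k. (x k)\<^sup>2) summable_on UNIV"
    show "infsum (\<lambda>k. x k * x k) UNIV = 0 \<longleftrightarrow> x = (\<lambda>_. 0)"
    proof
      assume 0: "infsum (\<lambda>k. x k * x k) UNIV = 0"
      show "x = (\<lambda>_. 0)"
      proof
        fix k
        have "(\<Sum>k\<in>{k}. x k * x k) \<le> infsum (\<lambda>k. x k * x k) UNIV"
          using x by (intro finite_sum_le_infsum) (auto simp: power2_eq_square)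
        with 0 show "x k = 0" by (auto simp: mult_le_0_iff)
      qed
    qed simp
  qed
  show "norm x = sqrt (inner x x)" by (rule norm_ell2_def)
qed

end

lemma coord_simps [simp]:
  "coord 0 k = 0" "coord (x + y) k = coord x k + coord y k" "coord (x - y) k = coord x k - coord y k"
  "coord (- x) k = - coord x k" "coord (r *\<^sub>R x) k = r * coord x k"
  by (transfer, simp)+

lemma ell2_eqI: "(\<And>k. coord x k = coord y k) \<Longrightarrow> x = y"
  by transfer auto

lemma coord_summable: "(\<lambda>k. (coord x k)\<^sup>2) summable_on UNIV"
  by transfer

lemma norm_ell2_power2: "(norm x)\<^sup>2 = infsum (\<lambda>k. (coord x k)\<^sup>2) UNIV"
  unfolding power2_norm_eq_inner by transfer (simp add: power2_eq_square)

lemma sum_coord_le: "finite F \<Longrightarrow> (\<Sum>k\<in>F. (coord x k)\<^sup>2) \<le> (norm x)\<^sup>2"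
  unfolding norm_ell2_power2 by (rule finite_sum_le_infsum[OF coord_summable]) auto

lemma norm_ell2_le:
  assumes "0 \<le> C" "\<And>F. finite F \<Longrightarrow> (\<Sum>k\<in>F. (coord x k)\<^sup>2) \<le> C\<^sup>2"
  shows "norm x \<le> C"
proof (rule power2_le_imp_le)
  show "(norm x)\<^sup>2 \<le> C\<^sup>2"
    unfolding norm_ell2_power2 by (rule infsum_le_finite_sums[OF coord_summable]) (use assms in auto)
qed fact

text \<open>A bound on finite partial sums is the only thing to check; limits, weighted shifts and
  coefficient sequences are produced this way.\<close>

lemma ell2_exists:
  assumes "0 \<le> C" "\<And>F. finite F \<Longrightarrow> (\<Sum>k\<in>F. (f k)\<^sup>2) \<le> C\<^sup>2"
  shows "\<exists>x. coord x = f \<and> norm x \<le> C"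
proof -
  have "(\<lambda>k. (f k)\<^sup>2) summable_on UNIV"
    by (rule nonneg_bdd_above_summable_on) (use assms in \<open>auto intro!: bdd_aboveI[where M = "C\<^sup>2"]\<close>)
  then have c: "coord (Abs_ell2 f) = f" by (simp add: Abs_ell2_inverse)
  then show ?thesis using assms by (intro exI[of _ "Abs_ell2 f"] conjI norm_ell2_le) auto
qed

lemma abs_coord_le: "\<bar>coord x k\<bar> \<le> norm x"
  using sum_coord_le[of "{k}" x] by (simp add: abs_le_square_iff[symmetric])

lemma bounded_linear_coord: "bounded_linear (\<lambda>x. coord x k)"
  by (rule bounded_linear_intro[where K = 1]) (use abs_coord_le in auto)

text \<open>Coordinates converge in the reals, and the Cauchy estimate survives on each finite
  partial sum; these finite estimates are then reassembled into a norm bound.\<close>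

instance ell2 :: (type) banach
proof
  fix X :: "nat \<Rightarrow> 'a ell2" assume C: "Cauchy X"
  have "convergent (\<lambda>n. coord (X n) k)" for k
    by (intro Cauchy_convergent bounded_linear.Cauchy[OF bounded_linear_coord C])
  then obtain f where f: "\<And>k. (\<lambda>n. coord (X n) k) \<longlonglongrightarrow> f k"
    unfolding convergent_def by metis
  have tail: "\<exists>N. \<forall>n\<ge>N. \<exists>y. coord y = (\<lambda>k. f k - coord (X n) k) \<and> norm y \<le> e" if e: "e > 0" for e
  proof -
    obtain N where N: "\<forall>m\<ge>N. \<forall>n\<ge>N. norm (X m - X n) < e"
      using C e unfolding Cauchy_iff by blast
    have "\<exists>y. coord y = (\<lambda>k. f k - coord (X n) k) \<and> norm y \<le> e" if "n \<ge> N" for n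
    proof -
      have "(\<Sum>k\<in>F. (f k - coord (X n) k)\<^sup>2) \<le> e\<^sup>2" if "finite F" for F
      proof (rule LIMSEQ_le_const2)
        show "(\<lambda>m. \<Sum>k\<in>F. (coord (X m) k - coord (X n) k)\<^sup>2) \<longlonglongrightarrow> (\<Sum>k\<in>F. (f k - coord (X n) k)\<^sup>2)"
          by (intro tendsto_intros f)
        show "\<exists>N. \<forall>m\<ge>N. (\<Sum>k\<in>F. (coord (X m) k - coord (X n) k)\<^sup>2) \<le> e\<^sup>2"
        proof (intro exI allI impI)
          fix m assume "m \<ge> N"
          have "(\<Sum>k\<in>F. (coord (X m) k - coord (X n) k)\<^sup>2) \<le> (norm (X m - X n))\<^sup>2"
            using sum_coord_le[OF that, of "X m - X n"] by simp
          also have "\<dots> \<le> e\<^sup>2"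
            using N \<open>m \<ge> N\<close> \<open>n \<ge> N\<close> by (intro power_mono order_less_imp_le[of _ e]) simp_all
          finally show "(\<Sum>k\<in>F. (coord (X m) k - coord (X n) k)\<^sup>2) \<le> e\<^sup>2" .
        qed
      qed
      then show ?thesis using e by (intro ell2_exists) auto
    qed
    then show ?thesis by blast
  qed
  \<comment> \<open>A single tail suffices to see that the limit is square summable: it is a square
    summable family plus \<open>X n\<close>.\<close>
  obtain n y where y: "coord y = (\<lambda>k. f k - coord (X n) k)"
    using tail[of 1] by (meson le_refl zero_less_one)
  define x where "x = y + X n"
  have x: "coord x k = f k" for k by (simp add: x_def y)
  have "X \<longlonglongrightarrow> x"
  proof (rule LIMSEQ_I)
    fix r :: real assume "0 < r"
    then obtain N where N: "\<forall>n\<ge>N. \<exists>y. coord y = (\<lambda>k. f k - coord (X n) k) \<and> norm y \<le> r / 2"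
      using tail[of "r/2"] by auto
    have "norm (X n - x) < r" if n: "n \<ge> N" for n
    proof -
      obtain y where "coord y = (\<lambda>k. f k - coord (X n) k)" "norm y \<le> r / 2" using N n by blast
      then have "y = x - X n" by (intro ell2_eqI) (simp add: x)
      with \<open>norm y \<le> r / 2\<close> \<open>0 < r\<close> show ?thesis by (simp add: norm_minus_commute)
    qed
    then show "\<exists>no. \<forall>n\<ge>no. norm (X n - x) < r" by blast
  qed
  then show "convergent X" by (auto simp: convergent_def)
qed

text \<open>Injectivity of \<open>\<sigma>\<close> counts each coordinate of \<open>x\<close> at
  most once, so the operator norm is at most the bound on the weights. Diagonal operators and the
  two neighbour shifts of a cosine are instances.\<close>

lemma weighted_shift_exists:
  fixes m :: "'k \<Rightarrow> real" and \<sigma> :: "'k \<Rightarrow> 'k"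
  assumes inj: "inj_on \<sigma> P" and m: "\<And>k. k \<in> P \<Longrightarrow> \<bar>m k\<bar> \<le> C" and C: "0 \<le> C"
  obtains B :: "'k ell2 \<Rightarrow> 'k ell2" where "bounded_linear B"
    "\<And>x k. coord (B x) k = (if k \<in> P then m k * coord x (\<sigma> k) else 0)" "\<And>x. norm (B x) \<le> C * norm x"
proof -
  have "\<exists>y. coord y = (\<lambda>k. if k \<in> P then m k * coord x (\<sigma> k) else 0) \<and> norm y \<le> C * norm x" for x
  proof -
    have "(\<Sum>k\<in>F. (if k \<in> P then m k * coord x (\<sigma> k) else 0)\<^sup>2) \<le> (C * norm x)\<^sup>2" if "finite F" for F
    proof -
      have "(\<Sum>k\<in>F. (if k \<in> P then m k * coord x (\<sigma> k) else 0)\<^sup>2) = (\<Sum>k\<in>F \<inter> P. (m k * coord x (\<sigma> k))\<^sup>2)"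
        by (rule sum.mono_neutral_cong_right) (use that in auto)
      also have "\<dots> \<le> (\<Sum>k\<in>F \<inter> P. C\<^sup>2 * (coord x (\<sigma> k))\<^sup>2)"
      proof (intro sum_mono)
        fix k assume "k \<in> F \<inter> P"
        then have "\<bar>m k\<bar>\<^sup>2 \<le> C\<^sup>2" using m by (intro power_mono) auto
        then show "(m k * coord x (\<sigma> k))\<^sup>2 \<le> C\<^sup>2 * (coord x (\<sigma> k))\<^sup>2"
          by (simp add: power_mult_distrib mult_right_mono)
      qed
      also have "\<dots> = C\<^sup>2 * (\<Sum>k\<in>\<sigma> ` (F \<inter> P). (coord x k)\<^sup>2)"
        by (subst sum.reindex) (use inj in \<open>auto simp: sum_distrib_left inj_on_def\<close>)
      also have "\<dots> \<le> C\<^sup>2 * (norm x)\<^sup>2"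
        using that by (intro mult_left_mono sum_coord_le) auto
      finally show ?thesis by (simp add: power_mult_distrib)
    qed
    then show ?thesis
      using C by (intro ell2_exists) auto
  qed
  then obtain B where B: "\<And>x. coord (B x) = (\<lambda>k. if k \<in> P then m k * coord x (\<sigma> k) else 0)"
    "\<And>x. norm (B x) \<le> C * norm x" by metis
  have "bounded_linear B"
  proof (rule bounded_linear_intro[where K = C])
    show "B (x + y) = B x + B y" for x y by (rule ell2_eqI) (simp add: B distrib_left)
    show "B (r *\<^sub>R x) = r *\<^sub>R B x" for r x by (rule ell2_eqI) (simp add: B)
    show "norm (B x) \<le> norm x * C" for x using B(2)[of x] by (simp add: mult.commute)
  qed
  with B show thesis by (intro that[of B]) auto
qed

section \<open>Coordinate projections and tails\<close>

lift_definition proj :: "'k set \<Rightarrow> 'k ell2 \<Rightarrow> 'k ell2" is "\<lambda>F x k. if k \<in> F then x k else 0"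
proof -
  fix F :: "'k set" and x :: "'k \<Rightarrow> real"
  assume "(\<lambda>k. (x k)\<^sup>2) summable_on UNIV"
  then show "(\<lambda>k. (if k \<in> F then x k else 0)\<^sup>2) summable_on UNIV"
    by (rule summable_on_comparison_test) auto
qed

lemma coord_proj [simp]: "coord (proj F x) k = (if k \<in> F then coord x k else 0)"
  by transfer simp

lemma proj_diff: "proj F (x - y) = proj F x - proj F y"
  by (rule ell2_eqI) simp

lemma norm_mono_coord:
  assumes "\<And>k. \<bar>coord x k\<bar> \<le> \<bar>coord y k\<bar>"
  shows "norm x \<le> norm y"
proof (rule norm_ell2_le)
  fix F :: "'a set" assume "finite F"
  have "(\<Sum>k\<in>F. (coord x k)\<^sup>2) \<le> (\<Sum>k\<in>F. (coord y k)\<^sup>2)"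
    using assms by (intro sum_mono) (simp add: abs_le_square_iff)
  also have "\<dots> \<le> (norm y)\<^sup>2" by (rule sum_coord_le) fact
  finally show "(\<Sum>k\<in>F. (coord x k)\<^sup>2) \<le> (norm y)\<^sup>2" .
qed simp

lemma norm_tail_le: "norm (x - proj F x) \<le> norm x"
  by (rule norm_mono_coord) simp

lemma norm_tail_antimono: "F \<subseteq> G \<Longrightarrow> norm (x - proj G x) \<le> norm (x - proj F x)"
  by (rule norm_mono_coord) auto

lemma norm_proj_power2:
  assumes "finite F"
  shows "(norm (proj F x))\<^sup>2 = (\<Sum>k\<in>F. (coord x k)\<^sup>2)"
proof -
  have "infsum (\<lambda>k. (coord (proj F x) k)\<^sup>2) UNIV = infsum (\<lambda>k. (coord x k)\<^sup>2) F"
    by (rule infsum_cong_neutral) auto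
  then show ?thesis using assms by (simp add: norm_ell2_power2)
qed

lemma norm_Pythagoras: "(norm (x - proj F x))\<^sup>2 = (norm x)\<^sup>2 - (norm (proj F x))\<^sup>2"
proof -
  have "inner (proj F x) (x - proj F x) = 0"
  proof -
    have "inner (proj F x) (x - proj F x) = infsum (\<lambda>k. 0) (UNIV :: 'a set)"
      by transfer (auto intro!: infsum_0)
    then show ?thesis by simp
  qed
  then show ?thesis
    by (simp add: power2_norm_eq_inner inner_diff_left inner_diff_right inner_commute)
qed

lemma tail_tendsto: "e > 0 \<Longrightarrow> \<exists>F. finite F \<and> norm (x - proj F x) < e"
proof -
  assume e: "e > 0"
  have "((\<lambda>k. (coord x k)\<^sup>2) has_sum (norm x)\<^sup>2) UNIV"
    unfolding norm_ell2_power2 using coord_summable by (rule has_sum_infsum)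
  then have "(sum (\<lambda>k. (coord x k)\<^sup>2) \<longlongrightarrow> (norm x)\<^sup>2) (finite_subsets_at_top UNIV)"
    by (simp add: has_sum_def)
  then have "\<forall>\<^sub>F F in finite_subsets_at_top UNIV. dist (sum (\<lambda>k. (coord x k)\<^sup>2) F) ((norm x)\<^sup>2) < e\<^sup>2"
    by (rule tendstoD) (use e in simp)
  then obtain F where F: "finite F" "dist (sum (\<lambda>k. (coord x k)\<^sup>2) F) ((norm x)\<^sup>2) < e\<^sup>2"
    unfolding eventually_finite_subsets_at_top by blast
  then have "(norm (x - proj F x))\<^sup>2 < e\<^sup>2"
    by (simp add: norm_Pythagoras norm_proj_power2 dist_real_def)
  then have "norm (x - proj F x) < e" using e by (intro power2_less_imp_less[of _ e]) auto
  with F show ?thesis by blast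
qed

text \<open>Take a finite net and the union of its exhausting sets; the remaining error is
  controlled because cutting off coordinates does not increase the norm. Applied to the image of a
  time interval under a continuous curve, it gives finitely many modes that serve all times.\<close>

lemma tail_uniform:
  fixes C :: "'k ell2 set"
  assumes C: "compact C" and e: "e > 0"
  shows "\<exists>F. finite F \<and> (\<forall>x\<in>C. norm (x - proj F x) < e)"
proof -
  obtain D where D: "finite D" "D \<subseteq> C" "C \<subseteq> (\<Union>d\<in>D. ball d (e/2))"
    by (rule compactE_image[OF C, of C "\<lambda>d. ball d (e/2)"]) (use e in auto)
  have "\<forall>d :: 'k ell2. \<exists>G. finite G \<and> norm (d - proj G d) < e/2"
    by (intro allI tail_tendsto) (use e in simp)
  then obtain G where G: "\<And>d :: 'k ell2. finite (G d)" "\<And>d. norm (d - proj (G d) d) < e/2"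
    by metis
  define F where "F = (\<Union>d\<in>D. G d)"
  have "norm (x - proj F x) < e" if x: "x \<in> C" for x
  proof -
    obtain d where d: "d \<in> D" "dist d x < e/2" using D x by auto
    have "norm (d - proj F d) < e/2"
      using norm_tail_antimono[OF UN_upper[OF d(1), of G], of d] G(2)[of d] by (simp add: F_def)
    moreover have "norm ((x - d) - proj F (x - d)) < e/2"
      using norm_tail_le[of "x - d" F] d(2) by (simp add: dist_norm norm_minus_commute)
    moreover have "x - proj F x = (d - proj F d) + ((x - d) - proj F (x - d))"
      by (simp add: proj_diff)
    then have "norm (x - proj F x) \<le> norm (d - proj F d) + norm ((x - d) - proj F (x - d))"
      by (metis norm_triangle_ineq)
    ultimately show ?thesis by linarith
  qed
  moreover have "finite F" using D G by (simp add: F_def)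
  ultimately show ?thesis by blast
qed

text \<open>The decay rate \<open>\<gamma>\<close> dominates the perturbation, so Duhamel's formula is a contraction in the
  sup norm over the whole time interval.\<close>

lemma Duhamel_solution:
  fixes S :: "real \<Rightarrow> 'a::banach \<Rightarrow> 'a" and B :: "'a \<Rightarrow> 'a"
  assumes T: "0 \<le> T" and lin: "\<And>t. 0 \<le> t \<Longrightarrow> linear (S t)"
    and S0: "\<And>x. S 0 x = x"
    and decay: "\<And>t x. 0 \<le> t \<Longrightarrow> norm (S t x) \<le> exp (- \<gamma> * t) * norm x"
    and cont: "\<And>x. continuous_on {0..} (\<lambda>t. S t x)"
    and B: "bounded_linear B" "\<And>x. norm (B x) \<le> M * norm x" and M: "0 \<le> M" "2 * M \<le> \<gamma>" "0 < \<gamma>"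
  obtains u where "continuous_on {0..T} u"
    "\<And>t. t \<in> {0..T} \<Longrightarrow> ((\<lambda>s. S (t - s) (B (u s))) has_integral (u t - S t x0)) {0..t}"
proof -
  have diff: "S t (x - y) = S t x - S t y" if "0 \<le> t" for t x y
    using lin[OF that] by (rule linear_diff)
  have contr: "norm (S t x) \<le> norm x" if "0 \<le> t" for t x
  proof -
    have "exp (- \<gamma> * t) \<le> 1" using M that by simp
    then have "exp (- \<gamma> * t) * norm x \<le> 1 * norm x" by (rule mult_right_mono) simp
    with decay[OF that, of x] show ?thesis by linarith
  qed
  \<comment> \<open>Continuity in time at a fixed vector and contractivity in the vector combine to
    continuity of the composite.\<close>
  have joint: "continuous_on A (\<lambda>z. S (p z) (g z))"
    if p: "continuous_on A p" and g: "continuous_on A g" and pos: "\<And>z. z \<in> A \<Longrightarrow> 0 \<le> p z"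
    for A :: "'b::metric_space set" and p g
    unfolding continuous_on_def
  proof
    fix z assume z: "z \<in> A"
    have "((\<lambda>y. S (p y) (g z)) \<longlongrightarrow> S (p z) (g z)) (at z within A)"
      using continuous_on_compose2[OF cont p, of "g z"] pos z by (auto simp: continuous_on_def)
    moreover have "((\<lambda>y. S (p y) (g y) - S (p y) (g z)) \<longlongrightarrow> 0) (at z within A)"
    proof (rule Lim_null_comparison)
      show "\<forall>\<^sub>F y in at z within A. norm (S (p y) (g y) - S (p y) (g z)) \<le> norm (g y - g z)"
        using contr pos by (auto simp: eventually_at_filter simp flip: diff intro!: always_eventually)
      show "((\<lambda>y. norm (g y - g z)) \<longlongrightarrow> 0) (at z within A)"
        using g z by (auto simp: continuous_on_def intro!: tendsto_norm_zero LIM_zero)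
    qed
    ultimately show "((\<lambda>y. S (p y) (g y)) \<longlongrightarrow> S (p z) (g z)) (at z within A)"
      using tendsto_add by fastforce
  qed
  have contB: "continuous_on A (\<lambda>z. B (h z))" if "continuous_on A h" for A :: "real set" and h
    using bounded_linear.continuous_on[OF B(1) that] .
  have integ: "(\<lambda>s. S (t - s) (B (h s))) integrable_on {0..t}"
    if "continuous_on UNIV h" for t h
    by (intro integrable_continuous_real joint continuous_intros contB continuous_on_subset[OF that]) auto
  \<comment> \<open>Clamping time to the interval lets the fixed point live in the complete space of
    bounded continuous functions on the whole line.\<close>
  define \<tau> where "\<tau> t = max 0 (min T t)" for t
  define \<Phi>0 where "\<Phi>0 h t = S t x0 + integral {0..t} (\<lambda>s. S (t - s) (B (h s)))" for h t
  \<comment> \<open>The domain of integration is made independent of \<open>t\<close>: for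
    \<open>s > t\<close> the semigroup is frozen at \<open>S 0\<close>, the identity, and this
    surplus is subtracted again. Continuity in \<open>t\<close> then reduces to integrals depending
    on a parameter.\<close>
  have split: "\<Phi>0 h t = S t x0 + integral {0..T} (\<lambda>s. S (max 0 (t - s)) (B (h s))) - (integral {0..T} (\<lambda>s. B (h s)) - integral {0..t} (\<lambda>s. B (h s)))"
    if h: "continuous_on UNIV h" and t: "t \<in> {0..T}" for h t
  proof -
    have i1: "(\<lambda>s. S (max 0 (t - s)) (B (h s))) integrable_on {0..T}"
      by (intro integrable_continuous_real joint continuous_intros contB continuous_on_subset[OF h]) auto
    have i2: "(\<lambda>s. B (h s)) integrable_on {0..T}"
      by (intro integrable_continuous_real contB continuous_on_subset[OF h]) auto
    have "integral {0..T} (\<lambda>s. S (max 0 (t - s)) (B (h s))) =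
        integral {0..t} (\<lambda>s. S (max 0 (t - s)) (B (h s))) + integral {t..T} (\<lambda>s. S (max 0 (t - s)) (B (h s)))"
      using t i1 by (intro Henstock_Kurzweil_Integration.integral_combine[symmetric]) auto
    also have "integral {0..t} (\<lambda>s. S (max 0 (t - s)) (B (h s))) = integral {0..t} (\<lambda>s. S (t - s) (B (h s)))"
      by (intro Henstock_Kurzweil_Integration.integral_cong) auto
    also have "integral {t..T} (\<lambda>s. S (max 0 (t - s)) (B (h s))) = integral {t..T} (\<lambda>s. B (h s))"
      by (intro Henstock_Kurzweil_Integration.integral_cong) (auto simp: max_def S0)
    also have "integral {t..T} (\<lambda>s. B (h s)) = integral {0..T} (\<lambda>s. B (h s)) - integral {0..t} (\<lambda>s. B (h s))"
      using t i2 Henstock_Kurzweil_Integration.integral_combine[of 0 t T "\<lambda>s. B (h s)"] by (auto simp: algebra_simps)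
    finally show ?thesis by (simp add: \<Phi>0_def)
  qed
  have cont\<Phi>0: "continuous_on {0..T} (\<Phi>0 h)" if h: "continuous_on UNIV h" for h
  proof -
    have c1: "continuous_on {0..T} (\<lambda>t. integral (cbox 0 T) (\<lambda>s. S (max 0 (t - s)) (B (h s))))"
    proof (rule integral_continuous_on_param)
      have hs: "continuous_on ({0..T} \<times> cbox 0 T) (\<lambda>z. B (h (snd z)))"
        by (intro bounded_linear.continuous_on[OF B(1)] continuous_on_compose2[OF h] continuous_intros) auto
      show "continuous_on ({0..T} \<times> cbox 0 T) (\<lambda>(t, s). S (max 0 (t - s)) (B (h s)))"
        unfolding case_prod_beta by (intro joint continuous_intros hs) auto
    qed
    have "continuous_on {0..T} (\<lambda>t. S t x0)" by (rule continuous_on_subset[OF cont]) auto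
    moreover have "continuous_on {0..T} (\<lambda>t. integral {0..t} (\<lambda>s. B (h s)))"
      by (intro indefinite_integral_continuous_1 integrable_continuous_real contB continuous_on_subset[OF h]) auto
    ultimately have "continuous_on {0..T} (\<lambda>t. S t x0 + integral {0..T} (\<lambda>s. S (max 0 (t - s)) (B (h s))) - (integral {0..T} (\<lambda>s. B (h s)) - integral {0..t} (\<lambda>s. B (h s))))"
      using c1 by (intro continuous_intros) auto
    then show ?thesis by (rule continuous_on_eq) (use split[OF h] in auto)
  qed
  have \<tau>: "\<tau> t \<in> {0..T}" for t using T by (auto simp: \<tau>_def)
  have \<tau>c: "continuous_on UNIV \<tau>" unfolding \<tau>_def by (intro continuous_intros)
  define \<Phi> where "\<Phi> h = Bcontfun (\<lambda>t. \<Phi>0 (apply_bcontfun h) (\<tau> t))" for h :: "real \<Rightarrow>\<^sub>C 'a"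
  have ch: "continuous_on UNIV (apply_bcontfun h)" for h :: "real \<Rightarrow>\<^sub>C 'a"
    using apply_bcontfun[of h] by (auto simp: bcontfun_def)
  have \<Phi>: "apply_bcontfun (\<Phi> h) t = \<Phi>0 (apply_bcontfun h) (\<tau> t)" for h t
  proof -
    have c: "continuous_on UNIV (\<lambda>t. \<Phi>0 (apply_bcontfun h) (\<tau> t))"
      by (rule continuous_on_compose2[OF cont\<Phi>0[OF ch] \<tau>c]) (use \<tau> in auto)
    have "bounded (\<Phi>0 (apply_bcontfun h) ` {0..T})"
      by (intro compact_imp_bounded compact_continuous_image cont\<Phi>0 ch) auto
    then have "bounded (range (\<lambda>t. \<Phi>0 (apply_bcontfun h) (\<tau> t)))"
      by (rule bounded_subset) (use \<tau> in auto)
    with c have "(\<lambda>t. \<Phi>0 (apply_bcontfun h) (\<tau> t)) \<in> bcontfun" by (simp add: bcontfun_def)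
    then show ?thesis by (simp add: \<Phi>_def Bcontfun_inverse)
  qed
  have "\<exists>!h. \<Phi> h = h"
  proof (rule banach_fix_type)
    show "\<forall>f g :: real \<Rightarrow>\<^sub>C 'a. dist (\<Phi> f) (\<Phi> g) \<le> (1/2) * dist f g"
    proof (intro allI dist_bound)
      fix f g :: "real \<Rightarrow>\<^sub>C 'a" and t :: real
      let ?t = "\<tau> t"
      have t: "0 \<le> ?t" using \<tau> by auto
      have eint: "((\<lambda>s. M * dist f g * exp (- \<gamma> * (?t - s))) has_integral
          (M * dist f g * (exp (- \<gamma> * (?t - ?t)) / \<gamma>) - M * dist f g * (exp (- \<gamma> * (?t - 0)) / \<gamma>))) {0..?t}"
        using t M by (intro fundamental_theorem_of_calculus)
          (auto intro!: derivative_eq_intros simp flip: has_real_derivative_iff_has_vector_derivative)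
      have "apply_bcontfun (\<Phi> f) t - apply_bcontfun (\<Phi> g) t =
          integral {0..?t} (\<lambda>s. S (?t - s) (B (f s)) - S (?t - s) (B (g s)))"
        unfolding \<Phi> \<Phi>0_def by (subst Henstock_Kurzweil_Integration.integral_diff[OF integ integ]) (auto simp: ch)
      also have "norm \<dots> \<le> integral {0..?t} (\<lambda>s. M * dist f g * exp (- \<gamma> * (?t - s)))"
      proof (rule integral_norm_bound_integral)
        show "(\<lambda>s. S (?t - s) (B (f s)) - S (?t - s) (B (g s))) integrable_on {0..?t}"
          by (intro Henstock_Kurzweil_Integration.integrable_diff integ ch)
        show "(\<lambda>s. M * dist f g * exp (- \<gamma> * (?t - s))) integrable_on {0..?t}" using eint by blast
        fix s assume s: "s \<in> {0..?t}"
        have "norm (S (?t - s) (B (f s)) - S (?t - s) (B (g s))) = norm (S (?t - s) (B (f s - g s)))"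
          using s by (simp add: diff linear_diff[OF bounded_linear.linear[OF B(1)]])
        also have "\<dots> \<le> exp (- \<gamma> * (?t - s)) * norm (B (f s - g s))" using s by (intro decay) auto
        also have "\<dots> \<le> exp (- \<gamma> * (?t - s)) * (M * norm (f s - g s))" by (intro mult_left_mono B) auto
        also have "\<dots> \<le> exp (- \<gamma> * (?t - s)) * (M * dist f g)"
          using dist_bounded[of f s g] M by (intro mult_left_mono) (auto simp: dist_norm)
        finally show "norm (S (?t - s) (B (f s)) - S (?t - s) (B (g s))) \<le> M * dist f g * exp (- \<gamma> * (?t - s))"
          by (simp add: mult_ac)
      qed
      also have "\<dots> = M * dist f g * (exp (- \<gamma> * (?t - ?t)) / \<gamma>) - M * dist f g * (exp (- \<gamma> * (?t - 0)) / \<gamma>)"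
        using eint by (rule integral_unique)
      also have "\<dots> \<le> M / \<gamma> * dist f g" using M by simp
      also have "\<dots> \<le> (1/2) * dist f g" using M by (intro mult_right_mono) (auto simp: field_simps)
      finally show "dist (apply_bcontfun (\<Phi> f) t) (apply_bcontfun (\<Phi> g) t) \<le> (1/2) * dist f g" by (simp add: dist_norm)
    qed
  qed auto
  then obtain h where h: "\<Phi> h = h" by auto
  show thesis
  proof (rule that[of "apply_bcontfun h"])
    show "continuous_on {0..T} (apply_bcontfun h)" using ch by (rule continuous_on_subset) auto
    fix t assume t: "t \<in> {0..T}"
    then have "\<tau> t = t" by (auto simp: \<tau>_def)
    then have "apply_bcontfun h t = \<Phi>0 (apply_bcontfun h) t" using \<Phi>[of h t] h by simp
    then have "integral {0..t} (\<lambda>s. S (t - s) (B (apply_bcontfun h s))) = apply_bcontfun h t - S t x0" by (simp add: \<Phi>0_def)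
    with integ[OF ch, of t h] show "((\<lambda>s. S (t - s) (B (apply_bcontfun h s))) has_integral (apply_bcontfun h t - S t x0)) {0..t}"
      by (metis has_integral_integrable_integral)
  qed
qed

subsection \<open>Trigonometric functions on a box\<close>

text \<open>By construction \<open>lborel\<close> is the image of a product of one-dimensional
  measures, which reduces the claim to the product formula for such measures.\<close>

lemma integral_lborel_prod_Basis:
  fixes h :: "'a::euclidean_space \<Rightarrow> real \<Rightarrow> real"
  assumes int: "\<And>b. b \<in> Basis \<Longrightarrow> integrable lborel (h b)"
  shows "(LINT x|lborel. (\<Prod>b\<in>Basis. h b (x \<bullet> b))) = (\<Prod>b\<in>Basis. LINT s|lborel. h b s)"
proof -
  interpret product_sigma_finite "\<lambda>_::'a. lborel :: real measure"
    by (simp add: product_sigma_finite_def sigma_finite_lborel)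
  have meas: "(\<lambda>f. \<Sum>b\<in>Basis. f b *\<^sub>R b) \<in> (\<Pi>\<^sub>M b\<in>(Basis::'a set). (lborel :: real measure)) \<rightarrow>\<^sub>M borel"
    by measurable
  have lb: "(lborel :: 'a measure) = distr (\<Pi>\<^sub>M b\<in>Basis. lborel) borel (\<lambda>f. \<Sum>b\<in>Basis. f b *\<^sub>R b)"
    unfolding lborel_def[where 'a = 'a] by (simp flip: lborel_eq_real)
  have hm [measurable]: "b \<in> Basis \<Longrightarrow> h b \<in> borel_measurable borel" for b
    using borel_measurable_integrable[OF int] by simp
  have "(LINT x|lborel. (\<Prod>b\<in>Basis. h b (x \<bullet> b))) =
      (LINT f|(\<Pi>\<^sub>M b\<in>Basis. lborel). (\<Prod>b\<in>Basis. h b ((\<Sum>c\<in>Basis. f c *\<^sub>R c) \<bullet> b)))"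
    by (subst lb, rule integral_distr[OF meas]) measurable
  also have "\<dots> = (LINT f|(\<Pi>\<^sub>M b\<in>(Basis::'a set). lborel). (\<Prod>b\<in>Basis. h b (f b)))"
    by (intro Bochner_Integration.integral_cong prod.cong refl) simp
  also have "\<dots> = (\<Prod>b\<in>Basis. LINT s|lborel. h b s)"
    by (rule product_integral_prod) (use int in auto)
  finally show ?thesis .
qed

text \<open>A cosine whose frequency is a nonzero integer multiple of \<open>pi / L\<close> has an
  antiderivative vanishing at both ends of the interval. Positivity of \<open>m\<close> and
  \<open>n\<close> excludes frequency zero in the sum.\<close>

lemma integral_cos_mult:
  fixes L :: real and m n :: nat
  assumes L: "0 < L" and mn: "0 < m" "0 < n"
  shows "(LINT y|lborel. cos ((real m * pi / L - real n * pi / L) * (y - a)) * indicator {a..a + L} y) = (if m = n then L else 0)"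
    and "(LINT y|lborel. cos ((real m * pi / L + real n * pi / L) * (y - a)) * indicator {a..a + L} y) = 0"
proof -
  have *: "(LINT y|lborel. cos (real_of_int z * pi / L * (y - a)) * indicator {a..a + L} y) = 0" if "z \<noteq> 0" for z :: int
  proof -
    have "(LINT y|lborel. cos (real_of_int z * pi / L * (y - a)) * indicator {a..a + L} y) =
        sin (real_of_int z * pi / L * (a + L - a)) / (real_of_int z * pi / L) - sin (real_of_int z * pi / L * (a - a)) / (real_of_int z * pi / L)"
      by (rule integral_FTC_Icc_real[where F = "\<lambda>y. sin (real_of_int z * pi / L * (y - a)) / (real_of_int z * pi / L)"])
        (use L that in \<open>auto intro!: derivative_eq_intros continuous_intros\<close>)
    also have "real_of_int z * pi / L * (a + L - a) = real_of_int z * pi" using L by simp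
    also have "sin (real_of_int z * pi) = 0" using sin_zero_iff_int2 by blast
    also have "0 / (real_of_int z * pi / L) - sin (real_of_int z * pi / L * (a - a)) / (real_of_int z * pi / L) = 0" by simp
    finally show ?thesis .
  qed
  show "(LINT y|lborel. cos ((real m * pi / L + real n * pi / L) * (y - a)) * indicator {a..a + L} y) = 0"
    using *[of "int m + int n"] mn by (simp add: add_divide_distrib distrib_right)
  show "(LINT y|lborel. cos ((real m * pi / L - real n * pi / L) * (y - a)) * indicator {a..a + L} y) = (if m = n then L else 0)"
    using *[of "int m - int n"] L by (auto simp: diff_divide_distrib left_diff_distrib measure_def)
qed

locale rect =
  fixes a b :: "real ^ 'n"
  assumes ab: "a $ i < b $ i"
begin

abbreviation "\<Omega> \<equiv> box a b"
abbreviation "M \<equiv> lebesgue_on (box a b)"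
definition "len i = b $ i - a $ i"

lemma len_pos: "0 < len i" using ab by (simp add: len_def)

lemma finite_M: "finite_measure M"
  by (rule finite_measureI) (simp add: emeasure_restrict_space emeasure_lborel_box_eq ennreal_prod_eq_top)

lemma open_Om: "open \<Omega>" by (rule open_box)

lemma mem_Om: "x \<in> \<Omega> \<longleftrightarrow> (\<forall>i. a $ i < x $ i \<and> x $ i < b $ i)"
  by (simp add: mem_box_cart)

lemma continuous_measurable_M: "continuous_on UNIV f \<Longrightarrow> f \<in> borel_measurable M"
  by (intro measurable_restrict_space1 measurable_completion) (simp add: borel_measurable_continuous_onI)

section \<open>Products of functions of one coordinate\<close>

definition tensor :: "('n \<Rightarrow> real \<Rightarrow> real) \<Rightarrow> real ^ 'n \<Rightarrow> real" where
  "tensor G x = (\<Prod>i\<in>UNIV. G i (x $ i))"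

lemma tensor_continuous:
  assumes "\<And>i. continuous_on UNIV (G i)" shows "continuous_on UNIV (tensor G)"
proof -
  have "continuous_on UNIV (\<lambda>x :: real ^ 'n. G i (x $ i))" for i
    by (rule continuous_on_compose2[OF assms]) (auto intro: continuous_intros)
  then show ?thesis unfolding tensor_def[abs_def] by (rule continuous_on_prod)
qed

lemma tensor_mult: "tensor G x * tensor H x = tensor (\<lambda>i y. G i y * H i y) x"
  by (simp add: tensor_def prod.distrib)

lemma tensor_deriv:
  assumes "(G i has_real_derivative d (x $ i)) (at (x $ i))"
  shows "((\<lambda>s. tensor G (x + s *\<^sub>R axis i 1)) has_real_derivative tensor (G(i := d)) x) (at 0)"
proof -
  have eq: "tensor G (x + s *\<^sub>R axis i 1) = G i (x $ i + s) * (\<Prod>j\<in>UNIV - {i}. G j (x $ j))" for s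
    unfolding tensor_def by (subst prod.remove[of UNIV i]) (auto simp: axis_def intro!: prod.cong)
  have "((\<lambda>s. G i (x $ i + s)) has_real_derivative d (x $ i)) (at 0)"
    using DERIV_shift[of "G i" "d (x $ i)" 0 "x $ i"] assms by (simp add: add.commute)
  then have "((\<lambda>s. G i (x $ i + s) * (\<Prod>j\<in>UNIV - {i}. G j (x $ j))) has_real_derivative
      d (x $ i) * (\<Prod>j\<in>UNIV - {i}. G j (x $ j))) (at 0)"
    by (rule DERIV_cmult_right)
  moreover have "tensor (G(i := d)) x = d (x $ i) * (\<Prod>j\<in>UNIV - {i}. G j (x $ j))"
    unfolding tensor_def by (subst prod.remove[of UNIV i]) (auto intro!: prod.cong)
  ultimately show ?thesis by (simp add: eq)
qed

lemma tensor_bound: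
  assumes "x \<in> \<Omega>" "\<And>i y. a $ i < y \<Longrightarrow> y < b $ i \<Longrightarrow> \<bar>G i y\<bar> \<le> K i"
  shows "\<bar>tensor G x\<bar> \<le> (\<Prod>i\<in>UNIV. K i)"
proof -
  have "\<bar>G i (x $ i)\<bar> \<le> K i" for i using assms(1) by (intro assms(2)) (auto simp: mem_Om)
  then show ?thesis unfolding tensor_def abs_prod by (intro prod_mono) simp
qed

lemma tensor_sq_int:
  assumes "\<And>i. continuous_on UNIV (G i)" "\<And>i y. a $ i < y \<Longrightarrow> y < b $ i \<Longrightarrow> \<bar>G i y\<bar> \<le> K i"
  shows "sq_int M (tensor G)"
  using assms tensor_bound[of _ G K]
  by (intro sq_int_bounded[OF finite_M, of _ "\<Prod>i\<in>UNIV. K i"] continuous_measurable_M tensor_continuous) auto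

text \<open>Convergence of products in \<open>L2\<close> is reduced to pointwise convergence and
  uniform bounds of the factors: the box has finite measure, so a constant is an admissible
  majorant.\<close>

lemma tensor_limit:
  assumes c: "\<And>j i. continuous_on UNIV (G j i)" "\<And>i. continuous_on UNIV (H i)"
    and b: "\<And>j i y. a $ i < y \<Longrightarrow> y < b $ i \<Longrightarrow> \<bar>G j i y\<bar> \<le> K i"
    and l: "\<And>i y. a $ i < y \<Longrightarrow> y < b $ i \<Longrightarrow> (\<lambda>j. G j i y) \<longlonglongrightarrow> H i y"
  shows "(\<lambda>j. nrm M (\<lambda>x. tensor (G j) x - tensor H x)) \<longlonglongrightarrow> 0"
proof (rule nrm_dominated_convergence(2)[where w = "\<lambda>_. \<Prod>i\<in>UNIV. K i"])
  show "sq_int M (\<lambda>_. \<Prod>i\<in>UNIV. K i)" by (rule sq_int_bounded[OF finite_M]) auto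
  show "AE x in M. \<bar>tensor (G j) x\<bar> \<le> (\<Prod>i\<in>UNIV. K i)" for j
    by (rule AE_I2) (use b tensor_bound[of _ "G j" K] in auto)
  show "AE x in M. (\<lambda>j. tensor (G j) x) \<longlonglongrightarrow> tensor H x"
    by (rule AE_I2) (use l in \<open>auto simp: tensor_def mem_Om intro!: tendsto_prod\<close>)
qed (intro continuous_measurable_M tensor_continuous c)+

lemma tensor_smooth:
  assumes "\<And>i. Ck_fun k (G i)" shows "Ck_fun k (tensor G)"
  unfolding tensor_def[abs_def]
  by (intro Ck_fun_prod Ck_fun_compose_linear[where L = "\<lambda>x. x $ _"] bounded_linear_vec_nth assms)

lemma tensor_integral:
  assumes c: "\<And>i. continuous_on UNIV (G i)"
  shows "(LINT x|M. tensor G x) = (\<Prod>i\<in>UNIV. LINT y|lborel. G i y * indicator {a $ i..a $ i + len i} y)"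
proof -
  \<comment> \<open>The product formula is indexed by basis vectors, the factors by coordinates;
    \<open>idx\<close> translates.\<close>
  define idx where "idx v = (THE i :: 'n. v = axis i 1)" for v :: "real ^ 'n"
  have idx: "idx (axis i 1) = i" for i unfolding idx_def by (auto simp: axis_eq_axis)
  define h where "h v y = G (idx v) y * indicator {a $ idx v<..<b $ idx v} y" for v :: "real ^ 'n" and y
  have h: "h (axis i 1) y = G i y * indicator {a $ i<..<b $ i} y" for i y
    unfolding h_def idx by (rule refl)
  then have hh: "h (axis i 1) = (\<lambda>y. G i y * indicator {a $ i<..<b $ i} y)" for i
    by (rule ext)
  have inj: "inj_on (\<lambda>i::'n. axis i (1::real)) UNIV" by (auto simp: inj_on_def axis_eq_axis)
  have B: "(Basis :: (real ^ 'n) set) = range (\<lambda>i. axis i 1)" by (auto simp: Basis_vec_def)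
  \<comment> \<open>The box is open, while the one-dimensional integrals run over closed intervals;
    the two end points are null sets.\<close>
  have AEy: "AE y in lborel. G i y * indicator {a $ i<..<b $ i} y = G i y * indicator {a $ i..a $ i + len i} y" for i
    using AE_lborel_singleton[of "a $ i"] AE_lborel_singleton[of "b $ i"]
    by eventually_elim (auto simp: indicator_def len_def)
  have Gm [measurable]: "G i \<in> borel_measurable borel" for i
    using c by (rule borel_measurable_continuous_onI)
  have intc: "integrable lborel (\<lambda>y. G i y * indicator {a $ i..a $ i + len i} y)" for i
    using borel_integrable_atLeastAtMost'[OF continuous_on_subset[OF c[of i]], of "a $ i" "a $ i + len i"]
    by (simp add: set_integrable_def mult.commute)
  have into: "integrable lborel (\<lambda>y. G i y * indicator {a $ i<..<b $ i} y)" for i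
  proof (rule integrable_cong_AE_imp[OF intc])
    show "AE y in lborel. G i y * indicator {a $ i..a $ i + len i} y = G i y * indicator {a $ i<..<b $ i} y"
      using AEy[of i] by eventually_elim (rule sym)
  qed measurable
  have cm: "tensor G \<in> borel_measurable borel"
    by (intro borel_measurable_continuous_onI tensor_continuous c)
  have "(LINT x|M. tensor G x) = (LINT x|lborel. (if x \<in> \<Omega> then tensor G x else 0))"
    using cm by (intro LINT_lebesgue_on_lborel) auto
  also have "\<dots> = (LINT x|lborel. (\<Prod>v\<in>Basis. h v (x \<bullet> v)))"
  proof (intro Bochner_Integration.integral_cong refl)
    fix x :: "real ^ 'n"
    have "(\<Prod>v\<in>Basis. h v (x \<bullet> v)) = (\<Prod>i\<in>UNIV. G i (x $ i) * indicator {a $ i<..<b $ i} (x $ i))"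
      unfolding B by (subst prod.reindex[OF inj]) (simp add: h inner_axis)
    also have "\<dots> = (if x \<in> \<Omega> then tensor G x else 0)"
    proof (cases "x \<in> \<Omega>")
      case True then show ?thesis by (auto simp: tensor_def mem_Om intro!: prod.cong)
    next
      case False
      then obtain i where "\<not> (a $ i < x $ i \<and> x $ i < b $ i)" by (auto simp: mem_Om)
      then have "(\<Prod>i\<in>UNIV. G i (x $ i) * indicator {a $ i<..<b $ i} (x $ i)) = 0"
        by (intro prod_zero bexI[of _ i]) auto
      with False show ?thesis by simp
    qed
    finally show "(if x \<in> \<Omega> then tensor G x else 0) = (\<Prod>v\<in>Basis. h v (x \<bullet> v))" by simp
  qed
  also have "\<dots> = (\<Prod>v\<in>Basis. LINT s|lborel. h v s)"
    by (rule integral_lborel_prod_Basis) (use into in \<open>auto simp: B hh\<close>)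
  also have "\<dots> = (\<Prod>i\<in>UNIV. LINT y|lborel. G i y * indicator {a $ i<..<b $ i} y)"
    unfolding B by (subst prod.reindex[OF inj]) (simp add: hh)
  also have "\<dots> = (\<Prod>i\<in>UNIV. LINT y|lborel. G i y * indicator {a $ i..a $ i + len i} y)"
    using AEy by (intro prod.cong refl integral_cong_AE) auto
  finally show ?thesis .
qed

section \<open>Eigenvalues and trigonometric systems\<close>

definition wt :: "('n \<Rightarrow> nat) \<Rightarrow> 'n \<Rightarrow> real" where "wt k i = real (Suc (k i)) * pi / len i"

lemma wt_pos: "0 < wt k i" using len_pos by (simp add: wt_def)

text \<open>The eigenvalue of minus the Dirichlet Laplacian for the mode
  \<open>trig {} k\<close>.\<close>

definition lam :: "('n \<Rightarrow> nat) \<Rightarrow> real" where "lam k = (\<Sum>i\<in>UNIV. (wt k i)\<^sup>2)"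

lemma lam_pos: "0 < lam k"
  unfolding lam_def using wt_pos by (intro sum_pos zero_less_power) auto

text \<open>Cosine factors in the directions belonging to \<open>D\<close>, sine factors in the others; the
  eigenfunctions of the Dirichlet Laplacian have \<open>D = {}\<close>.\<close>

definition osc :: "'n set \<Rightarrow> ('n \<Rightarrow> nat) \<Rightarrow> 'n \<Rightarrow> real \<Rightarrow> real" where
  "osc D k i y = sqrt (2 / len i) * (if i \<in> D then cos (wt k i * (y - a $ i)) else sin (wt k i * (y - a $ i)))"

definition trig :: "'n set \<Rightarrow> ('n \<Rightarrow> nat) \<Rightarrow> real ^ 'n \<Rightarrow> real" where "trig D k = tensor (osc D k)"

definition flip :: "'n \<Rightarrow> 'n set \<Rightarrow> 'n set" where "flip i D = (if i \<in> D then D - {i} else insert i D)"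

text \<open>Differentiation in direction \<open>i\<close> exchanges sine and cosine there, which is
  \<open>flip\<close>; the sign is negative when a cosine is differentiated.\<close>

definition dsign :: "'n \<Rightarrow> 'n set \<Rightarrow> real" where "dsign i D = (if i \<in> D then -1 else 1)"

lemma osc_continuous: "continuous_on UNIV (osc D k i)"
  unfolding osc_def[abs_def] by (cases "i \<in> D") (auto intro!: continuous_intros)

lemma osc_bound: "\<bar>osc D k i y\<bar> \<le> sqrt (2 / len i)"
  using len_pos[of i] by (auto simp: osc_def abs_mult intro!: mult_left_le)

lemma osc_deriv: "(osc D k i has_real_derivative dsign i D * wt k i * osc (flip i D) k i y) (at y)"
  unfolding osc_def[abs_def] dsign_def flip_def
  by (cases "i \<in> D") (auto intro!: derivative_eq_intros)

lemma osc_flip_other: "j \<noteq> i \<Longrightarrow> osc (flip i D) k j = osc D k j"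
  by (auto simp: osc_def flip_def)

lemma trig_continuous: "continuous_on UNIV (trig D k)"
  unfolding trig_def by (intro tensor_continuous osc_continuous)

lemma trig_sq_int: "sq_int M (trig D k)"
  unfolding trig_def by (rule tensor_sq_int[OF osc_continuous osc_bound])

lemma trig_deriv:
  "((\<lambda>s. trig D k (x + s *\<^sub>R axis i 1)) has_real_derivative dsign i D * wt k i * trig (flip i D) k x) (at 0)"
proof -
  have "tensor ((osc D k)(i := \<lambda>y. dsign i D * wt k i * osc (flip i D) k i y)) x = dsign i D * wt k i * trig (flip i D) k x"
  proof -
    have "(\<Prod>j\<in>UNIV - {i}. ((osc D k)(i := \<lambda>y. dsign i D * wt k i * osc (flip i D) k i y)) j (x $ j)) =
        (\<Prod>j\<in>UNIV - {i}. osc (flip i D) k j (x $ j))"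
      by (intro prod.cong) (auto simp: osc_flip_other)
    then show ?thesis unfolding tensor_def trig_def by (subst (1 2) prod.remove[of UNIV i]) auto
  qed
  then show ?thesis
    unfolding trig_def using tensor_deriv[of "osc D k" i "\<lambda>y. dsign i D * wt k i * osc (flip i D) k i y" x] osc_deriv
    by (simp add: trig_def)
qed

text \<open>The product formula leaves one-dimensional integrals, which the addition theorems split
  into cosines of the difference and of the sum of two frequencies. Frequencies start at
  \<open>pi / len i\<close>, so no constant cosine occurs and one normalisation fits sines and
  cosines alike.\<close>

lemma trig_orthonormal: "ip M (trig D k) (trig D m) = (if k = m then 1 else 0)"
proof -
  have 1: "(LINT y|lborel. osc D k i y * osc D m i y * indicator {a $ i..a $ i + len i} y) = (if k i = m i then 1 else 0)" for i
  proof -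
    define s :: real where "s = (if i \<in> D then 1 else -1)"
    have eq: "osc D k i y * osc D m i y * indicator {a $ i..a $ i + len i} y =
        (1 / len i) * (cos ((wt k i - wt m i) * (y - a $ i)) * indicator {a $ i..a $ i + len i} y)
        + (s / len i) * (cos ((wt k i + wt m i) * (y - a $ i)) * indicator {a $ i..a $ i + len i} y)" for y
    proof -
      define P Q where "P = wt k i * (y - a $ i)" and "Q = wt m i * (y - a $ i)"
      have PQ: "(wt k i - wt m i) * (y - a $ i) = P - Q" "(wt k i + wt m i) * (y - a $ i) = P + Q"
        by (simp_all add: P_def Q_def algebra_simps)
      define r where "r = sqrt (2 / len i)"
      have sq: "r * r = 2 / len i" using len_pos[of i] by (simp add: r_def)
      have o: "osc D k i y = r * (if i \<in> D then cos P else sin P)" "osc D m i y = r * (if i \<in> D then cos Q else sin Q)"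
        unfolding osc_def r_def P_def Q_def by (rule refl)+
      have "osc D k i y * osc D m i y = (r * r) * (if i \<in> D then cos P * cos Q else sin P * sin Q)"
        by (simp add: o)
      also have "\<dots> = (1 / len i) * cos (P - Q) + (s / len i) * cos (P + Q)"
        unfolding sq s_def cos_times_cos sin_times_sin by (simp add: add_divide_distrib diff_divide_distrib)
      finally show ?thesis unfolding PQ by (simp add: distrib_right)
    qed
    have int: "integrable lborel (\<lambda>y. cos (w * (y - a $ i)) * indicator {a $ i..a $ i + len i} y)" for w
      using borel_integrable_atLeastAtMost'[of "a $ i" "a $ i + len i" "\<lambda>y. cos (w * (y - a $ i))"]
      by (simp add: set_integrable_def mult.commute continuous_intros)
    show ?thesis
      unfolding eq using len_pos[of i] integral_cos_mult[OF len_pos[of i], of "Suc (k i)" "Suc (m i)" "a $ i"]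
      by (subst Bochner_Integration.integral_add) (auto intro!: integrable_mult_right int simp: wt_def)
  qed
  have "ip M (trig D k) (trig D m) = (\<Prod>i\<in>UNIV. (if k i = m i then 1 else 0))"
    unfolding ip_def trig_def tensor_mult
    by (subst tensor_integral) (auto intro!: continuous_intros osc_continuous simp: 1)
  also have "\<dots> = (if k = m then 1 else 0)"
  proof (cases "k = m")
    case False
    then obtain i where "k i \<noteq> m i" by auto
    then have "(\<Prod>i\<in>UNIV. (if k i = m i then 1 else 0 :: real)) = 0"
      by (intro prod_zero bexI[of _ i]) auto
    with False show ?thesis by simp
  qed simp
  finally show ?thesis .
qed

lemma trig_sum_sq_int: "sq_int M (\<lambda>x. \<Sum>k\<in>F. c k * trig D k x)"
proof (rule sq_int_sum)
  show "sq_int M (\<lambda>x. c k * trig D k x)" for k by (rule sq_int_cmult) (rule trig_sq_int)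
qed

lemma ip_trig_sum:
  assumes h: "sq_int M h"
  shows "ip M (\<lambda>x. \<Sum>k\<in>F. c k * trig D k x) h = (\<Sum>k\<in>F. c k * ip M (trig D k) h)"
proof -
  have "ip M (\<lambda>x. \<Sum>k\<in>F. c k * trig D k x) h = (\<Sum>k\<in>F. ip M (\<lambda>x. c k * trig D k x) h)"
  proof (rule ip_sum_left[OF _ h])
    show "sq_int M (\<lambda>x. c k * trig D k x)" for k by (rule sq_int_cmult) (rule trig_sq_int)
  qed
  also have "\<dots> = (\<Sum>k\<in>F. c k * ip M (trig D k) h)"
    by (intro sum.cong refl) (rule ip_cmult_left)
  finally show ?thesis .
qed

lemma ip_trig_sum_trig:
  assumes "finite F"
  shows "ip M (\<lambda>x. \<Sum>m\<in>F. c m * trig D m x) (trig D k) = (if k \<in> F then c k else 0)"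
proof -
  have "ip M (\<lambda>x. \<Sum>m\<in>F. c m * trig D m x) (trig D k) = (\<Sum>m\<in>F. c m * (if m = k then 1 else 0))"
    unfolding ip_trig_sum[OF trig_sq_int] trig_orthonormal by (rule refl)
  also have "\<dots> = (\<Sum>m\<in>F. if m = k then c m else 0)" by (intro sum.cong refl) simp
  finally show ?thesis using assms by (simp add: sum.delta)
qed

lemma nrm_trig_sum:
  assumes "finite F" shows "(nrm M (\<lambda>x. \<Sum>k\<in>F. c k * trig D k x))\<^sup>2 = (\<Sum>k\<in>F. (c k)\<^sup>2)"
proof -
  have "(nrm M (\<lambda>x. \<Sum>k\<in>F. c k * trig D k x))\<^sup>2 = (\<Sum>k\<in>F. c k * ip M (trig D k) (\<lambda>x. \<Sum>k\<in>F. c k * trig D k x))"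
    unfolding nrm_power2_ip by (rule ip_trig_sum[OF trig_sum_sq_int])
  also have "\<dots> = (\<Sum>k\<in>F. c k * c k)"
  proof (intro sum.cong refl)
    fix k assume "k \<in> F"
    then show "c k * ip M (trig D k) (\<lambda>x. \<Sum>k\<in>F. c k * trig D k x) = c k * c k"
      using ip_trig_sum_trig[OF assms, of c D k] ip_commute[of M "trig D k"] by simp
  qed
  finally show ?thesis by (simp only: power2_eq_square)
qed

abbreviation "e \<equiv> trig {}"

section \<open>Test functions approximating the eigenfunctions\<close>

definition cutoff :: "nat \<Rightarrow> 'n \<Rightarrow> real \<Rightarrow> real" where
  "cutoff j i y = flat (real j * (y - a $ i) - 1) * flat (real j * (b $ i - y) - 1)"

definition cutoff' :: "nat \<Rightarrow> 'n \<Rightarrow> real \<Rightarrow> real" where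
  "cutoff' j i y = real j * flat_poly (flat_step 1) (real j * (y - a $ i) - 1) * flat (real j * (b $ i - y) - 1)
     - flat (real j * (y - a $ i) - 1) * (real j * flat_poly (flat_step 1) (real j * (b $ i - y) - 1))"

lemma cutoff_deriv: "(cutoff j i has_real_derivative cutoff' j i y) (at y)"
proof -
  have 1: "((\<lambda>y. flat (real j * (y - a $ i) - 1)) has_real_derivative
      flat_poly (flat_step 1) (real j * (y - a $ i) - 1) * real j) (at y)"
    by (rule DERIV_chain2[OF flat_poly_DERIV]) (auto intro!: derivative_eq_intros)
  have 2: "((\<lambda>y. flat (real j * (b $ i - y) - 1)) has_real_derivative
      flat_poly (flat_step 1) (real j * (b $ i - y) - 1) * (- real j)) (at y)"
    by (rule DERIV_chain2[OF flat_poly_DERIV]) (auto intro!: derivative_eq_intros)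
  show ?thesis
    unfolding cutoff_def[abs_def] using DERIV_mult[OF 1 2] by (simp add: cutoff'_def algebra_simps)
qed

lemma cutoff_bounds: "0 \<le> cutoff j i y" "cutoff j i y \<le> 1"
  unfolding cutoff_def by (auto intro!: mult_le_one simp: flat_nonneg flat_le_1)

lemma scaled_at_top:
  assumes "0 < r" shows "filterlim (\<lambda>j. real j * r - 1) at_top sequentially"
proof -
  have "filterlim (\<lambda>j. real j * r) at_top sequentially"
    by (rule filterlim_at_top_mult_tendsto_pos[OF tendsto_const assms filterlim_real_sequentially])
  from filterlim_tendsto_add_at_top[OF tendsto_const[of "-1"] this] show ?thesis by simp
qed

lemma cutoff_tendsto: "a $ i < y \<Longrightarrow> y < b $ i \<Longrightarrow> (\<lambda>j. cutoff j i y) \<longlonglongrightarrow> 1"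
  unfolding cutoff_def
  using tendsto_mult[OF flat_tendsto_1[OF scaled_at_top] flat_tendsto_1[OF scaled_at_top], of "y - a $ i" "b $ i - y"] by simp

lemma cutoff_smooth: "Ck_fun k (cutoff j i)"
proof -
  have l: "Ck_fun k (\<lambda>y. c * y + d)" for c d :: real
    by (intro Ck_fun_add Ck_fun_mult Ck_fun_const Ck_fun_linear bounded_linear_ident)
  have "Ck_fun k (\<lambda>y. flat (real j * y + (- real j * a $ i - 1)) * flat (- real j * y + (real j * b $ i - 1)))"
    by (intro Ck_fun_mult Ck_fun_flat l)
  moreover have "(\<lambda>y. flat (real j * y + (- real j * a $ i - 1)) * flat (- real j * y + (real j * b $ i - 1))) = cutoff j i"
    by (rule ext) (simp add: cutoff_def algebra_simps)
  ultimately show ?thesis by simp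
qed

text \<open>Each differentiation of the sine is a shift of the argument by \<open>pi / 2\<close>,
  which provides the sequence of derivatives for \<open>Ck_fun_compose_real\<close>.\<close>

lemma Ck_fun_sin: "Ck_fun k f \<Longrightarrow> Ck_fun k (\<lambda>x. sin (f x))"
proof -
  assume f: "Ck_fun k f"
  have "((\<lambda>x. sin (x + real n * (pi/2))) has_real_derivative sin (x + real (Suc n) * (pi/2))) (at x)" for n x
  proof -
    have "sin (x + real (Suc n) * (pi/2)) = cos (x + real n * (pi/2))"
    proof -
      have "x + real (Suc n) * (pi/2) = (x + real n * (pi/2)) + pi/2" by (simp add: algebra_simps)
      then show ?thesis by (simp only: sin_add[of "x + real n * (pi/2)"]) simp
    qed
    then show ?thesis by (auto intro!: derivative_eq_intros)
  qed
  from Ck_fun_compose_real[where D = "\<lambda>n x. sin (x + real n * (pi/2))" and n = 0, OF this f]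
  show ?thesis by simp
qed

lemma osc_empty: "osc {} k i y = sqrt (2 / len i) * sin (wt k i * (y - a $ i))"
  by (simp add: osc_def)

lemma osc_smooth: "Ck_fun m (osc {} k i)"
proof -
  have "Ck_fun m (\<lambda>y. sqrt (2 / len i) * sin (wt k i * y + - wt k i * a $ i))"
    by (intro Ck_fun_add Ck_fun_mult Ck_fun_const Ck_fun_sin Ck_fun_linear bounded_linear_ident)
  moreover have "(\<lambda>y. sqrt (2 / len i) * sin (wt k i * y + - wt k i * a $ i)) = osc {} k i"
    by (rule ext) (simp add: osc_empty algebra_simps)
  ultimately show ?thesis by simp
qed

text \<open>The sine vanishes at both end points, and
  \<open>\<bar>sin x\<bar> \<le> \<bar>x\<bar>\<close>. This linear decay is what will absorb the
  factor \<open>j\<close> in the derivative of the cutoff.\<close>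

lemma osc_boundary:
  "\<bar>osc {} k i y\<bar> \<le> sqrt (2 / len i) * wt k i * \<bar>y - a $ i\<bar>"
  "\<bar>osc {} k i y\<bar> \<le> sqrt (2 / len i) * wt k i * \<bar>b $ i - y\<bar>"
proof -
  have w: "0 < wt k i" by (rule wt_pos)
  have s: "0 \<le> sqrt (2 / len i)" using len_pos[of i] by simp
  have 1: "\<bar>sin (wt k i * z)\<bar> \<le> wt k i * \<bar>z\<bar>" for z
    using abs_sin_x_le_abs_x[of "wt k i * z"] w by (simp add: abs_mult)
  show "\<bar>osc {} k i y\<bar> \<le> sqrt (2 / len i) * wt k i * \<bar>y - a $ i\<bar>"
    using mult_left_mono[OF 1[of "y - a $ i"] s] s by (simp add: osc_empty abs_mult mult.assoc)
  have "\<bar>sin (wt k i * (y - a $ i))\<bar> = \<bar>sin (wt k i * (b $ i - y))\<bar>"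
  proof -
    \<comment> \<open>Reflection to the right end point: \<open>wt k i * len i\<close> is an integer
      multiple of \<open>pi\<close>, so the sine changes at most its sign.\<close>
    have "wt k i * (y - a $ i) = real (Suc (k i)) * pi - wt k i * (b $ i - y)"
      using len_pos[of i] by (simp add: wt_def len_def field_simps)
    then show ?thesis
      by (simp add: sin_diff sin_npi cos_npi abs_mult power_abs del: of_nat_Suc)
  qed
  then show "\<bar>osc {} k i y\<bar> \<le> sqrt (2 / len i) * wt k i * \<bar>b $ i - y\<bar>"
    using mult_left_mono[OF 1[of "b $ i - y"] s] s by (simp add: osc_empty abs_mult mult.assoc)
qed

text \<open>The derivative of the cutoff carries a factor \<open>j\<close>, while the sine is
  bounded by a multiple of the distance to either face; the product is governed by
  \<open>flat_deriv_bound\<close>. Each of the two faces contributes the constant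
  \<open>3\<close>.\<close>

lemma osc_cutoff'_bound:
  assumes "a $ i < y" "y < b $ i"
  shows "\<bar>osc {} k i y * cutoff' j i y\<bar> \<le> sqrt (2 / len i) * wt k i * 6"
    and "(\<lambda>j. osc {} k i y * cutoff' j i y) \<longlonglongrightarrow> 0"
proof -
  define C where "C = sqrt (2 / len i) * wt k i"
  define r s where "r j = real j * (y - a $ i) - 1" and "s j = real j * (b $ i - y) - 1" for j
  let ?f = "flat_poly (flat_step 1)"
  have C: "0 \<le> C" unfolding C_def using wt_pos[of k i] len_pos[of i] by simp
  have le: "\<bar>osc {} k i y * cutoff' j i y\<bar> \<le> C * ((r j + 1) * ?f (r j)) + C * ((s j + 1) * ?f (s j))" for j
  proof -
    have "\<bar>osc {} k i y * (real j * ?f (r j) * flat (s j))\<bar> \<le> C * ((r j + 1) * ?f (r j))"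
    proof -
      have "\<bar>osc {} k i y * (real j * ?f (r j) * flat (s j))\<bar> = \<bar>osc {} k i y\<bar> * (real j * ?f (r j)) * flat (s j)"
        by (simp add: abs_mult flat_deriv_bound(1) flat_nonneg)
      also have "\<dots> \<le> \<bar>osc {} k i y\<bar> * (real j * ?f (r j)) * 1"
        by (intro mult_left_mono flat_le_1 mult_nonneg_nonneg) (auto simp: flat_deriv_bound(1))
      also have "\<dots> \<le> C * (y - a $ i) * (real j * ?f (r j)) * 1"
        using osc_boundary(1)[of k i y] assms
        by (intro mult_right_mono mult_nonneg_nonneg) (auto simp: flat_deriv_bound(1) C_def)
      also have "\<dots> = C * ((r j + 1) * ?f (r j))" by (simp add: r_def)
      finally show ?thesis .
    qed
    moreover have "\<bar>osc {} k i y * (flat (r j) * (real j * ?f (s j)))\<bar> \<le> C * ((s j + 1) * ?f (s j))"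
    proof -
      have "\<bar>osc {} k i y * (flat (r j) * (real j * ?f (s j)))\<bar> = \<bar>osc {} k i y\<bar> * (real j * ?f (s j)) * flat (r j)"
        by (simp add: abs_mult flat_deriv_bound(1) flat_nonneg)
      also have "\<dots> \<le> \<bar>osc {} k i y\<bar> * (real j * ?f (s j)) * 1"
        by (intro mult_left_mono flat_le_1 mult_nonneg_nonneg) (auto simp: flat_deriv_bound(1))
      also have "\<dots> \<le> C * (b $ i - y) * (real j * ?f (s j)) * 1"
        using osc_boundary(2)[of k i y] assms
        by (intro mult_right_mono mult_nonneg_nonneg) (auto simp: flat_deriv_bound(1) C_def)
      also have "\<dots> = C * ((s j + 1) * ?f (s j))" by (simp add: s_def)
      finally show ?thesis .
    qed
    moreover have "osc {} k i y * cutoff' j i y =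
        osc {} k i y * (real j * ?f (r j) * flat (s j)) - osc {} k i y * (flat (r j) * (real j * ?f (s j)))"
      by (simp add: cutoff'_def r_def s_def right_diff_distrib)
    ultimately show ?thesis by linarith
  qed
  have "C * ((r j + 1) * ?f (r j)) + C * ((s j + 1) * ?f (s j)) \<le> C * 3 + C * 3"
    by (intro add_mono mult_left_mono flat_deriv_bound C)
  with le[of j] have "\<bar>osc {} k i y * cutoff' j i y\<bar> \<le> C * 6" by linarith
  then show "\<bar>osc {} k i y * cutoff' j i y\<bar> \<le> sqrt (2 / len i) * wt k i * 6"
    by (simp only: C_def)
  show "(\<lambda>j. osc {} k i y * cutoff' j i y) \<longlonglongrightarrow> 0"
  proof (rule Lim_null_comparison)
    show "\<forall>\<^sub>F j in sequentially. norm (osc {} k i y * cutoff' j i y) \<le> C * ((r j + 1) * ?f (r j)) + C * ((s j + 1) * ?f (s j))"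
      using le by simp
    have "(\<lambda>j. C * ((r j + 1) * ?f (r j)) + C * ((s j + 1) * ?f (s j))) \<longlonglongrightarrow> C * 0 + C * 0"
      unfolding r_def s_def by (intro tendsto_add tendsto_mult[OF tendsto_const] flat_deriv_tendsto_0 scaled_at_top) (use assms in auto)
    then show "(\<lambda>j. C * ((r j + 1) * ?f (r j)) + C * ((s j + 1) * ?f (s j))) \<longlonglongrightarrow> 0" by simp
  qed
qed

text \<open>The mode \<open>e k\<close> has no compact support. The shift by \<open>1\<close> in
  \<open>cutoff\<close> makes these truncations vanish within distance \<open>1 / j\<close> of the
  faces, hence they are test functions, and they converge to \<open>e k\<close> together with their
  first derivatives.\<close>

definition etest :: "('n \<Rightarrow> nat) \<Rightarrow> nat \<Rightarrow> real ^ 'n \<Rightarrow> real" where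
  "etest k j = tensor (\<lambda>i y. osc {} k i y * cutoff j i y)"

lemma etest_smooth: "Ck_fun m (etest k j)"
  unfolding etest_def by (intro tensor_smooth Ck_fun_mult osc_smooth cutoff_smooth)

lemma etest_test: "etest k j \<in> test_functions \<Omega>"
proof (cases "j = 0")
  \<comment> \<open>For \<open>j = 0\<close> both arguments of the cutoff are \<open>-1\<close>, so
    the function vanishes identically; the other case may divide by \<open>j\<close>.\<close>
  case True
  have "etest k j = (\<lambda>_. 0)"
    by (rule ext) (auto simp: etest_def tensor_def cutoff_def True flat_eq_0)
  then show ?thesis by (simp add: test_functions_zero)
next
  case False
  define c d where "c = (\<chi> i. a $ i + 1 / real j)" and "d = (\<chi> i. b $ i - 1 / real j)"
  show ?thesis
  proof (rule test_functionsI[OF etest_smooth compact_cbox[of c d]])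
    show "cbox c d \<subseteq> \<Omega>"
    proof
      fix x assume x: "x \<in> cbox c d"
      have "0 < 1 / real j" using False by simp
      moreover have "a $ i + 1 / real j \<le> x $ i \<and> x $ i \<le> b $ i - 1 / real j" for i
        using x by (simp add: mem_box_cart c_def d_def)
      ultimately have "a $ i < x $ i \<and> x $ i < b $ i" for i by (smt (verit))
      then show "x \<in> \<Omega>" by (simp add: mem_Om)
    qed
    fix x assume "x \<notin> cbox c d"
    then obtain i where i: "x $ i < a $ i + 1 / real j \<or> b $ i - 1 / real j < x $ i"
      by (auto simp: mem_box_cart c_def d_def not_le)
    then have "real j * (x $ i - a $ i) - 1 \<le> 0 \<or> real j * (b $ i - x $ i) - 1 \<le> 0"
      using False by (auto simp: field_simps)
    then have "osc {} k i (x $ i) * cutoff j i (x $ i) = 0" by (auto simp: cutoff_def flat_eq_0)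
    then show "etest k j x = 0" unfolding etest_def tensor_def by (intro prod_zero bexI[of _ i]) auto
  qed
qed

lemma continuous_osc_cutoff: "continuous_on UNIV (\<lambda>y. osc {} k i y * cutoff j i y)"
  using Ck_fun_continuous[OF Ck_fun_mult[OF osc_smooth[of 0] cutoff_smooth]] .

lemma continuous_cutoff': "continuous_on UNIV (cutoff' j i)"
proof -
  have c: "continuous_on UNIV (flat_poly p)" for p
    using flat_poly_DERIV by (auto intro!: continuous_at_imp_continuous_on DERIV_isCont)
  have c2: "continuous_on UNIV (\<lambda>y. flat_poly p (u * y + v))" for p u v
    by (rule continuous_on_compose2[OF c]) (auto intro!: continuous_intros)
  have "continuous_on UNIV (\<lambda>y. real j * flat_poly (flat_step 1) (real j * y + (- real j * a $ i - 1)) * flat (- real j * y + (real j * b $ i - 1))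
     - flat (real j * y + (- real j * a $ i - 1)) * (real j * flat_poly (flat_step 1) (- real j * y + (real j * b $ i - 1))))"
    by (intro continuous_on_diff continuous_on_mult continuous_on_const c2)
  then show ?thesis by (simp add: cutoff'_def[abs_def] algebra_simps)
qed

lemma osc_cutoff_le: "\<bar>osc {} k i y * cutoff j i y\<bar> \<le> sqrt (2 / len i)"
proof -
  have "\<bar>osc {} k i y\<bar> * cutoff j i y \<le> sqrt (2 / len i) * 1"
    using osc_bound[of "{}" k i y] cutoff_bounds[of j i y] len_pos[of i] by (intro mult_mono) auto
  then show ?thesis using cutoff_bounds(1)[of j i y] by (simp add: abs_mult)
qed

lemma etest_tendsto: "(\<lambda>j. nrm M (\<lambda>x. etest k j x - e k x)) \<longlonglongrightarrow> 0"
  unfolding etest_def trig_def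
proof (rule tensor_limit[where K = "\<lambda>i. sqrt (2 / len i)"])
  show "(\<lambda>j. osc {} k i y * cutoff j i y) \<longlonglongrightarrow> osc {} k i y" if "a $ i < y" "y < b $ i" for i y
    using tendsto_mult[OF tendsto_const cutoff_tendsto[OF that], of "osc {} k i y"] by simp
qed (rule continuous_osc_cutoff osc_continuous osc_cutoff_le)+

text \<open>The product rule leaves one term with the derivative of the cutoff, which stays bounded
  and tends to zero pointwise by the decay of the sine at the faces.\<close>

lemma etest_deriv_tendsto:
  "(\<lambda>j. nrm M (\<lambda>x. frechet_derivative (etest k j) (at x) (axis i 1) - wt k i * trig {i} k x)) \<longlonglongrightarrow> 0"
proof -
  define d where "d j y = wt k i * osc {i} k i y * cutoff j i y + osc {} k i y * cutoff' j i y" for j y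
  let ?G = "\<lambda>j. (\<lambda>i y. osc {} k i y * cutoff j i y)(i := d j)"
  let ?H = "(\<lambda>i y. osc {} k i y)(i := \<lambda>y. wt k i * osc {i} k i y)"
  have der: "((\<lambda>y. osc {} k i y * cutoff j i y) has_real_derivative d j y) (at y)" for j y
    using DERIV_mult[OF osc_deriv[of "{}" k i y] cutoff_deriv[of j i y]]
    by (simp add: d_def dsign_def flip_def algebra_simps)
  have fd: "frechet_derivative (etest k j) (at x) (axis i 1) = tensor (?G j) x" for j x
    unfolding etest_def
    by (rule frechet_derivative_directional[OF etest_smooth[unfolded etest_def]]) (rule tensor_deriv, rule der)
  have H: "tensor ?H x = wt k i * trig {i} k x" for x
  proof -
    have "(\<Prod>l\<in>UNIV - {i}. ?H l (x $ l)) = (\<Prod>l\<in>UNIV - {i}. osc {i} k l (x $ l))"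
      by (intro prod.cong) (auto simp: osc_def)
    then show ?thesis unfolding tensor_def trig_def by (subst (1 2) prod.remove[of UNIV i]) auto
  qed
  have "(\<lambda>j. nrm M (\<lambda>x. tensor (?G j) x - tensor ?H x)) \<longlonglongrightarrow> 0"
  \<comment> \<open>One bound for all factors: the first summand covers the directions other than
    \<open>i\<close>; in direction \<open>i\<close> the cut off cosine contributes \<open>1\<close>
    and the derivative of the cutoff \<open>6\<close> times
    \<open>sqrt (2 / len i) * wt k i\<close>.\<close>
  proof (rule tensor_limit[where K = "\<lambda>l. sqrt (2 / len l) + sqrt (2 / len l) * wt k l * 7"])
    fix j l
    have "continuous_on UNIV (d j)" unfolding d_def[abs_def]
      by (intro continuous_intros osc_continuous continuous_cutoff' Ck_fun_continuous[OF cutoff_smooth[of 0]])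
    then show "continuous_on UNIV (?G j l)" using continuous_osc_cutoff by simp
    show "continuous_on UNIV (?H l)" using osc_continuous by (auto intro!: continuous_intros)
    fix y assume y: "a $ l < y" "y < b $ l"
    have w: "0 \<le> sqrt (2 / len l) * wt k l" using wt_pos[of k l] len_pos[of l] by simp
    show "\<bar>?G j l y\<bar> \<le> sqrt (2 / len l) + sqrt (2 / len l) * wt k l * 7"
    proof (cases "l = i")
      case True
      have "\<bar>osc {i} k i y * cutoff j i y\<bar> \<le> sqrt (2 / len i) * 1"
        using osc_bound[of "{i}" k i y] cutoff_bounds[of j i y] len_pos[of i] unfolding abs_mult by (intro mult_mono) auto
      then have "wt k i * \<bar>osc {i} k i y * cutoff j i y\<bar> \<le> wt k i * sqrt (2 / len i)"
        using wt_pos[of k i] by (intro mult_left_mono) auto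
      then have "\<bar>wt k i * osc {i} k i y * cutoff j i y\<bar> \<le> sqrt (2 / len i) * wt k i"
        using wt_pos[of k i] by (simp add: abs_mult mult_ac)
      moreover have "0 \<le> sqrt (2 / len i)" using len_pos[of i] by simp
      ultimately have "\<bar>wt k i * osc {i} k i y * cutoff j i y + osc {} k i y * cutoff' j i y\<bar>
          \<le> sqrt (2 / len i) + sqrt (2 / len i) * wt k i * 7"
        using osc_cutoff'_bound(1)[of i y k j] y[unfolded True] abs_triangle_ineq[of "wt k i * osc {i} k i y * cutoff j i y" "osc {} k i y * cutoff' j i y"]
        by argo
      then show ?thesis by (simp add: True d_def)
    next
      case False
      then show ?thesis using osc_cutoff_le[of k l y j] w by simp
    qed
    show "(\<lambda>j. ?G j l y) \<longlonglongrightarrow> ?H l y"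
    proof (cases "l = i")
      case True
      have "(\<lambda>j. wt k i * osc {i} k i y * cutoff j i y + osc {} k i y * cutoff' j i y) \<longlonglongrightarrow> wt k i * osc {i} k i y * 1 + 0"
        using y True by (intro tendsto_add tendsto_mult tendsto_const cutoff_tendsto osc_cutoff'_bound(2)) auto
      then show ?thesis by (simp add: True d_def)
    next
      case False
      then show ?thesis using tendsto_mult[OF tendsto_const cutoff_tendsto[OF y], of "osc {} k l y"] by simp
    qed
  qed
  then show ?thesis by (simp add: fd H)
qed

lemma Basis_axis: "(Basis :: (real ^ 'n) set) = range (\<lambda>i. axis i 1)"
  by (auto simp: Basis_vec_def)

lemma axis_Basis: "axis i (1::real) \<in> Basis"
  by (simp add: Basis_axis)

lemma trig_weak_deriv: "has_weak_deriv \<Omega> (axis i 1) (trig D k) (\<lambda>x. dsign i D * wt k i * trig (flip i D) k x)"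
proof (rule has_weak_deriv_classical[OF open_Om axis_Basis])
  show "sq_int M (\<lambda>x. dsign i D * wt k i * trig (flip i D) k x)"
    by (rule sq_int_cmult) (rule trig_sq_int)
qed (auto intro!: trig_sq_int trig_deriv continuous_on_mult continuous_on_const intro: continuous_on_subset[OF trig_continuous])

text \<open>Integration by parts twice; the first step uses that \<open>e k\<close>, the second one that \<open>w\<close> is a
  limit of test functions.\<close>

lemma H2_H10_eigen:
  assumes w: "w \<in> H2 \<Omega>" "w \<in> H10 \<Omega>"
  shows "ip M (weak_deriv \<Omega> (axis i 1) (weak_deriv \<Omega> (axis i 1) w)) (e k) = - (wt k i)\<^sup>2 * ip M w (e k)"
proof -
  let ?b = "axis i (1::real)"
  define g where "g = weak_deriv \<Omega> ?b w"
  define h where "h = weak_deriv \<Omega> ?b g"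
  have wg: "has_weak_deriv \<Omega> ?b w g" and gh: "has_weak_deriv \<Omega> ?b g h"
    using H2D(2,3)[OF open_Om w(1)] axis_Basis by (auto simp: g_def h_def)
  have sq: "sq_int M w" "sq_int M g" "sq_int M h" using wg gh by (auto simp: has_weak_deriv_iff)
  have s1: "sq_int M (\<lambda>x. wt k i * trig {i} k x)" by (rule sq_int_cmult) (rule trig_sq_int)
  have st: "sq_int M (etest k j)" "sq_int M (\<lambda>x. frechet_derivative (etest k j) (at x) ?b)" for j
    by (rule test_function_sq_int[OF etest_test open_Om],
        rule test_function_sq_int[OF test_functions_deriv[OF etest_test axis_Basis] open_Om])
  have "(\<lambda>j. ip M (etest k j) h) \<longlonglongrightarrow> ip M (e k) h"
    by (rule sq_int_tendsto_ip[OF st(1) trig_sq_int sq(3) etest_tendsto])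
  moreover have "(\<lambda>j. ip M (\<lambda>x. frechet_derivative (etest k j) (at x) ?b) g) \<longlonglongrightarrow> ip M (\<lambda>x. wt k i * trig {i} k x) g"
    by (rule sq_int_tendsto_ip[OF st(2) s1 sq(2) etest_deriv_tendsto])
  moreover have "ip M (\<lambda>x. frechet_derivative (etest k j) (at x) ?b) g = - ip M (etest k j) h" for j
    using gh etest_test[of k j] by (simp add: has_weak_deriv_iff ip_commute[of M _ g] ip_commute[of M _ h])
  ultimately have "(\<lambda>j. - ip M (etest k j) h) \<longlonglongrightarrow> ip M (\<lambda>x. wt k i * trig {i} k x) g"
    and "(\<lambda>j. - ip M (etest k j) h) \<longlonglongrightarrow> - ip M (e k) h"
    by (auto intro: tendsto_minus)
  then have A: "ip M (\<lambda>x. wt k i * trig {i} k x) g = - ip M (e k) h" by (rule LIMSEQ_unique)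
  obtain \<phi> where \<phi>: "\<And>j::nat. \<phi> j \<in> test_functions \<Omega>" "(\<lambda>j. nrm M (\<lambda>x. w x - \<phi> j x)) \<longlonglongrightarrow> 0"
    "(\<lambda>j. nrm M (\<lambda>x. g x - frechet_derivative (\<phi> j) (at x) ?b)) \<longlonglongrightarrow> 0"
    using H10D[OF open_Om w(2)] axis_Basis unfolding g_def by blast
  have s\<phi>: "sq_int M (\<phi> j)" "sq_int M (\<lambda>x. frechet_derivative (\<phi> j) (at x) ?b)" for j
    by (rule test_function_sq_int[OF \<phi>(1) open_Om],
        rule test_function_sq_int[OF test_functions_deriv[OF \<phi>(1) axis_Basis] open_Om])
  have "(\<lambda>j. ip M (\<phi> j) (e k)) \<longlonglongrightarrow> ip M w (e k)"
    by (rule sq_int_tendsto_ip[OF s\<phi>(1) sq(1) trig_sq_int]) (use \<phi>(2) in \<open>simp add: nrm_minus_commute[of M w]\<close>)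
  then have "(\<lambda>j. wt k i * ip M (\<phi> j) (e k)) \<longlonglongrightarrow> wt k i * ip M w (e k)" by (intro tendsto_intros)
  moreover have "(\<lambda>j. ip M (\<lambda>x. frechet_derivative (\<phi> j) (at x) ?b) (trig {i} k)) \<longlonglongrightarrow> ip M g (trig {i} k)"
    by (rule sq_int_tendsto_ip[OF s\<phi>(2) sq(2) trig_sq_int]) (use \<phi>(3) in \<open>simp add: nrm_minus_commute[of M g]\<close>)
  moreover have "ip M (\<lambda>x. frechet_derivative (\<phi> j) (at x) ?b) (trig {i} k) = wt k i * ip M (\<phi> j) (e k)" for j
  proof -
    have "ip M (trig {i} k) (\<lambda>x. frechet_derivative (\<phi> j) (at x) ?b) = - ip M (\<lambda>x. dsign i {i} * wt k i * trig (flip i {i}) k x) (\<phi> j)"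
      using trig_weak_deriv[of i "{i}" k] \<phi>(1)[of j] by (simp add: has_weak_deriv_iff)
    also have "\<dots> = wt k i * ip M (e k) (\<phi> j)"
      by (simp add: ip_cmult_left dsign_def flip_def ip_minus_left)
    finally show ?thesis by (simp add: ip_commute[of M _ "trig {i} k"] ip_commute[of M _ "e k"])
  qed
  ultimately have B: "ip M g (trig {i} k) = wt k i * ip M w (e k)"
    using LIMSEQ_unique by auto
  have "ip M h (e k) = - (wt k i * ip M g (trig {i} k))"
    using A by (simp add: ip_cmult_left ip_commute[of M _ g] ip_commute[of M "e k"])
  then show ?thesis unfolding B by (simp add: h_def g_def power2_eq_square)
qed

subsection \<open>Completeness of the sine functions\<close>

text \<open>Completing the square in every coefficient. With the coefficients of \<open>w\<close> it
  gives Bessel's inequality; for any other choice it says that the partial sum of the series of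
  \<open>w\<close> is at least as good.\<close>

lemma best_approximation:
  assumes w: "sq_int M w" and F: "finite F"
  shows "(nrm M (\<lambda>x. w x - (\<Sum>k\<in>F. c k * e k x)))\<^sup>2 =
    (nrm M w)\<^sup>2 - (\<Sum>k\<in>F. (ip M w (e k))\<^sup>2) + (\<Sum>k\<in>F. (c k - ip M w (e k))\<^sup>2)"
proof -
  define s where "s x = (\<Sum>k\<in>F. c k * e k x)" for x
  have s: "sq_int M s" unfolding s_def[abs_def] by (rule trig_sum_sq_int)
  have ws: "ip M s w = (\<Sum>k\<in>F. c k * ip M w (e k))"
    unfolding s_def[abs_def] ip_trig_sum[OF w] by (simp add: ip_commute[of M w])
  have ss: "ip M s s = (\<Sum>k\<in>F. (c k)\<^sup>2)"
    using nrm_trig_sum[OF F, of c "{}"] by (simp add: nrm_power2_ip s_def[abs_def])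
  have d: "sq_int M (\<lambda>x. w x - s x)" using w s by auto
  have "(nrm M (\<lambda>x. w x - s x))\<^sup>2 = ip M w w - 2 * ip M s w + ip M s s"
    unfolding nrm_power2_ip ip_diff_left[OF w s d]
    using ip_diff_left[OF w s w] ip_diff_left[OF w s s]
    by (simp add: ip_commute[of M w "\<lambda>x. w x - s x"] ip_commute[of M s "\<lambda>x. w x - s x"] ip_commute[of M w s])
  also have "\<dots> = (nrm M w)\<^sup>2 - (\<Sum>k\<in>F. (ip M w (e k))\<^sup>2) + (\<Sum>k\<in>F. (c k - ip M w (e k))\<^sup>2)"
    unfolding ws ss nrm_power2_ip
    by (simp add: power2_diff sum.distrib sum_subtractf sum_distrib_left mult.assoc)
  finally show ?thesis by (simp add: s_def)
qed

lemma Bessel: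
  assumes "sq_int M w" "finite F"
  shows "(\<Sum>k\<in>F. (ip M w (e k))\<^sup>2) \<le> (nrm M w)\<^sup>2"
proof -
  have "0 \<le> (nrm M (\<lambda>x. w x - (\<Sum>k\<in>F. ip M w (e k) * e k x)))\<^sup>2" by simp
  then show ?thesis unfolding best_approximation[OF assms] by simp
qed

text \<open>Controls are taken from this algebra. The inductive form matches the closure conditions
  of the Stone-Weierstrass theorem, and boundedness, continuity and the action on the sine modes
  follow by induction.\<close>

inductive_set cospoly :: "(real ^ 'n \<Rightarrow> real) set" where
  const: "(\<lambda>x. c) \<in> cospoly"
| cos: "(\<lambda>x. cos (pi / len i * (x $ i - a $ i))) \<in> cospoly"
| add: "p \<in> cospoly \<Longrightarrow> q \<in> cospoly \<Longrightarrow> (\<lambda>x. p x + q x) \<in> cospoly"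
| mult: "p \<in> cospoly \<Longrightarrow> q \<in> cospoly \<Longrightarrow> (\<lambda>x. p x * q x) \<in> cospoly"

lemma cospoly_continuous: "p \<in> cospoly \<Longrightarrow> continuous_on S p"
  by (induction rule: cospoly.induct) (auto intro!: continuous_intros simp: less_imp_neq[OF len_pos, symmetric])

lemma cospoly_bounded: "p \<in> cospoly \<Longrightarrow> \<exists>C. \<forall>x. \<bar>p x\<bar> \<le> C"
proof (induction rule: cospoly.induct)
  case (const c)
  then show ?case by blast
next
  case (cos i)
  then show ?case by (intro exI[of _ 1]) auto
next
  case (add p q)
  then obtain C D where "\<forall>x. \<bar>p x\<bar> \<le> C" "\<forall>x. \<bar>q x\<bar> \<le> D" by blast
  then have "\<bar>p x + q x\<bar> \<le> C + D" for x
    by (meson abs_triangle_ineq add_mono order_trans)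
  then show ?case by blast
next
  case (mult p q)
  then obtain C D where CD: "\<And>x. \<bar>p x\<bar> \<le> C" "\<And>x. \<bar>q x\<bar> \<le> D" by blast
  have "\<bar>p x * q x\<bar> \<le> C * D" for x
    unfolding abs_mult using CD(1)[of x] CD(2)[of x] abs_ge_zero[of "p x"] by (intro mult_mono) linarith+
  then show ?case by blast
qed

text \<open>Stone-Weierstrass. Points are separated because the cosine is injective on the interval
  from \<open>0\<close> to \<open>pi\<close>, onto which each edge of the box is scaled.\<close>

lemma cospoly_dense:
  assumes f: "continuous_on (cbox a b) f" and \<epsilon>: "\<epsilon> > 0"
  shows "\<exists>p\<in>cospoly. \<forall>x\<in>cbox a b. \<bar>f x - p x\<bar> < \<epsilon>"
proof -
  interpret function_ring_on cospoly "cbox a b"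
  proof
    show "compact (cbox a b)" by (rule compact_cbox)
    fix x y assume xy: "x \<in> cbox a b" "y \<in> cbox a b" "x \<noteq> y"
    then obtain i where i: "x $ i \<noteq> y $ i" by (auto simp: vec_eq_iff)
    have bd: "0 \<le> pi / len i * (z $ i - a $ i) \<and> pi / len i * (z $ i - a $ i) \<le> pi" if "z \<in> cbox a b" for z
    proof -
      have "0 \<le> z $ i - a $ i" "z $ i - a $ i \<le> len i" using that by (auto simp: mem_box_cart len_def)
      moreover have "0 \<le> pi / len i" using len_pos[of i] by simp
      ultimately have "0 \<le> pi / len i * (z $ i - a $ i)" "pi / len i * (z $ i - a $ i) \<le> pi / len i * len i"
        by (simp, intro mult_left_mono)
      then show ?thesis using len_pos[of i] by simp
    qed
    have "pi / len i * (x $ i - a $ i) \<noteq> pi / len i * (y $ i - a $ i)" using i len_pos[of i] by simp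
    then have "cos (pi / len i * (x $ i - a $ i)) \<noteq> cos (pi / len i * (y $ i - a $ i))"
      using bd[OF xy(1)] bd[OF xy(2)] cos_inj_pi by blast
    then show "\<exists>f\<in>cospoly. f x \<noteq> f y" using cospoly.cos[of i] by (intro bexI) auto
  qed (auto intro: cospoly.intros cospoly_continuous)
  show ?thesis by (rule Stone_Weierstrass_basic[OF f \<epsilon>])
qed

text \<open>Since \<open>wt k i = (k i + 1) \<pi> / len i\<close>, the index \<open>k i = 0\<close> belongs to the lowest mode, and the
  downward shift has no term there.\<close>

lemma cos_mult_e:
  "cos (pi / len i * (x $ i - a $ i)) * e k x =
    (1/2) * (e (k(i := Suc (k i))) x + (if k i > 0 then e (k(i := k i - 1)) x else 0))"
proof -
  define P where "P = (\<Prod>j\<in>UNIV - {i}. osc {} k j (x $ j))"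
  define t where "t = pi / len i * (x $ i - a $ i)"
  have split: "e k' x = osc {} k' i (x $ i) * P" if "\<And>j. j \<noteq> i \<Longrightarrow> k' j = k j" for k'
  proof -
    have "(\<Prod>j\<in>UNIV - {i}. osc {} k' j (x $ j)) = P"
      unfolding P_def by (intro prod.cong) (auto simp: osc_def wt_def that)
    then show ?thesis unfolding trig_def tensor_def by (subst prod.remove[of UNIV i]) auto
  qed
  have o: "osc {} k' i (x $ i) = sqrt (2 / len i) * sin (real (Suc (k' i)) * t)" for k'
  proof -
    have "wt k' i * (x $ i - a $ i) = real (Suc (k' i)) * t" unfolding wt_def t_def by simp
    then show ?thesis by (simp only: osc_empty)
  qed
  have up: "e (k(i := Suc (k i))) x = sqrt (2 / len i) * sin (real (Suc (k i)) * t + t) * P"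
    by (subst split) (auto simp: o algebra_simps)
  have down: "(if k i > 0 then e (k(i := k i - 1)) x else 0) = sqrt (2 / len i) * sin (real (Suc (k i)) * t - t) * P"
  proof (cases "k i > 0")
    case True
    then have "real (Suc (k i)) * t - t = real (Suc ((k(i := k i - 1)) i)) * t"
      by (simp add: algebra_simps of_nat_diff)
    with True show ?thesis by (subst split) (auto simp: o)
  next
    case False
    then show ?thesis by simp
  qed
  have "cos t * e k x = sqrt (2 / len i) * (sin (real (Suc (k i)) * t) * cos t) * P"
    by (subst split) (auto simp: o)
  also have "\<dots> = (1/2) * (sqrt (2 / len i) * sin (real (Suc (k i)) * t + t) * P + sqrt (2 / len i) * sin (real (Suc (k i)) * t - t) * P)"
    unfolding sin_add sin_diff by (simp add: algebra_simps)
  finally show ?thesis unfolding up down t_def[symmetric] .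
qed

inductive_set espan :: "(real ^ 'n \<Rightarrow> real) set" where
  e: "e k \<in> espan"
| zero: "(\<lambda>x. 0) \<in> espan"
| add: "f \<in> espan \<Longrightarrow> g \<in> espan \<Longrightarrow> (\<lambda>x. f x + g x) \<in> espan"
| cmult: "f \<in> espan \<Longrightarrow> (\<lambda>x. c * f x) \<in> espan"

lemma espan_sum: "f \<in> espan \<Longrightarrow> \<exists>F c. finite F \<and> (\<forall>x. f x = (\<Sum>k\<in>F. c k * e k x))"
proof (induction rule: espan.induct)
  case (e k)
  then show ?case by (intro exI[of _ "{k}"] exI[of _ "\<lambda>_. 1"]) simp
next
  case zero
  then show ?case by (intro exI[of _ "{}"]) simp
next
  case (add f g)
  obtain F c where 1: "finite F" "\<forall>x. f x = (\<Sum>k\<in>F. c k * e k x)" using add.IH(1) by blast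
  obtain G d where 2: "finite G" "\<forall>x. g x = (\<Sum>k\<in>G. d k * e k x)" using add.IH(2) by blast
  have "f x + g x = (\<Sum>k\<in>F \<union> G. ((if k \<in> F then c k else 0) + (if k \<in> G then d k else 0)) * e k x)" for x
  proof -
    have "f x = (\<Sum>k\<in>F \<union> G. (if k \<in> F then c k else 0) * e k x)"
      unfolding 1(2)[rule_format] by (rule sum.mono_neutral_cong_left) (use 1(1) 2(1) in auto)
    moreover have "g x = (\<Sum>k\<in>F \<union> G. (if k \<in> G then d k else 0) * e k x)"
      unfolding 2(2)[rule_format] by (rule sum.mono_neutral_cong_left) (use 1(1) 2(1) in auto)
    ultimately show ?thesis by (simp add: distrib_right sum.distrib)
  qed
  with 1(1) 2(1) show ?case
    by (intro exI[of _ "F \<union> G"] exI[of _ "\<lambda>k. (if k \<in> F then c k else 0) + (if k \<in> G then d k else 0)"]) simp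
next
  case (cmult f r)
  then obtain F c where "finite F" "\<forall>x. f x = (\<Sum>k\<in>F. c k * e k x)" by blast
  then show ?case by (intro exI[of _ F] exI[of _ "\<lambda>k. r * c k"]) (simp add: sum_distrib_left mult.assoc)
qed

lemma espan_cos: "f \<in> espan \<Longrightarrow> (\<lambda>x. cos (pi / len i * (x $ i - a $ i)) * f x) \<in> espan"
proof (induction rule: espan.induct)
  case (e k)
  have "(\<lambda>x. if k i > 0 then e (k(i := k i - 1)) x else 0) \<in> espan"
    by (cases "k i > 0") (simp_all add: espan.e espan.zero)
  then show ?case unfolding cos_mult_e by (intro espan.cmult espan.add espan.e)
next
  case zero
  then show ?case by (simp add: espan.zero)
next
  case (add f g)
  then show ?case using espan.add by (simp add: distrib_left)
next
  case (cmult f c)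
  then show ?case using espan.cmult[OF cmult.IH, of c] by (simp add: mult.left_commute)
qed

text \<open>The span of the sine modes is a module over the cosine polynomials, so a single mode
  times all of them stays in the span; this is how density of the polynomials is
  transferred.\<close>

lemma espan_cospoly: "p \<in> cospoly \<Longrightarrow> f \<in> espan \<Longrightarrow> (\<lambda>x. p x * f x) \<in> espan"
proof (induction arbitrary: f rule: cospoly.induct)
  case (const c)
  then show ?case by (rule espan.cmult)
next
  case (cos i)
  then show ?case by (rule espan_cos)
next
  case (add p q)
  then show ?case using espan.add by (simp add: distrib_right)
next
  case (mult p q)
  then show ?case using mult.IH(1)[OF mult.IH(2)[OF mult.prems]] by (simp add: mult.assoc)
qed

lemma null_sets_M: "negligible N \<Longrightarrow> AE x in M. x \<notin> N"
proof -
  assume "negligible N"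
  then have "AE x in lebesgue. x \<notin> N" by (intro AE_not_in) (simp add: negligible_iff_null_sets)
  then have "AE x in lebesgue. x \<in> \<Omega> \<longrightarrow> x \<notin> N" by eventually_elim simp
  then show ?thesis by (subst AE_restrict_space_iff) auto
qed

text \<open>Measurability provides continuous functions converging off a negligible set; clamping
  them at the bound of \<open>f\<close> preserves the limit and supplies the uniform bound for
  dominated convergence.\<close>

lemma continuous_approx_bounded:
  fixes f :: "real ^ 'n \<Rightarrow> real"
  assumes f: "f \<in> borel_measurable M" and K: "\<And>x. x \<in> \<Omega> \<Longrightarrow> \<bar>f x\<bar> \<le> K"
  obtains g where "\<And>n::nat. continuous_on UNIV (g n)" "\<And>n x. \<bar>g n x\<bar> \<le> \<bar>K\<bar>" "AE x in M. (\<lambda>n. g n x) \<longlonglongrightarrow> f x"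
proof -
  have "f measurable_on \<Omega>" using f by (subst measurable_on_iff_borel_measurable) auto
  then obtain N h where N: "negligible N" and h: "\<And>n. continuous_on UNIV (h n)"
    "\<And>x. x \<notin> N \<Longrightarrow> (\<lambda>n. h n x) \<longlonglongrightarrow> (if x \<in> \<Omega> then f x else 0)"
    unfolding measurable_on_def by blast
  define g where "g n x = max (- \<bar>K\<bar>) (min \<bar>K\<bar> (h n x))" for n x
  show thesis
  proof (rule that[of g])
    show "continuous_on UNIV (g n)" for n unfolding g_def[abs_def] by (intro continuous_intros h)
    show "\<bar>g n x\<bar> \<le> \<bar>K\<bar>" for n x unfolding g_def by linarith
    have "AE x in M. x \<in> \<Omega>" by (rule AE_I2) simp
    with null_sets_M[OF N] show "AE x in M. (\<lambda>n. g n x) \<longlonglongrightarrow> f x"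
    proof eventually_elim
      case (elim x)
      have "(\<lambda>n. g n x) \<longlonglongrightarrow> max (- \<bar>K\<bar>) (min \<bar>K\<bar> (f x))"
        unfolding g_def using h(2)[OF elim(1)] elim(2) by (intro tendsto_intros) simp
      moreover have "max (- \<bar>K\<bar>) (min \<bar>K\<bar> (f x)) = f x" using K[OF elim(2)] by linarith
      ultimately show ?case by simp
    qed
  qed
qed

text \<open>The lowest mode \<open>S\<close> is positive inside the box. If a cosine polynomial
  \<open>p\<close> is close to \<open>g / S\<close>, then \<open>p * S\<close> is close to
  \<open>g\<close> and lies in the span. As \<open>S\<close> vanishes on the boundary, the
  denominator is first kept away from zero by a maximum with \<open>1 / (m + 1)\<close>.\<close>

lemma espan_dense_continuous:
  assumes g: "continuous_on UNIV g" and \<epsilon>: "\<epsilon> > 0"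
  shows "\<exists>s\<in>espan. nrm M (\<lambda>x. g x - s x) < \<epsilon>"
proof -
  define S where "S = e (\<lambda>_. 0)"
  have Sc: "continuous_on A S" for A unfolding S_def using trig_continuous continuous_on_subset by blast
  have Spos: "0 < S x" if "x \<in> \<Omega>" for x
  proof -
    have "0 < osc {} (\<lambda>_. 0) i (x $ i)" for i
    proof -
      have l: "0 < len i" "0 < x $ i - a $ i" "x $ i - a $ i < len i" using that len_pos by (auto simp: mem_Om len_def)
      moreover have "0 < pi / len i" using l by simp
      ultimately have "0 < pi / len i * (x $ i - a $ i)" "pi / len i * (x $ i - a $ i) < pi / len i * len i"
        by (auto intro: mult_strict_left_mono simp del: times_divide_eq_left)
      then have "0 < pi / len i * (x $ i - a $ i)" "pi / len i * (x $ i - a $ i) < pi" using l by simp_all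
      then have "0 < sin (pi / len i * (x $ i - a $ i))" by (rule sin_gt_zero)
      then show ?thesis using l by (simp add: osc_empty wt_def)
    qed
    then show ?thesis unfolding S_def trig_def tensor_def by (intro prod_pos) simp
  qed
  have bdd: "\<exists>C. \<forall>x\<in>cbox a b. \<bar>f x\<bar> \<le> C" if "continuous_on (cbox a b) f" for f :: "real ^ 'n \<Rightarrow> real"
    using compact_imp_bounded[OF compact_continuous_image[OF that compact_cbox]] by (auto simp: bounded_iff)
  obtain C where C: "\<And>x. x \<in> cbox a b \<Longrightarrow> \<bar>g x\<bar> \<le> C"
    using bdd[OF continuous_on_subset[OF g]] by auto
  define h where "h m x = g x / max (S x) (inverse (real (Suc m)))" for m x
  have pos: "0 < max (S x) (inverse (real (Suc m)))" for m x by (simp add: less_max_iff_disj)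
  have hc: "continuous_on A (h m)" for A m
    unfolding h_def[abs_def] using pos
    by (intro continuous_on_divide continuous_on_subset[OF g] continuous_on_max Sc continuous_on_const) (auto simp: less_imp_neq[symmetric])
  have "(\<lambda>m. nrm M (\<lambda>x. h m x * S x - g x)) \<longlonglongrightarrow> 0"
  proof (rule nrm_dominated_convergence(2)[where w = "\<lambda>_. C"])
    show "sq_int M (\<lambda>_. C)" by (rule sq_int_bounded[OF finite_M]) auto
    show "AE x in M. \<bar>h m x * S x\<bar> \<le> C" for m
    proof (rule AE_I2)
      fix x assume "x \<in> space M"
      then have x: "x \<in> \<Omega>" by simp
      have "\<bar>h m x * S x\<bar> = \<bar>g x\<bar> * (S x / max (S x) (inverse (real (Suc m))))"
        using Spos[OF x] pos[of x m] by (simp add: h_def abs_mult)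
      also have "\<dots> \<le> \<bar>g x\<bar> * 1" using pos[of x m] by (intro mult_left_mono) (simp_all add: divide_le_eq)
      also have "\<dots> \<le> C" using C[of x] x box_subset_cbox[of a b] by auto
      finally show "\<bar>h m x * S x\<bar> \<le> C" .
    qed
    show "AE x in M. (\<lambda>m. h m x * S x) \<longlonglongrightarrow> g x"
    proof (rule AE_I2)
      fix x assume "x \<in> space M"
      then have S: "0 < S x" using Spos by simp
      have "(\<lambda>m. g x / max (S x) (inverse (real (Suc m))) * S x) \<longlonglongrightarrow> g x / max (S x) 0 * S x"
        using S by (intro tendsto_intros LIMSEQ_inverse_real_of_nat) auto
      then show "(\<lambda>m. h m x * S x) \<longlonglongrightarrow> g x" using S by (simp add: h_def)
    qed
  qed (intro continuous_measurable_M continuous_on_mult hc Sc g)+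
  then have "\<forall>\<^sub>F m in sequentially. nrm M (\<lambda>x. h m x * S x - g x) < \<epsilon> / 2"
    using \<epsilon> by (intro order_tendstoD) auto
  then obtain m where m: "nrm M (\<lambda>x. h m x * S x - g x) < \<epsilon> / 2"
    using eventually_happens'[OF sequentially_bot] by blast
  have SS: "sq_int M S" unfolding S_def by (rule trig_sq_int)
  define \<delta> where "\<delta> = \<epsilon> / 2 / (nrm M S + 1)"
  have \<delta>: "\<delta> > 0" using \<epsilon> nrm_nonneg[of M S] by (simp add: \<delta>_def add_nonneg_pos)
  obtain p where p: "p \<in> cospoly" "\<And>x. x \<in> cbox a b \<Longrightarrow> \<bar>h m x - p x\<bar> < \<delta>"
    using cospoly_dense[OF hc \<delta>] by blast
  have meas: "h m \<in> borel_measurable M" "p \<in> borel_measurable M"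
    using hc cospoly_continuous[OF p(1)] by (auto intro: continuous_measurable_M)
  have sq1: "sq_int M (\<lambda>x. (h m x - p x) * S x)" and n1: "nrm M (\<lambda>x. (h m x - p x) * S x) \<le> \<delta> * nrm M S"
    using sq_int_bounded_mult[OF SS, of "\<lambda>x. h m x - p x" \<delta>] meas p(2) box_subset_cbox[of a b]
    by (auto intro: less_imp_le)
  have sqg: "sq_int M (\<lambda>x. h m x * S x - g x)"
  proof -
    have "sq_int M g" using C box_subset_cbox[of a b]
      by (intro sq_int_bounded[OF finite_M continuous_measurable_M[OF g], of C]) auto
    moreover obtain D where "\<And>x. x \<in> cbox a b \<Longrightarrow> \<bar>h m x\<bar> \<le> D"
      using bdd[OF hc[of "cbox a b" m]] by auto
    then have "sq_int M (\<lambda>x. h m x * S x)"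
      using box_subset_cbox[of a b] by (intro sq_int_bounded_mult(1)[OF SS meas(1), of D]) auto
    ultimately show ?thesis by auto
  qed
  have "nrm M (\<lambda>x. g x - p x * S x) = nrm M (\<lambda>x. - (h m x * S x - g x) + (h m x - p x) * S x)"
    by (intro arg_cong[where f = "nrm M"] ext) (simp add: algebra_simps)
  also have "\<dots> \<le> nrm M (\<lambda>x. - (h m x * S x - g x)) + nrm M (\<lambda>x. (h m x - p x) * S x)"
    by (intro nrm_triangle sq_int_minus sqg sq1)
  also have "\<dots> < \<epsilon> / 2 + \<epsilon> / 2"
  proof (rule add_less_le_mono)
    show "nrm M (\<lambda>x. - (h m x * S x - g x)) < \<epsilon> / 2" using m by (simp only: nrm_minus)
    have "\<delta> * nrm M S \<le> \<delta> * (nrm M S + 1)" using \<delta> by (intro mult_left_mono) auto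
    also have "\<dots> = \<epsilon> / 2"
    proof -
      have "nrm M S + 1 \<noteq> 0" using nrm_nonneg[of M S] by linarith
      then show ?thesis unfolding \<delta>_def by (rule nonzero_eq_divide_eq[THEN iffD1, OF _ refl])
    qed
    finally show "nrm M (\<lambda>x. (h m x - p x) * S x) \<le> \<epsilon> / 2" using n1 by linarith
  qed
  finally have "nrm M (\<lambda>x. g x - p x * S x) < \<epsilon>" by simp
  moreover have "(\<lambda>x. p x * S x) \<in> espan" unfolding S_def by (intro espan_cospoly p espan.e)
  ultimately show ?thesis by (rule bexI[where x = "\<lambda>x. p x * S x"])
qed

text \<open>Truncation to bounded functions, continuous approximation and density for continuous
  functions each cost a third of the tolerance.\<close>

lemma espan_dense:
  assumes w: "sq_int M w" and \<epsilon>: "\<epsilon> > 0"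
  shows "\<exists>s\<in>espan. nrm M (\<lambda>x. w x - s x) < \<epsilon>"
proof -
  define wc where "wc K x = max (- real K) (min (real K) (w x))" for K x
  have [measurable]: "w \<in> borel_measurable M" using w by (simp add: sq_int_def)
  have wcm: "wc K \<in> borel_measurable M" for K unfolding wc_def[abs_def] by measurable
  have wcb: "\<bar>wc K x\<bar> \<le> real K" for K x unfolding wc_def by linarith
  have wcs: "sq_int M (wc K)" for K by (rule sq_int_bounded[OF finite_M wcm wcb])
  have "(\<lambda>K. nrm M (\<lambda>x. wc K x - w x)) \<longlonglongrightarrow> 0"
  proof (rule nrm_dominated_convergence(2)[where w = "\<lambda>x. \<bar>w x\<bar>"])
    show "sq_int M (\<lambda>x. \<bar>w x\<bar>)" using w by (simp add: sq_int_def)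
    show "AE x in M. \<bar>wc K x\<bar> \<le> \<bar>w x\<bar>" for K
    proof (rule AE_I2)
      fix x
      have "0 \<le> real K" by simp
      then show "\<bar>wc K x\<bar> \<le> \<bar>w x\<bar>" unfolding wc_def by linarith
    qed
    show "AE x in M. (\<lambda>K. wc K x) \<longlonglongrightarrow> w x"
    proof (rule AE_I2)
      fix x
      obtain K0 :: nat where K0: "\<bar>w x\<bar> \<le> real K0" using real_arch_simple by blast
      have "\<forall>\<^sub>F K in sequentially. wc K x = w x"
        using eventually_ge_at_top[of K0]
      proof eventually_elim
        case (elim K)
        then have "real K0 \<le> real K" by simp
        with K0 show ?case unfolding wc_def by linarith
      qed
      then show "(\<lambda>K. wc K x) \<longlonglongrightarrow> w x" by (rule tendsto_eventually)
    qed
  qed (use wcm in auto)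
  then have "\<forall>\<^sub>F K in sequentially. nrm M (\<lambda>x. wc K x - w x) < \<epsilon> / 3" using \<epsilon> by (intro order_tendstoD) auto
  then obtain K where K: "nrm M (\<lambda>x. wc K x - w x) < \<epsilon> / 3"
    using eventually_happens'[OF sequentially_bot] by blast
  obtain g where g: "\<And>n::nat. continuous_on UNIV (g n)" "\<And>n x. \<bar>g n x\<bar> \<le> \<bar>real K\<bar>" "AE x in M. (\<lambda>n. g n x) \<longlonglongrightarrow> wc K x"
    using continuous_approx_bounded[OF wcm wcb, of K] by blast
  have gs: "sq_int M (g n)" for n by (rule sq_int_bounded[OF finite_M continuous_measurable_M[OF g(1)] g(2)])
  have "(\<lambda>n. nrm M (\<lambda>x. g n x - wc K x)) \<longlonglongrightarrow> 0"
  proof (rule nrm_dominated_convergence(2)[where w = "\<lambda>_. \<bar>real K\<bar>"])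
    show "sq_int M (\<lambda>_. \<bar>real K\<bar>)" by (rule sq_int_bounded[OF finite_M]) auto
  qed (use g wcm in \<open>auto intro: continuous_measurable_M\<close>)
  then have "\<forall>\<^sub>F n in sequentially. nrm M (\<lambda>x. g n x - wc K x) < \<epsilon> / 3" using \<epsilon> by (intro order_tendstoD) auto
  then obtain n where n: "nrm M (\<lambda>x. g n x - wc K x) < \<epsilon> / 3"
    using eventually_happens'[OF sequentially_bot] by blast
  obtain s where s: "s \<in> espan" "nrm M (\<lambda>x. g n x - s x) < \<epsilon> / 3"
    using espan_dense_continuous[OF g(1), of "\<epsilon> / 3" n] \<epsilon> by auto
  obtain F c where Fc: "\<And>x. s x = (\<Sum>k\<in>F. c k * e k x)" using espan_sum[OF s(1)] by blast
  have ss: "sq_int M s" using trig_sum_sq_int[of c "{}" F] by (simp add: Fc[abs_def])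
  have "nrm M (\<lambda>x. w x - s x) \<le> nrm M (\<lambda>x. w x - wc K x) + (nrm M (\<lambda>x. wc K x - g n x) + nrm M (\<lambda>x. g n x - s x))"
    using nrm_triangle_diff[OF w wcs[of K] ss] nrm_triangle_diff[OF wcs[of K] gs[of n] ss] by linarith
  then have "nrm M (\<lambda>x. w x - s x) < \<epsilon>"
    using K n s(2) by (simp add: nrm_minus_commute[of M w "wc K"] nrm_minus_commute[of M "wc K" "g n"])
  with s(1) show ?thesis by blast
qed

text \<open>The partial sum over the modes occurring in an approximating element of the span does at
  least as well as that element.\<close>

lemma Parseval_tail:
  assumes w: "sq_int M w" and \<epsilon>: "\<epsilon> > 0"
  shows "\<exists>F. finite F \<and> (nrm M w)\<^sup>2 - (\<Sum>k\<in>F. (ip M w (e k))\<^sup>2) < \<epsilon>"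
proof -
  obtain s where s: "s \<in> espan" "nrm M (\<lambda>x. w x - s x) < sqrt \<epsilon>" using espan_dense[OF w, of "sqrt \<epsilon>"] \<epsilon> by auto
  obtain F c where F: "finite F" and Fc: "\<And>x. s x = (\<Sum>k\<in>F. c k * e k x)" using espan_sum[OF s(1)] by blast
  have "(nrm M w)\<^sup>2 - (\<Sum>k\<in>F. (ip M w (e k))\<^sup>2) \<le> (nrm M (\<lambda>x. w x - s x))\<^sup>2"
    unfolding Fc best_approximation[OF w F] by (simp add: sum_nonneg)
  also have "\<dots> < (sqrt \<epsilon>)\<^sup>2" using s(2) by (intro power_strict_mono) auto
  finally show ?thesis using F \<epsilon> by auto
qed

text \<open>The sequence of sine coefficients, chosen in the type \<open>ell2\<close>; Bessel's
  inequality provides it for square integrable \<open>w\<close>.\<close>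

definition fcoef :: "(real ^ 'n \<Rightarrow> real) \<Rightarrow> ('n \<Rightarrow> nat) ell2" where
  "fcoef w = (SOME x. coord x = (\<lambda>k. ip M w (e k)))"

lemma coord_fcoef:
  assumes "sq_int M w" shows "coord (fcoef w) k = ip M w (e k)"
proof -
  have "\<exists>x. coord x = (\<lambda>k. ip M w (e k)) \<and> norm x \<le> nrm M w"
    by (rule ell2_exists) (use Bessel[OF assms] in auto)
  then have "coord (fcoef w) = (\<lambda>k. ip M w (e k))" unfolding fcoef_def by (metis (mono_tags, lifting) someI_ex)
  then show ?thesis by simp
qed

text \<open>Parseval's identity, one half from Bessel's inequality and the other from density. From
  here on \<open>L2\<close> estimates can be carried out on sequences.\<close>

lemma norm_fcoef:
  assumes w: "sq_int M w" shows "norm (fcoef w) = nrm M w"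
proof (rule antisym)
  show "norm (fcoef w) \<le> nrm M w"
    by (rule norm_ell2_le) (use Bessel[OF w] in \<open>auto simp: coord_fcoef[OF w]\<close>)
  show "nrm M w \<le> norm (fcoef w)"
  proof (rule power2_le_imp_le)
    show "(nrm M w)\<^sup>2 \<le> (norm (fcoef w))\<^sup>2"
    proof (rule field_le_epsilon)
      fix \<epsilon> :: real assume "\<epsilon> > 0"
      then obtain F where "finite F" "(nrm M w)\<^sup>2 - (\<Sum>k\<in>F. (ip M w (e k))\<^sup>2) < \<epsilon>" using Parseval_tail[OF w] by blast
      then show "(nrm M w)\<^sup>2 \<le> (norm (fcoef w))\<^sup>2 + \<epsilon>"
        using sum_coord_le[of F "fcoef w"] by (simp add: coord_fcoef[OF w])
    qed
  qed simp
qed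

lemma fcoef_diff:
  assumes "sq_int M v" "sq_int M w"
  shows "fcoef (\<lambda>x. v x - w x) = fcoef v - fcoef w"
  by (rule ell2_eqI) (use assms in \<open>simp add: coord_fcoef sq_int_diff ip_diff_left trig_sq_int\<close>)

lemma zero_coefficients:
  assumes w: "sq_int M w" and z: "\<And>k. ip M w (e k) = 0"
  shows "nrm M w = 0" "AE x in M. w x = 0"
proof -
  have "fcoef w = 0" by (rule ell2_eqI) (simp add: coord_fcoef[OF w] z)
  then show n: "nrm M w = 0" using norm_fcoef[OF w] by simp
  show "AE x in M. w x = 0" by (rule nrm_eq_0_AE[OF w n])
qed

end

subsection \<open>Sine series in Sobolev spaces\<close>

text \<open>The diagonal operator with symbol \<open>m\<close>. The choice is meaningful for bounded
  \<open>m\<close>, where existence is a weighted shift along the identity.\<close>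

definition mulop :: "('k \<Rightarrow> real) \<Rightarrow> 'k ell2 \<Rightarrow> 'k ell2" where
  "mulop m = (SOME B. bounded_linear B \<and> (\<forall>x k. coord (B x) k = m k * coord x k))"

lemma mulop:
  assumes "\<And>k. \<bar>m k\<bar> \<le> C"
  shows bounded_linear_mulop: "bounded_linear (mulop m)"
    and coord_mulop: "coord (mulop m x) k = m k * coord x k"
    and norm_mulop: "norm (mulop m x) \<le> C * norm x"
proof -
  have C: "0 \<le> C" using assms[of undefined] by linarith
  obtain B where B: "bounded_linear B" "\<And>x k. coord (B x) k = (if k \<in> UNIV then m k * coord x (id k) else 0)" "\<And>x. norm (B x) \<le> C * norm x"
    by (rule weighted_shift_exists[of id UNIV m C]) (use assms C in auto)
  have "\<exists>B. bounded_linear B \<and> (\<forall>x k. coord (B x) k = m k * coord x k)" using B(1,2) by auto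
  then have m: "bounded_linear (mulop m) \<and> (\<forall>x k. coord (mulop m x) k = m k * coord x k)"
    unfolding mulop_def by (rule someI_ex)
  then show "bounded_linear (mulop m)" and c: "coord (mulop m x) k = m k * coord x k" by auto
  have "mulop m x = B x" by (rule ell2_eqI) (use m B(2) in auto)
  then show "norm (mulop m x) \<le> C * norm x" using B(3) by simp
qed

lemma common_exhaustion:
  fixes c :: "'i \<Rightarrow> 'k ell2"
  assumes "finite I" "0 < \<epsilon>"
  shows "\<exists>F. finite F \<and> (\<forall>i\<in>I. norm (c i - proj F (c i)) < \<epsilon>)"
  using tail_uniform[of "c ` I" \<epsilon>] assms by (auto simp: finite_imp_compact)

context rect
begin

definition psum :: "'n set \<Rightarrow> ('n \<Rightarrow> nat) ell2 \<Rightarrow> ('n \<Rightarrow> nat) set \<Rightarrow> real ^ 'n \<Rightarrow> real" where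
  "psum D c F x = (\<Sum>k\<in>F. coord c k * trig D k x)"

lemma psum_sq_int: "sq_int M (psum D c F)"
  unfolding psum_def[abs_def] by (rule trig_sum_sq_int)

lemma psum_proj: "finite H \<Longrightarrow> F \<subseteq> H \<Longrightarrow> psum D c F x = psum D (proj F c) H x"
  unfolding psum_def by (rule sum.mono_neutral_cong_left) auto

lemma nrm_psum_diff:
  assumes "finite F" "finite G"
  shows "nrm M (\<lambda>x. psum D c F x - psum D d G x) = norm (proj F c - proj G d)"
proof -
  let ?H = "F \<union> G" and ?z = "proj F c - proj G d"
  have H: "finite ?H" using assms by simp
  have "psum D c F x - psum D d G x = psum D ?z ?H x" for x
    unfolding psum_proj[OF H, of F D c x, simplified] psum_proj[OF H, of G D d x, simplified]
    by (simp add: psum_def left_diff_distrib sum_subtractf)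
  then have "(nrm M (\<lambda>x. psum D c F x - psum D d G x))\<^sup>2 = (\<Sum>k\<in>?H. (coord ?z k)\<^sup>2)"
    using nrm_trig_sum[OF H, of "coord ?z" D] by (simp add: psum_def)
  also have "\<dots> = (norm (proj ?H ?z))\<^sup>2" using H by (simp add: norm_proj_power2)
  also have "proj ?H ?z = ?z" by (rule ell2_eqI) auto
  finally show ?thesis by (rule power2_eq_imp_eq) auto
qed

text \<open>The series over the modes \<open>trig D\<close> with coefficients \<open>c\<close>
  converges to \<open>f\<close>. Stating this as an error bound for every finite set of modes keeps
  it quantitative, so that uniform tail bounds along a curve become uniform errors of the time
  slices.\<close>

definition rep :: "'n set \<Rightarrow> ('n \<Rightarrow> nat) ell2 \<Rightarrow> (real ^ 'n \<Rightarrow> real) \<Rightarrow> bool" where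
  "rep D c f \<longleftrightarrow> sq_int M f \<and> (\<forall>F. finite F \<longrightarrow> nrm M (\<lambda>x. psum D c F x - f x) \<le> norm (c - proj F c))"

text \<open>The partial sums are jointly continuous in space and time, and by compactness one
  sequence of finite mode sets works for all times. Their pointwise limit is Borel on space-time,
  and the same limit represents each slice.\<close>

lemma joint_synthesis:
  fixes y :: "real \<Rightarrow> ('n \<Rightarrow> nat) ell2"
  assumes T: "0 \<le> T" and y: "continuous_on {0..T} y"
  obtains U :: "(real ^ 'n) \<times> real \<Rightarrow> real"
  where "U \<in> borel_measurable borel" "\<And>t. t \<in> {0..T} \<Longrightarrow> rep D (y t) (\<lambda>x. U (x, t))"
proof -
  define \<tau> where "\<tau> t = max 0 (min T t)" for t
  have \<tau>: "\<tau> t \<in> {0..T}" for t using T by (auto simp: \<tau>_def)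
  have \<tau>c: "continuous_on UNIV \<tau>" unfolding \<tau>_def by (intro continuous_intros)
  have yc: "continuous_on UNIV (\<lambda>t. y (\<tau> t))"
    by (rule continuous_on_compose2[OF y \<tau>c]) (use \<tau> in auto)
  \<comment> \<open>The tail is at most half of \<open>(1/2) ^ j\<close>, so consecutive partial
    sums differ by at most \<open>(1/2) ^ j\<close>, as \<open>Riesz_Fischer_fast\<close>
    requires.\<close>
  have "\<exists>F. finite F \<and> (\<forall>x\<in>y ` {0..T}. norm (x - proj F x) < (1/2) ^ j / 2)" for j
    by (rule tail_uniform[OF compact_continuous_image[OF y]]) auto
  then obtain F where F: "\<And>j::nat. finite (F j)" "\<And>j t. t \<in> {0..T} \<Longrightarrow> norm (y t - proj (F j) (y t)) < (1/2) ^ j / 2"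
    by (metis image_eqI)
  define s where "s j z = psum D (y (\<tau> (snd z))) (F j) (fst z)" for j z
  define U where "U z = lim (\<lambda>j. s j z)" for z
  have "continuous_on UNIV (s j)" for j
    unfolding s_def[abs_def] psum_def
    by (intro continuous_on_sum continuous_on_mult
        continuous_on_compose2[OF bounded_linear.continuous_on[OF bounded_linear_coord yc]]
        continuous_on_compose2[OF trig_continuous] continuous_on_fst continuous_on_snd continuous_on_id) auto
  then have [measurable]: "s j \<in> borel_measurable borel" for j by (rule borel_measurable_continuous_onI)
  have "U \<in> borel_measurable borel" unfolding U_def[abs_def] by measurable
  moreover have "rep D (y t) (\<lambda>x. U (x, t))" if t: "t \<in> {0..T}" for t
  proof -
    have tt: "\<tau> t = t" using t by (auto simp: \<tau>_def)
    have sj: "s j (x, t) = psum D (y t) (F j) x" for j x by (simp add: s_def tt)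
    have sq: "sq_int M (\<lambda>x. s j (x, t))" for j unfolding sj by (rule psum_sq_int)
    have fast: "nrm M (\<lambda>x. s (Suc j) (x, t) - s j (x, t)) \<le> (1/2) ^ j" for j
    proof -
      have "nrm M (\<lambda>x. s (Suc j) (x, t) - s j (x, t)) = norm (proj (F (Suc j)) (y t) - proj (F j) (y t))"
        unfolding sj by (rule nrm_psum_diff[OF F(1) F(1)])
      also have "\<dots> = norm ((y t - proj (F j) (y t)) - (y t - proj (F (Suc j)) (y t)))" by simp
      also have "\<dots> \<le> norm (y t - proj (F j) (y t)) + norm (y t - proj (F (Suc j)) (y t))" by (rule norm_triangle_ineq4)
      also have "\<dots> \<le> (1/2) ^ j / 2 + (1/2) ^ Suc j / 2"
        using F(2)[OF t, of j] F(2)[OF t, of "Suc j"] by linarith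
      also have "\<dots> \<le> (1/2) ^ j" by simp
      finally show ?thesis .
    qed
    note RF = Riesz_Fischer_fast[of M "\<lambda>j x. s j (x, t)", OF sq fast]
    have Us: "sq_int M (\<lambda>x. U (x, t))" using RF(1) by (simp add: U_def)
    have Uj: "nrm M (\<lambda>x. s j (x, t) - U (x, t)) \<le> 2 * (1/2) ^ j" for j using RF(2)[of j] by (simp add: U_def)
    show ?thesis
      unfolding rep_def
    proof (intro conjI allI impI Us)
      fix G :: "('n \<Rightarrow> nat) set" assume G: "finite G"
      have "nrm M (\<lambda>x. psum D (y t) G x - U (x, t)) \<le> norm (y t - proj G (y t)) + 3 * (1/2) ^ j" for j
      proof -
        have "nrm M (\<lambda>x. psum D (y t) G x - U (x, t)) \<le>
            nrm M (\<lambda>x. psum D (y t) G x - psum D (y t) (F j) x) + nrm M (\<lambda>x. psum D (y t) (F j) x - U (x, t))"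
          by (rule nrm_triangle_diff[OF psum_sq_int psum_sq_int Us])
        also have "nrm M (\<lambda>x. psum D (y t) G x - psum D (y t) (F j) x) = norm ((y t - proj (F j) (y t)) - (y t - proj G (y t)))"
          unfolding nrm_psum_diff[OF G F(1)] by simp
        also have "\<dots> \<le> norm (y t - proj (F j) (y t)) + norm (y t - proj G (y t))" by (rule norm_triangle_ineq4)
        finally have le: "nrm M (\<lambda>x. psum D (y t) G x - U (x, t)) \<le> norm (y t - proj (F j) (y t)) + norm (y t - proj G (y t))
            + nrm M (\<lambda>x. psum D (y t) (F j) x - U (x, t))" by simp
        define r :: real where "r = (1/2) ^ j"
        have "0 \<le> r" by (simp add: r_def)
        with le Uj[of j] F(2)[OF t, of j] show ?thesis unfolding sj r_def[symmetric] by linarith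
      qed
      moreover have "(\<lambda>j. norm (y t - proj G (y t)) + 3 * (1/2) ^ j) \<longlonglongrightarrow> norm (y t - proj G (y t)) + 3 * 0"
        by (intro tendsto_intros LIMSEQ_power_zero) auto
      ultimately show "nrm M (\<lambda>x. psum D (y t) G x - U (x, t)) \<le> norm (y t - proj G (y t))"
        by (intro LIMSEQ_le_const[of _ "norm (y t - proj G (y t))"]) auto
    qed
  qed
  ultimately show thesis by (rule that)
qed

lemma synthesis: "\<exists>f. rep D c f"
proof (rule joint_synthesis[where T = 1 and y = "\<lambda>_. c" and D = D])
  fix U :: "(real ^ 'n) \<times> real \<Rightarrow> real"
  assume "\<And>t. t \<in> {0..1} \<Longrightarrow> rep D c (\<lambda>x. U (x, t))"
  from this[of 0] show "\<exists>f. rep D c f" by auto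
qed auto

lemma rep_sq_int: "rep D c f \<Longrightarrow> sq_int M f"
  by (simp add: rep_def)

lemma rep_nrm:
  assumes r: "rep D c f" shows "nrm M f \<le> norm c"
proof -
  have "nrm M (\<lambda>x. psum D c {} x - f x) \<le> norm (c - proj {} c)" using r by (simp add: rep_def)
  moreover have "proj {} c = 0" by (rule ell2_eqI) simp
  ultimately show ?thesis by (simp add: psum_def nrm_minus)
qed

text \<open>The error of a partial sum of the sine series is exactly the tail of the coefficients,
  by best approximation and Parseval's identity.\<close>

lemma rep_e:
  assumes w: "sq_int M w" and c: "\<And>k. ip M w (e k) = coord c k"
  shows "rep {} c w"
  unfolding rep_def
proof (intro conjI allI impI w)
  fix F :: "('n \<Rightarrow> nat) set" assume F: "finite F"
  have cw: "c = fcoef w" by (rule ell2_eqI) (simp add: coord_fcoef[OF w] c)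
  have "(nrm M (\<lambda>x. w x - (\<Sum>k\<in>F. coord c k * e k x)))\<^sup>2 = (norm (c - proj F c))\<^sup>2"
    unfolding best_approximation[OF w F] norm_Pythagoras norm_proj_power2[OF F]
    using norm_fcoef[OF w] by (simp add: c cw)
  then have "nrm M (\<lambda>x. w x - (\<Sum>k\<in>F. coord c k * e k x)) = norm (c - proj F c)"
    by (rule power2_eq_imp_eq) auto
  then show "nrm M (\<lambda>x. psum {} c F x - w x) \<le> norm (c - proj F c)"
    by (simp add: psum_def nrm_minus_commute[of M w])
qed

lemma ip_psum: "finite F \<Longrightarrow> ip M (psum D c F) (trig D k) = (if k \<in> F then coord c k else 0)"
  unfolding psum_def[abs_def] by (rule ip_trig_sum_trig)

lemma rep_ip:
  assumes r: "rep D c f" shows "ip M f (trig D k) = coord c k"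
proof -
  have t1: "nrm M (trig D k) = 1"
    using trig_orthonormal[of D k k] nrm_power2_ip[of M "trig D k"] by (simp add: power2_eq_1_iff) (smt (verit) nrm_nonneg)
  have "\<bar>coord c k - ip M f (trig D k)\<bar> \<le> \<epsilon>" if "\<epsilon> > 0" for \<epsilon>
  proof -
    obtain F where F: "finite F" "norm (c - proj F c) < \<epsilon>" using tail_tendsto[OF \<open>\<epsilon> > 0\<close>] by blast
    \<comment> \<open>With \<open>k\<close> adjoined, the partial sum has the exact coefficient at
      \<open>k\<close>.\<close>
    have F': "finite (insert k F)" using F by simp
    have "coord c k - ip M f (trig D k) = ip M (\<lambda>x. psum D c (insert k F) x - f x) (trig D k)"
      using ip_psum[OF F', of D c k] by (simp add: ip_diff_left psum_sq_int rep_sq_int[OF r] trig_sq_int)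
    also have "\<bar>\<dots>\<bar> \<le> nrm M (\<lambda>x. psum D c (insert k F) x - f x) * nrm M (trig D k)"
      by (rule Cauchy_Schwarz_ip) (auto intro: psum_sq_int rep_sq_int[OF r] trig_sq_int)
    also have "\<dots> \<le> norm (c - proj (insert k F) c)" using r F' by (simp add: t1 rep_def)
    also have "\<dots> \<le> norm (c - proj F c)" by (rule norm_tail_antimono) auto
    finally show ?thesis using F(2) by simp
  qed
  then have "\<bar>coord c k - ip M f (trig D k)\<bar> \<le> 0" by (rule dense_ge)
  then show ?thesis by simp
qed

lemma psum_weak_deriv:
  assumes "\<And>k. coord d k = dsign i D * wt k i * coord c k"
  shows "has_weak_deriv \<Omega> (axis i 1) (psum D c F) (psum (flip i D) d F)"
proof -
  have "has_weak_deriv \<Omega> (axis i 1) (\<lambda>x. \<Sum>k\<in>F. coord c k * trig D k x) (\<lambda>x. \<Sum>k\<in>F. coord c k * (dsign i D * wt k i * trig (flip i D) k x))"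
    by (intro has_weak_deriv_sum[OF open_Om axis_Basis] has_weak_deriv_cmult[OF open_Om] trig_weak_deriv)
  moreover have "(\<lambda>x. \<Sum>k\<in>F. coord c k * (dsign i D * wt k i * trig (flip i D) k x)) = psum (flip i D) d F"
    by (rule ext) (simp add: psum_def assms mult_ac)
  ultimately show ?thesis by (simp add: psum_def[abs_def])
qed

text \<open>Finite sums are differentiated mode by mode; finite sets that exhaust \<open>c\<close>
  and \<open>d\<close> simultaneously carry this to the limit, since weak differentiation is
  closed.\<close>

lemma rep_weak_deriv:
  assumes f: "rep D c f" and g: "rep (flip i D) d g" and d: "\<And>k. coord d k = dsign i D * wt k i * coord c k"
  shows "has_weak_deriv \<Omega> (axis i 1) f g"
proof -
  have "\<exists>F. finite F \<and> (\<forall>b\<in>UNIV. norm ((if b then c else d) - proj F (if b then c else d)) < inverse (real (Suc n)))" for n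
    by (rule common_exhaustion) auto
  then obtain F where F: "\<And>n. finite (F n)" "\<And>n b. norm ((if b then c else d) - proj (F n) (if b then c else d)) < inverse (real (Suc n))"
    by (metis UNIV_I)
  have null: "X \<longlonglongrightarrow> 0" if "\<And>j. 0 \<le> X j" "\<And>j. X j \<le> inverse (real (Suc j))" for X
    by (rule tendsto_sandwich[OF _ _ tendsto_const LIMSEQ_inverse_real_of_nat]) (use that in auto)
  show ?thesis
  proof (rule has_weak_deriv_limit[OF open_Om axis_Basis psum_weak_deriv[OF d, of "F _"] rep_sq_int[OF f] rep_sq_int[OF g]])
    show "(\<lambda>n. nrm M (\<lambda>x. psum D c (F n) x - f x)) \<longlonglongrightarrow> 0"
    proof (rule null)
      show "nrm M (\<lambda>x. psum D c (F n) x - f x) \<le> inverse (real (Suc n))" for n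
        using f F(1)[of n] F(2)[of True n] by (auto simp: rep_def intro: order_trans)
    qed simp
    show "(\<lambda>n. nrm M (\<lambda>x. psum (flip i D) d (F n) x - g x)) \<longlonglongrightarrow> 0"
    proof (rule null)
      show "nrm M (\<lambda>x. psum (flip i D) d (F n) x - g x) \<le> inverse (real (Suc n))" for n
        using g F(1)[of n] F(2)[of False n] by (auto simp: rep_def intro: order_trans)
    qed simp
  qed
qed

section \<open>Bounded multipliers controlling two derivatives\<close>

lemma wt_power2_le: "(wt k i)\<^sup>2 \<le> lam k"
  unfolding lam_def by (rule member_le_sum) auto

lemma wt_lower: "pi / len i \<le> wt k i"
proof -
  have "1 * (pi / len i) \<le> real (Suc (k i)) * (pi / len i)" using len_pos[of i] by (intro mult_right_mono) auto
  then show ?thesis by (simp add: wt_def)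
qed

text \<open>If \<open>x\<close> has the coordinates \<open>lam k * ip M w (e k)\<close>, then
  \<open>w\<close>, its first and its second derivatives have as coefficients \<open>x\<close> times
  \<open>1 / lam\<close>, \<open>wt / lam\<close> and \<open>wt * wt / lam\<close>, up to sign. This
  and the next bounds make these multipliers bounded operators on \<open>ell2\<close>.\<close>

lemma mult_bound_0: "\<bar>1 / lam k\<bar> \<le> (len i / pi)\<^sup>2"
proof -
  have "(pi / len i)\<^sup>2 \<le> lam k"
    using power_mono[OF wt_lower[of i k], of 2] wt_power2_le[of k i] len_pos[of i] by simp
  then have "1 / lam k \<le> 1 / (pi / len i)\<^sup>2" using len_pos[of i] lam_pos[of k] by (intro divide_left_mono) auto
  then show ?thesis using lam_pos[of k] by (simp add: power_divide)
qed

lemma mult_bound_1: "\<bar>wt k i / lam k\<bar> \<le> len i / pi"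
proof -
  have "wt k i / lam k \<le> wt k i / (wt k i)\<^sup>2"
    using wt_pos[of k i] wt_power2_le[of k i] lam_pos[of k] by (intro divide_left_mono) auto
  also have "\<dots> = 1 / wt k i" using wt_pos[of k i] by (simp add: power2_eq_square)
  also have "\<dots> \<le> 1 / (pi / len i)"
    using wt_lower[of i k] wt_pos[of k i] len_pos[of i] by (intro divide_left_mono) auto
  finally show ?thesis using wt_pos[of k i] lam_pos[of k] by simp
qed

lemma mult_bound_2: "\<bar>wt k i * wt k j / lam k\<bar> \<le> 1"
proof -
  have "0 \<le> (wt k i - wt k j)\<^sup>2" by simp
  then have "2 * (wt k i * wt k j) \<le> (wt k i)\<^sup>2 + (wt k j)\<^sup>2" by (simp add: power2_diff)
  then have "wt k i * wt k j \<le> lam k" using wt_power2_le[of k i] wt_power2_le[of k j] by linarith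
  moreover have "0 < wt k i * wt k j" using wt_pos by simp
  ultimately show ?thesis using lam_pos[of k] by simp
qed

lemma mult_bound_2': "\<bar>dsign j {i} * (wt k i * wt k j / lam k)\<bar> \<le> 1"
  using mult_bound_2[of k i j] by (auto simp: dsign_def)

text \<open>Finitely many modes are cut off simultaneously; the errors of the single modes add up
  with the coefficients as weights.\<close>

lemma etest_sum_tendsto:
  "(\<lambda>j. nrm M (\<lambda>x. psum {} c F x - (\<Sum>k\<in>F. coord c k * etest k j x))) \<longlonglongrightarrow> 0"
  "(\<lambda>j. nrm M (\<lambda>x. (\<Sum>k\<in>F. coord c k * (wt k i * trig {i} k x)) - (\<Sum>k\<in>F. coord c k * frechet_derivative (etest k j) (at x) (axis i 1)))) \<longlonglongrightarrow> 0"
proof -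
  have gen: "(\<lambda>j. nrm M (\<lambda>x. (\<Sum>k\<in>F. coord c k * p k x) - (\<Sum>k\<in>F. coord c k * q k j x))) \<longlonglongrightarrow> 0"
    if s: "\<And>k. sq_int M (p k)" "\<And>k j. sq_int M (q k j)" and l: "\<And>k. (\<lambda>j. nrm M (\<lambda>x. q k j x - p k x)) \<longlonglongrightarrow> 0" for p q
  proof (rule Lim_null_comparison)
    show "\<forall>\<^sub>F j in sequentially. norm (nrm M (\<lambda>x. (\<Sum>k\<in>F. coord c k * p k x) - (\<Sum>k\<in>F. coord c k * q k j x)))
        \<le> (\<Sum>k\<in>F. \<bar>coord c k\<bar> * nrm M (\<lambda>x. q k j x - p k x))"
    proof (intro always_eventually allI)
      fix j
      have "nrm M (\<lambda>x. \<Sum>k\<in>F. coord c k * (p k x - q k j x)) \<le> (\<Sum>k\<in>F. nrm M (\<lambda>x. coord c k * (p k x - q k j x)))"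
        by (rule nrm_sum) (intro sq_int_cmult sq_int_diff s)
      also have "\<dots> = (\<Sum>k\<in>F. \<bar>coord c k\<bar> * nrm M (\<lambda>x. q k j x - p k x))"
        by (intro sum.cong refl) (simp only: nrm_cmult nrm_minus_commute[of M "p _"])
      finally show "norm (nrm M (\<lambda>x. (\<Sum>k\<in>F. coord c k * p k x) - (\<Sum>k\<in>F. coord c k * q k j x)))
        \<le> (\<Sum>k\<in>F. \<bar>coord c k\<bar> * nrm M (\<lambda>x. q k j x - p k x))"
        by (simp add: right_diff_distrib sum_subtractf)
    qed
    have "(\<lambda>j. \<Sum>k\<in>F. \<bar>coord c k\<bar> * nrm M (\<lambda>x. q k j x - p k x)) \<longlonglongrightarrow> (\<Sum>k\<in>F. \<bar>coord c k\<bar> * 0)"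
      by (intro tendsto_sum tendsto_mult tendsto_const l)
    then show "(\<lambda>j. \<Sum>k\<in>F. \<bar>coord c k\<bar> * nrm M (\<lambda>x. q k j x - p k x)) \<longlonglongrightarrow> 0" by simp
  qed
  show "(\<lambda>j. nrm M (\<lambda>x. psum {} c F x - (\<Sum>k\<in>F. coord c k * etest k j x))) \<longlonglongrightarrow> 0"
    unfolding psum_def by (intro gen trig_sq_int test_function_sq_int[OF etest_test open_Om] etest_tendsto)
  show "(\<lambda>j. nrm M (\<lambda>x. (\<Sum>k\<in>F. coord c k * (wt k i * trig {i} k x)) - (\<Sum>k\<in>F. coord c k * frechet_derivative (etest k j) (at x) (axis i 1)))) \<longlonglongrightarrow> 0"
    by (intro gen etest_deriv_tendsto test_function_sq_int[OF test_functions_deriv[OF etest_test axis_Basis] open_Om])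
      (rule sq_int_cmult, rule trig_sq_int)
qed

text \<open>Elliptic regularity on the box, read off from coefficients: square summability of the
  coefficients of the Laplacian controls all second derivatives through bounded multipliers. The
  constant adds their squared bounds, with \<open>i0\<close> any direction and one unit for each
  pair of directions. For \<open>H10\<close> a partial sum is taken before its modes are cut off at
  the boundary.\<close>

lemma e_coefficients_H2_H10:
  assumes w: "sq_int M w" and x: "\<And>k. lam k * ip M w (e k) = coord x k"
  shows "w \<in> H2 \<Omega>" "w \<in> H10 \<Omega>"
    and "H2_norm \<Omega> w \<le> sqrt ((len i0 / pi) ^ 4 + (\<Sum>i\<in>UNIV. (len i / pi)\<^sup>2) + real CARD('n) * real CARD('n)) * norm x"
proof -
  define c where "c = mulop (\<lambda>k. 1 / lam k) x"
  define d where "d i = mulop (\<lambda>k. wt k i / lam k) x" for i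
  define h where "h i j = mulop (\<lambda>k. dsign j {i} * (wt k i * wt k j / lam k)) x" for i j
  have cc: "coord c k = coord x k / lam k" for k by (simp add: c_def coord_mulop[OF mult_bound_0])
  have dc: "coord (d i) k = wt k i / lam k * coord x k" for i k by (simp add: d_def coord_mulop[OF mult_bound_1])
  have hc: "coord (h i j) k = dsign j {i} * (wt k i * wt k j / lam k) * coord x k" for i j k
    unfolding h_def by (rule coord_mulop[OF mult_bound_2'])
  have nc: "norm c \<le> (len i0 / pi)\<^sup>2 * norm x" unfolding c_def by (rule norm_mulop[OF mult_bound_0])
  have nd: "norm (d i) \<le> len i / pi * norm x" for i unfolding d_def by (rule norm_mulop[OF mult_bound_1])
  have nh: "norm (h i j) \<le> norm x" for i j unfolding h_def by (rule order_trans[OF norm_mulop[OF mult_bound_2']]) simp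
  have "ip M w (e k) = coord c k" for k using x[of k] lam_pos[of k] by (simp add: cc field_simps)
  then have rw: "rep {} c w" by (rule rep_e[OF w])
  have "\<forall>i. \<exists>f. rep {i} (d i) f" by (intro allI synthesis)
  then obtain g where g: "\<And>i. rep {i} (d i) (g i)" by metis
  have "\<forall>i j. \<exists>f. rep (flip j {i}) (h i j) f" by (intro allI synthesis)
  then obtain gg where gg: "\<And>i j. rep (flip j {i}) (h i j) (gg i j)" by metis
  define ix where "ix v = (THE i :: 'n. v = axis i (1::real))" for v
  have ix: "ix (axis i 1) = i" for i unfolding ix_def by (auto simp: axis_eq_axis)
  have w1: "has_weak_deriv \<Omega> v w (g (ix v))" if vB: "v \<in> Basis" for v
  proof -
    obtain i where v: "v = axis i 1" using vB by (auto simp: Basis_axis)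
    have fl: "flip i {} = {i}" by (simp add: flip_def)
    show ?thesis unfolding v ix
      by (rule rep_weak_deriv[OF rw, of i "d i"]) (use g[of i] in \<open>simp_all add: fl cc dc dsign_def\<close>)
  qed
  have w2: "has_weak_deriv \<Omega> u (g (ix v)) (gg (ix v) (ix u))" if uv: "v \<in> Basis" "u \<in> Basis" for u v
  proof -
    obtain i j where v: "v = axis i 1" "u = axis j 1" using uv by (auto simp: Basis_axis)
    show ?thesis unfolding v ix
      by (rule rep_weak_deriv[OF g gg]) (simp add: dc hc mult_ac)
  qed
  show "w \<in> H2 \<Omega>" by (rule H2I(1)[OF open_Om w w1 w2])
  have inj: "inj_on (\<lambda>i::'n. axis i (1::real)) UNIV" by (auto simp: inj_on_def axis_eq_axis)
  have sumB: "(\<Sum>v\<in>Basis. f (ix v)) = (\<Sum>i\<in>UNIV. f i)" for f :: "'n \<Rightarrow> real"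
    unfolding Basis_axis by (subst sum.reindex[OF inj]) (simp add: ix)
  have "H2_norm \<Omega> w = sqrt ((nrm M w)\<^sup>2 + (\<Sum>v\<in>Basis. (nrm M (g (ix v)))\<^sup>2) + (\<Sum>v\<in>Basis. \<Sum>u\<in>Basis. (nrm M (gg (ix v) (ix u)))\<^sup>2))"
    by (rule H2I(2)[OF open_Om w]) (use w1 w2 in auto)
  also have "\<dots> = sqrt ((nrm M w)\<^sup>2 + (\<Sum>i\<in>UNIV. (nrm M (g i))\<^sup>2) + (\<Sum>i\<in>UNIV. \<Sum>j\<in>UNIV. (nrm M (gg i j))\<^sup>2))"
    using sumB[of "\<lambda>i. (nrm M (g i))\<^sup>2"] sumB[of "\<lambda>i. \<Sum>j\<in>UNIV. (nrm M (gg i j))\<^sup>2"] sumB[of "\<lambda>j. (nrm M (gg i j))\<^sup>2" for i]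
    by simp
  also have "\<dots> \<le> sqrt (((len i0 / pi)\<^sup>2 * norm x)\<^sup>2 + (\<Sum>i\<in>UNIV. (len i / pi * norm x)\<^sup>2) + (\<Sum>i\<in>(UNIV :: 'n set). \<Sum>j\<in>(UNIV :: 'n set). (norm x)\<^sup>2))"
  proof (intro real_sqrt_le_mono add_mono sum_mono power_mono nrm_nonneg)
    show "nrm M w \<le> (len i0 / pi)\<^sup>2 * norm x" using rep_nrm[OF rw] nc by linarith
    show "nrm M (g i) \<le> len i / pi * norm x" for i using rep_nrm[OF g] nd by (rule order_trans)
    show "nrm M (gg i j) \<le> norm x" for i j using rep_nrm[OF gg] nh by (rule order_trans)
  qed
  also have "\<dots> = sqrt (((len i0 / pi) ^ 4 + (\<Sum>i\<in>UNIV. (len i / pi)\<^sup>2) + real CARD('n) * real CARD('n)) * (norm x)\<^sup>2)"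
  proof -
    define q where "q i = len i / pi" for i
    show ?thesis unfolding q_def[symmetric]
      by (simp add: power_mult_distrib sum_distrib_right distrib_right flip: power_mult)
  qed
  also have "\<dots> = sqrt ((len i0 / pi) ^ 4 + (\<Sum>i\<in>UNIV. (len i / pi)\<^sup>2) + real CARD('n) * real CARD('n)) * norm x"
    by (simp only: real_sqrt_mult real_sqrt_abs abs_norm_cancel)
  finally show "H2_norm \<Omega> w \<le> sqrt ((len i0 / pi) ^ 4 + (\<Sum>i\<in>UNIV. (len i / pi)\<^sup>2) + real CARD('n) * real CARD('n)) * norm x" .
  have "\<exists>\<phi>\<in>test_functions \<Omega>. nrm M (\<lambda>x. w x - \<phi> x) \<le> inverse (real (Suc n)) \<and>
      (\<forall>i. nrm M (\<lambda>x. g i x - frechet_derivative \<phi> (at x) (axis i 1)) \<le> inverse (real (Suc n)))" for n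
  proof -
    define \<epsilon> where "\<epsilon> = inverse (real (Suc n))"
    have \<epsilon>: "\<epsilon> > 0" by (simp add: \<epsilon>_def)
    \<comment> \<open>\<open>None\<close> stands for the function and \<open>Some i\<close> for its
      derivative in direction \<open>i\<close>, so that one finite set of modes serves all of
      them.\<close>
    obtain F where F: "finite F" "\<And>i. norm ((case i of None \<Rightarrow> c | Some i \<Rightarrow> d i) - proj F (case i of None \<Rightarrow> c | Some i \<Rightarrow> d i)) < \<epsilon> / 2"
      using common_exhaustion[of UNIV "\<epsilon> / 2" "\<lambda>i. case i of None \<Rightarrow> c | Some i \<Rightarrow> d i"] \<epsilon> by auto
    have F0: "nrm M (\<lambda>x. psum {} c F x - w x) < \<epsilon> / 2"
      using rw F(1) F(2)[of None] unfolding rep_def by fastforce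
    have Fi: "nrm M (\<lambda>x. psum {i} (d i) F x - g i x) < \<epsilon> / 2" for i
      using g[of i] F(1) F(2)[of "Some i"] unfolding rep_def by fastforce
    have "\<forall>\<^sub>F j in sequentially. nrm M (\<lambda>x. psum {} c F x - (\<Sum>k\<in>F. coord c k * etest k j x)) < \<epsilon> / 2"
      by (rule order_tendstoD[OF etest_sum_tendsto(1)]) (use \<epsilon> in simp)
    moreover have "\<forall>\<^sub>F j in sequentially. \<forall>i\<in>UNIV. nrm M (\<lambda>x. (\<Sum>k\<in>F. coord c k * (wt k i * trig {i} k x)) - (\<Sum>k\<in>F. coord c k * frechet_derivative (etest k j) (at x) (axis i 1))) < \<epsilon> / 2"
      by (intro eventually_ball_finite ballI order_tendstoD[OF etest_sum_tendsto(2)]) (use \<epsilon> in simp_all)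
    ultimately have "\<forall>\<^sub>F j in sequentially. nrm M (\<lambda>x. psum {} c F x - (\<Sum>k\<in>F. coord c k * etest k j x)) < \<epsilon> / 2 \<and>
      (\<forall>i\<in>UNIV. nrm M (\<lambda>x. (\<Sum>k\<in>F. coord c k * (wt k i * trig {i} k x)) - (\<Sum>k\<in>F. coord c k * frechet_derivative (etest k j) (at x) (axis i 1))) < \<epsilon> / 2)"
      by (rule eventually_conj)
    from eventually_happens'[OF sequentially_bot this] obtain j where
      j0: "nrm M (\<lambda>x. psum {} c F x - (\<Sum>k\<in>F. coord c k * etest k j x)) < \<epsilon> / 2" and
      ji: "\<And>i. nrm M (\<lambda>x. (\<Sum>k\<in>F. coord c k * (wt k i * trig {i} k x)) - (\<Sum>k\<in>F. coord c k * frechet_derivative (etest k j) (at x) (axis i 1))) < \<epsilon> / 2"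
      by blast
    define \<phi> where "\<phi> x = (\<Sum>k\<in>F. coord c k * etest k j x)" for x
    have \<phi>t: "\<phi> \<in> test_functions \<Omega>"
      unfolding \<phi>_def[abs_def] by (intro test_functions_sum test_functions_cmult etest_test)
    have fd: "frechet_derivative \<phi> (at x) (axis i 1) = (\<Sum>k\<in>F. coord c k * frechet_derivative (etest k j) (at x) (axis i 1))" for x i
      unfolding \<phi>_def[abs_def] by (rule frechet_derivative_linear_comb) (rule etest_smooth)
    have ps: "(\<Sum>k\<in>F. coord c k * (wt k i * trig {i} k x)) = psum {i} (d i) F x" for i x
      unfolding psum_def by (intro sum.cong refl) (simp add: cc dc)
    have "nrm M (\<lambda>x. w x - \<phi> x) \<le> nrm M (\<lambda>x. w x - psum {} c F x) + nrm M (\<lambda>x. psum {} c F x - \<phi> x)"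
      by (rule nrm_triangle_diff[OF w psum_sq_int test_function_sq_int[OF \<phi>t open_Om]])
    then have 1: "nrm M (\<lambda>x. w x - \<phi> x) \<le> \<epsilon>"
      using F0 j0 by (simp add: nrm_minus_commute[of M w] \<phi>_def)
    have tri: "nrm M (\<lambda>x. g i x - frechet_derivative \<phi> (at x) (axis i 1)) \<le>
        nrm M (\<lambda>x. g i x - psum {i} (d i) F x) + nrm M (\<lambda>x. psum {i} (d i) F x - frechet_derivative \<phi> (at x) (axis i 1))" for i
      by (rule nrm_triangle_diff[OF rep_sq_int[OF g] psum_sq_int test_function_sq_int[OF test_functions_deriv[OF \<phi>t axis_Basis] open_Om]])
    have 2: "nrm M (\<lambda>x. g i x - frechet_derivative \<phi> (at x) (axis i 1)) \<le> \<epsilon>" for i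
      using tri[of i] Fi[of i] ji[of i] nrm_minus_commute[of M "g i" "psum {i} (d i) F"] unfolding ps fd by linarith
    show ?thesis
      by (rule bexI[OF _ \<phi>t]) (use 1 2 in \<open>simp add: \<epsilon>_def\<close>)
  qed
  then have "\<forall>n. \<exists>\<phi>. \<phi> \<in> test_functions \<Omega> \<and> nrm M (\<lambda>x. w x - \<phi> x) \<le> inverse (real (Suc n)) \<and>
      (\<forall>i. nrm M (\<lambda>x. g i x - frechet_derivative \<phi> (at x) (axis i 1)) \<le> inverse (real (Suc n)))"
    unfolding Bex_def by (rule allI)
  from choice[OF this] obtain \<phi> where \<phi>': "\<forall>n. \<phi> n \<in> test_functions \<Omega> \<and> nrm M (\<lambda>x. w x - \<phi> n x) \<le> inverse (real (Suc n)) \<and>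
      (\<forall>i. nrm M (\<lambda>x. g i x - frechet_derivative (\<phi> n) (at x) (axis i 1)) \<le> inverse (real (Suc n)))" ..
  then have \<phi>: "\<phi> n \<in> test_functions \<Omega>" "nrm M (\<lambda>x. w x - \<phi> n x) \<le> inverse (real (Suc n))"
    "nrm M (\<lambda>x. g i x - frechet_derivative (\<phi> n) (at x) (axis i 1)) \<le> inverse (real (Suc n))" for n i
    by simp_all
  have null: "X \<longlonglongrightarrow> 0" if "\<And>j. 0 \<le> X j" "\<And>j. X j \<le> inverse (real (Suc j))" for X
    by (rule tendsto_sandwich[OF _ _ tendsto_const LIMSEQ_inverse_real_of_nat]) (use that in auto)
  show "w \<in> H10 \<Omega>"
  proof (rule H10I[OF open_Om w1 \<phi>(1)])
    show "(\<lambda>n. nrm M (\<lambda>x. w x - \<phi> n x)) \<longlonglongrightarrow> 0" by (rule null[OF nrm_nonneg \<phi>(2)])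
    fix v :: "real ^ 'n" assume "v \<in> Basis"
    then obtain i where v: "v = axis i 1" by (auto simp: Basis_axis)
    show "(\<lambda>n. nrm M (\<lambda>x. g (ix v) x - frechet_derivative (\<phi> n) (at x) v)) \<longlonglongrightarrow> 0"
      unfolding v ix by (rule null[OF nrm_nonneg \<phi>(3)])
  qed
qed

text \<open>In the coordinates \<open>lam k * ip M w (e k)\<close> the graph norm of the Dirichlet Laplacian is the norm
  of \<open>ell2\<close>, so \<open>B\<close> represents multiplication by \<open>\<alpha>\<close> as a bounded operator on its domain.\<close>

definition domain_multiplier :: "(real ^ 'n \<Rightarrow> real) \<Rightarrow> (('n \<Rightarrow> nat) ell2 \<Rightarrow> ('n \<Rightarrow> nat) ell2) \<Rightarrow> bool" where
  "domain_multiplier \<alpha> B \<longleftrightarrow> bounded_linear B \<and>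
     (\<forall>w x. sq_int M w \<longrightarrow> (\<forall>k. lam k * ip M w (e k) = coord x k) \<longrightarrow>
        (\<forall>k. lam k * ip M (\<lambda>x. \<alpha> x * w x) (e k) = coord (B x) k))"

section \<open>Multiplication by cosine polynomials on the domain of the Laplacian\<close>

lemma cospoly_measurable: "p \<in> cospoly \<Longrightarrow> p \<in> borel_measurable M"
  by (intro continuous_measurable_M cospoly_continuous)

lemma cospoly_sq_int:
  assumes "p \<in> cospoly" "sq_int M w" shows "sq_int M (\<lambda>x. p x * w x)"
proof -
  obtain C where "\<And>x. \<bar>p x\<bar> \<le> C" using cospoly_bounded[OF assms(1)] by blast
  then show ?thesis by (intro sq_int_bounded_mult(1)[OF assms(2) cospoly_measurable[OF assms(1)], of C])
qed

lemma lam_ratio_up: "\<bar>lam k / lam (k(i := Suc (k i)))\<bar> \<le> 1"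
proof -
  have "lam k \<le> lam (k(i := Suc (k i)))"
    unfolding lam_def wt_def using len_pos
    by (intro sum_mono power_mono divide_right_mono mult_right_mono) (auto intro: less_imp_le)
  then show ?thesis using lam_pos[of k] lam_pos[of "k(i := Suc (k i))"] by simp
qed

text \<open>For \<open>k i \<ge> 1\<close> the frequency in direction \<open>i\<close> is at most
  twice that of the lowered index, so its square is at most four times as large; the other
  directions agree.\<close>

lemma lam_ratio_down:
  assumes "0 < k i" shows "\<bar>lam k / lam (k(i := k i - 1))\<bar> \<le> 4"
proof -
  have "lam k \<le> 4 * lam (k(i := k i - 1))"
    unfolding lam_def sum_distrib_left
  proof (rule sum_mono)
    fix j
    have "real (Suc (k j)) \<le> 2 * real (Suc ((k(i := k i - 1)) j))" using assms by auto
    then have "wt k j \<le> 2 * wt (k(i := k i - 1)) j"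
      unfolding wt_def using len_pos[of j]
      by (auto simp: divide_le_cancel intro!: mult_right_mono[of "real (Suc (k j))" _ pi, simplified mult.assoc])
    then have "(wt k j)\<^sup>2 \<le> (2 * wt (k(i := k i - 1)) j)\<^sup>2" using wt_pos[of k j] by (intro power_mono) auto
    then show "(wt k j)\<^sup>2 \<le> 4 * (wt (k(i := k i - 1)) j)\<^sup>2" by (simp add: power_mult_distrib)
  qed
  then show ?thesis using lam_pos[of k] lam_pos[of "k(i := k i - 1)"] by (simp add: divide_le_eq)
qed

text \<open>For one cosine the operator is half the sum of two neighbour shifts; in the weighted
  coordinates their weights are ratios of neighbouring eigenvalues, which are bounded. Sums and
  products of multipliers correspond to sums and compositions of operators.\<close>

lemma cospoly_domain_multiplier: "p \<in> cospoly \<Longrightarrow> \<exists>B. domain_multiplier p B"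
proof (induction rule: cospoly.induct)
  case (const c)
  have "domain_multiplier (\<lambda>x. c) (\<lambda>x. c *\<^sub>R x)"
    unfolding domain_multiplier_def by (auto simp: ip_cmult_left mult.left_commute intro: bounded_linear_scaleR_right)
  then show ?case by blast
next
  case (cos i)
  let ?u = "\<lambda>k :: 'n \<Rightarrow> nat. k(i := Suc (k i))" and ?d = "\<lambda>k :: 'n \<Rightarrow> nat. k(i := k i - 1)"
  have iu: "inj_on ?u UNIV"
  proof (rule inj_onI)
    fix k l :: "'n \<Rightarrow> nat" assume kl: "?u k = ?u l"
    have "k j = l j" for j
      using fun_cong[OF kl, of j] by (cases "j = i") auto
    then show "k = l" by blast
  qed
  have id: "inj_on ?d {k. 0 < k i}"
  proof (rule inj_onI)
    fix k l :: "'n \<Rightarrow> nat" assume kl: "k \<in> {k. 0 < k i}" "l \<in> {k. 0 < k i}" "?d k = ?d l"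
    have "k j = l j" for j
    proof (cases "j = i")
      case True
      have "k i - 1 = l i - 1" using fun_cong[OF kl(3), of i] by simp
      with kl True show ?thesis by auto
    next
      case False
      with fun_cong[OF kl(3), of j] show ?thesis by simp
    qed
    then show "k = l" by blast
  qed
  obtain U where U: "bounded_linear U" "\<And>x k. coord (U x) k = (if k \<in> UNIV then lam k / lam (?u k) * coord x (?u k) else 0)"
    by (rule weighted_shift_exists[OF iu, of "\<lambda>k. lam k / lam (?u k)" 1]) (use lam_ratio_up in auto)
  obtain V where V: "bounded_linear V" "\<And>x k. coord (V x) k = (if k \<in> {k. 0 < k i} then lam k / lam (?d k) * coord x (?d k) else 0)"
    by (rule weighted_shift_exists[OF id, of "\<lambda>k. lam k / lam (?d k)" 4]) (use lam_ratio_down in auto)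
  have "domain_multiplier (\<lambda>x. cos (pi / len i * (x $ i - a $ i))) (\<lambda>x. (1/2) *\<^sub>R (U x + V x))"
    unfolding domain_multiplier_def
  proof (intro conjI allI impI)
    show "bounded_linear (\<lambda>x. (1/2) *\<^sub>R (U x + V x))"
      by (intro bounded_linear_compose[OF bounded_linear_scaleR_right] bounded_linear_add U V)
    fix w x k assume w: "sq_int M w" and x: "\<forall>k. lam k * ip M w (e k) = coord x k"
    have ipw: "ip M (e k) w = coord x k / lam k" for k
      using x lam_pos[of k] by (simp add: ip_commute[of M _ w] field_simps flip: x[rule_format])
    \<comment> \<open>The cosine is moved onto the mode, where it acts as a shift.\<close>
    have "ip M (\<lambda>x. cos (pi / len i * (x $ i - a $ i)) * w x) (e k) = ip M (\<lambda>x. cos (pi / len i * (x $ i - a $ i)) * e k x) w"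
      unfolding ip_def by (intro Bochner_Integration.integral_cong) auto
    also have "\<dots> = (1/2) * ip M (\<lambda>x. e (?u k) x + (if k i > 0 then e (?d k) x else 0)) w"
      unfolding cos_mult_e by (rule ip_cmult_left)
    also have "ip M (\<lambda>x. e (?u k) x + (if k i > 0 then e (?d k) x else 0)) w = ip M (e (?u k)) w + (if k i > 0 then ip M (e (?d k)) w else 0)"
      by (cases "k i > 0") (simp_all add: ip_add_left trig_sq_int w)
    finally show "lam k * ip M (\<lambda>x. cos (pi / len i * (x $ i - a $ i)) * w x) (e k) = coord ((1/2) *\<^sub>R (U x + V x)) k"
      by (simp add: ipw U(2) V(2) distrib_left)
  qed
  then show ?case by blast
next
  case (add p q)
  then obtain B C where B: "domain_multiplier p B" and C: "domain_multiplier q C" by blast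
  have "domain_multiplier (\<lambda>x. p x + q x) (\<lambda>x. B x + C x)"
    unfolding domain_multiplier_def
  proof (intro conjI allI impI)
    show "bounded_linear (\<lambda>x. B x + C x)" using B C by (intro bounded_linear_add) (auto simp: domain_multiplier_def)
    fix w x k assume w: "sq_int M w" and x: "\<forall>k. lam k * ip M w (e k) = coord x k"
    have "ip M (\<lambda>x. (p x + q x) * w x) (e k) = ip M (\<lambda>x. p x * w x) (e k) + ip M (\<lambda>x. q x * w x) (e k)"
      unfolding distrib_right by (rule ip_add_left[OF cospoly_sq_int[OF add.hyps(1) w] cospoly_sq_int[OF add.hyps(2) w] trig_sq_int])
    moreover have "lam k * ip M (\<lambda>x. p x * w x) (e k) = coord (B x) k" "lam k * ip M (\<lambda>x. q x * w x) (e k) = coord (C x) k"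
      using B C w x by (auto simp: domain_multiplier_def)
    ultimately show "lam k * ip M (\<lambda>x. (p x + q x) * w x) (e k) = coord (B x + C x) k" by (simp add: distrib_left)
  qed
  then show ?case by blast
next
  case (mult p q)
  then obtain B C where B: "domain_multiplier p B" and C: "domain_multiplier q C" by blast
  have "domain_multiplier (\<lambda>x. p x * q x) (\<lambda>x. B (C x))"
    unfolding domain_multiplier_def
  proof (intro conjI allI impI)
    show "bounded_linear (\<lambda>x. B (C x))" using B C by (intro bounded_linear_compose[of B C]) (auto simp: domain_multiplier_def)
    fix w x k assume w: "sq_int M w" and x: "\<forall>k. lam k * ip M w (e k) = coord x k"
    have "\<forall>k. lam k * ip M (\<lambda>x. q x * w x) (e k) = coord (C x) k" using C w x by (auto simp: domain_multiplier_def)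
    then have "lam k * ip M (\<lambda>x. p x * (q x * w x)) (e k) = coord (B (C x)) k"
      using B cospoly_sq_int[OF mult.hyps(2) w] unfolding domain_multiplier_def by blast
    then show "lam k * ip M (\<lambda>x. p x * q x * w x) (e k) = coord (B (C x)) k" by (simp add: mult.assoc)
  qed
  then show ?case by blast
qed

end

lemma coord_sum: "coord (\<Sum>i\<in>I. f i) k = (\<Sum>i\<in>I. coord (f i) k)"
  using linear_sum[OF bounded_linear.linear[OF bounded_linear_coord], of f I k] by simp

subsection \<open>Existence of solutions\<close>

text \<open>The exponents may be unbounded, so continuity is proved at each \<open>x\<close>
  separately: it is clear on finitely many coordinates, and the tail is small uniformly in time by
  contractivity.\<close>

lemma mulop_exp_continuous:
  fixes \<mu> :: "'k \<Rightarrow> real"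
  assumes \<mu>: "\<And>k. 0 \<le> \<mu> k"
  shows "continuous_on {0..} (\<lambda>t. mulop (\<lambda>k. exp (- \<mu> k * t)) x)"
proof -
  define S where "S t = mulop (\<lambda>k. exp (- \<mu> k * t))" for t
  have bd: "\<bar>exp (- \<mu> k * t)\<bar> \<le> 1" if "0 \<le> t" for t k using that \<mu> by simp
  have Sc: "coord (S t x) k = exp (- \<mu> k * t) * coord x k" if "0 \<le> t" for t x k
    unfolding S_def by (rule coord_mulop[OF bd[OF that]])
  have Sn: "norm (S t x) \<le> norm x" if "0 \<le> t" for t x
    unfolding S_def using norm_mulop[where x = x, OF bd[OF that]] by simp
  have Sd: "S t x - S t y = S t (x - y)" if "0 \<le> t" for t x y
    using that by (intro ell2_eqI) (simp add: Sc right_diff_distrib)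
  have fin: "continuous_on {0..} (\<lambda>t. S t (proj F x))" if "finite F" for F
  proof (rule continuous_on_eq)
    show "continuous_on {0..} (\<lambda>t. \<Sum>k\<in>F. exp (- \<mu> k * t) *\<^sub>R proj {k} x)" by (intro continuous_intros)
    fix t :: real assume t: "t \<in> {0..}"
    show "(\<Sum>k\<in>F. exp (- \<mu> k * t) *\<^sub>R proj {k} x) = S t (proj F x)"
    proof (rule ell2_eqI)
      fix k
      have "coord (\<Sum>k\<in>F. exp (- \<mu> k * t) *\<^sub>R proj {k} x) k = (\<Sum>m\<in>F. if m = k then exp (- \<mu> k * t) * coord x k else 0)"
        unfolding coord_sum by (intro sum.cong refl) auto
      then show "coord (\<Sum>k\<in>F. exp (- \<mu> k * t) *\<^sub>R proj {k} x) k = coord (S t (proj F x)) k"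
        using that t by (simp add: Sc)
    qed
  qed
  have "continuous_on {0..} (\<lambda>t. S t x)"
    unfolding continuous_on_iff
  proof (intro ballI allI impI)
    fix t \<epsilon> :: real assume t: "t \<in> {0..}" and \<epsilon>: "0 < \<epsilon>"
    obtain F where F: "finite F" "norm (x - proj F x) < \<epsilon> / 3" using tail_tendsto[of "\<epsilon> / 3" x] \<epsilon> by auto
    obtain d where d: "0 < d" "\<And>s. s \<in> {0..} \<Longrightarrow> dist s t < d \<Longrightarrow> dist (S s (proj F x)) (S t (proj F x)) < \<epsilon> / 3"
      using fin[OF F(1)] t \<epsilon> unfolding continuous_on_iff by (metis zero_less_divide_iff zero_less_numeral)
    have "dist (S s x) (S t x) < \<epsilon>" if s: "s \<in> {0..}" "dist s t < d" for s
    proof -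
      have "norm (S s (x - proj F x)) < \<epsilon> / 3" "norm (S t (x - proj F x)) < \<epsilon> / 3"
        using Sn[of s "x - proj F x"] Sn[of t "x - proj F x"] s t F by auto
      moreover have eq: "S s x - S t x = S s (x - proj F x) + (S s (proj F x) - S t (proj F x)) - S t (x - proj F x)"
        using s t by (simp flip: Sd)
      moreover have "norm (S s (x - proj F x) + (S s (proj F x) - S t (proj F x)) - S t (x - proj F x)) \<le>
          norm (S s (x - proj F x)) + norm (S s (proj F x) - S t (proj F x)) + norm (S t (x - proj F x))"
        by (intro order_trans[OF norm_triangle_ineq4] add_right_mono norm_triangle_ineq)
      moreover have "norm (S s (proj F x) - S t (proj F x)) < \<epsilon> / 3" using d(2)[OF s] by (simp add: dist_norm)
      ultimately show ?thesis unfolding dist_norm eq by linarith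
    qed
    then show "\<exists>d>0. \<forall>s\<in>{0..}. dist s t < d \<longrightarrow> dist (S s x) (S t x) < \<epsilon>" using d(1) by blast
  qed
  then show ?thesis by (simp add: S_def)
qed

text \<open>Adding \<open>\<gamma> = 2 * K\<close> to all decay rates meets the requirement of the
  contraction argument; the factor \<open>exp (\<gamma> * t)\<close> removes it afterwards. The
  differential equation is asserted coordinate by coordinate, which avoids domains of unbounded
  operators.\<close>

lemma evolution_exists:
  fixes \<mu> :: "'k \<Rightarrow> real" and B :: "'k ell2 \<Rightarrow> 'k ell2"
  assumes \<mu>: "\<And>k. 0 \<le> \<mu> k" and B: "bounded_linear B" and T: "0 \<le> T"
  obtains X where "continuous_on {0..T} X" "X 0 = x0"
    "\<And>t k. t \<in> {0..T} \<Longrightarrow> ((\<lambda>t. coord (X t) k) has_real_derivative (- \<mu> k * coord (X t) k + coord (B (X t)) k)) (at t within {0..T})"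
proof -
  obtain K where K: "K > 0" "\<And>x. norm (B x) \<le> norm x * K" using bounded_linear.pos_bounded[OF B] by blast
  define \<gamma> where "\<gamma> = 2 * K"
  define \<nu> where "\<nu> k = \<mu> k + \<gamma>" for k
  have \<nu>: "0 \<le> \<nu> k" for k using \<mu>[of k] K by (simp add: \<nu>_def \<gamma>_def)
  define S where "S t = mulop (\<lambda>k. exp (- \<nu> k * t))" for t
  have bd: "\<bar>exp (- \<nu> k * t)\<bar> \<le> exp (- \<gamma> * t)" if "0 \<le> t" for t k
    using that \<mu>[of k] by (simp add: \<nu>_def left_diff_distrib)
  have Sc: "coord (S t x) k = exp (- \<nu> k * t) * coord x k" if "0 \<le> t" for t x k
    unfolding S_def by (rule coord_mulop[OF bd[OF that]])
  obtain Y where Y: "continuous_on {0..T} Y"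
    "\<And>t. t \<in> {0..T} \<Longrightarrow> ((\<lambda>s. S (t - s) (B (Y s))) has_integral (Y t - S t x0)) {0..t}"
  proof (rule Duhamel_solution[where S = S and B = B and M = K and \<gamma> = \<gamma> and T = T and ?x0.0 = x0])
    show "linear (S t)" if "0 \<le> t" for t
      unfolding S_def by (rule bounded_linear.linear[OF bounded_linear_mulop[OF bd[OF that]]])
    show "S 0 x = x" for x by (rule ell2_eqI) (simp add: Sc)
    show "norm (S t x) \<le> exp (- \<gamma> * t) * norm x" if "0 \<le> t" for t x
      unfolding S_def by (rule norm_mulop[OF bd[OF that]])
    show "continuous_on {0..} (\<lambda>t. S t x)" for x unfolding S_def by (rule mulop_exp_continuous[OF \<nu>])
    show "norm (B x) \<le> K * norm x" for x using K(2)[of x] by (simp add: mult.commute)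
  qed (use T B K in \<open>auto simp: \<gamma>_def\<close>)
  have bc: "continuous_on {0..T} (\<lambda>s. coord (B (Y s)) k)" for k
    by (rule bounded_linear.continuous_on[OF bounded_linear_coord bounded_linear.continuous_on[OF B Y(1)]])
  have gc: "continuous_on {0..T} (\<lambda>s. exp (\<nu> k * s) * coord (B (Y s)) k)" for k
    by (intro continuous_intros bc)
  \<comment> \<open>In each coordinate the kernel factors into a function of \<open>t\<close> and
    one of \<open>s\<close>, so the integrand no longer depends on \<open>t\<close> and the
    fundamental theorem of calculus applies.\<close>
  have Yk: "coord (Y t) k = exp (- \<nu> k * t) * (coord x0 k + integral {0..t} (\<lambda>s. exp (\<nu> k * s) * coord (B (Y s)) k))"
    if t: "t \<in> {0..T}" for t k
  proof -
    have "((\<lambda>s. coord (S (t - s) (B (Y s))) k) has_integral coord (Y t - S t x0) k) {0..t}"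
      using has_integral_linear[OF Y(2)[OF t] bounded_linear_coord[of k]] by (simp add: o_def)
    then have "((\<lambda>s. exp (- \<nu> k * t) * (exp (\<nu> k * s) * coord (B (Y s)) k)) has_integral coord (Y t - S t x0) k) {0..t}"
    proof (rule has_integral_eq[rotated])
      fix s assume s: "s \<in> {0..t}"
      have "exp (- \<nu> k * t) * exp (\<nu> k * s) = exp (- \<nu> k * (t - s))" by (simp add: exp_add[symmetric] algebra_simps)
      then show "coord (S (t - s) (B (Y s))) k = exp (- \<nu> k * t) * (exp (\<nu> k * s) * coord (B (Y s)) k)"
        using s by (simp add: Sc mult.assoc[symmetric])
    qed
    moreover have "((\<lambda>s. exp (- \<nu> k * t) * (exp (\<nu> k * s) * coord (B (Y s)) k)) has_integral
        exp (- \<nu> k * t) * integral {0..t} (\<lambda>s. exp (\<nu> k * s) * coord (B (Y s)) k)) {0..t}"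
      using t by (intro has_integral_mult_right integrable_integral integrable_continuous_real continuous_on_subset[OF gc]) auto
    ultimately have "coord (Y t - S t x0) k = exp (- \<nu> k * t) * integral {0..t} (\<lambda>s. exp (\<nu> k * s) * coord (B (Y s)) k)"
      by (rule has_integral_unique)
    then show ?thesis using t by (simp add: Sc distrib_left)
  qed
  define X where "X t = exp (\<gamma> * t) *\<^sub>R Y t" for t
  have Xk: "coord (X t) k = exp (- \<mu> k * t) * (coord x0 k + integral {0..t} (\<lambda>s. exp (\<nu> k * s) * coord (B (Y s)) k))"
    if t: "t \<in> {0..T}" for t k
  proof -
    have "exp (\<gamma> * t) * exp (- \<nu> k * t) = exp (- \<mu> k * t)" by (simp add: \<nu>_def exp_add[symmetric] algebra_simps)
    then show ?thesis unfolding X_def by (simp add: Yk[OF t] mult.assoc[symmetric])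
  qed
  show thesis
  proof (rule that[of X])
    show "continuous_on {0..T} X" unfolding X_def[abs_def] by (intro continuous_intros Y)
    show "X 0 = x0" using T by (intro ell2_eqI) (simp add: Xk)
    fix t k assume t: "t \<in> {0..T}"
    let ?I = "\<lambda>t. integral {0..t} (\<lambda>s. exp (\<nu> k * s) * coord (B (Y s)) k)"
    have "((\<lambda>t. exp (- \<mu> k * t) * (coord x0 k + ?I t)) has_real_derivative
        (- \<mu> k * exp (- \<mu> k * t)) * (coord x0 k + ?I t) + (0 + exp (\<nu> k * t) * coord (B (Y t)) k) * exp (- \<mu> k * t)) (at t within {0..T})"
      by (intro DERIV_mult DERIV_add DERIV_const integral_has_real_derivative[OF gc t]) (auto intro!: derivative_eq_intros)
    moreover have "(- \<mu> k * exp (- \<mu> k * t)) * (coord x0 k + ?I t) + (0 + exp (\<nu> k * t) * coord (B (Y t)) k) * exp (- \<mu> k * t)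
        = - \<mu> k * coord (X t) k + coord (B (X t)) k"
    proof -
      have "B (X t) = exp (\<gamma> * t) *\<^sub>R B (Y t)"
        unfolding X_def using linear_cmul[OF bounded_linear.linear[OF B]] by simp
      moreover have "exp (\<nu> k * t) * exp (- \<mu> k * t) = exp (\<gamma> * t)" by (simp add: \<nu>_def exp_add[symmetric] algebra_simps)
      ultimately show ?thesis unfolding Xk[OF t] by (simp add: algebra_simps)
    qed
    ultimately have "((\<lambda>t. exp (- \<mu> k * t) * (coord x0 k + ?I t)) has_real_derivative (- \<mu> k * coord (X t) k + coord (B (X t)) k)) (at t within {0..T})"
      by simp
    then show "((\<lambda>t. coord (X t) k) has_real_derivative (- \<mu> k * coord (X t) k + coord (B (X t)) k)) (at t within {0..T})"
      by (rule has_field_derivative_transform_within[where d = 1]) (use t Xk in auto)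
  qed
qed

context rect
begin

text \<open>Sine coefficients of minus the weak Laplacian of \<open>w\<close>. Taking them from that
  function gives an element of \<open>ell2\<close> at once; the identification with
  \<open>lam k * ip M w (e k)\<close> uses the boundary condition.\<close>

definition lapcoef :: "(real ^ 'n \<Rightarrow> real) \<Rightarrow> ('n \<Rightarrow> nat) ell2" where
  "lapcoef w = - fcoef (\<lambda>x. \<Sum>i\<in>UNIV. weak_deriv \<Omega> (axis i 1) (weak_deriv \<Omega> (axis i 1) w) x)"

lemma lapcoef:
  assumes w: "w \<in> H2 \<Omega>" "w \<in> H10 \<Omega>"
  shows coord_lapcoef: "coord (lapcoef w) k = lam k * ip M w (e k)"
    and norm_lapcoef: "norm (lapcoef w) \<le> real CARD('n) * H2_norm \<Omega> w"
proof -
  let ?d = "\<lambda>i. weak_deriv \<Omega> (axis i 1) (weak_deriv \<Omega> (axis i 1) w)"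
  have sd: "sq_int M (?d i)" for i
    using H2D(3)[OF open_Om w(1) axis_Basis axis_Basis, of i i] by (simp add: has_weak_deriv_iff)
  have s: "sq_int M (\<lambda>x. \<Sum>i\<in>UNIV. ?d i x)" by (rule sq_int_sum) (rule sd)
  have "ip M (\<lambda>x. \<Sum>i\<in>UNIV. ?d i x) (e k) = (\<Sum>i\<in>UNIV. - (wt k i)\<^sup>2 * ip M w (e k))"
    by (subst ip_sum_left) (auto simp: sd trig_sq_int H2_H10_eigen[OF w])
  then show "coord (lapcoef w) k = lam k * ip M w (e k)"
    by (simp add: lapcoef_def coord_fcoef[OF s] lam_def sum_distrib_right sum_negf)
  have "norm (lapcoef w) = nrm M (\<lambda>x. \<Sum>i\<in>UNIV. ?d i x)" by (simp add: lapcoef_def norm_fcoef[OF s])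
  also have "\<dots> \<le> (\<Sum>i\<in>UNIV. nrm M (?d i))" by (rule nrm_sum) (rule sd)
  also have "\<dots> \<le> (\<Sum>i\<in>(UNIV :: 'n set). H2_norm \<Omega> w)"
    by (intro sum_mono H2D(5)[OF open_Om w(1)] axis_Basis)
  finally show "norm (lapcoef w) \<le> real CARD('n) * H2_norm \<Omega> w" by simp
qed

section \<open>Functions on the space-time cylinder\<close>

abbreviation "MQ T \<equiv> lebesgue_on (cylinder \<Omega> T)"

lemma open_cylinder: "open (cylinder \<Omega> T)"
  unfolding cylinder_def by (intro open_Times open_box open_greaterThanLessThan)

lemma space_Basis: "(axis i (1::real) :: real ^ 'n, 0 :: real) \<in> Basis" "(0 :: real ^ 'n, 1 :: real) \<in> Basis"
  by (auto simp: Basis_prod_def axis_Basis)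

lemma borel_measurable_MQ: "g \<in> borel_measurable borel \<Longrightarrow> g \<in> borel_measurable (MQ T)"
  by (intro measurable_restrict_space1 measurable_completion) simp

lemma nn_integral_lebesgue_on_borel:
  fixes g :: "'a::euclidean_space \<Rightarrow> ennreal"
  assumes "g \<in> borel_measurable borel" "U \<in> sets borel"
  shows "(\<integral>\<^sup>+x. g x \<partial>lebesgue_on U) = (\<integral>\<^sup>+x. g x * indicator U x \<partial>lborel)"
  using assms by (simp add: nn_integral_restrict_space nn_integral_completion)

text \<open>Tonelli's theorem for a Borel integrand. With \<open>R = 0\<close> it shows that a
  function whose slices vanish in norm vanishes on the cylinder.\<close>

lemma cylinder_slices:
  assumes g: "g \<in> borel_measurable borel" and T: "0 \<le> T" and R: "0 \<le> R"
    and s: "\<And>t. t \<in> {0<..<T} \<Longrightarrow> sq_int M (\<lambda>x. g (x, t))" "\<And>t. t \<in> {0<..<T} \<Longrightarrow> nrm M (\<lambda>x. g (x, t)) \<le> R"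
  shows "sq_int (MQ T) g" "nrm (MQ T) g \<le> sqrt T * R"
proof -
  note g [measurable]
  have cyl: "cylinder \<Omega> T \<in> sets borel" by (intro borel_open open_cylinder)
  have "(\<integral>\<^sup>+z. ennreal ((g z)\<^sup>2) \<partial>MQ T) = (\<integral>\<^sup>+z. ennreal ((g z)\<^sup>2) * indicator (cylinder \<Omega> T) z \<partial>lborel)"
    by (rule nn_integral_lebesgue_on_borel) (use cyl in auto)
  also have "\<dots> = (\<integral>\<^sup>+z. ennreal ((g z)\<^sup>2) * indicator (cylinder \<Omega> T) z \<partial>(lborel \<Otimes>\<^sub>M lborel))"
    by (simp add: lborel_prod)
  also have "\<dots> = (\<integral>\<^sup>+t. (\<integral>\<^sup>+x. ennreal ((g (x, t))\<^sup>2) * indicator (cylinder \<Omega> T) (x, t) \<partial>lborel) \<partial>lborel)"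
    by (rule lborel_pair.nn_integral_snd[symmetric]) (use cyl in \<open>simp add: lborel_prod\<close>)
  also have "\<dots> \<le> (\<integral>\<^sup>+t. ennreal (R\<^sup>2) * indicator {0<..<T} t \<partial>lborel)"
  proof (rule nn_integral_mono)
    fix t :: real
    show "(\<integral>\<^sup>+x. ennreal ((g (x, t))\<^sup>2) * indicator (cylinder \<Omega> T) (x, t) \<partial>lborel) \<le> ennreal (R\<^sup>2) * indicator {0<..<T} t"
    proof (cases "t \<in> {0<..<T}")
      case True
      have "(\<integral>\<^sup>+x. ennreal ((g (x, t))\<^sup>2) * indicator (cylinder \<Omega> T) (x, t) \<partial>lborel) = (\<integral>\<^sup>+x. ennreal ((g (x, t))\<^sup>2) * indicator \<Omega> x \<partial>lborel)"
        using True by (intro nn_integral_cong) (auto simp: cylinder_def indicator_def)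
      also have "\<dots> = (\<integral>\<^sup>+x. ennreal ((g (x, t))\<^sup>2) \<partial>M)"
        by (rule nn_integral_lebesgue_on_borel[symmetric]) auto
      also have "\<dots> = ennreal ((nrm M (\<lambda>x. g (x, t)))\<^sup>2)" by (rule nn_integral_sq_int[OF s(1)[OF True]])
      also have "\<dots> \<le> ennreal (R\<^sup>2)" using s(2)[OF True] by (intro ennreal_leI power_mono) auto
      finally show ?thesis using True by simp
    qed (simp add: cylinder_def)
  qed
  also have "\<dots> = ennreal (R\<^sup>2) * emeasure lborel {0<..<T}" by (rule nn_integral_cmult_indicator) simp
  also have "\<dots> = ennreal ((sqrt T * R)\<^sup>2)"
    using T by (simp add: ennreal_mult power_mult_distrib mult.commute)
  finally have le: "(\<integral>\<^sup>+z. ennreal ((g z)\<^sup>2) \<partial>MQ T) \<le> ennreal ((sqrt T * R)\<^sup>2)" .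
  show "sq_int (MQ T) g" "nrm (MQ T) g \<le> sqrt T * R"
    using sq_int_nn_integral[OF borel_measurable_MQ[OF g] le] T R by auto
qed

lemma bounded_curve:
  fixes y :: "real \<Rightarrow> ('n \<Rightarrow> nat) ell2"
  assumes "continuous_on {0..T} y"
  obtains R where "0 \<le> R" "\<And>t. t \<in> {0..T} \<Longrightarrow> norm (y t) \<le> R"
proof -
  have "bounded (y ` {0..T})" by (intro compact_imp_bounded compact_continuous_image assms) auto
  then obtain R where R: "\<forall>t\<in>{0..T}. norm (y t) \<le> R" unfolding bounded_iff by auto
  show thesis
  proof (rule that[of "max R 0"])
    show "norm (y t) \<le> max R 0" if "t \<in> {0..T}" for t using R that by (intro max.coboundedI1) blast
  qed simp
qed

lemma joint_sq_int:
  assumes U: "U \<in> borel_measurable borel" "\<And>t. t \<in> {0..T} \<Longrightarrow> rep D (y t) (\<lambda>x. U (x, t))"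
    and y: "continuous_on {0..T} y" and T: "0 \<le> T"
  shows "sq_int (MQ T) U"
proof -
  obtain R where R: "0 \<le> R" "\<And>t. t \<in> {0..T} \<Longrightarrow> norm (y t) \<le> R" using bounded_curve[OF y] by blast
  show ?thesis
  proof (rule cylinder_slices(1)[OF U(1) T R(1)])
    fix t assume "t \<in> {0<..<T}"
    then have t: "t \<in> {0..T}" by simp
    show "sq_int M (\<lambda>x. U (x, t))" by (rule rep_sq_int[OF U(2)[OF t]])
    show "nrm M (\<lambda>x. U (x, t)) \<le> R" using rep_nrm[OF U(2)[OF t]] R(2)[OF t] by linarith
  qed
qed

lemma continuous_mode:
  assumes y: "continuous_on UNIV y"
  shows "continuous_on A (\<lambda>z. coord (y (snd z)) k * trig D k (fst z))"
  by (intro continuous_on_mult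
      continuous_on_compose2[OF bounded_linear.continuous_on[OF bounded_linear_coord y]]
      continuous_on_compose2[OF trig_continuous] continuous_on_fst continuous_on_snd continuous_on_id) auto

text \<open>Weak derivatives on the cylinder are checked mode by mode; uniformity of the tails in time
  carries them over to the limit.\<close>

lemma joint_weak_deriv:
  assumes T: "0 \<le> T" and E: "E \<in> Basis"
    and y: "continuous_on UNIV y" and d: "continuous_on UNIV d"
    and U: "U \<in> borel_measurable borel" "\<And>t. t \<in> {0..T} \<Longrightarrow> rep D (y t) (\<lambda>x. U (x, t))"
    and W: "W \<in> borel_measurable borel" "\<And>t. t \<in> {0..T} \<Longrightarrow> rep D' (d t) (\<lambda>x. W (x, t))"
    and mode: "\<And>k z. z \<in> cylinder \<Omega> T \<Longrightarrow> ((\<lambda>s. coord (y (snd (z + s *\<^sub>R E))) k * trig D k (fst (z + s *\<^sub>R E)))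
        has_real_derivative coord (d (snd z)) k * trig D' k (fst z)) (at 0)"
  shows "has_weak_deriv (cylinder \<Omega> T) E U W"
proof -
  have y': "continuous_on {0..T} y" and d': "continuous_on {0..T} d" using y d by (auto intro: continuous_on_subset)
  have msq: "sq_int (MQ T) (\<lambda>z. coord (y (snd z)) k * trig D k (fst z))"
    if y: "continuous_on UNIV y" for y k D
  proof -
    have y': "continuous_on {0..T} y" using y by (rule continuous_on_subset) auto
    obtain R where R: "0 \<le> R" "\<And>t. t \<in> {0..T} \<Longrightarrow> norm (y t) \<le> R" using bounded_curve[OF y'] by blast
    have t1: "nrm M (trig D k) = 1"
      using nrm_trig_sum[of "{k}" "\<lambda>_. 1" D] by (simp add: power2_eq_1_iff) (smt (verit) nrm_nonneg)
    show ?thesis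
    proof (rule cylinder_slices(1)[OF borel_measurable_continuous_onI[OF continuous_mode[OF y]] T R(1)])
      fix t assume "t \<in> {0<..<T}"
      then have t: "t \<in> {0..T}" by simp
      show "sq_int M (\<lambda>x. coord (y (snd (x, t))) k * trig D k (fst (x, t)))" unfolding fst_conv snd_conv
        by (rule sq_int_cmult) (rule trig_sq_int)
      show "nrm M (\<lambda>x. coord (y (snd (x, t))) k * trig D k (fst (x, t))) \<le> R"
        unfolding fst_conv snd_conv nrm_cmult t1 using abs_coord_le[of "y t" k] R(2)[OF t] by simp
    qed
  qed
  have modes: "has_weak_deriv (cylinder \<Omega> T) E (\<lambda>z. coord (y (snd z)) k * trig D k (fst z)) (\<lambda>z. coord (d (snd z)) k * trig D' k (fst z))" for k
    by (rule has_weak_deriv_classical[OF open_cylinder E continuous_mode[OF y] continuous_mode[OF d] msq[OF y] msq[OF d] mode])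
  have "\<exists>F. finite F \<and> (\<forall>x\<in>y ` {0..T} \<union> d ` {0..T}. norm (x - proj F x) < inverse (real (Suc n)))" for n
    by (rule tail_uniform) (intro compact_Un compact_continuous_image y' d' compact_Icc, simp)
  then have "\<forall>n. \<exists>F. finite F \<and> (\<forall>x\<in>y ` {0..T} \<union> d ` {0..T}. norm (x - proj F x) < inverse (real (Suc n)))" by blast
  from choice[OF this] obtain F where F: "\<And>n. finite (F n)"
    "\<And>n t. t \<in> {0..T} \<Longrightarrow> norm (y t - proj (F n) (y t)) < inverse (real (Suc n))"
    "\<And>n t. t \<in> {0..T} \<Longrightarrow> norm (d t - proj (F n) (d t)) < inverse (real (Suc n))" by blast
  define s where "s n z = (\<Sum>k\<in>F n. coord (y (snd z)) k * trig D k (fst z))" for n z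
  define s' where "s' n z = (\<Sum>k\<in>F n. coord (d (snd z)) k * trig D' k (fst z))" for n z
  have ws: "has_weak_deriv (cylinder \<Omega> T) E (s n) (s' n)" for n
    unfolding s_def[abs_def] s'_def[abs_def] by (intro has_weak_deriv_sum[OF open_cylinder E] modes)
  have lim: "(\<lambda>n. nrm (MQ T) (\<lambda>z. (\<Sum>k\<in>F n. coord (y (snd z)) k * trig D k (fst z)) - U z)) \<longlonglongrightarrow> 0"
    if y: "continuous_on UNIV y" and U: "U \<in> borel_measurable borel" "\<And>t. t \<in> {0..T} \<Longrightarrow> rep D (y t) (\<lambda>x. U (x, t))"
      and tail: "\<And>n t. t \<in> {0..T} \<Longrightarrow> norm (y t - proj (F n) (y t)) < inverse (real (Suc n))" for y D U
  proof (rule tendsto_sandwich[OF _ _ tendsto_const])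
    show "\<forall>\<^sub>F n in sequentially. nrm (MQ T) (\<lambda>z. (\<Sum>k\<in>F n. coord (y (snd z)) k * trig D k (fst z)) - U z) \<le> sqrt T * inverse (real (Suc n))"
    proof (intro always_eventually allI)
      fix n
      have cs: "continuous_on UNIV (\<lambda>z. \<Sum>k\<in>F n. coord (y (snd z)) k * trig D k (fst z))"
        by (intro continuous_on_sum continuous_mode y)
      have ps: "(\<Sum>k\<in>F n. coord (y t) k * trig D k x) = psum D (y t) (F n) x" for t x by (simp add: psum_def)
      show "nrm (MQ T) (\<lambda>z. (\<Sum>k\<in>F n. coord (y (snd z)) k * trig D k (fst z)) - U z) \<le> sqrt T * inverse (real (Suc n))"
      proof (rule cylinder_slices(2)[OF borel_measurable_diff[OF borel_measurable_continuous_onI[OF cs] U(1)] T])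
        fix t assume "t \<in> {0<..<T}"
        then have t: "t \<in> {0..T}" by simp
        show "sq_int M (\<lambda>x. (\<Sum>k\<in>F n. coord (y (snd (x, t))) k * trig D k (fst (x, t))) - U (x, t))"
          unfolding fst_conv snd_conv ps by (intro sq_int_diff psum_sq_int rep_sq_int[OF U(2)[OF t]])
        have "nrm M (\<lambda>x. psum D (y t) (F n) x - U (x, t)) \<le> norm (y t - proj (F n) (y t))"
          using U(2)[OF t] F(1)[of n] by (simp add: rep_def)
        then show "nrm M (\<lambda>x. (\<Sum>k\<in>F n. coord (y (snd (x, t))) k * trig D k (fst (x, t))) - U (x, t)) \<le> inverse (real (Suc n))"
          unfolding fst_conv snd_conv ps using tail[OF t, of n] by linarith
      qed simp
    qed
    have "(\<lambda>n. sqrt T * inverse (real (Suc n))) \<longlonglongrightarrow> sqrt T * 0" by (intro tendsto_intros LIMSEQ_inverse_real_of_nat)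
    then show "(\<lambda>n. sqrt T * inverse (real (Suc n))) \<longlonglongrightarrow> 0" by simp
  qed simp
  show ?thesis
  proof (rule has_weak_deriv_limit[OF open_cylinder E ws])
    show "sq_int (MQ T) U" by (rule joint_sq_int[OF U y' T])
    show "sq_int (MQ T) W" by (rule joint_sq_int[OF W d' T])
    show "(\<lambda>n. nrm (MQ T) (\<lambda>z. s n z - U z)) \<longlonglongrightarrow> 0" unfolding s_def by (rule lim[OF y U F(2)])
    show "(\<lambda>n. nrm (MQ T) (\<lambda>z. s' n z - W z)) \<longlonglongrightarrow> 0" unfolding s'_def by (rule lim[OF d W F(3)])
  qed
qed

text \<open>The unknown \<open>X\<close> collects the coefficients multiplied by \<open>lam\<close>,
  so continuity of \<open>X\<close> in \<open>ell2\<close> is continuity of the solution in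
  \<open>H2\<close>. The solution and all derivatives in the definition are synthesised from bounded
  operators applied to \<open>X\<close>; the equation holds since its residual has vanishing
  coefficients at every time.\<close>

lemma solution_exists:
  assumes q: "q \<in> cospoly" and T: "0 < T" and u0: "u\<^sub>0 \<in> H2 \<Omega>" "u\<^sub>0 \<in> H10 \<Omega>"
  shows "\<exists>u. is_solution \<Omega> T (\<lambda>z. q (fst z)) u\<^sub>0 u"
proof -
  obtain B where B: "domain_multiplier q B" using cospoly_domain_multiplier[OF q] by blast
  have Bl: "bounded_linear B" using B by (simp add: domain_multiplier_def)
  have T0: "0 \<le> T" using T by simp
  obtain X0 where X0: "continuous_on {0..T} X0" "X0 0 = lapcoef u\<^sub>0"
    "\<And>t k. t \<in> {0..T} \<Longrightarrow> ((\<lambda>t. coord (X0 t) k) has_real_derivative (- lam k * coord (X0 t) k + coord (B (X0 t)) k)) (at t within {0..T})"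
    using evolution_exists[of lam B T "lapcoef u\<^sub>0", OF less_imp_le[OF lam_pos] Bl T0] by blast
  define \<tau> where "\<tau> t = max 0 (min T t)" for t
  have \<tau>: "\<tau> t \<in> {0..T}" for t using T by (auto simp: \<tau>_def)
  have \<tau>c: "continuous_on UNIV \<tau>" unfolding \<tau>_def by (intro continuous_intros)
  \<comment> \<open>Frozen outside the time interval, to have curves that are continuous on the
    whole line.\<close>
  define X where "X t = X0 (\<tau> t)" for t
  have Xc: "continuous_on UNIV X"
    unfolding X_def by (rule continuous_on_compose2[OF X0(1) \<tau>c]) (use \<tau> in auto)
  have XX0: "X t = X0 t" if "t \<in> {0..T}" for t using that by (simp add: X_def \<tau>_def)
  have Xd: "((\<lambda>t. coord (X t) k) has_real_derivative (- lam k * coord (X t) k + coord (B (X t)) k)) (at t)" if t: "t \<in> {0<..<T}" for t k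
  proof -
    have "((\<lambda>t. coord (X0 t) k) has_real_derivative (- lam k * coord (X0 t) k + coord (B (X0 t)) k)) (at t)"
      using X0(3)[of t k] t at_within_interior[of t "{0..T}"] by simp
    then have "((\<lambda>t. coord (X t) k) has_real_derivative (- lam k * coord (X0 t) k + coord (B (X0 t)) k)) (at t)"
      by (rule has_field_derivative_transform_within_open[where S = "{0<..<T}"]) (use t XX0 in auto)
    then show ?thesis using t XX0 by simp
  qed
  define C where "C t = mulop (\<lambda>k. 1 / lam k) (X t)" for t
  define D1 where "D1 i t = mulop (\<lambda>k. wt k i / lam k) (X t)" for i t
  define D2 where "D2 i j t = mulop (\<lambda>k. dsign j {i} * (wt k i * wt k j / lam k)) (X t)" for i j t
  \<comment> \<open>Coefficients of the time derivative: the evolution equation for \<open>X\<close>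
    divided by \<open>lam k\<close>.\<close>
  define V where "V t = mulop (\<lambda>k. 1 / lam k) (B (X t)) - X t" for t
  have Cc: "coord (C t) k = coord (X t) k / lam k" for t k by (simp add: C_def coord_mulop[OF mult_bound_0])
  have D1c: "coord (D1 i t) k = wt k i / lam k * coord (X t) k" for i t k by (simp add: D1_def coord_mulop[OF mult_bound_1])
  have D2c: "coord (D2 i j t) k = dsign j {i} * (wt k i * wt k j / lam k) * coord (X t) k" for i j t k
    unfolding D2_def by (rule coord_mulop[OF mult_bound_2'])
  have Vc: "coord (V t) k = coord (B (X t)) k / lam k - coord (X t) k" for t k by (simp add: V_def coord_mulop[OF mult_bound_0])
  have BX: "continuous_on UNIV (\<lambda>t. B (X t))" by (rule bounded_linear.continuous_on[OF Bl Xc])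
  have cC: "continuous_on UNIV C" unfolding C_def[abs_def]
    by (rule bounded_linear.continuous_on[OF bounded_linear_mulop[OF mult_bound_0] Xc])
  have cD1: "continuous_on UNIV (D1 i)" for i unfolding D1_def[abs_def]
    by (rule bounded_linear.continuous_on[OF bounded_linear_mulop[OF mult_bound_1] Xc])
  have cD2: "continuous_on UNIV (D2 i j)" for i j unfolding D2_def[abs_def]
    by (rule bounded_linear.continuous_on[OF bounded_linear_mulop[OF mult_bound_2'] Xc])
  have cV: "continuous_on UNIV V" unfolding V_def[abs_def]
    by (intro continuous_on_diff bounded_linear.continuous_on[OF bounded_linear_mulop[OF mult_bound_0] BX] Xc)
  have syn: "\<exists>U. U \<in> borel_measurable borel \<and> (\<forall>t\<in>{0..T}. rep D (y t) (\<lambda>x. U (x, t)))" if "continuous_on UNIV y" for D y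
    by (rule joint_synthesis[OF T0 continuous_on_subset[OF that], of D]) auto
  obtain u where u: "u \<in> borel_measurable borel" "\<And>t. t \<in> {0..T} \<Longrightarrow> rep {} (C t) (\<lambda>x. u (x, t))"
    using syn[OF cC] by blast
  obtain v where v: "v \<in> borel_measurable borel" "\<And>t. t \<in> {0..T} \<Longrightarrow> rep {} (V t) (\<lambda>x. v (x, t))"
    using syn[OF cV] by blast
  have "\<forall>i. \<exists>U. U \<in> borel_measurable borel \<and> (\<forall>t\<in>{0..T}. rep {i} (D1 i t) (\<lambda>x. U (x, t)))"
    by (intro allI syn cD1)
  from choice[OF this] obtain g where g: "\<And>i. g i \<in> borel_measurable borel" "\<And>i t. t \<in> {0..T} \<Longrightarrow> rep {i} (D1 i t) (\<lambda>x. g i (x, t))"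
    by blast
  have "\<forall>p. \<exists>U. U \<in> borel_measurable borel \<and> (\<forall>t\<in>{0..T}. rep (flip (snd p) {fst p}) (D2 (fst p) (snd p) t) (\<lambda>x. U (x, t)))"
    by (intro allI syn cD2)
  from choice[OF this] obtain h where h: "\<And>p. h p \<in> borel_measurable borel"
    "\<And>p t. t \<in> {0..T} \<Longrightarrow> rep (flip (snd p) {fst p}) (D2 (fst p) (snd p) t) (\<lambda>x. h p (x, t))"
    by blast
  let ?Q = "cylinder \<Omega> T"
  have wx: "has_weak_deriv ?Q (axis i 1, 0) U W"
    if y: "continuous_on UNIV y" and d: "continuous_on UNIV d"
      and U: "U \<in> borel_measurable borel" "\<And>t. t \<in> {0..T} \<Longrightarrow> rep D (y t) (\<lambda>x. U (x, t))"
      and W: "W \<in> borel_measurable borel" "\<And>t. t \<in> {0..T} \<Longrightarrow> rep (flip i D) (d t) (\<lambda>x. W (x, t))"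
      and dy: "\<And>t k. coord (d t) k = dsign i D * wt k i * coord (y t) k" for y d U W D i
  proof (rule joint_weak_deriv[OF T0 space_Basis(1) y d U W])
    fix k z
    have "((\<lambda>s. coord (y (snd z)) k * trig D k (fst z + s *\<^sub>R axis i 1)) has_real_derivative
        coord (y (snd z)) k * (dsign i D * wt k i * trig (flip i D) k (fst z))) (at 0)"
      by (rule DERIV_cmult[OF trig_deriv])
    then show "((\<lambda>s. coord (y (snd (z + s *\<^sub>R (axis i 1, 0)))) k * trig D k (fst (z + s *\<^sub>R (axis i 1, 0))))
        has_real_derivative coord (d (snd z)) k * trig (flip i D) k (fst z)) (at 0)"
      by (simp add: dy mult_ac)
  qed
  have w1: "has_weak_deriv ?Q (axis i 1, 0) u (g i)" for i
  proof (rule wx[OF cC cD1 u])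
    show "rep (flip i {}) (D1 i t) (\<lambda>x. g i (x, t))" if "t \<in> {0..T}" for t using g(2)[OF that] by (simp add: flip_def)
  qed (use g(1) in \<open>simp_all add: Cc D1c dsign_def\<close>)
  have w2: "has_weak_deriv ?Q (axis j 1, 0) (g i) (h (i, j))" for i j
  proof (rule wx[OF cD1 cD2 g])
    show "h (i, j) \<in> borel_measurable borel" by (rule h(1))
    show "rep (flip j {i}) (D2 i j t) (\<lambda>x. h (i, j) (x, t))" if "t \<in> {0..T}" for t using h(2)[OF that, of "(i, j)"] by simp
  qed (simp_all add: D1c D2c mult_ac)
  have wt: "has_weak_deriv ?Q (0, 1) u v"
  proof (rule joint_weak_deriv[OF T0 space_Basis(2) cC cV u v])
    fix k z assume "z \<in> ?Q"
    then have t: "snd z \<in> {0<..<T}" by (auto simp: cylinder_def)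
    have d: "((\<lambda>s. coord (X (snd z + s)) k) has_real_derivative (- lam k * coord (X (snd z)) k + coord (B (X (snd z))) k)) (at 0)"
      using Xd[OF t, of k] DERIV_shift[of "\<lambda>t. coord (X t) k" "- lam k * coord (X (snd z)) k + coord (B (X (snd z))) k" 0 "snd z"]
      by (simp add: add.commute)
    have eq: "(- lam k * coord (X (snd z)) k + coord (B (X (snd z))) k) / lam k = coord (V (snd z)) k"
      using lam_pos[of k] by (simp add: Vc field_simps)
    have "((\<lambda>s. coord (X (snd z + s)) k / lam k * e k (fst z)) has_real_derivative coord (V (snd z)) k * e k (fst z)) (at 0)"
      unfolding eq[symmetric] by (rule DERIV_cmult_right[OF DERIV_cdivide[OF d]])
    then show "((\<lambda>s. coord (C (snd (z + s *\<^sub>R (0, 1)))) k * e k (fst (z + s *\<^sub>R (0, 1))))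
        has_real_derivative coord (V (snd z)) k * e k (fst z)) (at 0)"
      by (simp add: Cc)
  qed
  have coefu: "lam k * ip M (\<lambda>x. u (x, t)) (e k) = coord (X t) k" if "t \<in> {0..T}" for t k
    using rep_ip[OF u(2)[OF that], of k] lam_pos[of k] by (simp add: Cc)
  have squ: "sq_int M (\<lambda>x. u (x, t))" if "t \<in> {0..T}" for t by (rule rep_sq_int[OF u(2)[OF that]])
  have BasisD: "\<exists>i. w = axis i 1" if "w \<in> Basis" for w :: "real ^ 'n" using that by (auto simp: Basis_axis)
  have H21: "u \<in> H21 \<Omega> T"
    unfolding H21_def
  proof (intro CollectI conjI ballI)
    show "u \<in> L2 ?Q" using w1 by (simp add: L2_iff_sq_int has_weak_deriv_iff)
    show "\<exists>g. has_weak_deriv ?Q (0, 1) u g" using wt by blast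
    fix w :: "real ^ 'n" assume "w \<in> Basis"
    then obtain i where "w = axis i 1" using BasisD by blast
    moreover have "\<exists>h. has_weak_deriv ?Q (d, 0) (g i) h" if "d \<in> Basis" for d using BasisD[OF that] w2 by blast
    ultimately show "\<exists>g. has_weak_deriv ?Q (w, 0) u g \<and> (\<forall>d\<in>Basis. \<exists>h. has_weak_deriv ?Q (d, 0) g h)"
      using w1 by blast
  qed
  have CH: "u \<in> C_H2_H10 \<Omega> T"
    unfolding C_H2_H10_def
  proof (intro CollectI ballI conjI IntI)
    fix t assume t: "t \<in> {0..T}"
    show "(\<lambda>x. u (x, t)) \<in> H2 \<Omega>" "(\<lambda>x. u (x, t)) \<in> H10 \<Omega>"
      using e_coefficients_H2_H10[OF squ[OF t] coefu[OF t]] by auto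
    \<comment> \<open>Any direction may play the part of \<open>i0\<close>; it occurs only in the
      constant.\<close>
    define K where "K = sqrt ((len (SOME i. True) / pi) ^ 4 + (\<Sum>i\<in>UNIV. (len i / pi)\<^sup>2) + real CARD('n) * real CARD('n))"
    have b: "H2_norm \<Omega> (\<lambda>x. u (x, s) - u (x, t)) \<le> K * norm (X s - X t)" if s: "s \<in> {0..T}" for s
      unfolding K_def
    proof (rule e_coefficients_H2_H10(3))
      show "sq_int M (\<lambda>x. u (x, s) - u (x, t))" by (rule sq_int_diff[OF squ[OF s] squ[OF t]])
      show "lam k * ip M (\<lambda>x. u (x, s) - u (x, t)) (e k) = coord (X s - X t) k" for k
        using coefu[OF s, of k] coefu[OF t, of k] squ s t by (simp add: ip_diff_left trig_sq_int right_diff_distrib)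
    qed
    have "continuous_on {0..T} X" using Xc by (rule continuous_on_subset) simp
    then have "(X \<longlongrightarrow> X t) (at t within {0..T})" using t by (simp add: continuous_on_def)
    then have "((\<lambda>s. K * norm (X s - X t)) \<longlongrightarrow> K * norm (X t - X t)) (at t within {0..T})" by (intro tendsto_intros)
    then have K0: "((\<lambda>s. K * norm (X s - X t)) \<longlongrightarrow> 0) (at t within {0..T})" by simp
    show "((\<lambda>s. H2_norm \<Omega> (\<lambda>x. u (x, s) - u (x, t))) \<longlongrightarrow> 0) (at t within {0..T})"
    proof (rule Lim_null_comparison[OF _ K0])
      have "0 \<le> H2_norm \<Omega> w" for w unfolding H2_norm_def by (simp add: sum_nonneg)
      then show "\<forall>\<^sub>F s in at t within {0..T}. norm (H2_norm \<Omega> (\<lambda>x. u (x, s) - u (x, t))) \<le> K * norm (X s - X t)"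
        using b by (auto simp: eventually_at_filter)
    qed
  qed
  have qc: "continuous_on UNIV (\<lambda>z :: (real ^ 'n) \<times> real. q (fst z))"
    by (rule continuous_on_compose2[OF cospoly_continuous[OF q, of UNIV] continuous_on_fst[OF continuous_on_id]]) simp
  \<comment> \<open>The residual of the equation. It is Borel on space-time and zero in the norm of
    every slice, hence zero almost everywhere on the cylinder.\<close>
  define r where "r z = v z - (\<Sum>i\<in>UNIV. h (i, i) z) - q (fst z) * u z" for z
  have rb: "r \<in> borel_measurable borel"
    unfolding r_def[abs_def] using v(1) h(1) u(1) borel_measurable_continuous_onI[OF qc]
    by (intro borel_measurable_diff borel_measurable_sum borel_measurable_times)
  have rs: "sq_int M (\<lambda>x. r (x, t)) \<and> nrm M (\<lambda>x. r (x, t)) = 0" if t: "t \<in> {0..T}" for t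
  proof -
    have s1: "sq_int M (\<lambda>x. v (x, t))" by (rule rep_sq_int[OF v(2)[OF t]])
    have s2: "sq_int M (\<lambda>x. h (i, i) (x, t))" for i by (rule rep_sq_int[OF h(2)[OF t]])
    have s2': "sq_int M (\<lambda>x. \<Sum>i\<in>UNIV. h (i, i) (x, t))" by (rule sq_int_sum) (rule s2)
    have s3: "sq_int M (\<lambda>x. q x * u (x, t))" by (rule cospoly_sq_int[OF q squ[OF t]])
    have s: "sq_int M (\<lambda>x. r (x, t))" unfolding r_def fst_conv by (intro sq_int_diff s1 s2' s3)
    have "ip M (\<lambda>x. r (x, t)) (e k) = 0" for k
    proof -
      have hi: "ip M (\<lambda>x. h (i, i) (x, t)) (e k) = - ((wt k i)\<^sup>2 / lam k * coord (X t) k)" for i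
      proof -
        have f: "flip i {i} = {}" by (simp add: flip_def)
        show ?thesis using rep_ip[OF h(2)[OF t, of "(i, i)", unfolded fst_conv snd_conv f], of k]
          by (simp add: D2c dsign_def power2_eq_square)
      qed
      have "ip M (\<lambda>x. \<Sum>i\<in>UNIV. h (i, i) (x, t)) (e k) = (\<Sum>i\<in>UNIV. - ((wt k i)\<^sup>2 / lam k * coord (X t) k))"
        unfolding hi[symmetric] by (rule ip_sum_left[OF s2 trig_sq_int])
      also have "\<dots> = - ((\<Sum>i\<in>UNIV. (wt k i)\<^sup>2) / lam k * coord (X t) k)"
        by (simp add: sum_negf sum_distrib_right sum_divide_distrib)
      also have "\<dots> = - coord (X t) k" using lam_pos[of k] by (simp flip: lam_def)
      finally have 2: "ip M (\<lambda>x. \<Sum>i\<in>UNIV. h (i, i) (x, t)) (e k) = - coord (X t) k" .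
      have 1: "ip M (\<lambda>x. v (x, t)) (e k) = coord (B (X t)) k / lam k - coord (X t) k"
        using rep_ip[OF v(2)[OF t], of k] by (simp add: Vc)
      have "lam k * ip M (\<lambda>x. q x * u (x, t)) (e k) = coord (B (X t)) k"
        using B squ[OF t] coefu[OF t] unfolding domain_multiplier_def by blast
      then have 3: "ip M (\<lambda>x. q x * u (x, t)) (e k) = coord (B (X t)) k / lam k" using lam_pos[of k] by (simp add: field_simps)
      show ?thesis
        unfolding r_def fst_conv
        by (subst ip_diff_left, intro sq_int_diff s1 s2', rule s3, rule trig_sq_int,
            subst ip_diff_left[OF s1 s2' trig_sq_int]) (simp add: 1 2 3)
    qed
    then show ?thesis using s zero_coefficients(1)[OF s] by blast
  qed
  have rsq1: "sq_int (MQ T) r"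
    by (rule cylinder_slices(1)[OF rb T0 order_refl]) (use rs in auto)
  have rsq2: "nrm (MQ T) r \<le> sqrt T * 0"
    by (rule cylinder_slices(2)[OF rb T0 order_refl]) (use rs in auto)
  have r0: "AE z in MQ T. r z = 0"
    by (rule nrm_eq_0_AE[OF rsq1]) (use rsq2 nrm_nonneg[of "MQ T" r] in simp)
  have aev: "AE z in MQ T. weak_deriv ?Q (0, 1) u z = v z"
    by (rule weak_deriv_AE[OF open_cylinder space_Basis(2) wt])
  have aeh: "AE z in MQ T. \<forall>i. weak_deriv ?Q (axis i 1, 0) (weak_deriv ?Q (axis i 1, 0) u) z = h (i, i) z"
  proof (subst AE_all_countable, rule allI)
    fix i
    show "AE z in MQ T. weak_deriv ?Q (axis i 1, 0) (weak_deriv ?Q (axis i 1, 0) u) z = h (i, i) z"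
      by (rule weak_deriv_AE[OF open_cylinder space_Basis(1) has_weak_deriv_weak_deriv[OF open_cylinder space_Basis(1) space_Basis(1) w1 w2]])
  qed
  have inj: "inj_on (\<lambda>i::'n. axis i (1::real)) UNIV" by (auto simp: inj_on_def axis_eq_axis)
  have pde: "AE z in MQ T. weak_deriv ?Q (0, 1) u z =
      (\<Sum>w\<in>Basis. weak_deriv ?Q (w, 0) (weak_deriv ?Q (w, 0) u) z) + q (fst z) * u z"
    using r0 aev aeh
  proof eventually_elim
    case (elim z)
    have "(\<Sum>w\<in>Basis. weak_deriv ?Q (w, 0) (weak_deriv ?Q (w, 0) u) z) = (\<Sum>i\<in>UNIV. h (i, i) z)"
      unfolding Basis_axis by (subst sum.reindex[OF inj]) (use elim(3) in simp)
    then show ?case using elim(1,2) by (simp add: r_def)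
  qed
  have t0: "0 \<in> {0..T}" using T by simp
  have squ0: "sq_int M u\<^sub>0" by (rule H2D(1)[OF open_Om u0(1)])
  \<comment> \<open>The curve starts at \<open>lapcoef u\<^sub>0\<close>, so both sides have the
    same sine coefficients, and completeness identifies them.\<close>
  have init: "AE x in M. u (x, 0) = u\<^sub>0 x"
  proof -
    have s: "sq_int M (\<lambda>x. u (x, 0) - u\<^sub>0 x)" by (intro sq_int_diff squ[OF t0] squ0)
    have "ip M (\<lambda>x. u (x, 0) - u\<^sub>0 x) (e k) = 0" for k
    proof -
      have "lam k * ip M (\<lambda>x. u (x, 0)) (e k) = lam k * ip M u\<^sub>0 (e k)"
        using coefu[OF t0, of k] coord_lapcoef[OF u0, of k] XX0[OF t0] X0(2) by simp
      then show ?thesis using lam_pos[of k] by (simp add: ip_diff_left squ[OF t0] squ0 trig_sq_int)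
    qed
    from zero_coefficients(2)[OF s this] show ?thesis by simp
  qed
  show ?thesis
    by (intro exI[of _ u]) (use H21 CH pde init in \<open>simp add: is_solution_def\<close>)
qed

end

subsection \<open>Coefficients of an arbitrary solution\<close>

lemma measurable_on_lebesgue_extend:
  fixes f :: "'a::euclidean_space \<Rightarrow> real"
  assumes "f \<in> borel_measurable (lebesgue_on U)" "U \<in> sets lebesgue"
  shows "(\<lambda>x. indicator U x * f x) \<in> borel_measurable lebesgue"
proof -
  have "(\<lambda>x. if x \<in> U then f x else 0) \<in> borel_measurable lebesgue"
    using assms borel_measurable_if[of U f] by simp
  moreover have "(\<lambda>x. if x \<in> U then f x else 0) = (\<lambda>x. indicator U x * f x)" by auto
  ultimately show ?thesis by simp
qed

lemma borel_measurable_swap: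
  fixes f :: "'a::euclidean_space \<times> 'b::euclidean_space \<Rightarrow> 'c::topological_space"
  assumes "f \<in> borel_measurable borel"
  shows "(\<lambda>(t, x). f (x, t)) \<in> borel_measurable (lborel \<Otimes>\<^sub>M lborel)"
proof -
  have "f \<in> borel_measurable (lborel \<Otimes>\<^sub>M lborel)" using assms by (simp add: lborel_prod)
  then show ?thesis by (rule measurable_pair_swap)
qed

text \<open>\<open>f\<close> is measurable only with respect to the completion. It agrees with a
  Borel function off a null set, almost every slice of which is null by Tonelli's theorem, so the
  slices of the two functions have equal integrals for almost all \<open>t\<close>.\<close>

lemma Fubini_lebesgue:
  fixes f :: "'a::euclidean_space \<times> 'b::euclidean_space \<Rightarrow> real"
  assumes f: "integrable lebesgue f" and sl: "\<And>t. (\<lambda>x. f (x, t)) \<in> borel_measurable lebesgue"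
    and m: "(\<lambda>t. LINT x|lebesgue. f (x, t)) \<in> borel_measurable lebesgue"
  shows "(LINT z|lebesgue. f z) = (LINT t|lebesgue. LINT x|lebesgue. f (x, t))"
proof -
  obtain g where g: "g \<in> borel_measurable lborel" "AE z in lborel. f z = g z"
    using completion_ex_borel_measurable_real[OF borel_measurable_integrable[OF f]] by blast
  have fg: "AE z in lebesgue. f z = g z" by (rule AE_completion[OF g(2)])
  have gl: "g \<in> borel_measurable lebesgue" by (rule measurable_completion[OF g(1)])
  have "integrable lebesgue g"
    by (rule integrable_cong_AE_imp[OF f gl fg])
  then have gi: "integrable lborel g" using g(1) by (simp add: integrable_completion)
  have "(LINT z|lebesgue. f z) = (LINT z|lebesgue. g z)"
    by (rule integral_cong_AE[OF borel_measurable_integrable[OF f] gl fg])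
  also have "\<dots> = (LINT z|lborel. g z)" using g(1) by (rule integral_completion)
  also have "\<dots> = (LINT z|(lborel \<Otimes>\<^sub>M lborel). (\<lambda>(x, t). g (x, t)) z)" by (simp add: lborel_prod)
  also have "\<dots> = (LINT t|lborel. LINT x|lborel. g (x, t))"
    by (rule lborel_pair.integral_snd[symmetric]) (use gi in \<open>simp add: lborel_prod\<close>)
  also have "\<dots> = (LINT t|lebesgue. LINT x|lborel. g (x, t))"
  proof (rule integral_completion[symmetric])
    have "(\<lambda>t. LINT x|lborel. g (x, t)) = (\<lambda>t. LINT x|lborel. (case (t, x) of (t, x) \<Rightarrow> g (x, t)))" by simp
    moreover have "(\<lambda>(t, x). g (x, t)) \<in> borel_measurable (lborel \<Otimes>\<^sub>M lborel)"
      by (rule borel_measurable_swap) (use g(1) in simp)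
    ultimately show "(\<lambda>t. LINT x|lborel. g (x, t)) \<in> lborel \<rightarrow>\<^sub>M borel"
      using lborel.borel_measurable_lebesgue_integral[of "\<lambda>t x. g (x, t)" lborel] by simp
  qed
  also have "\<dots> = (LINT t|lebesgue. LINT x|lebesgue. f (x, t))"
  proof (rule integral_cong_AE[OF _ m])
    obtain N where N: "N \<in> null_sets lborel" "{z \<in> space lborel. f z \<noteq> g z} \<subseteq> N"
      using g(2) unfolding eventually_ae_filter by auto
    have NN: "f z = g z" if "z \<notin> N" for z using N(2) that by auto
    have Nb: "N \<in> sets borel" using N(1) by auto
    have "0 = (\<integral>\<^sup>+z. indicator N z \<partial>(lborel \<Otimes>\<^sub>M lborel))" using null_setsD1[OF N(1)] null_setsD2[OF N(1)] by (simp add: lborel_prod)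
    also have "\<dots> = (\<integral>\<^sup>+t. (\<integral>\<^sup>+x. indicator N (x, t) \<partial>lborel) \<partial>lborel)"
      by (rule lborel_pair.nn_integral_snd[symmetric]) (use Nb in \<open>simp add: lborel_prod\<close>)
    finally have z: "(\<integral>\<^sup>+t. (\<integral>\<^sup>+x. indicator N (x, t) \<partial>lborel) \<partial>lborel) = 0" by simp
    have indN: "(indicator N :: 'a \<times> 'b \<Rightarrow> ennreal) \<in> borel_measurable borel" using Nb by measurable
    have "AE t in lborel. (\<integral>\<^sup>+x. indicator N (x, t) \<partial>lborel) = 0"
    proof (subst nn_integral_0_iff_AE[symmetric])
      have "(\<lambda>(t, x). indicator N (x, t) :: ennreal) \<in> borel_measurable (lborel \<Otimes>\<^sub>M lborel)"
        by (rule borel_measurable_swap) (use indN in simp)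
      then show "(\<lambda>t. \<integral>\<^sup>+x. indicator N (x, t) \<partial>lborel) \<in> borel_measurable lborel"
        using lborel.borel_measurable_nn_integral[of "\<lambda>t x. indicator N (x, t)" lborel] by simp
    qed (rule z)
    then have "AE t in lebesgue. (\<integral>\<^sup>+x. indicator N (x, t) \<partial>lborel) = 0" by (rule AE_completion)
    then show "AE t in lebesgue. (LINT x|lborel. g (x, t)) = (LINT x|lebesgue. f (x, t))"
    proof eventually_elim
      case (elim t)
      have gt: "(\<lambda>x. g (x, t)) \<in> borel_measurable borel" using g(1) by measurable
      have "AE x in lborel. indicator N (x, t) = (0 :: ennreal)"
        using elim by (subst (asm) nn_integral_0_iff_AE) (use indN in measurable)
      then have "AE x in lborel. g (x, t) = f (x, t)"
      proof eventually_elim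
        case (elim x)
        then have "(x, t) \<notin> N" by (auto simp: indicator_def)
        then show ?case by (rule NN[symmetric])
      qed
      then have ae: "AE x in lebesgue. g (x, t) = f (x, t)" by (rule AE_completion)
      have "(LINT x|lborel. g (x, t)) = (LINT x|lebesgue. g (x, t))"
        by (rule integral_completion[symmetric]) (use gt in simp)
      also have "\<dots> = (LINT x|lebesgue. f (x, t))"
        by (rule integral_cong_AE[OF measurable_completion sl ae]) (use gt in simp)
      finally show ?case .
    qed
    show "(\<lambda>t. LINT x|lborel. g (x, t)) \<in> borel_measurable lebesgue"
    proof (rule measurable_completion)
      have "(\<lambda>(t, x). g (x, t)) \<in> borel_measurable (lborel \<Otimes>\<^sub>M lborel)"
        by (rule borel_measurable_swap) (use g(1) in simp)
      then show "(\<lambda>t. LINT x|lborel. g (x, t)) \<in> lborel \<rightarrow>\<^sub>M borel"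
        using lborel.borel_measurable_lebesgue_integral[of "\<lambda>t x. g (x, t)" lborel] by simp
    qed
  qed
  finally show ?thesis .
qed

section \<open>Weak derivatives on a time interval\<close>

lemma finite_measure_interval: "finite_measure (lebesgue_on {0<..<T::real})"
  by (rule finite_measureI, cases "0 \<le> T") (simp_all add: emeasure_restrict_space)

lemma continuous_interval_sq_int:
  assumes "continuous_on {0..T::real} F" shows "sq_int (lebesgue_on {0<..<T}) F"
proof -
  obtain C where C: "\<forall>t\<in>{0..T}. \<bar>F t\<bar> \<le> C"
    using compact_imp_bounded[OF compact_continuous_image[OF assms compact_Icc]] by (auto simp: bounded_iff)
  have "F \<in> borel_measurable (lebesgue_on {0<..<T})"
    by (rule continuous_imp_measurable_on_sets_lebesgue[OF continuous_on_subset[OF assms]]) auto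
  then show ?thesis by (rule sq_int_bounded[OF finite_measure_interval, of _ _ C]) (use C in auto)
qed

text \<open>The antiderivative from the left vanishes before the support; mean zero makes it vanish
  behind the support as well.\<close>

lemma test_antiderivative:
  assumes T: "0 < T" and \<phi>: "\<phi> \<in> test_functions {0<..<T::real}" and mean: "integral {0..T} \<phi> = 0"
  shows "\<exists>\<eta>\<in>test_functions {0<..<T}. \<forall>t. frechet_derivative \<eta> (at t) 1 = \<phi> t"
proof -
  obtain K where K: "compact K" "K \<subseteq> {0<..<T}" "\<And>x. x \<notin> K \<Longrightarrow> \<phi> x = 0" using test_functionsE[OF \<phi>] by metis
  obtain l r where lr: "0 < l" "r < T" "K \<subseteq> {l..r}"
  proof (cases "K = {}")
    case True
    then show thesis using that[of 1 "T - 1"] by auto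
  next
    case False
    obtain l where l: "l \<in> K" "\<And>x. x \<in> K \<Longrightarrow> l \<le> x"
      using continuous_attains_inf[OF K(1) False continuous_on_id] by auto
    obtain r where r: "r \<in> K" "\<And>x. x \<in> K \<Longrightarrow> x \<le> r"
      using continuous_attains_sup[OF K(1) False continuous_on_id] by auto
    show thesis by (rule that[of l r]) (use K(2) l r in auto)
  qed
  have c: "continuous_on A \<phi>" for A
    using Ck_fun_continuous[OF test_functions_smooth[OF \<phi>]] continuous_on_subset by blast
  \<comment> \<open>Starting at \<open>-1\<close>, left of the support, makes every
    \<open>t \<ge> l\<close> an interior point of an interval on which the fundamental theorem
    applies.\<close>
  define \<eta> where "\<eta> t = integral {-1..t} \<phi>" for t
  have z: "integral {u..v} \<phi> = 0" if "\<And>s. s \<in> {u..v} \<Longrightarrow> \<phi> s = 0" for u v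
    using Henstock_Kurzweil_Integration.integral_cong[of "{u..v}" \<phi> "\<lambda>_. 0"] that by simp
  have \<eta>0: "\<eta> t = 0" if "t < l" for t
    unfolding \<eta>_def by (rule z) (use that lr K(3) in force)
  have \<eta>1: "\<eta> t = 0" if t: "t > r" for t
  proof (cases "t < l")
    case False
    then have t0: "0 < t" using lr by simp
    have i: "\<phi> integrable_on {u..v}" for u v by (rule integrable_continuous_real[OF c])
    have "integral {-1..t} \<phi> = integral {-1..0} \<phi> + integral {0..t} \<phi>"
      by (rule Henstock_Kurzweil_Integration.integral_combine[symmetric]) (use t0 i in auto)
    also have "integral {-1..0} \<phi> = 0" by (rule z) (use lr K(3) in force)
    also have "integral {0..t} \<phi> = 0"
    proof (cases "t \<le> T")
      case True
      have "integral {0..T} \<phi> = integral {0..t} \<phi> + integral {t..T} \<phi>"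
        by (rule Henstock_Kurzweil_Integration.integral_combine[symmetric]) (use t0 True i in auto)
      moreover have "integral {t..T} \<phi> = 0" by (rule z) (use t lr K(3) in force)
      ultimately show ?thesis using mean by simp
    next
      case False
      have "integral {0..t} \<phi> = integral {0..T} \<phi> + integral {T..t} \<phi>"
        by (rule Henstock_Kurzweil_Integration.integral_combine[symmetric]) (use T False i in auto)
      moreover have "integral {T..t} \<phi> = 0" by (rule z) (use lr K(3) in force)
      ultimately show ?thesis using mean by simp
    qed
    finally show ?thesis by (simp add: \<eta>_def)
  qed (rule \<eta>0)
  have der: "(\<eta> has_real_derivative \<phi> t) (at t)" for t
  proof (cases "t < l")
    case True
    have "((\<lambda>_. 0) has_real_derivative 0) (at t)" by simp
    then have "(\<eta> has_real_derivative 0) (at t)"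
      by (rule has_field_derivative_transform_within_open[where S = "{..<l}"]) (use True \<eta>0 in auto)
    moreover have "\<phi> t = 0" by (rule K(3)) (use True lr in auto)
    ultimately show ?thesis by simp
  next
    case False
    have "(\<eta> has_real_derivative \<phi> t) (at t within {-1..t+1})"
      unfolding \<eta>_def by (rule integral_has_real_derivative[OF c]) (use False lr in auto)
    moreover have "at t within {-1..t+1} = at t" by (rule at_within_interior) (use False lr in auto)
    ultimately show ?thesis by simp
  qed
  have fd: "frechet_derivative \<eta> (at t) v = \<phi> t * v" for t v
    using frechet_derivative_at[OF der[unfolded has_field_derivative_def], of t, symmetric] by simp
  have sm: "Ck_fun k \<eta>" for k
  proof (cases k)
    case 0
    then show ?thesis using der by (auto intro!: continuous_at_imp_continuous_on DERIV_isCont)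
  next
    case (Suc j)
    have "\<eta> differentiable at t" for t using der[of t] by (meson has_field_derivative_imp_has_derivative differentiableI)
    then show ?thesis using Suc test_functions_smooth[OF \<phi>] by (simp add: fd)
  qed
  have "\<eta> \<in> test_functions {0<..<T}"
    by (rule test_functionsI[OF sm, of "{l..r}"]) (use lr \<eta>0 \<eta>1 in \<open>auto simp: not_le\<close>)
  then show ?thesis by (rule bexI[rotated]) (simp add: fd)
qed

lemma test_integral_eq:
  assumes \<phi>: "\<phi> \<in> test_functions {0<..<T::real}"
  shows "ip (lebesgue_on {0<..<T}) (\<lambda>_. 1) \<phi> = integral {0..T} \<phi>"
proof -
  have "integrable (lebesgue_on {0<..<T}) \<phi>"
    using sq_int_mult_integrable[OF sq_int_bounded[OF finite_measure_interval, of "\<lambda>_. 1" T 1] test_function_sq_int[OF \<phi>]] by simp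
  then have "ip (lebesgue_on {0<..<T}) (\<lambda>_. 1) \<phi> = integral {0<..<T} \<phi>"
    unfolding ip_def by (simp add: lebesgue_integral_eq_integral)
  also have "\<dots> = integral {0..T} \<phi>" using integral_open_interval_real[of 0 T \<phi>] by simp
  finally show ?thesis .
qed

text \<open>The lemma of du Bois-Reymond. Subtracting a multiple of a fixed test function
  \<open>\<rho>\<close> with nonzero mean from \<open>\<phi>\<close> leaves a function of mean zero,
  that is, the derivative of a test function, to which \<open>D\<close> is orthogonal. Continuity
  upgrades the result from almost all to all points.\<close>

lemma weak_deriv_zero_imp_constant:
  assumes T: "0 < T" and D: "continuous_on {0<..<T} D" and w: "has_weak_deriv {0<..<T::real} 1 D (\<lambda>_. 0)"
  shows "\<exists>c. \<forall>t\<in>{0<..<T}. D t = c"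
proof -
  let ?I = "lebesgue_on {0<..<T}"
  have one: "sq_int ?I (\<lambda>_. c)" for c :: real by (rule sq_int_bounded[OF finite_measure_interval, of _ _ "\<bar>c\<bar>"]) auto
  have sD: "sq_int ?I D" using w by (simp add: has_weak_deriv_iff)
  have st: "sq_int ?I \<phi>" if "\<phi> \<in> test_functions {0<..<T}" for \<phi> by (rule test_function_sq_int[OF that]) simp
  \<comment> \<open>If every test function had mean zero, the fundamental lemma would force the
    constant \<open>1\<close> to vanish almost everywhere.\<close>
  have "\<exists>\<rho>\<in>test_functions {0<..<T}. ip ?I (\<lambda>_. 1) \<rho> \<noteq> 0"
  proof (rule ccontr)
    assume "\<not> (\<exists>\<rho>\<in>test_functions {0<..<T}. ip ?I (\<lambda>_. 1) \<rho> \<noteq> 0)"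
    then have "AE x in ?I. (1::real) = 0" by (intro fundamental_lemma one) auto
    then have "(LINT x|?I. (1::real)) = (LINT x|?I. 0)" by (intro integral_cong_AE) auto
    then show False using T by (simp add: measure_restrict_space)
  qed
  then obtain \<rho> where \<rho>: "\<rho> \<in> test_functions {0<..<T}" "ip ?I (\<lambda>_. 1) \<rho> \<noteq> 0" by blast
  define c where "c = ip ?I D \<rho> / ip ?I (\<lambda>_. 1) \<rho>"
  have ae: "AE t in ?I. D t - c = 0"
  proof (rule fundamental_lemma)
    show "sq_int ?I (\<lambda>t. D t - c)" by (intro sq_int_diff sD one)
    fix \<phi> assume \<phi>: "\<phi> \<in> test_functions {0<..<T}"
    define r where "r = ip ?I (\<lambda>_. 1) \<phi> / ip ?I (\<lambda>_. 1) \<rho>"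
    define \<zeta> where "\<zeta> t = \<phi> t + (- r) * \<rho> t" for t
    have \<zeta>: "\<zeta> \<in> test_functions {0<..<T}" unfolding \<zeta>_def[abs_def] by (intro test_functions_add test_functions_cmult \<phi> \<rho>)
    have ipz: "ip ?I f \<zeta> = ip ?I f \<phi> - r * ip ?I f \<rho>" if "sq_int ?I f" for f
    proof -
      have "ip ?I \<zeta> f = ip ?I \<phi> f + ip ?I (\<lambda>t. (- r) * \<rho> t) f"
        unfolding \<zeta>_def[abs_def] by (rule ip_add_left[OF st[OF \<phi>] sq_int_cmult[OF st[OF \<rho>(1)]] that])
      also have "ip ?I (\<lambda>t. (- r) * \<rho> t) f = (- r) * ip ?I \<rho> f" by (rule ip_cmult_left)
      finally show ?thesis by (simp add: ip_commute[of ?I _ f])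
    qed
    have "integral {0..T} \<zeta> = 0"
      using test_integral_eq[OF \<zeta>] ipz[OF one] \<rho>(2) by (simp add: r_def)
    then obtain \<eta> where \<eta>: "\<eta> \<in> test_functions {0<..<T}" "\<And>t. frechet_derivative \<eta> (at t) 1 = \<zeta> t"
      using test_antiderivative[OF T \<zeta>] by blast
    have "ip ?I D (\<lambda>t. frechet_derivative \<eta> (at t) 1) = 0"
      using w \<eta>(1) by (simp add: has_weak_deriv_iff ip_def)
    then have "ip ?I D \<zeta> = 0" by (simp add: \<eta>(2))
    then have "ip ?I D \<phi> = r * ip ?I D \<rho>" using ipz[OF sD] by simp
    also have "\<dots> = c * ip ?I (\<lambda>_. 1) \<phi>" using \<rho>(2) by (simp add: r_def c_def)
    also have "\<dots> = ip ?I (\<lambda>_. c) \<phi>" using ip_cmult_left[of ?I c "\<lambda>_. 1" \<phi>] by simp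
    finally show "ip ?I (\<lambda>t. D t - c) \<phi> = 0"
      using ip_diff_left[OF sD one st[OF \<phi>]] by simp
  qed simp
  have "D t = c" if t: "t \<in> {0<..<T}" for t
  proof (rule ccontr)
    assume ne: "D t \<noteq> c"
    have "open {s \<in> {0<..<T}. D s \<noteq> c}"
    proof -
      have "open (D -` (- {c}) \<inter> {0<..<T})" using D continuous_on_open_vimage[of "{0<..<T}" D] by auto
      then show ?thesis by (simp add: vimage_def Int_def conj_commute)
    qed
    then obtain \<epsilon> where \<epsilon>: "\<epsilon> > 0" "ball t \<epsilon> \<subseteq> {s \<in> {0<..<T}. D s \<noteq> c}" using t ne by (auto simp: open_contains_ball)
    have "AE s in lebesgue. s \<in> {0<..<T} \<longrightarrow> D s = c"
      using ae by (subst (asm) AE_restrict_space_iff) auto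
    then have "AE s in lebesgue. s \<notin> ball t \<epsilon>" by eventually_elim (use \<epsilon>(2) in auto)
    then have "ball t \<epsilon> \<in> null_sets lebesgue" by (simp add: AE_iff_null_sets)
    then have "negligible (ball t \<epsilon>)" by (simp add: negligible_iff_null_sets)
    then show False using \<epsilon>(1) open_not_negligible[of "ball t \<epsilon>"] by auto
  qed
  then show ?thesis by blast
qed

text \<open>Subtracting the integral of \<open>G\<close> leaves a continuous function with weak
  derivative zero, whose constant value extends to the end points by continuity.\<close>

lemma weak_deriv_integral:
  assumes T: "0 < T" and F: "continuous_on {0..T} F" and G: "continuous_on {0..T} G"
    and w: "has_weak_deriv {0<..<T::real} 1 F G" and t: "t \<in> {0..T}"
  shows "F t = F 0 + integral {0..t} G"
proof -
  define H where "H t = integral {0..t} G" for t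
  have Hd: "(H has_real_derivative G t) (at t within {0..T})" if "t \<in> {0..T}" for t
    unfolding H_def by (rule integral_has_real_derivative[OF G that])
  have Hc: "continuous_on {0..T} H" using Hd by (rule DERIV_continuous_on)
  have "has_weak_deriv {0<..<T} 1 H G"
  proof (rule has_weak_deriv_classical)
    show "((\<lambda>s. H (t + s *\<^sub>R 1)) has_real_derivative G t) (at 0)" if t: "t \<in> {0<..<T}" for t
    proof -
      have "(H has_real_derivative G t) (at t)" using Hd[of t] t at_within_interior[of t "{0..T}"] by simp
      then show ?thesis using DERIV_shift[of H "G t" 0 t] by (simp add: add.commute)
    qed
  qed (use Hc G in \<open>auto intro: continuous_on_subset continuous_interval_sq_int\<close>)
  then have "has_weak_deriv {0<..<T} 1 (\<lambda>t. F t - H t) (\<lambda>t. G t - G t)"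
    using w by (intro has_weak_deriv_diff) auto
  then obtain c where c: "\<And>t. t \<in> {0<..<T} \<Longrightarrow> F t - H t = c"
    using weak_deriv_zero_imp_constant[OF T, of "\<lambda>t. F t - H t"] continuous_on_subset[OF continuous_on_diff[OF F Hc], of "{0<..<T}"]
    by fastforce
  have "F t - H t = c" if "t \<in> {0..T}" for t
  proof -
    have cl: "closure {0<..<T} = {0..T}" using T by simp
    have "continuous_on (closure {0<..<T}) (\<lambda>t. F t - H t)" unfolding cl by (intro continuous_intros F Hc)
    then show ?thesis using continuous_constant_on_closure[of "{0<..<T}" "\<lambda>t. F t - H t" c t] c that cl by auto
  qed
  from this[OF t] this[of 0] show ?thesis using T by (simp add: H_def)
qed

context rect
begin

section \<open>From the equation on the cylinder to its time slices\<close>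

lemma cylinder_Fubini:
  assumes u: "sq_int (MQ T) u" and us: "\<And>t. t \<in> {0<..<T} \<Longrightarrow> sq_int M (\<lambda>x. u (x, t))"
    and p: "sq_int M p" and p\<zeta>: "sq_int (MQ T) (\<lambda>z. p (fst z) * \<zeta> (snd z))"
    and c: "continuous_on {0..T} (\<lambda>t. ip M (\<lambda>x. u (x, t)) p)" and \<zeta>: "continuous_on UNIV \<zeta>"
  shows "ip (MQ T) u (\<lambda>z. p (fst z) * \<zeta> (snd z)) = ip (lebesgue_on {0<..<T}) (\<lambda>t. ip M (\<lambda>x. u (x, t)) p) \<zeta>"
proof -
  let ?Q = "cylinder \<Omega> T"
  have Q: "?Q \<in> sets lebesgue" using open_cylinder[of T] by auto
  define f where "f z = indicator ?Q z * (u z * (p (fst z) * \<zeta> (snd z)))" for z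
  have fi: "integrable lebesgue f"
    using sq_int_mult_integrable[OF u p\<zeta>] Q by (simp add: integrable_restrict_space f_def[abs_def])
  have inner: "(\<lambda>x. f (x, t)) = (\<lambda>x. indicator {0<..<T} t * (\<zeta> t * (indicator \<Omega> x * (u (x, t) * p x))))" for t
    by (rule ext) (auto simp: f_def cylinder_def indicator_def)
  have mt: "(\<lambda>x. indicator \<Omega> x * (u (x, t) * p x)) \<in> borel_measurable lebesgue" if t: "t \<in> {0<..<T}" for t
    by (rule measurable_on_lebesgue_extend) (use us[OF t] p in \<open>auto simp: sq_int_def\<close>)
  have sl: "(\<lambda>x. f (x, t)) \<in> borel_measurable lebesgue" for t
    unfolding inner using mt[of t] by (cases "t \<in> {0<..<T}") auto
  have int: "(LINT x|lebesgue. f (x, t)) = indicator {0<..<T} t * (ip M (\<lambda>x. u (x, t)) p * \<zeta> t)" for t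
  proof -
    have "(LINT x|lebesgue. indicator \<Omega> x * (u (x, t) * p x)) = ip M (\<lambda>x. u (x, t)) p"
      unfolding ip_def by (subst integral_restrict_space) auto
    then show ?thesis unfolding inner by simp
  qed
  have im: "(\<lambda>t. ip M (\<lambda>x. u (x, t)) p * \<zeta> t) \<in> borel_measurable (lebesgue_on {0<..<T})"
    by (rule continuous_imp_measurable_on_sets_lebesgue[OF continuous_on_subset[of "{0..T}"]])
      (auto intro!: continuous_on_mult c continuous_on_subset[OF \<zeta>])
  have m: "(\<lambda>t. LINT x|lebesgue. f (x, t)) \<in> borel_measurable lebesgue"
    unfolding int by (rule measurable_on_lebesgue_extend[OF im]) simp
  have "ip (MQ T) u (\<lambda>z. p (fst z) * \<zeta> (snd z)) = (LINT z|lebesgue. f z)"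
    unfolding ip_def f_def using Q by (subst integral_restrict_space) auto
  also have "\<dots> = (LINT t|lebesgue. LINT x|lebesgue. f (x, t))" by (rule Fubini_lebesgue[OF fi sl m])
  also have "\<dots> = (LINT t|lebesgue_on {0<..<T}. ip M (\<lambda>x. u (x, t)) p * \<zeta> t)"
    unfolding int by (subst integral_restrict_space) auto
  finally show ?thesis by (simp only: ip_def)
qed

lemma product_test:
  assumes \<psi>: "\<psi> \<in> test_functions \<Omega>" and \<eta>: "\<eta> \<in> test_functions {0<..<T}"
  shows "(\<lambda>z. \<psi> (fst z) * \<eta> (snd z)) \<in> test_functions (cylinder \<Omega> T)"
    and "frechet_derivative (\<lambda>z. \<psi> (fst z) * \<eta> (snd z)) (at z) (0, 1) = \<psi> (fst z) * frechet_derivative \<eta> (at (snd z)) 1"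
    and "frechet_derivative (\<lambda>z. \<psi> (fst z) * \<eta> (snd z)) (at z) (v, 0) = frechet_derivative \<psi> (at (fst z)) v * \<eta> (snd z)"
proof -
  let ?f = "\<lambda>z. \<psi> (fst z) * \<eta> (snd z)"
  obtain K where K: "compact K" "K \<subseteq> \<Omega>" "\<And>x. x \<notin> K \<Longrightarrow> \<psi> x = 0" using test_functionsE[OF \<psi>] by metis
  obtain L where L: "compact L" "L \<subseteq> {0<..<T}" "\<And>x. x \<notin> L \<Longrightarrow> \<eta> x = 0" using test_functionsE[OF \<eta>] by metis
  have sm: "Ck_fun k ?f" for k
    by (intro Ck_fun_mult Ck_fun_compose_linear[OF bounded_linear_fst] Ck_fun_compose_linear[OF bounded_linear_snd]
        test_functions_smooth[OF \<psi>] test_functions_smooth[OF \<eta>])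
  show "?f \<in> test_functions (cylinder \<Omega> T)"
  proof (rule test_functionsI[OF sm])
    show "compact (K \<times> L)" by (intro compact_Times K L)
    show "K \<times> L \<subseteq> cylinder \<Omega> T" unfolding cylinder_def using K(2) L(2) by blast
    show "?f z = 0" if "z \<notin> K \<times> L" for z using that K(3) L(3) by (cases z) auto
  qed
  have d\<eta>: "((\<lambda>s. \<eta> (t + s *\<^sub>R 1)) has_real_derivative frechet_derivative \<eta> (at t) 1) (at 0)" for t
    by (rule has_derivative_directional[OF Ck_fun_has_derivative[OF test_functions_smooth[OF \<eta>]]])
  have d\<psi>: "((\<lambda>s. \<psi> (x + s *\<^sub>R v)) has_real_derivative frechet_derivative \<psi> (at x) v) (at 0)" for x
    by (rule has_derivative_directional[OF Ck_fun_has_derivative[OF test_functions_smooth[OF \<psi>]]])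
  show "frechet_derivative ?f (at z) (0, 1) = \<psi> (fst z) * frechet_derivative \<eta> (at (snd z)) 1"
    by (rule frechet_derivative_directional[OF sm]) (use DERIV_cmult[OF d\<eta>] in simp)
  show "frechet_derivative ?f (at z) (v, 0) = frechet_derivative \<psi> (at (fst z)) v * \<eta> (snd z)"
    by (rule frechet_derivative_directional[OF sm]) (use DERIV_cmult_right[OF d\<psi>] in simp)
qed

lemma cospoly_MQ_sq_int:
  assumes q: "q \<in> cospoly" and f: "sq_int (MQ T) f"
  shows "sq_int (MQ T) (\<lambda>z. q (fst z) * f z)"
proof -
  obtain C where C: "\<And>x. \<bar>q x\<bar> \<le> C" using cospoly_bounded[OF q] by blast
  have qc: "continuous_on UNIV (\<lambda>z :: (real ^ 'n) \<times> real. q (fst z))"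
    by (rule continuous_on_compose2[OF cospoly_continuous[OF q, of UNIV] continuous_on_fst[OF continuous_on_id]]) simp
  show ?thesis
    by (rule sq_int_bounded_mult(1)[OF f borel_measurable_MQ[OF borel_measurable_continuous_onI[OF qc]], of C]) (use C in auto)
qed

text \<open>All derivatives are moved to the test function. What remains is \<open>u\<close> itself,
  whose values on the cylinder and on the slices are those of one function, in contrast to chosen
  representatives of its derivatives.\<close>

lemma solution_weak_form:
  assumes sol: "is_solution \<Omega> T (\<lambda>z. q (fst z)) u\<^sub>0 u" and q: "q \<in> cospoly" and \<phi>: "\<phi> \<in> test_functions (cylinder \<Omega> T)"
  shows "ip (MQ T) u (\<lambda>z. frechet_derivative \<phi> (at z) (0, 1)) +
      (\<Sum>i\<in>UNIV. ip (MQ T) u (\<lambda>z. frechet_derivative (\<lambda>z. frechet_derivative \<phi> (at z) (axis i 1, 0)) (at z) (axis i 1, 0)))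
      + ip (MQ T) u (\<lambda>z. q (fst z) * \<phi> z) = 0"
proof -
  let ?Q = "cylinder \<Omega> T"
  define ut where "ut = weak_deriv ?Q (0, 1) u"
  define w where "w i = weak_deriv ?Q (axis i 1, 0) u" for i
  define ww where "ww i = weak_deriv ?Q (axis i 1, 0) (w i)" for i
  have H: "u \<in> H21 \<Omega> T" using sol by (simp add: is_solution_def)
  have t: "has_weak_deriv ?Q (0, 1) u ut"
    using H weak_deriv_works[OF open_cylinder] unfolding H21_def ut_def by blast
  have wd: "has_weak_deriv ?Q (axis i 1, 0) u (w i) \<and> has_weak_deriv ?Q (axis i 1, 0) (w i) (ww i)" for i
  proof -
    obtain g h where gh: "has_weak_deriv ?Q (axis i 1, 0) u g" "has_weak_deriv ?Q (axis i 1, 0) g h"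
      using H axis_Basis[of i] unfolding H21_def by blast
    have "has_weak_deriv ?Q (axis i 1, 0) (w i) h"
      unfolding w_def by (rule has_weak_deriv_weak_deriv[OF open_cylinder space_Basis(1) space_Basis(1) gh])
    then show ?thesis unfolding w_def ww_def using weak_deriv_works[OF open_cylinder] gh(1) by blast
  qed
  have sq: "sq_int (MQ T) u" "sq_int (MQ T) ut" "sq_int (MQ T) (ww i)" for i
    using t wd by (auto simp: has_weak_deriv_iff)
  have s\<phi>: "sq_int (MQ T) \<phi>" by (rule test_function_sq_int[OF \<phi> open_cylinder])
  have squ: "sq_int (MQ T) (\<lambda>z. q (fst z) * u z)" by (rule cospoly_MQ_sq_int[OF q sq(1)])
  have sqs: "sq_int (MQ T) (\<lambda>z. \<Sum>i\<in>UNIV. ww i z)" by (rule sq_int_sum) (rule sq)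
  have inj: "inj_on (\<lambda>i::'n. axis i (1::real)) UNIV" by (auto simp: inj_on_def axis_eq_axis)
  have "AE z in MQ T. ut z = (\<Sum>v\<in>Basis. weak_deriv ?Q (v, 0) (weak_deriv ?Q (v, 0) u) z) + q (fst z) * u z"
    using sol by (simp add: is_solution_def ut_def)
  moreover have "(\<Sum>v\<in>Basis. weak_deriv ?Q (v, 0) (weak_deriv ?Q (v, 0) u) z) = (\<Sum>i\<in>UNIV. ww i z)" for z
    unfolding Basis_axis by (subst sum.reindex[OF inj]) (simp add: ww_def w_def)
  ultimately have ae: "AE z in MQ T. ut z = (\<Sum>i\<in>UNIV. ww i z) + q (fst z) * u z" by simp
  have "ip (MQ T) u (\<lambda>z. frechet_derivative \<phi> (at z) (0, 1)) = - ip (MQ T) ut \<phi>"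
    using t \<phi> by (simp add: has_weak_deriv_iff)
  also have "ip (MQ T) ut \<phi> = ip (MQ T) (\<lambda>z. (\<Sum>i\<in>UNIV. ww i z) + q (fst z) * u z) \<phi>"
    using sq(2) sqs squ s\<phi> by (intro ip_cong_AE[OF ae]) (auto simp: sq_int_def)
  also have "\<dots> = (\<Sum>i\<in>UNIV. ip (MQ T) (ww i) \<phi>) + ip (MQ T) (\<lambda>z. q (fst z) * u z) \<phi>"
    unfolding ip_add_left[OF sqs squ s\<phi>] using ip_sum_left[of UNIV "MQ T" ww \<phi>, OF sq(3) s\<phi>] by simp
  also have "ip (MQ T) (\<lambda>z. q (fst z) * u z) \<phi> = ip (MQ T) u (\<lambda>z. q (fst z) * \<phi> z)" by (rule ip_mult_assoc)
  also have "(\<Sum>i\<in>UNIV. ip (MQ T) (ww i) \<phi>) =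
      (\<Sum>i\<in>UNIV. ip (MQ T) u (\<lambda>z. frechet_derivative (\<lambda>z. frechet_derivative \<phi> (at z) (axis i 1, 0)) (at z) (axis i 1, 0)))"
  proof (intro sum.cong refl)
    fix i
    have \<phi>i: "(\<lambda>z. frechet_derivative \<phi> (at z) (axis i 1, 0)) \<in> test_functions ?Q"
      by (rule test_functions_deriv[OF \<phi> space_Basis(1)])
    show "ip (MQ T) (ww i) \<phi> = ip (MQ T) u (\<lambda>z. frechet_derivative (\<lambda>z. frechet_derivative \<phi> (at z) (axis i 1, 0)) (at z) (axis i 1, 0))"
      using wd[of i] \<phi> \<phi>i by (simp add: has_weak_deriv_iff)
  qed
  finally show ?thesis by simp
qed

lemma solution_slices:
  assumes sol: "is_solution \<Omega> T v u\<^sub>0 u" and t: "t \<in> {0..T}"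
  shows "(\<lambda>x. u (x, t)) \<in> H2 \<Omega>" "(\<lambda>x. u (x, t)) \<in> H10 \<Omega>" "sq_int M (\<lambda>x. u (x, t))"
proof -
  show h: "(\<lambda>x. u (x, t)) \<in> H2 \<Omega>" "(\<lambda>x. u (x, t)) \<in> H10 \<Omega>" using sol t by (auto simp: is_solution_def C_H2_H10_def)
  show "sq_int M (\<lambda>x. u (x, t))" by (rule H2D(1)[OF open_Om h(1)])
qed

text \<open>The \<open>H2\<close> norm dominates the \<open>L2\<close> norm and, up to a factor, the
  norm of the Laplacian coefficients, so continuity in \<open>H2\<close> passes to both coefficient
  curves.\<close>

lemma solution_curves:
  assumes sol: "is_solution \<Omega> T v u\<^sub>0 u"
  shows "continuous_on {0..T} (\<lambda>t. fcoef (\<lambda>x. u (x, t)))" "continuous_on {0..T} (\<lambda>t. lapcoef (\<lambda>x. u (x, t)))"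
proof -
  note sl = solution_slices[OF sol]
  have lim: "((\<lambda>s. H2_norm \<Omega> (\<lambda>x. u (x, s) - u (x, t))) \<longlongrightarrow> 0) (at t within {0..T})" if "t \<in> {0..T}" for t
    using sol that by (auto simp: is_solution_def C_H2_H10_def)
  have d2: "(\<lambda>x. u (x, s) - u (x, t)) \<in> H2 \<Omega>" "(\<lambda>x. u (x, s) - u (x, t)) \<in> H10 \<Omega>" if "s \<in> {0..T}" "t \<in> {0..T}" for s t
    using H2_diff[OF open_Om sl(1)[OF that(1)] sl(1)[OF that(2)]]
      H10_diff[OF open_Om sl(2)[OF that(1)] sl(2)[OF that(2)]] by blast+
  show "continuous_on {0..T} (\<lambda>t. fcoef (\<lambda>x. u (x, t)))"
    unfolding continuous_on_def
  proof (intro ballI)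
    fix t assume t: "t \<in> {0..T}"
    have "((\<lambda>s. fcoef (\<lambda>x. u (x, s)) - fcoef (\<lambda>x. u (x, t))) \<longlongrightarrow> 0) (at t within {0..T})"
    proof (rule Lim_null_comparison[OF _ lim[OF t]])
      have "norm (fcoef (\<lambda>x. u (x, s)) - fcoef (\<lambda>x. u (x, t))) \<le> H2_norm \<Omega> (\<lambda>x. u (x, s) - u (x, t))" if s: "s \<in> {0..T}" for s
        using H2D(4)[OF open_Om d2(1)[OF s t]] norm_fcoef[OF sq_int_diff[OF sl(3)[OF s] sl(3)[OF t]]]
        by (simp add: fcoef_diff[OF sl(3)[OF s] sl(3)[OF t]])
      then show "\<forall>\<^sub>F s in at t within {0..T}. norm (fcoef (\<lambda>x. u (x, s)) - fcoef (\<lambda>x. u (x, t))) \<le> H2_norm \<Omega> (\<lambda>x. u (x, s) - u (x, t))"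
        by (auto simp: eventually_at_filter)
    qed
    then show "((\<lambda>s. fcoef (\<lambda>x. u (x, s))) \<longlongrightarrow> fcoef (\<lambda>x. u (x, t))) (at t within {0..T})" by (rule LIM_zero_cancel)
  qed
  have ldiff: "lapcoef (\<lambda>x. u (x, s)) - lapcoef (\<lambda>x. u (x, t)) = lapcoef (\<lambda>x. u (x, s) - u (x, t))" if st: "s \<in> {0..T}" "t \<in> {0..T}" for s t
    by (rule ell2_eqI) (use st in \<open>simp add: coord_lapcoef sl d2 ip_diff_left trig_sq_int right_diff_distrib\<close>)
  show "continuous_on {0..T} (\<lambda>t. lapcoef (\<lambda>x. u (x, t)))"
    unfolding continuous_on_def
  proof (intro ballI)
    fix t assume t: "t \<in> {0..T}"
    have l0: "((\<lambda>s. real CARD('n) * H2_norm \<Omega> (\<lambda>x. u (x, s) - u (x, t))) \<longlongrightarrow> 0) (at t within {0..T})"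
      using tendsto_mult_right_zero[OF lim[OF t]] .
    have "((\<lambda>s. lapcoef (\<lambda>x. u (x, s)) - lapcoef (\<lambda>x. u (x, t))) \<longlongrightarrow> 0) (at t within {0..T})"
    proof (rule Lim_null_comparison[OF _ l0])
      have "norm (lapcoef (\<lambda>x. u (x, s)) - lapcoef (\<lambda>x. u (x, t))) \<le> real CARD('n) * H2_norm \<Omega> (\<lambda>x. u (x, s) - u (x, t))" if s: "s \<in> {0..T}" for s
        unfolding ldiff[OF s t] by (rule norm_lapcoef[OF d2[OF s t]])
      then show "\<forall>\<^sub>F s in at t within {0..T}. norm (lapcoef (\<lambda>x. u (x, s)) - lapcoef (\<lambda>x. u (x, t))) \<le> real CARD('n) * H2_norm \<Omega> (\<lambda>x. u (x, s) - u (x, t))"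
        by (auto simp: eventually_at_filter)
    qed
    then show "((\<lambda>s. lapcoef (\<lambda>x. u (x, s))) \<longlongrightarrow> lapcoef (\<lambda>x. u (x, t))) (at t within {0..T})" by (rule LIM_zero_cancel)
  qed
qed

lemma ip_curve_continuous:
  assumes s: "\<And>t. t \<in> {0..T} \<Longrightarrow> sq_int M (z t)" and c: "continuous_on {0..T} (\<lambda>t. fcoef (z t))" and p: "sq_int M p"
  shows "continuous_on {0..T} (\<lambda>t. ip M (z t) p)"
  unfolding continuous_on_def
proof (intro ballI)
  fix t assume t: "t \<in> {0..T}"
  have "((\<lambda>r. fcoef (z r)) \<longlongrightarrow> fcoef (z t)) (at t within {0..T})" using c t by (simp add: continuous_on_def)
  then have "((\<lambda>r. norm (fcoef (z r) - fcoef (z t))) \<longlongrightarrow> 0) (at t within {0..T})" by (intro tendsto_norm_zero LIM_zero)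
  then have l0: "((\<lambda>r. norm (fcoef (z r) - fcoef (z t)) * nrm M p) \<longlongrightarrow> 0) (at t within {0..T})" by (rule tendsto_mult_left_zero)
  have "((\<lambda>r. ip M (z r) p - ip M (z t) p) \<longlongrightarrow> 0) (at t within {0..T})"
  proof (rule Lim_null_comparison[OF _ l0])
    have "norm (ip M (z r) p - ip M (z t) p) \<le> norm (fcoef (z r) - fcoef (z t)) * nrm M p" if r: "r \<in> {0..T}" for r
      using Cauchy_Schwarz_ip[OF sq_int_diff[OF s[OF r] s[OF t]] p] norm_fcoef[OF sq_int_diff[OF s[OF r] s[OF t]]]
      by (simp add: fcoef_diff[OF s[OF r] s[OF t]] ip_diff_left[OF s[OF r] s[OF t] p])
    then show "\<forall>\<^sub>F r in at t within {0..T}. norm (ip M (z r) p - ip M (z t) p) \<le> norm (fcoef (z r) - fcoef (z t)) * nrm M p"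
      by (auto simp: eventually_at_filter)
  qed
  then show "((\<lambda>r. ip M (z r) p) \<longlongrightarrow> ip M (z t) p) (at t within {0..T})" by (rule LIM_zero_cancel)
qed

text \<open>Products \<open>\<psi>(x) \<eta>(t)\<close> are inserted into the weak form, and
  Fubini's theorem separates the variables: the pairing of the slices with \<open>\<psi>\<close> has
  the pairing with \<open>L\<close> as its weak derivative in time. Both are continuous, so the
  identity can be integrated.\<close>

lemma solution_test_integral:
  assumes sol: "is_solution \<Omega> T (\<lambda>z. q (fst z)) u\<^sub>0 u" and q: "q \<in> cospoly" and T: "0 < T"
    and \<psi>: "\<psi> \<in> test_functions \<Omega>" and t: "t \<in> {0..T}"
  defines "L \<equiv> \<lambda>x. (\<Sum>i\<in>UNIV. frechet_derivative (\<lambda>x. frechet_derivative \<psi> (at x) (axis i 1)) (at x) (axis i 1)) + q x * \<psi> x"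
  shows "ip M (\<lambda>x. u (x, t)) \<psi> = ip M (\<lambda>x. u (x, 0)) \<psi> + integral {0..t} (\<lambda>s. ip M (\<lambda>x. u (x, s)) L)"
proof -
  let ?I = "lebesgue_on {0<..<T}"
  note sl = solution_slices[OF sol]
  define \<psi>2 where "\<psi>2 i x = frechet_derivative (\<lambda>x. frechet_derivative \<psi> (at x) (axis i 1)) (at x) (axis i 1)" for i x
  have \<psi>2: "\<psi>2 i \<in> test_functions \<Omega>" for i
    unfolding \<psi>2_def[abs_def] by (intro test_functions_deriv \<psi> axis_Basis)
  have s\<psi>: "sq_int M \<psi>" "sq_int M (\<psi>2 i)" "sq_int M (\<lambda>x. q x * \<psi> x)" "sq_int M (\<lambda>x. \<Sum>i\<in>UNIV. \<psi>2 i x)" for i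
    using test_function_sq_int[OF \<psi> open_Om] test_function_sq_int[OF \<psi>2 open_Om] cospoly_sq_int[OF q] sq_int_sum[of UNIV M \<psi>2]
    by auto
  have Ls: "L = (\<lambda>x. (\<Sum>i\<in>UNIV. \<psi>2 i x) + q x * \<psi> x)" by (simp add: L_def \<psi>2_def)
  have sL: "sq_int M L" unfolding Ls by (intro sq_int_add s\<psi>)
  have cont: "continuous_on {0..T} (\<lambda>t. ip M (\<lambda>x. u (x, t)) p)" if "sq_int M p" for p
    by (rule ip_curve_continuous[OF sl(3) solution_curves(1)[OF sol] that])
  have squ: "sq_int (MQ T) u" using sol by (simp add: is_solution_def H21_def L2_iff_sq_int)
  have ipL: "ip M (\<lambda>x. u (x, s)) L = (\<Sum>i\<in>UNIV. ip M (\<lambda>x. u (x, s)) (\<psi>2 i)) + ip M (\<lambda>x. u (x, s)) (\<lambda>x. q x * \<psi> x)" if s: "s \<in> {0..T}" for s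
    unfolding Ls ip_commute[of M "\<lambda>x. u (x, s)"]
    by (subst ip_add_left[OF s\<psi>(4,3) sl(3)[OF s]]) (simp add: ip_sum_left[of UNIV M \<psi>2, OF s\<psi>(2) sl(3)[OF s]])
  have "has_weak_deriv {0<..<T} 1 (\<lambda>t. ip M (\<lambda>x. u (x, t)) \<psi>) (\<lambda>t. ip M (\<lambda>x. u (x, t)) L)"
    unfolding has_weak_deriv_iff
  proof (intro conjI ballI continuous_interval_sq_int cont s\<psi> sL)
    fix \<eta> assume \<eta>: "\<eta> \<in> test_functions {0<..<T}"
    have \<eta>': "(\<lambda>t. frechet_derivative \<eta> (at t) 1) \<in> test_functions {0<..<T}" by (rule test_functions_deriv[OF \<eta>]) simp
    have Fub: "ip (MQ T) u (\<lambda>z. p (fst z) * \<zeta> (snd z)) = ip ?I (\<lambda>t. ip M (\<lambda>x. u (x, t)) p) \<zeta>"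
      if "sq_int M p" "sq_int (MQ T) (\<lambda>z. p (fst z) * \<zeta> (snd z))" "\<zeta> \<in> test_functions {0<..<T}" for p \<zeta>
      using that by (intro cylinder_Fubini[OF squ sl(3)] cont Ck_fun_continuous[OF test_functions_smooth]) auto
    have Fubt: "ip (MQ T) u (\<lambda>z. p (fst z) * \<zeta> (snd z)) = ip ?I (\<lambda>t. ip M (\<lambda>x. u (x, t)) p) \<zeta>"
      if "p \<in> test_functions \<Omega>" "\<zeta> \<in> test_functions {0<..<T}" for p \<zeta>
      by (rule Fub[OF test_function_sq_int[OF that(1) open_Om] test_function_sq_int[OF product_test(1)[OF that] open_cylinder] that(2)])
    have d1: "frechet_derivative (\<lambda>z. \<psi> (fst z) * \<eta> (snd z)) (at z) (axis i 1, 0) = frechet_derivative \<psi> (at (fst z)) (axis i 1) * \<eta> (snd z)" for i z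
      by (rule product_test(3)[OF \<psi> \<eta>])
    have d2: "frechet_derivative (\<lambda>z. frechet_derivative \<psi> (at (fst z)) (axis i 1) * \<eta> (snd z)) (at z) (axis i 1, 0) = \<psi>2 i (fst z) * \<eta> (snd z)" for i z
      unfolding \<psi>2_def by (rule product_test(3)[OF test_functions_deriv[OF \<psi> axis_Basis] \<eta>])
    have q1: "ip (MQ T) u (\<lambda>z. q (fst z) * (\<psi> (fst z) * \<eta> (snd z))) = ip ?I (\<lambda>t. ip M (\<lambda>x. u (x, t)) (\<lambda>x. q x * \<psi> x)) \<eta>"
      using Fub[OF s\<psi>(3), of \<eta>] cospoly_MQ_sq_int[OF q test_function_sq_int[OF product_test(1)[OF \<psi> \<eta>] open_cylinder]] \<eta>
      by (simp add: mult.assoc)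
    from solution_weak_form[OF sol q product_test(1)[OF \<psi> \<eta>]]
    have "ip (MQ T) u (\<lambda>z. \<psi> (fst z) * frechet_derivative \<eta> (at (snd z)) 1) + (\<Sum>i\<in>UNIV. ip (MQ T) u (\<lambda>z. \<psi>2 i (fst z) * \<eta> (snd z)))
        + ip (MQ T) u (\<lambda>z. q (fst z) * (\<psi> (fst z) * \<eta> (snd z))) = 0"
      unfolding product_test(2)[OF \<psi> \<eta>] d1 d2 .
    then have 1: "ip ?I (\<lambda>t. ip M (\<lambda>x. u (x, t)) \<psi>) (\<lambda>t. frechet_derivative \<eta> (at t) 1) =
        - ((\<Sum>i\<in>UNIV. ip ?I (\<lambda>t. ip M (\<lambda>x. u (x, t)) (\<psi>2 i)) \<eta>) + ip ?I (\<lambda>t. ip M (\<lambda>x. u (x, t)) (\<lambda>x. q x * \<psi> x)) \<eta>)"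
      unfolding Fubt[OF \<psi> \<eta>'] Fubt[OF \<psi>2 \<eta>] q1 by linarith
    have s\<eta>: "sq_int ?I \<eta>" by (rule test_function_sq_int[OF \<eta>]) simp
    have sI: "sq_int ?I (\<lambda>t. ip M (\<lambda>x. u (x, t)) p)" if "sq_int M p" for p by (rule continuous_interval_sq_int[OF cont[OF that]])
    have "ip ?I (\<lambda>t. ip M (\<lambda>x. u (x, t)) L) \<eta> = ip ?I (\<lambda>t. (\<Sum>i\<in>UNIV. ip M (\<lambda>x. u (x, t)) (\<psi>2 i)) + ip M (\<lambda>x. u (x, t)) (\<lambda>x. q x * \<psi> x)) \<eta>"
      unfolding ip_def[of ?I] by (intro Bochner_Integration.integral_cong refl) (simp add: ipL)
    also have "\<dots> = (\<Sum>i\<in>UNIV. ip ?I (\<lambda>t. ip M (\<lambda>x. u (x, t)) (\<psi>2 i)) \<eta>) + ip ?I (\<lambda>t. ip M (\<lambda>x. u (x, t)) (\<lambda>x. q x * \<psi> x)) \<eta>"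
    proof -
      have "ip ?I (\<lambda>t. \<Sum>i\<in>UNIV. ip M (\<lambda>x. u (x, t)) (\<psi>2 i)) \<eta> = (\<Sum>i\<in>UNIV. ip ?I (\<lambda>t. ip M (\<lambda>x. u (x, t)) (\<psi>2 i)) \<eta>)"
        by (rule ip_sum_left[OF sI[OF s\<psi>(2)] s\<eta>])
      moreover have "sq_int ?I (\<lambda>t. \<Sum>i\<in>UNIV. ip M (\<lambda>x. u (x, t)) (\<psi>2 i))" by (rule sq_int_sum) (rule sI[OF s\<psi>(2)])
      ultimately show ?thesis using ip_add_left[OF _ sI[OF s\<psi>(3)] s\<eta>] by simp
    qed
    finally show "ip ?I (\<lambda>t. ip M (\<lambda>x. u (x, t)) \<psi>) (\<lambda>t. frechet_derivative \<eta> (at t) 1) = - ip ?I (\<lambda>t. ip M (\<lambda>x. u (x, t)) L) \<eta>"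
      using 1 by simp
  qed
  from weak_deriv_integral[OF T cont[OF s\<psi>(1)] cont[OF sL] this t] show ?thesis .
qed

text \<open>The mode \<open>e k\<close> is approximated by the test functions
  \<open>etest k j\<close>. No bound on their second derivatives is at hand as \<open>j\<close>
  grows, so these are shifted back onto the slice, which lies in \<open>H2\<close>. Then convergence
  of \<open>etest k j\<close> in \<open>L2\<close> suffices, with an error uniform in time.\<close>

lemma solution_coefficients:
  assumes sol: "is_solution \<Omega> T (\<lambda>z. q (fst z)) u\<^sub>0 u" and q: "q \<in> cospoly" and T: "0 < T" and t: "t \<in> {0..T}"
  shows "((\<lambda>t. ip M (\<lambda>x. u (x, t)) (e k)) has_real_derivative
      - lam k * ip M (\<lambda>x. u (x, t)) (e k) + ip M (\<lambda>x. q x * u (x, t)) (e k)) (at t within {0..T})"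
proof -
  note sl = solution_slices[OF sol]
  let ?w = "\<lambda>t x. u (x, t)"
  define L where "L j = (\<lambda>x. (\<Sum>i\<in>UNIV. frechet_derivative (\<lambda>x. frechet_derivative (etest k j) (at x) (axis i 1)) (at x) (axis i 1)) + q x * etest k j x)" for j
  define G where "G s = - lam k * ip M (?w s) (e k) + ip M (\<lambda>x. q x * ?w s x) (e k)" for s
  define \<delta> where "\<delta> j = nrm M (\<lambda>x. etest k j x - e k x)" for j
  have \<delta>0: "\<delta> \<longlonglongrightarrow> 0" unfolding \<delta>_def by (rule etest_tendsto)
  have st: "sq_int M (etest k j)" for j by (rule test_function_sq_int[OF etest_test open_Om])
  have cont: "continuous_on {0..T} (\<lambda>t. ip M (?w t) p)" if "sq_int M p" for p
    by (rule ip_curve_continuous[OF sl(3) solution_curves(1)[OF sol] that])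
  have qe: "ip M (\<lambda>x. q x * ?w s x) p = ip M (?w s) (\<lambda>x. q x * p x)" for s p by (rule ip_mult_assoc)
  have Gc: "continuous_on {0..T} G"
    unfolding G_def[abs_def] qe by (intro continuous_intros cont trig_sq_int cospoly_sq_int[OF q])
  obtain R where R: "0 \<le> R" "\<And>s. s \<in> {0..T} \<Longrightarrow> norm (lapcoef (?w s)) \<le> R"
    using bounded_curve[OF solution_curves(2)[OF sol]] by blast
  obtain R' where R': "0 \<le> R'" "\<And>s. s \<in> {0..T} \<Longrightarrow> norm (fcoef (?w s)) \<le> R'"
    using bounded_curve[OF solution_curves(1)[OF sol]] by blast
  obtain K where K: "\<And>x. \<bar>q x\<bar> \<le> K" using cospoly_bounded[OF q] by blast
  have K0: "0 \<le> K" using K[of 0] by linarith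
  \<comment> \<open>\<open>R\<close> bounds the Laplacian of the slices and \<open>K * R'\<close>
    the potential term, both independently of \<open>s\<close>; this uniformity allows the limit
    under the time integral.\<close>
  have close: "\<bar>ip M (?w s) (L j) - G s\<bar> \<le> (R + K * R') * \<delta> j" if s: "s \<in> {0..T}" for s j
  proof -
    define ww where "ww i = weak_deriv \<Omega> (axis i 1) (weak_deriv \<Omega> (axis i 1) (?w s))" for i
    define LL where "LL x = (\<Sum>i\<in>UNIV. ww i x)" for x
    define \<psi>2 where "\<psi>2 i x = frechet_derivative (\<lambda>x. frechet_derivative (etest k j) (at x) (axis i 1)) (at x) (axis i 1)" for i x
    have wd: "has_weak_deriv \<Omega> (axis i 1) (?w s) (weak_deriv \<Omega> (axis i 1) (?w s))"
      "has_weak_deriv \<Omega> (axis i 1) (weak_deriv \<Omega> (axis i 1) (?w s)) (ww i)" for i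
      unfolding ww_def using H2D(2,3)[OF open_Om sl(1)[OF s]] axis_Basis by auto
    have sw: "sq_int M (ww i)" for i using wd(2)[of i] by (simp add: has_weak_deriv_iff)
    have sLL: "sq_int M LL" unfolding LL_def[abs_def] by (rule sq_int_sum) (rule sw)
    have nLL: "nrm M LL = norm (lapcoef (?w s))"
      unfolding lapcoef_def norm_minus_cancel ww_def[symmetric] LL_def[abs_def, symmetric] by (rule norm_fcoef[OF sLL, symmetric])
    have t1: "(\<lambda>x. frechet_derivative (etest k j) (at x) (axis i 1)) \<in> test_functions \<Omega>" for i
      by (rule test_functions_deriv[OF etest_test axis_Basis])
    have i2: "ip M (?w s) (\<psi>2 i) = ip M (ww i) (etest k j)" for i
    proof -
      have "ip M (?w s) (\<psi>2 i) = - ip M (weak_deriv \<Omega> (axis i 1) (?w s)) (\<lambda>x. frechet_derivative (etest k j) (at x) (axis i 1))"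
        unfolding \<psi>2_def[abs_def] using wd(1)[of i] t1[of i] unfolding has_weak_deriv_iff by blast
      also have "ip M (weak_deriv \<Omega> (axis i 1) (?w s)) (\<lambda>x. frechet_derivative (etest k j) (at x) (axis i 1)) = - ip M (ww i) (etest k j)"
        using wd(2)[of i] etest_test[of k j] unfolding has_weak_deriv_iff by blast
      finally show ?thesis by simp
    qed
    have s2: "sq_int M (\<psi>2 i)" for i
      unfolding \<psi>2_def[abs_def] by (rule test_function_sq_int[OF test_functions_deriv[OF t1 axis_Basis] open_Om])
    have "ip M (?w s) (L j) = (\<Sum>i\<in>UNIV. ip M (?w s) (\<psi>2 i)) + ip M (?w s) (\<lambda>x. q x * etest k j x)"
    proof -
      have Lj: "L j = (\<lambda>x. (\<Sum>i\<in>UNIV. \<psi>2 i x) + q x * etest k j x)" by (simp add: L_def \<psi>2_def)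
      show ?thesis
        unfolding Lj ip_commute[of M "?w s"]
        by (subst ip_add_left[OF sq_int_sum[OF s2] cospoly_sq_int[OF q st] sl(3)[OF s]])
          (simp add: ip_sum_left[of UNIV M \<psi>2, OF s2 sl(3)[OF s]])
    qed
    also have "\<dots> = ip M LL (etest k j) + ip M (\<lambda>x. q x * ?w s x) (etest k j)"
      unfolding i2 qe LL_def[abs_def] by (simp add: ip_sum_left[of UNIV M ww, OF sw st])
    finally have A: "ip M (?w s) (L j) = ip M LL (etest k j) + ip M (\<lambda>x. q x * ?w s x) (etest k j)" .
    have "ip M LL (e k) = (\<Sum>i\<in>UNIV. - (wt k i)\<^sup>2 * ip M (?w s) (e k))"
      unfolding LL_def[abs_def] ip_sum_left[of UNIV M ww, OF sw trig_sq_int]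
      unfolding ww_def by (intro sum.cong refl H2_H10_eigen sl s)
    then have B: "ip M LL (e k) = - lam k * ip M (?w s) (e k)"
      by (simp add: lam_def sum_distrib_right sum_negf)
    have "ip M (?w s) (L j) - G s = ip M LL (\<lambda>x. etest k j x - e k x) + ip M (\<lambda>x. q x * ?w s x) (\<lambda>x. etest k j x - e k x)"
      unfolding A G_def B[symmetric] ip_commute[of M LL] ip_commute[of M "\<lambda>x. q x * ?w s x"]
        ip_diff_left[OF st trig_sq_int sLL] ip_diff_left[OF st trig_sq_int cospoly_sq_int[OF q sl(3)[OF s]]] by simp
    also have "\<bar>\<dots>\<bar> \<le> nrm M LL * \<delta> j + nrm M (\<lambda>x. q x * ?w s x) * \<delta> j"
      unfolding \<delta>_def
      by (intro order_trans[OF abs_triangle_ineq] add_mono Cauchy_Schwarz_ip sLL sq_int_diff st trig_sq_int cospoly_sq_int[OF q] sl(3)[OF s])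
    also have "\<dots> \<le> R * \<delta> j + (K * R') * \<delta> j"
    proof (intro add_mono mult_right_mono)
      show "nrm M LL \<le> R" unfolding nLL by (rule R(2)[OF s])
      have "nrm M (\<lambda>x. q x * ?w s x) \<le> K * nrm M (?w s)"
        by (rule sq_int_bounded_mult(2)[OF sl(3)[OF s] cospoly_measurable[OF q] K])
      also have "\<dots> \<le> K * R'" using R'(2)[OF s] K0 by (intro mult_left_mono) (simp_all add: norm_fcoef[OF sl(3)[OF s]])
      finally show "nrm M (\<lambda>x. q x * ?w s x) \<le> K * R'" .
    qed (simp_all add: \<delta>_def)
    finally show ?thesis by (simp add: distrib_right)
  qed
  have int: "ip M (?w t) (e k) = ip M (?w 0) (e k) + integral {0..t} G" if t: "t \<in> {0..T}" for t
  proof -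
    have c0: "(\<lambda>j. ip M (?w s) (etest k j)) \<longlonglongrightarrow> ip M (?w s) (e k)" if "s \<in> {0..T}" for s
      unfolding ip_commute[of M "?w s"] by (rule sq_int_tendsto_ip[OF st trig_sq_int sl(3)[OF that] etest_tendsto])
    have sub: "{0..t} \<subseteq> {0..T}" using t by auto
    have sL: "sq_int M (L j)" for j
      unfolding L_def
      by (intro sq_int_add sq_int_sum cospoly_sq_int[OF q] st
          test_function_sq_int[OF test_functions_deriv[OF test_functions_deriv[OF etest_test axis_Basis] axis_Basis] open_Om])
    have i1: "(\<lambda>s. ip M (?w s) (L j)) integrable_on {0..t}" for j
      by (rule integrable_continuous_real[OF continuous_on_subset[OF cont[OF sL] sub]])
    have i2: "G integrable_on {0..t}" by (rule integrable_continuous_real[OF continuous_on_subset[OF Gc sub]])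
    have bd: "\<bar>integral {0..t} (\<lambda>s. ip M (?w s) (L j)) - integral {0..t} G\<bar> \<le> ((R + K * R') * t) * \<delta> j" for j
    proof -
      have "integral {0..t} (\<lambda>s. ip M (?w s) (L j)) - integral {0..t} G = integral {0..t} (\<lambda>s. ip M (?w s) (L j) - G s)"
        by (rule Henstock_Kurzweil_Integration.integral_diff[OF i1 i2, symmetric])
      also have "norm \<dots> \<le> integral {0..t} (\<lambda>s. (R + K * R') * \<delta> j)"
        by (rule integral_norm_bound_integral[OF Henstock_Kurzweil_Integration.integrable_diff[OF i1 i2]]) (use close sub in auto)
      also have "\<dots> = ((R + K * R') * t) * \<delta> j" using t by (simp add: mult_ac)
      finally show ?thesis by simp
    qed
    have "(\<lambda>j. integral {0..t} (\<lambda>s. ip M (?w s) (L j)) - integral {0..t} G) \<longlonglongrightarrow> 0"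
    proof (rule Lim_null_comparison)
      show "\<forall>\<^sub>F j in sequentially. norm (integral {0..t} (\<lambda>s. ip M (?w s) (L j)) - integral {0..t} G) \<le> ((R + K * R') * t) * \<delta> j"
        using bd by simp
      show "(\<lambda>j. ((R + K * R') * t) * \<delta> j) \<longlonglongrightarrow> 0" by (rule tendsto_mult_right_zero[OF \<delta>0])
    qed
    then have "(\<lambda>j. integral {0..t} (\<lambda>s. ip M (?w s) (L j))) \<longlonglongrightarrow> integral {0..t} G" by (rule LIM_zero_cancel)
    then have "(\<lambda>j. ip M (?w 0) (etest k j) + integral {0..t} (\<lambda>s. ip M (?w s) (L j))) \<longlonglongrightarrow> ip M (?w 0) (e k) + integral {0..t} G"
      using T by (intro tendsto_add c0) auto
    moreover have "ip M (?w 0) (etest k j) + integral {0..t} (\<lambda>s. ip M (?w s) (L j)) = ip M (?w t) (etest k j)" for j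
      using solution_test_integral[OF sol q T etest_test[of k j] t] by (simp add: L_def)
    ultimately have "(\<lambda>j. ip M (?w t) (etest k j)) \<longlonglongrightarrow> ip M (?w 0) (e k) + integral {0..t} G" by simp
    with c0[OF t] show ?thesis by (rule LIMSEQ_unique)
  qed
  have "((\<lambda>t. ip M (?w 0) (e k) + integral {0..t} G) has_real_derivative G t) (at t within {0..T})"
    using DERIV_add[OF DERIV_const integral_has_real_derivative[OF Gc t]] by simp
  then have "((\<lambda>t. ip M (?w t) (e k)) has_real_derivative G t) (at t within {0..T})"
    by (rule has_field_derivative_transform_within[OF _ zero_less_one t]) (rule int[symmetric])
  then show ?thesis unfolding G_def .
qed

subsection \<open>Short time asymptotics\<close>

lemma sum_sq_ip_le: "sq_int M w \<Longrightarrow> finite F \<Longrightarrow> (\<Sum>k\<in>F. (ip M w (e k))\<^sup>2) \<le> (nrm M w)\<^sup>2"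
  using sum_coord_le[of F "fcoef w"] by (simp add: coord_fcoef norm_fcoef)

text \<open>Gronwall's inequality for the energy of the coefficients. The potential contributes to a
  rate of order \<open>1 / T\<close>, which over a time \<open>T\<close> amounts to the fixed factor
  \<open>exp (1 + 2 * K)\<close>; the forcing contributes \<open>T * C^2\<close> per unit of time.
  The square root of the resulting bound is linear in \<open>T\<close>.\<close>

lemma coefficient_energy_estimate:
  fixes z :: "real \<Rightarrow> real ^ 'n \<Rightarrow> real"
  assumes T: "0 < T" and K: "0 < K" "\<And>x. \<bar>\<alpha> x\<bar> \<le> K" and \<alpha>: "\<alpha> \<in> borel_measurable M"
    and s: "\<And>t. t \<in> {0..T} \<Longrightarrow> sq_int M (z t)" and c: "continuous_on {0..T} (\<lambda>t. fcoef (z t))"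
    and D: "\<And>t k. t \<in> {0..T} \<Longrightarrow> ((\<lambda>t. ip M (z t) (e k)) has_real_derivative
        - lam k * ip M (z t) (e k) - Y t k + ip M (\<lambda>x. \<alpha> x * z t x) (e k) / T) (at t within {0..T})"
    and Y: "\<And>t F. t \<in> {0..T} \<Longrightarrow> finite F \<Longrightarrow> (\<Sum>k\<in>F. (Y t k)\<^sup>2) \<le> C\<^sup>2" and C: "0 \<le> C"
    and z0: "nrm M (z 0) = 0"
  shows "nrm M (z T) \<le> exp (1 / 2 + K) * C * T"
proof -
  define n where "n t = (norm (fcoef (z t)))\<^sup>2" for t
  define d where "d = (1 + 2 * K) / T"
  \<comment> \<open>Differentiability is at hand for finite sums of coefficients, not for the full
    norm. The derivatives of the finite sums lie below \<open>g\<close>, so the integral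
    \<open>G\<close> of \<open>g\<close> dominates all of them and hence the full norm.\<close>
  define g where "g t = d * n t + T * C\<^sup>2" for t
  define G where "G t = integral {0..t} g" for t
  have d0: "0 < d" using T K by (simp add: d_def)
  have n: "n t = (nrm M (z t))\<^sup>2" if "t \<in> {0..T}" for t using norm_fcoef[OF s[OF that]] by (simp add: n_def)
  have gc: "continuous_on {0..T} g" unfolding g_def n_def by (intro continuous_intros c)
  have Gd: "(G has_real_derivative g t) (at t within {0..T})" if "t \<in> {0..T}" for t
    unfolding G_def[abs_def] by (rule integral_has_real_derivative[OF gc that])
  have Gc: "continuous_on {0..T} G" by (rule DERIV_continuous_on[OF Gd])
  have le: "(\<Sum>k\<in>F. (ip M (z t) (e k))\<^sup>2) \<le> G t" if F: "finite F" and t: "t \<in> {0..T}" for F t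
  proof -
    define w where "w t k = ip M (\<lambda>x. \<alpha> x * z t x) (e k)" for t k
    define p where "p t k = ip M (z t) (e k)" for t k
    define E where "E t = (\<Sum>k\<in>F. (p t k)\<^sup>2)" for t
    define E' where "E' t = (\<Sum>k\<in>F. 2 * p t k * (- lam k * p t k - Y t k + w t k / T))" for t
    have Ed: "(E has_real_derivative E' t) (at t within {0..T})" if t: "t \<in> {0..T}" for t
    proof -
      have "((\<lambda>t. (p t k)\<^sup>2) has_real_derivative 2 * p t k * (- lam k * p t k - Y t k + w t k / T)) (at t within {0..T})" for k
        using DERIV_power[OF D[OF t, of k], of 2] by (simp add: p_def w_def mult_ac)
      then show ?thesis unfolding E_def[abs_def] E'_def by (intro DERIV_sum)
    qed
    have E'g: "E' t \<le> g t" if t: "t \<in> {0..T}" for t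
    proof -
      have "2 * p t k * (- lam k * p t k - Y t k + w t k / T)
          \<le> (1 + K) / T * (p t k)\<^sup>2 + T * (Y t k)\<^sup>2 + 1 / (T * K) * (w t k)\<^sup>2" for k
      proof -
        \<comment> \<open>Squares completed with the weights \<open>T\<close> and \<open>K\<close>
          absorb the forcing and the potential; the diffusion term has a favourable sign and is
          dropped.\<close>
        have "0 \<le> (p t k + T * Y t k)\<^sup>2 / T" "0 \<le> (K * p t k - w t k)\<^sup>2 / (T * K)" "0 \<le> 2 * lam k * (p t k)\<^sup>2"
          using T K lam_pos[of k] by auto
        moreover have "(p t k + T * Y t k)\<^sup>2 / T = (p t k)\<^sup>2 / T + T * (Y t k)\<^sup>2 + 2 * p t k * Y t k"
          using T by (simp add: power2_sum field_simps power2_eq_square)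
        moreover have "(K * p t k - w t k)\<^sup>2 / (T * K) = K * (p t k)\<^sup>2 / T + (w t k)\<^sup>2 / (T * K) - 2 * p t k * w t k / T"
          using T K by (simp add: power2_diff field_simps power2_eq_square)
        ultimately show ?thesis by (simp add: algebra_simps add_divide_distrib power2_eq_square)
      qed
      then have "E' t \<le> (\<Sum>k\<in>F. (1 + K) / T * (p t k)\<^sup>2 + T * (Y t k)\<^sup>2 + 1 / (T * K) * (w t k)\<^sup>2)"
        unfolding E'_def by (rule sum_mono)
      also have "\<dots> = (1 + K) / T * (\<Sum>k\<in>F. (p t k)\<^sup>2) + T * (\<Sum>k\<in>F. (Y t k)\<^sup>2) + 1 / (T * K) * (\<Sum>k\<in>F. (w t k)\<^sup>2)"
        by (simp only: sum.distrib sum_distrib_left)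
      also have "\<dots> \<le> (1 + K) / T * n t + T * C\<^sup>2 + 1 / (T * K) * (K\<^sup>2 * n t)"
      proof (intro add_mono mult_left_mono)
        show "(\<Sum>k\<in>F. (p t k)\<^sup>2) \<le> n t" unfolding p_def n[OF t] by (rule sum_sq_ip_le[OF s[OF t] F])
        show "(\<Sum>k\<in>F. (Y t k)\<^sup>2) \<le> C\<^sup>2" by (rule Y[OF t F])
        have "(\<Sum>k\<in>F. (w t k)\<^sup>2) \<le> (nrm M (\<lambda>x. \<alpha> x * z t x))\<^sup>2"
          unfolding w_def by (rule sum_sq_ip_le[OF sq_int_bounded_mult(1)[OF s[OF t] \<alpha> K(2)] F])
        also have "\<dots> \<le> (K * nrm M (z t))\<^sup>2" by (rule power_mono[OF sq_int_bounded_mult(2)[OF s[OF t] \<alpha> K(2)] nrm_nonneg])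
        finally show "(\<Sum>k\<in>F. (w t k)\<^sup>2) \<le> K\<^sup>2 * n t" unfolding n[OF t] by (simp add: power_mult_distrib)
      qed (use T K in auto)
      also have "\<dots> = g t" using T K by (simp add: g_def d_def field_simps power2_eq_square)
      finally show ?thesis .
    qed
    have at: "at r within {0..T} = at r" if "0 < r" "r < T" for r using that by (rule at_within_Icc_at)
    have "G 0 - E 0 \<le> G t - E t"
    proof (rule DERIV_nonneg_imp_increasing_open[where f = "\<lambda>r. G r - E r"])
      show "0 \<le> t" using t by simp
      show "\<exists>y. ((\<lambda>r. G r - E r) has_real_derivative y) (at r) \<and> 0 \<le> y" if r: "0 < r" "r < t" for r
      proof -
        have r': "r \<in> {0..T}" "r < T" using r t by auto
        show ?thesis
          using DERIV_diff[OF Gd[OF r'(1)] Ed[OF r'(1)]] E'g[OF r'(1)] at[OF r(1) r'(2)] by auto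
      qed
      show "continuous_on {0..t} (\<lambda>r. G r - E r)"
        using t by (intro continuous_on_diff continuous_on_subset[OF Gc] continuous_on_subset[OF DERIV_continuous_on[OF Ed]]) auto
    qed
    moreover have "E 0 = 0"
    proof -
      have "E 0 \<le> (nrm M (z 0))\<^sup>2" unfolding E_def p_def using T by (intro sum_sq_ip_le s F) auto
      moreover have "0 \<le> E 0" unfolding E_def by (rule sum_nonneg) simp
      ultimately show ?thesis using z0 by simp
    qed
    ultimately show ?thesis by (simp add: E_def p_def G_def)
  qed
  have nG: "n t \<le> G t" if t: "t \<in> {0..T}" for t
  proof -
    have G0: "0 \<le> G t" using le[of "{}", OF _ t] by simp
    have "norm (fcoef (z t)) \<le> sqrt (G t)"
      by (rule norm_ell2_le) (use G0 le[OF _ t] in \<open>simp_all add: coord_fcoef[OF s[OF t]]\<close>)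
    then have "n t \<le> (sqrt (G t))\<^sup>2" unfolding n_def by (rule power_mono) simp
    then show ?thesis using G0 by simp
  qed
  \<comment> \<open>As \<open>n \<le> G\<close>, the derivative of \<open>G\<close> is at most
    \<open>d * G + T * C^2\<close>, so this function does not increase.\<close>
  define H where "H t = exp (- d * t) * G t - T * C\<^sup>2 * t" for t
  have "H T \<le> H 0"
  proof (rule DERIV_nonpos_imp_decreasing_open[where f = H])
    show "0 \<le> T" using T by simp
    show "\<exists>y. (H has_real_derivative y) (at r) \<and> y \<le> 0" if r: "0 < r" "r < T" for r
    proof -
      have r': "r \<in> {0..T}" using r by auto
      have Gr: "(G has_real_derivative g r) (at r)" using Gd[OF r'] at_within_Icc_at[OF r] by simp
      have "(H has_real_derivative exp (- d * r) * (g r - d * G r) - T * C\<^sup>2) (at r)"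
        unfolding H_def[abs_def] by (rule derivative_eq_intros Gr refl)+ (simp add: algebra_simps)
      moreover have "exp (- d * r) * (g r - d * G r) \<le> T * C\<^sup>2"
      proof -
        have "g r - d * G r \<le> T * C\<^sup>2" using nG[OF r'] d0 by (simp add: g_def)
        then have "exp (- d * r) * (g r - d * G r) \<le> exp (- d * r) * (T * C\<^sup>2)" by (rule mult_left_mono) simp
        also have "\<dots> \<le> 1 * (T * C\<^sup>2)" using T d0 r by (intro mult_right_mono) auto
        finally show ?thesis by simp
      qed
      ultimately show ?thesis by auto
    qed
    show "continuous_on {0..T} H" unfolding H_def[abs_def] by (intro continuous_intros Gc)
  qed
  then have "exp (- d * T) * G T \<le> T * C\<^sup>2 * T" by (simp add: H_def G_def)
  then have "exp (d * T) * (exp (- d * T) * G T) \<le> exp (d * T) * (T * C\<^sup>2 * T)" by (rule mult_left_mono) simp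
  then have "G T \<le> exp (d * T) * (T * C\<^sup>2 * T)" by (simp flip: mult.assoc exp_add)
  \<comment> \<open>Split into equal halves so that the bound becomes a visible square.\<close>
  also have "d * T = (1 / 2 + K) + (1 / 2 + K)" using T by (simp add: d_def)
  also have "exp ((1 / 2 + K) + (1 / 2 + K)) * (T * C\<^sup>2 * T) = (exp (1 / 2 + K) * C * T)\<^sup>2"
    unfolding exp_add[of "1 / 2 + K" "1 / 2 + K"] by (simp add: power2_eq_square)
  finally have "(nrm M (z T))\<^sup>2 \<le> (exp (1 / 2 + K) * C * T)\<^sup>2" using nG[of T] n[of T] T by simp
  then show ?thesis by (rule power2_le_imp_le) (use T C in auto)
qed

end

text \<open>The upper bound comes from \<open>exp h * (1 - h) \<le> 1\<close> and
  \<open>1 \<le> (1 + h + 2 * h^2) * (1 - h)\<close>, the latter for \<open>h \<le> 1 / 2\<close>;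
  the lower bound is \<open>1 + h \<le> exp h\<close>.\<close>

lemma exp_remainder_bound: "\<bar>exp h - 1 - h\<bar> \<le> 2 * h\<^sup>2" if h: "\<bar>h\<bar> \<le> 1 / 2" for h :: real
proof -
  have "1 - h \<le> exp (- h)" using exp_ge_add_one_self[of "- h"] by simp
  then have "exp h * (1 - h) \<le> 1" using mult_left_mono[of "1 - h" "exp (- h)" "exp h"] by (simp flip: exp_add)
  moreover have "1 \<le> (1 + h + 2 * h\<^sup>2) * (1 - h)"
  proof -
    have "(1 + h + 2 * h\<^sup>2) * (1 - h) = 1 + h\<^sup>2 * (1 - 2 * h)" by (simp add: algebra_simps power2_eq_square)
    then show ?thesis using h by simp
  qed
  ultimately have "exp h * (1 - h) \<le> (1 + h + 2 * h\<^sup>2) * (1 - h)" by linarith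
  then have "exp h \<le> 1 + h + 2 * h\<^sup>2" using h by (simp add: mult_le_cancel_right)
  then show ?thesis using exp_ge_add_one_self[of h] by linarith
qed

context rect
begin

lemma cospoly_exp_mult:
  assumes \<alpha>: "\<alpha> \<in> cospoly" and w: "sq_int M w"
  shows "sq_int M (\<lambda>x. exp (s * \<alpha> x) * w x)"
proof -
  obtain C where C: "\<And>x. \<bar>\<alpha> x\<bar> \<le> C" using cospoly_bounded[OF \<alpha>] by blast
  show ?thesis
  proof (rule sq_int_bounded_mult(1)[OF w])
    show "(\<lambda>x. exp (s * \<alpha> x)) \<in> borel_measurable M" using cospoly_measurable[OF \<alpha>] by measurable
    show "\<bar>exp (s * \<alpha> x)\<bar> \<le> exp (\<bar>s\<bar> * C)" for x
    proof -
      have "s * \<alpha> x \<le> \<bar>s * \<alpha> x\<bar>" by (rule abs_ge_self)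
      also have "\<dots> \<le> \<bar>s\<bar> * C" unfolding abs_mult by (rule mult_left_mono[OF C]) simp
      finally show ?thesis by simp
    qed
  qed
qed

text \<open>Boundedness of \<open>\<alpha>\<close> makes the remainder of the exponential
  quadratically small uniformly in \<open>x\<close>, so the derivative exists in norm and not only
  coefficient by coefficient.\<close>

lemma exp_flow_derivative:
  assumes \<alpha>: "\<alpha> \<in> cospoly" and w: "sq_int M w"
  shows "((\<lambda>s. fcoef (\<lambda>x. exp (s * \<alpha> x) * w x)) has_vector_derivative
    fcoef (\<lambda>x. \<alpha> x * (exp (s * \<alpha> x) * w x))) (at s)"
proof -
  obtain C where C: "\<And>x. \<bar>\<alpha> x\<bar> \<le> C" using cospoly_bounded[OF \<alpha>] by blast
  define K where "K = C + 1"
  have C0: "0 \<le> C" using C[of 0] by linarith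
  have K: "\<bar>\<alpha> x\<bar> \<le> K" "0 < K" for x using C[of x] C0 by (auto simp: K_def)
  define y where "y s x = exp (s * \<alpha> x) * w x" for s x
  have sy: "sq_int M (y s)" for s unfolding y_def[abs_def] by (rule cospoly_exp_mult[OF \<alpha> w])
  have say: "sq_int M (\<lambda>x. \<alpha> x * y s x)" by (rule cospoly_sq_int[OF \<alpha> sy])
  define P where "P = fcoef (\<lambda>x. \<alpha> x * y s x)"
  have "((\<lambda>s. fcoef (y s)) has_derivative (\<lambda>r. r *\<^sub>R P)) (at s)"
  proof (rule has_derivativeI_sandwich)
    show "0 < 1 / (2 * K)" using K by simp
    show "bounded_linear (\<lambda>r. r *\<^sub>R P)" by (rule bounded_linear_scaleR_left)
    show "norm (fcoef (y r) - fcoef (y s) - (r - s) *\<^sub>R P) / norm (r - s) \<le> 2 * K\<^sup>2 * nrm M (y s) * \<bar>r - s\<bar>"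
      if "r \<noteq> s" and d: "dist r s < 1 / (2 * K)" for r
    proof -
      define \<delta> where "\<delta> = r - s"
      have \<delta>: "\<delta> \<noteq> 0" using that(1) by (simp add: \<delta>_def)
      have \<delta>K: "\<bar>\<delta>\<bar> * K \<le> 1 / 2" using d K(2) by (simp add: \<delta>_def dist_real_def field_simps)
      have b: "\<bar>exp (\<delta> * \<alpha> x) - 1 - \<delta> * \<alpha> x\<bar> \<le> 2 * (\<bar>\<delta>\<bar> * K)\<^sup>2" for x
      proof -
        have "\<bar>\<delta> * \<alpha> x\<bar> \<le> \<bar>\<delta>\<bar> * K" unfolding abs_mult by (rule mult_left_mono[OF K(1)]) simp
        moreover have "(\<delta> * \<alpha> x)\<^sup>2 \<le> (\<bar>\<delta>\<bar> * K)\<^sup>2" using power_mono[OF calculation, of 2] by simp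
        moreover have "\<bar>\<delta> * \<alpha> x\<bar> \<le> 1 / 2" using calculation(1) \<delta>K by linarith
        ultimately show ?thesis using exp_remainder_bound[of "\<delta> * \<alpha> x"] by linarith
      qed
      have m: "(\<lambda>x. exp (\<delta> * \<alpha> x) - 1 - \<delta> * \<alpha> x) \<in> borel_measurable M" using cospoly_measurable[OF \<alpha>] by measurable
      have sd: "sq_int M (\<lambda>x. \<delta> * (\<alpha> x * y s x))" by (rule sq_int_cmult[OF say])
      have fd: "\<delta> *\<^sub>R P = fcoef (\<lambda>x. \<delta> * (\<alpha> x * y s x))"
        by (rule ell2_eqI) (simp add: P_def coord_fcoef[OF say] coord_fcoef[OF sd] ip_cmult_left)
      have "fcoef (y r) - fcoef (y s) - \<delta> *\<^sub>R P = fcoef (\<lambda>x. y r x - y s x - \<delta> * (\<alpha> x * y s x))"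
        unfolding fd by (simp add: fcoef_diff sy sd sq_int_diff)
      also have "norm \<dots> = nrm M (\<lambda>x. y r x - y s x - \<delta> * (\<alpha> x * y s x))"
        by (intro norm_fcoef sq_int_diff sy sd)
      also have "(\<lambda>x. y r x - y s x - \<delta> * (\<alpha> x * y s x)) = (\<lambda>x. (exp (\<delta> * \<alpha> x) - 1 - \<delta> * \<alpha> x) * y s x)"
      proof
        fix x
        have "r * \<alpha> x = \<delta> * \<alpha> x + s * \<alpha> x" by (simp add: \<delta>_def algebra_simps)
        then have "y r x = exp (\<delta> * \<alpha> x) * y s x" by (simp add: y_def exp_add)
        then show "y r x - y s x - \<delta> * (\<alpha> x * y s x) = (exp (\<delta> * \<alpha> x) - 1 - \<delta> * \<alpha> x) * y s x"
          by (simp add: left_diff_distrib)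
      qed
      also have "nrm M \<dots> \<le> 2 * (\<bar>\<delta>\<bar> * K)\<^sup>2 * nrm M (y s)" by (rule sq_int_bounded_mult(2)[OF sy m b])
      finally have "norm (fcoef (y r) - fcoef (y s) - \<delta> *\<^sub>R P) / \<bar>\<delta>\<bar> \<le> (2 * (\<bar>\<delta>\<bar> * K)\<^sup>2 * nrm M (y s)) / \<bar>\<delta>\<bar>"
        by (rule divide_right_mono) simp
      also have "\<dots> = 2 * K\<^sup>2 * nrm M (y s) * \<bar>\<delta>\<bar>" using \<delta> by (simp add: power2_eq_square)
      finally show ?thesis by (simp add: \<delta>_def)
    qed
    have "((\<lambda>r. 2 * K\<^sup>2 * nrm M (y s) * \<bar>r - s\<bar>) \<longlongrightarrow> 2 * K\<^sup>2 * nrm M (y s) * \<bar>s - s\<bar>) (at s)"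
      by (intro tendsto_intros)
    then show "((\<lambda>r. 2 * K\<^sup>2 * nrm M (y s) * \<bar>r - s\<bar>) \<longlongrightarrow> 0) (at s)" by simp
  qed
  then show ?thesis by (simp add: has_vector_derivative_def y_def[abs_def] P_def)
qed

text \<open>In the weighted coordinates each factor \<open>1 + r * \<alpha>\<close> acts as the
  identity plus \<open>r\<close> times \<open>B\<close>, an operator of norm at most
  \<open>1 + r * \<beta>\<close>. The witness \<open>Z\<close> is the image of \<open>X\<close>
  under its power.\<close>

lemma domain_multiplier_power:
  assumes g: "domain_multiplier \<alpha> B" and \<beta>: "0 \<le> \<beta>" "\<And>x. norm (B x) \<le> norm x * \<beta>" and r: "0 \<le> r" and \<alpha>: "\<alpha> \<in> cospoly"
    and w: "sq_int M w" "\<And>k. lam k * ip M w (e k) = coord X k"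
  shows "\<exists>Z. sq_int M (\<lambda>x. (1 + r * \<alpha> x) ^ n * w x) \<and> (\<forall>k. lam k * ip M (\<lambda>x. (1 + r * \<alpha> x) ^ n * w x) (e k) = coord Z k)
    \<and> norm Z \<le> (1 + r * \<beta>) ^ n * norm X"
proof (induction n)
  case 0
  show ?case using w by auto
next
  case (Suc n)
  let ?f = "\<lambda>x. (1 + r * \<alpha> x) ^ n * w x"
  obtain Z where Z: "sq_int M ?f" "\<And>k. lam k * ip M ?f (e k) = coord Z k" "norm Z \<le> (1 + r * \<beta>) ^ n * norm X"
    using Suc.IH by auto
  have sa: "sq_int M (\<lambda>x. \<alpha> x * ?f x)" by (rule cospoly_sq_int[OF \<alpha> Z(1)])
  have eq: "(\<lambda>x. (1 + r * \<alpha> x) ^ Suc n * w x) = (\<lambda>x. ?f x + r * (\<alpha> x * ?f x))"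
    by (rule ext) (simp add: algebra_simps)
  have BZ: "lam k * ip M (\<lambda>x. \<alpha> x * ?f x) (e k) = coord (B Z) k" for k
    using g Z(1,2) unfolding domain_multiplier_def by blast
  have "lam k * ip M (\<lambda>x. ?f x + r * (\<alpha> x * ?f x)) (e k) = coord (Z + r *\<^sub>R B Z) k" for k
    unfolding ip_add_left[OF Z(1) sq_int_cmult[OF sa] trig_sq_int] ip_cmult_left
    by (simp add: distrib_left Z(2) mult.left_commute[of "lam k"] BZ)
  moreover have "norm (Z + r *\<^sub>R B Z) \<le> (1 + r * \<beta>) ^ Suc n * norm X"
  proof -
    have "norm (Z + r *\<^sub>R B Z) \<le> norm Z + r * (norm Z * \<beta>)"
      using norm_triangle_ineq[of Z "r *\<^sub>R B Z"] mult_left_mono[OF \<beta>(2)[of Z] r] r by simp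
    also have "\<dots> = (1 + r * \<beta>) * norm Z" by (simp add: algebra_simps)
    also have "\<dots> \<le> (1 + r * \<beta>) * ((1 + r * \<beta>) ^ n * norm X)" using \<beta> r by (intro mult_left_mono Z(3)) auto
    finally show ?thesis by simp
  qed
  moreover have "sq_int M (\<lambda>x. ?f x + r * (\<alpha> x * ?f x))" by (rule sq_int_add[OF Z(1) sq_int_cmult[OF sa]])
  ultimately show ?case unfolding eq by blast
qed

text \<open>Approximating the exponential by \<open>(1 + s \<alpha> / N) ^ N\<close> keeps the functions in the domain of the
  Laplacian, on which multiplication by \<open>\<alpha>\<close> is bounded.\<close>

lemma exp_flow_Laplacian_bound:
  assumes \<alpha>: "\<alpha> \<in> cospoly" and w: "w \<in> H2 \<Omega>" "w \<in> H10 \<Omega>"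
  shows "\<exists>C\<ge>0. \<forall>s\<in>{0..1}. \<forall>F. finite F \<longrightarrow> (\<Sum>k\<in>F. (lam k * ip M (\<lambda>x. exp (s * \<alpha> x) * w x) (e k))\<^sup>2) \<le> C\<^sup>2"
proof -
  obtain B where g: "domain_multiplier \<alpha> B" using cospoly_domain_multiplier[OF \<alpha>] by blast
  then have "bounded_linear B" by (simp add: domain_multiplier_def)
  from bounded_linear.nonneg_bounded[OF this] obtain \<beta> where \<beta>: "0 \<le> \<beta>" "\<And>x. norm (B x) \<le> norm x * \<beta>" by blast
  obtain K where K: "\<And>x. \<bar>\<alpha> x\<bar> \<le> K" using cospoly_bounded[OF \<alpha>] by blast
  have K0: "0 \<le> K" using K[of 0] by linarith
  have sw: "sq_int M w" by (rule H2D(1)[OF open_Om w(1)])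
  define X where "X = lapcoef w"
  define C where "C = exp \<beta> * norm X"
  have "(\<Sum>k\<in>F. (lam k * ip M (\<lambda>x. exp (s * \<alpha> x) * w x) (e k))\<^sup>2) \<le> C\<^sup>2"
    if s: "s \<in> {0..1}" and F: "finite F" for s F
  proof -
    define f where "f j x = (1 + s / real (Suc j) * \<alpha> x) ^ Suc j * w x" for j x
    define y where "y x = exp (s * \<alpha> x) * w x" for x
    have sy: "sq_int M y" unfolding y_def[abs_def] by (rule cospoly_exp_mult[OF \<alpha> sw])
    have pw: "(1 + x / real (Suc j)) ^ Suc j \<le> exp x" if "0 \<le> x" for x j
      using exp_ge_one_plus_x_over_n_power_n[of "Suc j" x] that by simp
    have fj: "sq_int M (f j)" "(\<Sum>k\<in>F. (lam k * ip M (f j) (e k))\<^sup>2) \<le> C\<^sup>2" for j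
    proof -
      have r: "0 \<le> s / real (Suc j)" using s by simp
      obtain Z where Z: "sq_int M (f j)" "\<And>k. lam k * ip M (f j) (e k) = coord Z k"
          "norm Z \<le> (1 + s / real (Suc j) * \<beta>) ^ Suc j * norm X"
        using domain_multiplier_power[OF g \<beta> r \<alpha> sw, of X "Suc j"] coord_lapcoef[OF w] unfolding X_def f_def[abs_def] by metis
      show "sq_int M (f j)" by (rule Z(1))
      have "(1 + s / real (Suc j) * \<beta>) ^ Suc j \<le> (1 + \<beta> / real (Suc j)) ^ Suc j"
        using s \<beta> by (intro power_mono add_left_mono) (auto simp: divide_simps mult_left_le_one_le)
      also have "\<dots> \<le> exp \<beta>" by (rule pw[OF \<beta>(1)])
      finally have "(1 + s / real (Suc j) * \<beta>) ^ Suc j * norm X \<le> C" unfolding C_def by (rule mult_right_mono) simp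
      with Z(3) have "norm Z \<le> C" by linarith
      then have "(norm Z)\<^sup>2 \<le> C\<^sup>2" by (rule power_mono) simp
      then show "(\<Sum>k\<in>F. (lam k * ip M (f j) (e k))\<^sup>2) \<le> C\<^sup>2" unfolding Z(2) using sum_coord_le[OF F, of Z] by linarith
    qed
    have lim: "(\<lambda>j. nrm M (\<lambda>x. f j x - y x)) \<longlonglongrightarrow> 0"
    proof (rule nrm_dominated_convergence(2)[of M "\<lambda>x. exp K * \<bar>w x\<bar>"])
      have "sq_int M (\<lambda>x. \<bar>w x\<bar>)" by (rule nrm_mono(1)[OF sw]) (use sw in auto)
      then show "sq_int M (\<lambda>x. exp K * \<bar>w x\<bar>)" by (rule sq_int_cmult)
      show "f j \<in> borel_measurable M" for j using fj(1) by (rule sq_int_measurable)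
      show "y \<in> borel_measurable M" using sy by (rule sq_int_measurable)
      show "AE x in M. \<bar>f j x\<bar> \<le> exp K * \<bar>w x\<bar>" for j
      proof (rule AE_I2)
        fix x
        have "\<bar>s / real (Suc j) * \<alpha> x\<bar> \<le> K / real (Suc j)"
          using s K[of x] mult_mono[of s 1 "\<bar>\<alpha> x\<bar>" K] by (simp add: abs_mult divide_right_mono)
        then have "\<bar>1 + s / real (Suc j) * \<alpha> x\<bar> \<le> 1 + K / real (Suc j)" by linarith
        then have "\<bar>1 + s / real (Suc j) * \<alpha> x\<bar> ^ Suc j \<le> (1 + K / real (Suc j)) ^ Suc j" by (rule power_mono) simp
        also have "\<dots> \<le> exp K" by (rule pw[OF K0])
        finally show "\<bar>f j x\<bar> \<le> exp K * \<bar>w x\<bar>" unfolding f_def abs_mult power_abs by (rule mult_right_mono) simp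
      qed
      show "AE x in M. (\<lambda>j. f j x) \<longlonglongrightarrow> y x"
      proof (rule AE_I2)
        fix x
        have "(\<lambda>j. (1 + (s * \<alpha> x) / real (Suc j)) ^ Suc j * w x) \<longlonglongrightarrow> exp (s * \<alpha> x) * w x"
          by (intro tendsto_mult_right LIMSEQ_Suc[OF tendsto_exp_limit_sequentially])
        then show "(\<lambda>j. f j x) \<longlonglongrightarrow> y x" by (simp only: f_def y_def times_divide_eq_left)
      qed
    qed
    \<comment> \<open>For finitely many coefficients convergence in \<open>L2\<close> suffices, and
      the bound \<open>C\<close> does not depend on \<open>F\<close>.\<close>
    have "(\<lambda>j. \<Sum>k\<in>F. (lam k * ip M (f j) (e k))\<^sup>2) \<longlonglongrightarrow> (\<Sum>k\<in>F. (lam k * ip M y (e k))\<^sup>2)"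
    proof (intro tendsto_sum tendsto_power tendsto_mult_left)
      fix k
      show "(\<lambda>j. ip M (f j) (e k)) \<longlonglongrightarrow> ip M y (e k)"
        by (rule sq_int_tendsto_ip[OF fj(1) sy trig_sq_int lim])
    qed
    then have "(\<Sum>k\<in>F. (lam k * ip M y (e k))\<^sup>2) \<le> C\<^sup>2" by (rule LIMSEQ_le_const2) (use fj(2) in blast)
    then show ?thesis by (simp add: y_def[abs_def])
  qed
  then show ?thesis by (intro exI[of _ C]) (auto simp: C_def)
qed

text \<open>The difference \<open>z\<close> of the solution and
  \<open>exp (t / T * \<alpha>) * u\<^sub>0\<close> satisfies the same equation with the Laplacian
  of the comparison function as forcing. In coefficients this is minus
  \<open>lam k * ip M (y t) (e k)\<close>, bounded uniformly in \<open>T\<close> because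
  \<open>t / T\<close> always runs through the unit interval.\<close>

lemma short_time_estimate:
  assumes \<alpha>: "\<alpha> \<in> cospoly" and u0: "u\<^sub>0 \<in> H2 \<Omega>" "u\<^sub>0 \<in> H10 \<Omega>"
  shows "\<exists>C. \<forall>T>0. \<forall>u. is_solution \<Omega> T (\<lambda>z. 1 / T * \<alpha> (fst z)) u\<^sub>0 u \<longrightarrow>
    nrm M (\<lambda>x. u (x, T) - exp (\<alpha> x) * u\<^sub>0 x) \<le> C * T"
proof -
  obtain C where C: "0 \<le> C" "\<And>s F. s \<in> {0..1} \<Longrightarrow> finite F \<Longrightarrow> (\<Sum>k\<in>F. (lam k * ip M (\<lambda>x. exp (s * \<alpha> x) * u\<^sub>0 x) (e k))\<^sup>2) \<le> C\<^sup>2"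
    using exp_flow_Laplacian_bound[OF \<alpha> u0] by blast
  obtain K' where K': "\<And>x. \<bar>\<alpha> x\<bar> \<le> K'" using cospoly_bounded[OF \<alpha>] by blast
  define K where "K = \<bar>K'\<bar> + 1"
  have K: "0 < K" "\<bar>\<alpha> x\<bar> \<le> K" for x using K'[of x] by (auto simp: K_def)
  have su0: "sq_int M u\<^sub>0" by (rule H2D(1)[OF open_Om u0(1)])
  have "nrm M (\<lambda>x. u (x, T) - exp (\<alpha> x) * u\<^sub>0 x) \<le> exp (1 / 2 + K) * C * T"
    if T: "0 < T" and sol: "is_solution \<Omega> T (\<lambda>z. 1 / T * \<alpha> (fst z)) u\<^sub>0 u" for T u
  proof -
    define y where "y t x = exp (t / T * \<alpha> x) * u\<^sub>0 x" for t x
    define z where "z t x = u (x, t) - y t x" for t x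
    have q: "(\<lambda>x. 1 / T * \<alpha> x) \<in> cospoly" by (rule cospoly.mult[OF cospoly.const \<alpha>])
    have su: "sq_int M (\<lambda>x. u (x, t))" if "t \<in> {0..T}" for t by (rule solution_slices(3)[OF sol that])
    have sy: "sq_int M (y t)" for t unfolding y_def[abs_def] by (rule cospoly_exp_mult[OF \<alpha> su0])
    have sz: "sq_int M (z t)" if "t \<in> {0..T}" for t unfolding z_def[abs_def] by (rule sq_int_diff[OF su[OF that] sy])
    have say: "sq_int M (\<lambda>x. \<alpha> x * y t x)" for t by (rule cospoly_sq_int[OF \<alpha> sy])
    have sau: "sq_int M (\<lambda>x. \<alpha> x * u (x, t))" if "t \<in> {0..T}" for t by (rule cospoly_sq_int[OF \<alpha> su[OF that]])
    have yd: "((\<lambda>t. fcoef (y t)) has_vector_derivative (1 / T) *\<^sub>R fcoef (\<lambda>x. \<alpha> x * y t x)) (at t within {0..T})" for t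
    proof -
      have "((\<lambda>t. t / T) has_vector_derivative 1 / T) (at t within {0..T})"
        using DERIV_cdivide[OF DERIV_ident, of T t "{0..T}"] by (simp add: has_real_derivative_iff_has_vector_derivative)
      from vector_diff_chain_within[OF this has_vector_derivative_at_within[OF exp_flow_derivative[OF \<alpha> su0, of "t / T"]]]
      show ?thesis by (simp add: o_def y_def[abs_def])
    qed
    have yc: "continuous_on {0..T} (\<lambda>t. fcoef (y t))"
      unfolding continuous_on_eq_continuous_within using has_vector_derivative_continuous[OF yd] by blast
    show ?thesis
    proof -
      have "nrm M (z T) \<le> exp (1 / 2 + K) * C * T"
      proof (rule coefficient_energy_estimate[OF T K cospoly_measurable[OF \<alpha>] sz, where Y = "\<lambda>t k. lam k * ip M (y t) (e k)"])
        have "fcoef (z t) = fcoef (\<lambda>x. u (x, t)) - fcoef (y t)" if "t \<in> {0..T}" for t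
          unfolding z_def[abs_def] by (rule fcoef_diff[OF su[OF that] sy])
        then show "continuous_on {0..T} (\<lambda>t. fcoef (z t))"
          by (intro continuous_on_eq[OF continuous_on_diff[OF solution_curves(1)[OF sol] yc]]) simp
        show "((\<lambda>t. ip M (z t) (e k)) has_real_derivative
            - lam k * ip M (z t) (e k) - lam k * ip M (y t) (e k) + ip M (\<lambda>x. \<alpha> x * z t x) (e k) / T) (at t within {0..T})"
          if t: "t \<in> {0..T}" for t k
        proof -
          have zk: "ip M (z t) (e k) = ip M (\<lambda>x. u (x, t)) (e k) - ip M (y t) (e k)" if "t \<in> {0..T}" for t
            unfolding z_def[abs_def] by (rule ip_diff_left[OF su[OF that] sy trig_sq_int])
          have azk: "ip M (\<lambda>x. \<alpha> x * z t x) (e k) = ip M (\<lambda>x. \<alpha> x * u (x, t)) (e k) - ip M (\<lambda>x. \<alpha> x * y t x) (e k)"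
            unfolding z_def right_diff_distrib by (rule ip_diff_left[OF sau[OF t] say trig_sq_int])
          have ud: "((\<lambda>t. ip M (\<lambda>x. u (x, t)) (e k)) has_real_derivative
              - lam k * ip M (\<lambda>x. u (x, t)) (e k) + ip M (\<lambda>x. 1 / T * \<alpha> x * u (x, t)) (e k)) (at t within {0..T})"
            by (rule solution_coefficients[OF sol q T t])
          have "((\<lambda>t. coord (fcoef (y t)) k) has_vector_derivative coord ((1 / T) *\<^sub>R fcoef (\<lambda>x. \<alpha> x * y t x)) k) (at t within {0..T})"
            by (rule bounded_linear.has_vector_derivative[OF bounded_linear_coord yd])
          then have ykd: "((\<lambda>t. ip M (y t) (e k)) has_real_derivative 1 / T * ip M (\<lambda>x. \<alpha> x * y t x) (e k)) (at t within {0..T})"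
            by (simp add: coord_fcoef[OF sy] coord_fcoef[OF say] has_real_derivative_iff_has_vector_derivative)
          have qu: "ip M (\<lambda>x. 1 / T * \<alpha> x * u (x, t)) (e k) = 1 / T * ip M (\<lambda>x. \<alpha> x * u (x, t)) (e k)"
            unfolding mult.assoc by (rule ip_cmult_left)
          have dd: "((\<lambda>t. ip M (\<lambda>x. u (x, t)) (e k) - ip M (y t) (e k)) has_real_derivative
              - lam k * ip M (z t) (e k) - lam k * ip M (y t) (e k) + ip M (\<lambda>x. \<alpha> x * z t x) (e k) / T) (at t within {0..T})"
            using DERIV_diff[OF ud ykd] unfolding qu zk[OF t] azk by (simp add: algebra_simps diff_divide_distrib)
          show ?thesis
            by (rule has_field_derivative_transform_within[OF dd zero_less_one t]) (rule zk[symmetric])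
        qed
        show "(\<Sum>k\<in>F. (lam k * ip M (y t) (e k))\<^sup>2) \<le> C\<^sup>2" if "t \<in> {0..T}" "finite F" for t F
          unfolding y_def[abs_def] using that T by (intro C(2)) auto
        show "nrm M (z 0) = 0"
        proof -
          have "AE x in M. z 0 x = 0" using sol by (simp add: is_solution_def z_def y_def)
          then have "nrm M (z 0) = nrm M (\<lambda>x. 0)"
            using sz[of 0] T by (intro nrm_cong_AE) auto
          then show ?thesis by simp
        qed
      qed (use C(1) in auto)
      then show ?thesis using T by (simp add: z_def[abs_def] y_def)
    qed
  qed
  then show ?thesis by blast
qed

end

subsection \<open>Choice of the control\<close>

lemma sign_change_surfacesD:
  assumes "sign_change_surfaces \<Omega> \<G> \<P> \<N> f"
  shows "finite \<P>" "finite \<N>" "\<Union>\<G> \<in> null_sets lebesgue" "\<Omega> - \<Union>\<G> = \<Union>(\<P> \<union> \<N>)"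
    and "S \<in> \<P> \<union> \<N> \<Longrightarrow> open S"
    and "S \<in> \<P> \<Longrightarrow> AE x in lebesgue_on S. f x > 0" "S \<in> \<N> \<Longrightarrow> AE x in lebesgue_on S. f x < 0"
  using assms by (simp_all add: sign_change_surfaces_def)

text \<open>The surfaces form a null set and finitely many subdomains cover the rest of
  \<open>\<Omega>\<close>, so the sign conditions combine to one almost everywhere statement. Both
  functions come with the same families, hence with equal signs.\<close>

lemma same_sign_change_surfaces_AE:
  assumes \<Omega>: "open \<Omega>" and "same_sign_change_surfaces \<Omega> f g"
  shows "AE x in lebesgue_on \<Omega>. f x > 0 \<and> g x > 0 \<or> f x < 0 \<and> g x < 0"
proof -
  obtain \<G> \<P> \<N> where f: "sign_change_surfaces \<Omega> \<G> \<P> \<N> f" and g: "sign_change_surfaces \<Omega> \<G> \<P> \<N> g"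
    using assms(2) unfolding same_sign_change_surfaces_def by blast
  note F = sign_change_surfacesD[OF f] and G = sign_change_surfacesD[OF g]
  have sub: "AE x in lebesgue. x \<in> S \<longrightarrow> Q x" if "S \<in> \<P> \<union> \<N>" "AE x in lebesgue_on S. Q x" for S Q
    using that(2) F(5)[OF that(1)] by (simp add: AE_restrict_space_iff)
  have "AE x in lebesgue. \<forall>S\<in>\<P>. x \<in> S \<longrightarrow> f x > 0" "AE x in lebesgue. \<forall>S\<in>\<P>. x \<in> S \<longrightarrow> g x > 0"
    by (intro AE_finite_allI F(1) sub UnI1 F(6) G(6); assumption)+
  moreover have "AE x in lebesgue. \<forall>S\<in>\<N>. x \<in> S \<longrightarrow> f x < 0" "AE x in lebesgue. \<forall>S\<in>\<N>. x \<in> S \<longrightarrow> g x < 0"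
    by (intro AE_finite_allI F(2) sub UnI2 F(7) G(7); assumption)+
  ultimately have "AE x in lebesgue. x \<in> \<Omega> \<longrightarrow> f x > 0 \<and> g x > 0 \<or> f x < 0 \<and> g x < 0"
    using AE_not_in[OF F(3)]
  proof eventually_elim
    case (elim x)
    show ?case
    proof
      assume "x \<in> \<Omega>"
      then have "x \<in> \<Union>(\<P> \<union> \<N>)" using elim(5) unfolding F(4)[symmetric] by blast
      then obtain S where "x \<in> S" "S \<in> \<P> \<or> S \<in> \<N>" by blast
      then show "f x > 0 \<and> g x > 0 \<or> f x < 0 \<and> g x < 0" using elim(1-4) by blast
    qed
  qed
  then show ?thesis using \<Omega> by (simp add: AE_restrict_space_iff)
qed

context rect
begin

text \<open>An upper bound for the exponents yields the majorant
  \<open>exp c * \<bar>w\<bar>\<close>; how negative they become does not matter.\<close>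

lemma exp_mult_tendsto:
  assumes w: "sq_int M w" and h: "\<And>j. h j \<in> borel_measurable M" "h' \<in> borel_measurable M"
    and le: "\<And>j x. x \<in> \<Omega> \<Longrightarrow> h j x \<le> c" and lim: "AE x in M. (\<lambda>j. h j x) \<longlonglongrightarrow> h' x"
  shows "sq_int M (\<lambda>x. exp (h' x) * w x)" "(\<lambda>j. nrm M (\<lambda>x. exp (h j x) * w x - exp (h' x) * w x)) \<longlonglongrightarrow> 0"
proof -
  have "sq_int M (\<lambda>x. \<bar>w x\<bar>)" by (rule nrm_mono(1)[OF w]) (use w in auto)
  then have s: "sq_int M (\<lambda>x. exp c * \<bar>w x\<bar>)" by (rule sq_int_cmult)
  have m: "(\<lambda>x. exp (h j x) * w x) \<in> borel_measurable M" for j using h(1)[of j] w by measurable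
  have m': "(\<lambda>x. exp (h' x) * w x) \<in> borel_measurable M" using h(2) w by measurable
  have b: "AE x in M. \<bar>exp (h j x) * w x\<bar> \<le> exp c * \<bar>w x\<bar>" for j
    by (rule AE_I2) (use le[of _ j] in \<open>simp add: abs_mult mult_right_mono\<close>)
  have l: "AE x in M. (\<lambda>j. exp (h j x) * w x) \<longlonglongrightarrow> exp (h' x) * w x"
    using lim by eventually_elim (intro tendsto_intros)
  show "sq_int M (\<lambda>x. exp (h' x) * w x)" "(\<lambda>j. nrm M (\<lambda>x. exp (h j x) * w x - exp (h' x) * w x)) \<longlonglongrightarrow> 0"
    by (rule nrm_dominated_convergence[OF s m m' b l])+
qed

text \<open>The exponent \<open>ln (u\<^sub>1 / u\<^sub>0)\<close> may be unbounded in both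
  directions; truncation, continuous approximation and Stone-Weierstrass each cost a third of
  \<open>\<epsilon>\<close>. The error is measured at each stage in \<open>L2\<close> for the
  product of the exponential with \<open>u\<^sub>0\<close>, not for the exponent.\<close>

lemma exists_exp_cospoly_approximation:
  assumes u0: "sq_int M u\<^sub>0" and u1: "sq_int M u\<^sub>1"
    and sgn: "AE x in M. u\<^sub>0 x > 0 \<and> u\<^sub>1 x > 0 \<or> u\<^sub>0 x < 0 \<and> u\<^sub>1 x < 0" and \<epsilon>: "\<epsilon> > 0"
  shows "\<exists>\<alpha>\<in>cospoly. nrm M (\<lambda>x. exp (\<alpha> x) * u\<^sub>0 x - u\<^sub>1 x) < \<epsilon>"
proof -
  define L where "L x = ln (u\<^sub>1 x / u\<^sub>0 x)" for x
  define h where "h m x = max (- real m) (min (real m) (L x))" for m x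
  have Lm: "L \<in> borel_measurable M" unfolding L_def[abs_def] using u0 u1 by measurable
  have hm: "h m \<in> borel_measurable M" for m unfolding h_def[abs_def] using Lm by measurable
  have hb: "\<bar>h m x\<bar> \<le> real m" for m x by (auto simp: h_def)
  have "(\<lambda>m. nrm M (\<lambda>x. exp (h m x) * u\<^sub>0 x - u\<^sub>1 x)) \<longlonglongrightarrow> 0"
  proof (rule nrm_dominated_convergence(2)[of M "\<lambda>x. \<bar>u\<^sub>0 x\<bar> + \<bar>u\<^sub>1 x\<bar>"])
    show "sq_int M (\<lambda>x. \<bar>u\<^sub>0 x\<bar> + \<bar>u\<^sub>1 x\<bar>)"
      by (intro sq_int_add nrm_mono(1)[OF u0] nrm_mono(1)[OF u1]) (use u0 u1 in auto)
    show "(\<lambda>x. exp (h m x) * u\<^sub>0 x) \<in> borel_measurable M" for m using hm[of m] u0 by measurable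
    show "u\<^sub>1 \<in> borel_measurable M" using u1 by (rule sq_int_measurable)
    have eL: "exp (L x) * u\<^sub>0 x = u\<^sub>1 x" if "u\<^sub>0 x > 0 \<and> u\<^sub>1 x > 0 \<or> u\<^sub>0 x < 0 \<and> u\<^sub>1 x < 0" for x
    proof -
      have "u\<^sub>1 x / u\<^sub>0 x > 0" using that by (auto simp: zero_less_divide_iff)
      then have "exp (L x) = u\<^sub>1 x / u\<^sub>0 x" by (simp add: L_def)
      then show ?thesis using that by auto
    qed
    show "AE x in M. \<bar>exp (h m x) * u\<^sub>0 x\<bar> \<le> \<bar>u\<^sub>0 x\<bar> + \<bar>u\<^sub>1 x\<bar>" for m
      using sgn
    proof eventually_elim
      case (elim x)
      \<comment> \<open>The truncated factor is at most the maximum of \<open>1\<close> and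
        \<open>u\<^sub>1 / u\<^sub>0\<close>, so its product with \<open>u\<^sub>0\<close> stays
        below \<open>\<bar>u\<^sub>0\<bar> + \<bar>u\<^sub>1\<bar>\<close> in absolute value for
        every \<open>m\<close>.\<close>
      have "h m x \<le> max 0 (L x)" by (auto simp: h_def)
      then have "exp (h m x) \<le> exp (max 0 (L x))" by simp
      also have "\<dots> \<le> 1 + exp (L x)" by (simp add: max_def)
      finally have "exp (h m x) * \<bar>u\<^sub>0 x\<bar> \<le> (1 + exp (L x)) * \<bar>u\<^sub>0 x\<bar>" by (rule mult_right_mono) simp
      also have "\<dots> = \<bar>u\<^sub>0 x\<bar> + \<bar>exp (L x) * u\<^sub>0 x\<bar>" by (simp add: distrib_right abs_mult)
      finally show ?case unfolding eL[OF elim] by (simp add: abs_mult)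
    qed
    show "AE x in M. (\<lambda>m. exp (h m x) * u\<^sub>0 x) \<longlonglongrightarrow> u\<^sub>1 x"
      using sgn
    proof eventually_elim
      case (elim x)
      have "\<forall>\<^sub>F m in sequentially. exp (h m x) * u\<^sub>0 x = u\<^sub>1 x"
      proof (rule eventually_sequentiallyI)
        fix m assume "nat \<lceil>\<bar>L x\<bar>\<rceil> \<le> m"
        then have "\<bar>L x\<bar> \<le> real m" by linarith
        then have "h m x = L x" by (auto simp: h_def)
        then show "exp (h m x) * u\<^sub>0 x = u\<^sub>1 x" using eL[OF elim] by simp
      qed
      then show ?case by (rule tendsto_eventually)
    qed
  qed
  from order_tendstoD(2)[OF this, of "\<epsilon> / 3"] \<epsilon> obtain m where m: "nrm M (\<lambda>x. exp (h m x) * u\<^sub>0 x - u\<^sub>1 x) < \<epsilon> / 3"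
    by (auto simp: eventually_sequentially)
  obtain g where g: "\<And>n::nat. continuous_on UNIV (g n)" "\<And>n x. \<bar>g n x\<bar> \<le> \<bar>real m\<bar>" "AE x in M. (\<lambda>n. g n x) \<longlonglongrightarrow> h m x"
    using continuous_approx_bounded[OF hm[of m] hb[of m]] by blast
  have gm: "g n \<in> borel_measurable M" for n by (rule continuous_measurable_M[OF continuous_on_subset[OF g(1)]]) simp
  have gc: "g n x \<le> real m" for n x using g(2)[of n x] by simp
  note G = exp_mult_tendsto[OF u0 gm hm gc g(3)]
  from order_tendstoD(2)[OF G(2), of "\<epsilon> / 3"] \<epsilon>
  obtain n where n: "nrm M (\<lambda>x. exp (g n x) * u\<^sub>0 x - exp (h m x) * u\<^sub>0 x) < \<epsilon> / 3"
    by (auto simp: eventually_sequentially)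
  have "\<exists>p\<in>cospoly. \<forall>x\<in>cbox a b. \<bar>g n x - p x\<bar> < 1 / real (Suc j)" for j
    by (rule cospoly_dense[OF continuous_on_subset[OF g(1)]]) auto
  then obtain p where p: "\<And>j. p j \<in> cospoly" "\<And>j x. x \<in> cbox a b \<Longrightarrow> \<bar>g n x - p j x\<bar> < 1 / real (Suc j)" by metis
  have p\<Omega>: "\<bar>g n x - p j x\<bar> < 1 / real (Suc j)" if "x \<in> \<Omega>" for x j
    using that box_subset_cbox by (intro p(2)) auto
  have pc: "p j x \<le> real m + 1" if "x \<in> \<Omega>" for j x
  proof -
    have "1 / real (Suc j) \<le> 1" by simp
    then show ?thesis using p\<Omega>[OF that, of j] gc[of n x] by linarith
  qed
  have pl: "AE x in M. (\<lambda>j. p j x) \<longlonglongrightarrow> g n x"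
  proof (rule AE_I2)
    fix x assume "x \<in> space M"
    then have x: "x \<in> \<Omega>" by simp
    show "(\<lambda>j. p j x) \<longlonglongrightarrow> g n x"
    proof (rule LIM_zero_cancel, rule Lim_null_comparison)
      show "\<forall>\<^sub>F j in sequentially. norm (p j x - g n x) \<le> 1 / real (Suc j)"
        using p\<Omega>[OF x] by (auto intro!: always_eventually less_imp_le simp: abs_minus_commute)
      show "(\<lambda>j. 1 / real (Suc j)) \<longlonglongrightarrow> 0" by (rule LIMSEQ_Suc[OF lim_1_over_n])
    qed
  qed
  note P = exp_mult_tendsto[OF u0 cospoly_measurable[OF p(1)] gm pc pl]
  from order_tendstoD(2)[OF P(2), of "\<epsilon> / 3"] \<epsilon>
  obtain j where j: "nrm M (\<lambda>x. exp (p j x) * u\<^sub>0 x - exp (g n x) * u\<^sub>0 x) < \<epsilon> / 3"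
    by (auto simp: eventually_sequentially)
  have sp: "sq_int M (\<lambda>x. exp (p j x) * u\<^sub>0 x)" using cospoly_exp_mult[OF p(1) u0, of 1 j] by simp
  have "nrm M (\<lambda>x. exp (p j x) * u\<^sub>0 x - u\<^sub>1 x) < \<epsilon>"
    using nrm_triangle_diff[OF sp P(1) u1] nrm_triangle_diff[OF P(1) G(1) u1] j n m by linarith
  then show ?thesis using p(1) by blast
qed

text \<open>The control is constant in time, so the partition consists of the single interval from
  \<open>0\<close> to \<open>T\<close>.\<close>

lemma cospoly_admissible_control:
  assumes q: "q \<in> cospoly" and T: "0 < T"
  shows "admissible_control \<Omega> T (\<lambda>z. q (fst z))"
proof -
  obtain C where C: "\<And>x. \<bar>q x\<bar> \<le> C" using cospoly_bounded[OF q] by blast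
  have qc: "continuous_on UNIV (\<lambda>z :: (real ^ 'n) \<times> real. q (fst z))"
    by (rule continuous_on_compose2[OF cospoly_continuous[OF q, of UNIV] continuous_on_fst[OF continuous_on_id]]) simp
  have "(\<lambda>z. q (fst z)) \<in> L_infinity (cylinder \<Omega> T)"
    unfolding L_infinity_def using borel_measurable_MQ[OF borel_measurable_continuous_onI[OF qc]] C by auto
  moreover have "q \<in> L_infinity \<Omega>" unfolding L_infinity_def using cospoly_measurable[OF q] C by auto
  ultimately show ?thesis
    unfolding admissible_control_def using T
    by (auto intro!: exI[of _ "1 :: nat"] exI[of _ "\<lambda>m. real m * T"] exI[of _ "\<lambda>_. q"])
qed

end

theorem theorem3p1:
  fixes a b :: "real ^ 'n" and \<Omega> :: "(real ^ 'n) set" and u\<^sub>0 u\<^sub>1 :: "real ^ 'n \<Rightarrow> real"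
  assumes "\<forall>i. a $ i < b $ i"
    and "\<Omega> = box a b"
    and "u\<^sub>0 \<in> H2 \<Omega> \<inter> H10 \<Omega>"
    and "u\<^sub>1 \<in> L2 \<Omega>"
    and "same_sign_change_surfaces \<Omega> u\<^sub>0 u\<^sub>1"
  shows "\<forall>\<epsilon>>0. \<exists>T>0. \<exists>v. admissible_control \<Omega> T v \<and>
           (\<exists>u. is_solution \<Omega> T v u\<^sub>0 u) \<and>
           (\<forall>u. is_solution \<Omega> T v u\<^sub>0 u \<longrightarrow> L2_norm \<Omega> (\<lambda>x. u (x, T) - u\<^sub>1 x) < \<epsilon>)"
proof (intro allI impI)
  fix \<epsilon> :: real assume \<epsilon>: "\<epsilon> > 0"
  interpret rect a b by unfold_locales (use assms(1) in simp)
  note \<Omega> = assms(2)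
  have u0: "u\<^sub>0 \<in> H2 (box a b)" "u\<^sub>0 \<in> H10 (box a b)" using assms(3) by (auto simp: \<Omega>)
  have su0: "sq_int (lebesgue_on (box a b)) u\<^sub>0" by (rule H2D(1)[OF open_box u0(1)])
  have su1: "sq_int (lebesgue_on (box a b)) u\<^sub>1" using assms(4) by (simp add: \<Omega> L2_iff_sq_int)
  have "AE x in lebesgue_on (box a b). u\<^sub>0 x > 0 \<and> u\<^sub>1 x > 0 \<or> u\<^sub>0 x < 0 \<and> u\<^sub>1 x < 0"
    using same_sign_change_surfaces_AE[OF open_box] assms(5) unfolding \<Omega> by blast
  from exists_exp_cospoly_approximation[OF su0 su1 this, of "\<epsilon> / 2"] \<epsilon>
  obtain \<alpha> where \<alpha>: "\<alpha> \<in> cospoly" "nrm (lebesgue_on (box a b)) (\<lambda>x. exp (\<alpha> x) * u\<^sub>0 x - u\<^sub>1 x) < \<epsilon> / 2" by auto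
  obtain C where C: "\<And>T u. 0 < T \<Longrightarrow> is_solution (box a b) T (\<lambda>z. 1 / T * \<alpha> (fst z)) u\<^sub>0 u \<Longrightarrow>
      nrm (lebesgue_on (box a b)) (\<lambda>x. u (x, T) - exp (\<alpha> x) * u\<^sub>0 x) \<le> C * T"
    using short_time_estimate[OF \<alpha>(1) u0] by blast
  \<comment> \<open>Half of \<open>\<epsilon>\<close> is left to the drift caused by diffusion;
    \<open>\<bar>C\<bar> + 1\<close> is positive whatever the sign of \<open>C\<close>.\<close>
  define T where "T = \<epsilon> / (2 * (\<bar>C\<bar> + 1))"
  have T: "0 < T" using \<epsilon> by (simp add: T_def)
  have CT: "C * T \<le> \<epsilon> / 2"
  proof -
    have "C * T \<le> (\<bar>C\<bar> + 1) * T" using T by (intro mult_right_mono) auto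
    also have "\<dots> = \<epsilon> / 2" by (simp add: T_def field_simps)
    finally show ?thesis .
  qed
  have q: "(\<lambda>x. 1 / T * \<alpha> x) \<in> cospoly" by (rule cospoly.mult[OF cospoly.const \<alpha>(1)])
  let ?v = "\<lambda>z. 1 / T * \<alpha> (fst z)"
  have "L2_norm (box a b) (\<lambda>x. u (x, T) - u\<^sub>1 x) < \<epsilon>" if sol: "is_solution (box a b) T ?v u\<^sub>0 u" for u
  proof -
    have su: "sq_int (lebesgue_on (box a b)) (\<lambda>x. u (x, T))" by (rule solution_slices(3)[OF sol]) (use T in simp)
    have sy: "sq_int (lebesgue_on (box a b)) (\<lambda>x. exp (\<alpha> x) * u\<^sub>0 x)"
      using cospoly_exp_mult[OF \<alpha>(1) su0, of 1] by simp
    show ?thesis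
      unfolding L2_norm_eq_nrm using nrm_triangle_diff[OF su sy su1] C[OF T sol] CT \<alpha>(2) by linarith
  qed
  then show "\<exists>T>0. \<exists>v. admissible_control \<Omega> T v \<and> (\<exists>u. is_solution \<Omega> T v u\<^sub>0 u) \<and>
      (\<forall>u. is_solution \<Omega> T v u\<^sub>0 u \<longrightarrow> L2_norm \<Omega> (\<lambda>x. u (x, T) - u\<^sub>1 x) < \<epsilon>)"
    unfolding \<Omega> using T cospoly_admissible_control[OF q T] solution_exists[OF q T u0] by blast
qed

end
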